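(* Let $\delta\in(0,1)$ and let $\overline{\mathbf W}\in\mathcal W$ be a reference model. Let $\mathcal W_1=\{\mathbf W\in\mathcal W:\|\mathbf W-\overline{\mathbf W}\|_F^2\le F(\overline{\mathbf W})\}$ and $\mathcal F=\{\mathbf x\mapsto f_{\mathbf W}(\mathbf x):\mathbf W\in\mathcal W_1\}$. If $$m\gtrsim n^3L^{16}d(\log m)^5\log(nL/\delta)\,F_S(\overline{\mathbf W})^4,$$ then with probability at least $1-\delta$, $$\mathfrak R_{S_1,n}(\mathcal F)\lesssim\sqrt{\frac{F(\overline{\mathbf W})}{n}},\qquad\text{where } \mathfrak R_{S_1,n}(\mathcal F)=\sup_{\widetilde S\subset S_1:|\widetilde S|=n}\mathfrak R_{\widetilde S}(\mathcal F).$$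
   Context: Network: $d,m,L$ are positive integers, $m$ even, $L\ge2$ (implicit in the initialization). $\sigma(t)=\max\{t,0\}$ entrywise. $\mathcal W=\mathbb R^{m\times d}\times(\mathbb R^{m\times m})^{L-1}$ with elements $\mathbf W=(\mathbf W^1,\dots,\mathbf W^L)$; $(\mathbf w_r^l)^\top$ is the $r$-th row of $\mathbf W^l$. For $\mathbf x\in\mathcal X=S^{d-1}$ (unit sphere of $\mathbb R^d$): $h^0(\mathbf x)=\mathbf x$, $h^l(\mathbf x)=\sqrt{2/m}\,\sigma(\mathbf W^l h^{l-1}(\mathbf x))$, $f_{\mathbf W}(\mathbf x)=\mathbf a^\top h^L(\mathbf x)$, with $\mathbf a\in\mathbb R^m$ fixed. Initialization: $a_{r+m/2}=-a_r\in\{-1,+1\}$ for $1\le r\le m/2$. $\mathbf W(0)$ is random: all rows $\mathbf w^l_r(0)$ with $l\le L-1$, $r\in[m]$, and $\mathbf w^L_r(0)$ with $r\le m/2$, are independent standard Gaussian vectors ($\mathcal N(0,\mathbf I_d)$ for $l=1$, $\mathcal N(0,\mathbf I_m)$ for $l\ge 2$), and $\mathbf w^L_{r+m/2}(0)=\mathbf w^L_r(0)$ for $r\le m/2$. Data and loss: $S=\{(\mathbf x_i,y_i)\}_{i=1}^n$ is an i.i.d. training sample from a probability measure $\rho$ on $\mathcal Z=\mathcal X\times\{1,-1\}$ (independent of the initialization), $S_1=\{\mathbf x_1,\dots,\mathbf x_n\}$; $\ell(z)=\log(1+e^{-z})$; $\mathcal L_S(\mathbf W)=\frac1n\sum_i\ell(y_if_{\mathbf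 W}(\mathbf x_i))$, $\mathcal L(\mathbf W)=\mathbb E_{(\mathbf x,y)\sim\rho}\,\ell(yf_{\mathbf W}(\mathbf x))$. With step size $\eta>0$ and number of iterations $T$ satisfying $\eta T\asymp n$ and $\eta\le\min\{\frac4{5L},\frac1{20L\tilde F_S(\overline{\mathbf W})}\}$, $\tilde F_S(\overline{\mathbf W})=\frac1n\sum_i|\ell'(y_if_{\overline{\mathbf W}}(\mathbf x_i))|$, define $G=\sup_{(\mathbf x,y)\in\mathcal Z}\ell(yf_{\overline{\mathbf W}}(\mathbf x))$, $F_S(\overline{\mathbf W})=3\eta T\mathcal L_S(\overline{\mathbf W})+\|\mathbf W(0)-\overline{\mathbf W}\|_F^2$ (assumed $\ge1$), and $$F(\overline{\mathbf W})=3\eta T\Big(2\mathcal L(\overline{\mathbf W})+\frac{7G\log(2/\delta)}{6n}\Big)+\|\mathbf W(0)-\overline{\mathbf W}\|_F^2.$$ The reference model may depend on $\mathbf W(0)$ but not on $S$. For tuples $\|\mathbf W\|_F^2=\sum_l\|\mathbf W^l\|_F^2$. Empirical Rademacher complexity: for $\widetilde S=\{\tilde{\mathbf x}_1,\dots,\tilde{\mathbf x}_n\}$, $\mathfrak R_{\widetilde S}(\mathcal F)=\mathbb E_{\epsilon}\big[\sup_{f\in\mathcal F}\frac1n\sum_{i=1}^n\epsilon_if(\tilde{\mathbf x}_i)\big]$ with $\epsilon_i$ independent uniform on $\{\pm1\}$. $A\gtrsim B$ (in the hypothesis) means $A\ge cB$ for a sufficiently large absolute constant $c$; $A\lesssim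 B$ (in the conclusion) means $A\le CB$ for an absolute constant $C$. *)

theory Defs
  imports "HOL-Probability.Probability"
begin

text \<open>
  The constants in the statement must not depend on the dimensions, so vectors and weight tuples
  are extensional functions on explicit finite index sets.  All indices are zero-based, except
  for the layer index, which ranges over \<open>{1..L}\<close>; the entry in row \<open>r\<close> and column \<open>j\<close> of the
  \<open>l\<close>-th weight matrix of \<open>W\<close> is \<open>W (l, r, j)\<close>.
\<close>

type_synonym weights = "nat \<times> nat \<times> nat \<Rightarrow> real"
type_synonym point = "nat \<Rightarrow> real"

definition fan_in :: "nat \<Rightarrow> nat \<Rightarrow> nat \<Rightarrow> nat" where
  "fan_in d m l = (if l = 1 then d else m)"

definition weight_idx :: "nat \<Rightarrow> nat \<Rightarrow> nat \<Rightarrow> (nat \<times> nat \<times> nat) set" where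
  "weight_idx d m L = (SIGMA l:{1..L}. {..<m} \<times> {..<fan_in d m l})"

definition weight_space :: "nat \<Rightarrow> nat \<Rightarrow> nat \<Rightarrow> weights set" where
  "weight_space d m L = weight_idx d m L \<rightarrow>\<^sub>E UNIV"

abbreviation weight_borel :: "nat \<Rightarrow> nat \<Rightarrow> nat \<Rightarrow> weights measure" where
  "weight_borel d m L \<equiv> PiM (weight_idx d m L) (\<lambda>_. borel)"

definition frob_dist_sq :: "nat \<Rightarrow> nat \<Rightarrow> nat \<Rightarrow> weights \<Rightarrow> weights \<Rightarrow> real" where
  "frob_dist_sq d m L V W =
     (\<Sum>l=1..L. \<Sum>r<m. \<Sum>j<fan_in d m l. (V (l, r, j) - W (l, r, j))\<^sup>2)"

definition unit_sphere :: "nat \<Rightarrow> point set" where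
  "unit_sphere d = {x \<in> {..<d} \<rightarrow>\<^sub>E UNIV. (\<Sum>i<d. (x i)\<^sup>2) = 1}"

definition labelled_points :: "nat \<Rightarrow> (point \<times> real) set" where
  "labelled_points d = unit_sphere d \<times> {1, -1}"

definition labelled_borel :: "nat \<Rightarrow> (point \<times> real) measure" where
  "labelled_borel d =
     restrict_space (PiM {..<d} (\<lambda>_. borel) \<Otimes>\<^sub>M borel) (labelled_points d)"


subsection \<open>The network and its initialization\<close>

definition relu :: "real \<Rightarrow> real" where
  "relu t = max t 0"

fun hidden :: "nat \<Rightarrow> nat \<Rightarrow> weights \<Rightarrow> nat \<Rightarrow> point \<Rightarrow> point" where
  "hidden d m W 0 x = x"
| "hidden d m W (Suc l) x =
     (\<lambda>r\<in>{..<m}. sqrt (2 / real m) *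
        relu (\<Sum>j<fan_in d m (Suc l). W (Suc l, r, j) * hidden d m W l x j))"

definition network :: "nat \<Rightarrow> nat \<Rightarrow> nat \<Rightarrow> (nat \<Rightarrow> real) \<Rightarrow> weights \<Rightarrow> point \<Rightarrow> real" where
  "network d m L a W x = (\<Sum>r<m. a r * hidden d m W L x r)"

definition antisymmetric_signs :: "nat \<Rightarrow> (nat \<Rightarrow> real) \<Rightarrow> bool" where
  "antisymmetric_signs m a \<longleftrightarrow>
     (\<forall>r<m div 2. a r \<in> {-1, 1} \<and> a (r + m div 2) = - a r)"

text \<open>
  In the last layer only the first \<open>m div 2\<close> rows are drawn; \<open>tie_rows\<close> copies them into the
  other half.
\<close>

definition free_idx :: "nat \<Rightarrow> nat \<Rightarrow> nat \<Rightarrow> (nat \<times> nat \<times> nat) set" where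
  "free_idx d m L = {(l, r, j) \<in> weight_idx d m L. l < L \<or> r < m div 2}"

definition tie_rows :: "nat \<Rightarrow> nat \<Rightarrow> nat \<Rightarrow> weights \<Rightarrow> weights" where
  "tie_rows d m L g =
     (\<lambda>(l, r, j)\<in>weight_idx d m L.
        if l = L \<and> m div 2 \<le> r then g (l, r - m div 2, j) else g (l, r, j))"

definition init_law :: "nat \<Rightarrow> nat \<Rightarrow> nat \<Rightarrow> weights measure" where
  "init_law d m L =
     distr (PiM (free_idx d m L) (\<lambda>_. density lborel std_normal_density))
       (weight_borel d m L) (tie_rows d m L)"

text \<open>The initialization together with an independent i.i.d. sample of size \<open>n\<close>.\<close>

definition joint_law ::
  "nat \<Rightarrow> nat \<Rightarrow> nat \<Rightarrow> nat \<Rightarrow> (point \<times> real) measure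
     \<Rightarrow> (weights \<times> (nat \<Rightarrow> point \<times> real)) measure" where
  "joint_law d m L n \<rho> = init_law d m L \<Otimes>\<^sub>M PiM {..<n} (\<lambda>_. \<rho>)"


subsection \<open>Losses\<close>

definition logistic :: "real \<Rightarrow> real" where
  "logistic z = ln (1 + exp (- z))"

definition emp_risk ::
  "nat \<Rightarrow> (nat \<Rightarrow> point \<times> real) \<Rightarrow> (point \<Rightarrow> real) \<Rightarrow> real" where
  "emp_risk n S f = (\<Sum>i<n. logistic (snd (S i) * f (fst (S i)))) / real n"

definition emp_deriv ::
  "nat \<Rightarrow> (nat \<Rightarrow> point \<times> real) \<Rightarrow> (point \<Rightarrow> real) \<Rightarrow> real" where
  "emp_deriv n S f = (\<Sum>i<n. \<bar>deriv logistic (snd (S i) * f (fst (S i)))\<bar>) / real n"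

definition risk :: "(point \<times> real) measure \<Rightarrow> (point \<Rightarrow> real) \<Rightarrow> real" where
  "risk \<rho> f = (\<integral>z. logistic (snd z * f (fst z)) \<partial>\<rho>)"

definition sup_loss :: "nat \<Rightarrow> (point \<Rightarrow> real) \<Rightarrow> real" where
  "sup_loss d f = (SUP z\<in>labelled_points d. logistic (snd z * f (fst z)))"

definition F_emp ::
  "nat \<Rightarrow> nat \<Rightarrow> nat \<Rightarrow> (nat \<Rightarrow> real) \<Rightarrow> nat \<Rightarrow> real \<Rightarrow> nat
     \<Rightarrow> (nat \<Rightarrow> point \<times> real) \<Rightarrow> weights \<Rightarrow> weights \<Rightarrow> real" where
  "F_emp d m L a n \<eta> T S W0 V =
     3 * \<eta> * real T * emp_risk n S (network d m L a V) + frob_dist_sq d m L W0 V"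

definition F_pop ::
  "nat \<Rightarrow> nat \<Rightarrow> nat \<Rightarrow> (nat \<Rightarrow> real) \<Rightarrow> nat \<Rightarrow> real \<Rightarrow> nat \<Rightarrow> real
     \<Rightarrow> (point \<times> real) measure \<Rightarrow> weights \<Rightarrow> weights \<Rightarrow> real" where
  "F_pop d m L a n \<eta> T \<delta> \<rho> W0 V =
     3 * \<eta> * real T *
       (2 * risk \<rho> (network d m L a V)
        + 7 * sup_loss d (network d m L a V) * ln (2 / \<delta>) / (6 * real n))
     + frob_dist_sq d m L W0 V"

definition ball_class ::
  "nat \<Rightarrow> nat \<Rightarrow> nat \<Rightarrow> (nat \<Rightarrow> real) \<Rightarrow> weights \<Rightarrow> real \<Rightarrow> (point \<Rightarrow> real) set" where
  "ball_class d m L a V B =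
     network d m L a ` {W \<in> weight_space d m L. frob_dist_sq d m L W V \<le> B}"


subsection \<open>Rademacher complexity\<close>

definition rademacher :: "nat \<Rightarrow> (nat \<Rightarrow> 'x) \<Rightarrow> ('x \<Rightarrow> real) set \<Rightarrow> real" where
  "rademacher n x \<F> =
     measure_pmf.expectation (Pi_pmf {..<n} 0 (\<lambda>_. pmf_of_set {-1, 1}))
       (\<lambda>\<epsilon>. SUP f\<in>\<F>. (\<Sum>i<n. \<epsilon> i * f (x i)) / real n)"

text \<open>
  The supremum ranges over all samples of \<open>n\<close> points taken from \<open>A\<close>, repetitions allowed; so the
  original sample is always among them, even if some of its points coincide.
\<close>

definition worst_rademacher :: "'x set \<Rightarrow> nat \<Rightarrow> ('x \<Rightarrow> real) set \<Rightarrow> real" where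
  "worst_rademacher A n \<F> = (SUP x\<in>{..<n} \<rightarrow>\<^sub>E A. rademacher n x \<F>)"

end

theory Submission
  imports Defs
begin

text \<open>
  Two copies of each top row with opposite signs make the network vanish identically as long as
  the top layer stays at its initial value, whatever the hidden layers are.  Hence only the increment
  of the top layer is seen, and the network is close to the linear function of that increment whose
  features are the active copies of the last hidden layer at initialization.  These features have
  norm of order one, so the linear class has Rademacher complexity of order \<open>sqrt (F / n)\<close>, without
  a factor depending on \<open>L\<close>.

  The linearization error is controlled by the stability of the hidden layers under a perturbation
  of the weights.  For the frozen activation pattern of a fixed input, the random linear map from
  layer \<open>k\<close> to layer \<open>l\<close> almost preserves the norm of each fixed vector, hence is bounded on sparse
  vectors by a net argument, and on all vectors by cutting them into blocks.  Only few units change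
  sign under the perturbation, because few pre-activations are small, and the resulting sparse
  corrections do not amplify each other.  A fine net of the unit ball makes this uniform
  over all inputs, so that the event depends on the initialization only.

  Finally a Chernoff bound for the empirical risk, together with the bound on the loss that the
  linearization implies, shows that the population radius exceeds the empirical one by at most a
  logarithmic factor, so that the assumed width is sufficient.
\<close>


section \<open>Gaussian vectors\<close>

text \<open>Everything is balanced on the sparsity level \<open>p\<close>, of order m / (L^2 ln m).
  Layer norms may drift by a factor 1 + 1/L per layer, since the product over \<open>L\<close>
  layers then stays below e. A Gaussian layer violates this with probability exp (- const m / L^2),
  while the number of sparse test vectors is about m^p up to constants in the exponent, so
  \<open>p\<close> cannot exceed that order. Cutting a vector into B = m / p blocks costs sqrt B. On
  the other side at most \<open>p\<close> units per hidden layer may flip, and for weights at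
  distance \<open>R\<close> this needs L^2 B^2 R^2 m^2 below p^3, that is, L^12 (ln m)^5 R^2 below
  \<open>m\<close>, up to constants: hence the fifth power of the logarithm. The factor n^3 comes
  from the top layer, where only a fraction of order 1 / n of the units may change sign if the
  linearization error is to be of order R / sqrt n.

  The radius is random, because F_S depends on the sample. The good event must therefore not mention
  it: \<open>p\<close> and the test vectors are fixed from the deterministic factors of the width
  bound, and a radius enters only through inequalities checked for each sample.\<close>

abbreviation std_gauss :: "real measure" where
  "std_gauss \<equiv> density lborel std_normal_density"

abbreviation gauss_vec :: "'i set \<Rightarrow> ('i \<Rightarrow> real) measure" where
  "gauss_vec I \<equiv> PiM I (\<lambda>_. std_gauss)"

lemma prob_space_std_gauss: "prob_space std_gauss"
  by (rule prob_space_normal_density) simp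

lemma prob_space_gauss_vec: "prob_space (gauss_vec I)"
  by (intro prob_space_PiM prob_space_std_gauss)

lemma sets_gauss_vec [measurable_cong]: "sets (gauss_vec I) = sets (PiM I (\<lambda>_. borel))"
  by (intro sets_PiM_cong) auto

lemma distributed_gauss_coord:
  assumes "i \<in> I" "finite I" "c > 0"
  shows "distributed (gauss_vec I) lborel (\<lambda>w. w i * c) (normal_density 0 c)"
proof -
  interpret prob_space "gauss_vec I" by (rule prob_space_gauss_vec)
  have "distr (gauss_vec I) std_gauss (\<lambda>w. w i) = std_gauss"
    using assms by (intro distr_PiM_component prob_space_std_gauss) auto
  moreover have "distr (gauss_vec I) std_gauss (\<lambda>w. w i) = distr (gauss_vec I) lborel (\<lambda>w. w i)"
    by (intro distr_cong) auto
  moreover have [measurable]: "(\<lambda>w. w i) \<in> borel_measurable (gauss_vec I)"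
    using assms by (auto simp: measurable_cong_sets[OF sets_gauss_vec refl])
  ultimately have "distributed (gauss_vec I) lborel (\<lambda>w. w i) std_normal_density"
    by (auto simp: distributed_def)
  from normal_density_affine[OF this, of c 0] assms show ?thesis
    by (simp add: mult.commute)
qed

lemma indep_gauss_coords:
  assumes "finite I" 
  shows "prob_space.indep_vars (gauss_vec I) (\<lambda>_. borel) (\<lambda>i w. w i) I"
proof -
  interpret prob_space "gauss_vec I" by (rule prob_space_gauss_vec)
  show ?thesis
  proof (cases "I = {}")
    case True
    have "prob_space.indep_vars (gauss_vec {}) (\<lambda>_. borel) (\<lambda>i w. w i) {}"
      by (simp add: prob_space.indep_vars_def[OF prob_space_gauss_vec] prob_space.indep_sets_def[OF prob_space_gauss_vec])
    with True show ?thesis by simp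
  next
    case False
    have "distr (gauss_vec I) (\<Pi>\<^sub>M i\<in>I. borel) (\<lambda>x. \<lambda>i\<in>I. x i) = distr (gauss_vec I) (gauss_vec I) (\<lambda>x. x)"
      by (intro distr_cong refl) (auto simp: sets_gauss_vec space_PiM PiE_def extensional_restrict)
    also have "\<dots> = gauss_vec I" by (rule distr_id)
    also have "\<dots> = (\<Pi>\<^sub>M i\<in>I. distr (gauss_vec I) borel (\<lambda>x. x i))"
    proof (rule PiM_cong[OF refl])
      fix i assume "i \<in> I"
      have "distr (gauss_vec I) std_gauss (\<lambda>w. w i) = std_gauss"
        using assms \<open>i \<in> I\<close> by (intro distr_PiM_component prob_space_std_gauss) auto
      moreover have "distr (gauss_vec I) std_gauss (\<lambda>w. w i) = distr (gauss_vec I) borel (\<lambda>w. w i)"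
        by (intro distr_cong) auto
      ultimately show "std_gauss = distr (gauss_vec I) borel (\<lambda>x. x i)" by simp
    qed
    finally show ?thesis
      by (subst indep_vars_iff_distr_eq_PiM'[OF False])
         (auto simp: measurable_cong_sets[OF sets_gauss_vec refl])
  qed
qed

text \<open>Zero coefficients are dropped first, because a summand with coefficient zero has no
  normal density. A negative coefficient is handled by reflecting the normal variable.\<close>

lemma distributed_gauss_inner:
  fixes y :: "nat \<Rightarrow> real"
  assumes "L2_set y {..<k} > 0"
  shows "distributed (gauss_vec {..<k}) lborel (\<lambda>w. \<Sum>j<k. w j * y j) (normal_density 0 (L2_set y {..<k}))"
proof -
  interpret prob_space "gauss_vec {..<k}" by (rule prob_space_gauss_vec)
  define K where "K = {j. j < k \<and> y j \<noteq> 0}"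
  have Kne: "K \<noteq> {}"
  proof
    assume "K = {}"
    then have "L2_set y {..<k} = 0" by (auto simp: L2_set_eq_0_iff K_def)
    with assms show False by simp
  qed
  have ind: "indep_vars (\<lambda>_. borel) (\<lambda>j w. w j * y j) K"
    using indep_vars_subset[OF indep_gauss_coords[of "{..<k}"], of K]
    by (intro indep_vars_compose2[where Y="\<lambda>j x. x * y j" and M'="\<lambda>_. borel"]) (auto simp: K_def)
  have dist: "distributed (gauss_vec {..<k}) lborel (\<lambda>w. w j * y j) (normal_density 0 \<bar>y j\<bar>)" if "j \<in> K" for j
  proof (cases "y j > 0")
    case True
    then show ?thesis using distributed_gauss_coord[of j "{..<k}" "y j"] that by (auto simp: K_def)
  next
    case False
    then have neg: "- y j > 0" using that by (auto simp: K_def)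
    have "distributed (gauss_vec {..<k}) lborel (\<lambda>w. w j * (- y j)) (normal_density 0 (- y j))"
      using distributed_gauss_coord[of j "{..<k}" "- y j"] that neg by (auto simp: K_def)
    from normal_density_affine[OF this neg, of "-1" 0] neg show ?thesis by (simp add: abs_if)
  qed
  have "distributed (gauss_vec {..<k}) lborel (\<lambda>w. \<Sum>j\<in>K. w j * y j)
     (normal_density (\<Sum>j\<in>K. 0) (sqrt (\<Sum>j\<in>K. \<bar>y j\<bar>\<^sup>2)))"
    by (intro sum_indep_normal Kne ind dist) (auto simp: K_def)
  moreover have "(\<Sum>j\<in>K. w j * y j) = (\<Sum>j<k. w j * y j)" for w
    by (intro sum.mono_neutral_left) (auto simp: K_def)
  moreover have "sqrt (\<Sum>j\<in>K. \<bar>y j\<bar>\<^sup>2) = L2_set y {..<k}"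
    unfolding L2_set_def by (intro arg_cong[where f=sqrt] sum.mono_neutral_cong_left) (auto simp: K_def)
  ultimately show ?thesis by simp
qed

text \<open>Multiplying the density by exp (t x^2) gives, up to the constant \<open>c\<close>,
  another centred normal density, with standard deviation \<open>r\<close>, whose total mass is one.
  A negative \<open>t\<close> is allowed, and the lower tail bound for relu uses it.\<close>

lemma nn_integral_normal_exp_square:
  assumes "0 < s" "2 * t * s\<^sup>2 < 1"
  shows "(\<integral>\<^sup>+ x. ennreal (normal_density 0 s x) * ennreal (exp (t * x\<^sup>2)) \<partial>lborel) = ennreal (1 / sqrt (1 - 2 * t * s\<^sup>2))"
proof -
  define r where "r = s / sqrt (1 - 2 * t * s\<^sup>2)"
  define c where "c = 1 / sqrt (1 - 2 * t * s\<^sup>2)"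
  have pos: "1 - 2 * t * s\<^sup>2 > 0" using assms by simp
  have r: "r > 0" unfolding r_def using assms by simp
  have c: "c > 0" unfolding c_def using pos by simp
  have rsq: "r\<^sup>2 = s\<^sup>2 / (1 - 2 * t * s\<^sup>2)" using pos by (simp add: r_def power_divide)
  have ex: "- x\<^sup>2 / (2 * s\<^sup>2) + t * x\<^sup>2 = - x\<^sup>2 / (2 * r\<^sup>2)" for x :: real
    unfolding rsq using assms pos by (simp add: divide_simps) (simp add: algebra_simps)
  have pre: "1 / sqrt (2 * pi * s\<^sup>2) = c * (1 / sqrt (2 * pi * r\<^sup>2))"
    using assms pos by (simp add: real_sqrt_mult c_def r_def)
  have "normal_density 0 s x * exp (t * x\<^sup>2) = c * normal_density 0 r x" for x
  proof -
    have "normal_density 0 s x * exp (t * x\<^sup>2) = 1 / sqrt (2 * pi * s\<^sup>2) * exp (- x\<^sup>2 / (2 * s\<^sup>2) + t * x\<^sup>2)"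
      by (simp only: normal_density_def exp_add mult.assoc) simp
    also have "\<dots> = c * normal_density 0 r x"
      unfolding ex unfolding pre by (simp add: normal_density_def)
    finally show ?thesis .
  qed
  then have "(\<integral>\<^sup>+ x. ennreal (normal_density 0 s x) * ennreal (exp (t * x\<^sup>2)) \<partial>lborel) =
     (\<integral>\<^sup>+ x. ennreal c * ennreal (normal_density 0 r x) \<partial>lborel)"
    using c by (intro nn_integral_cong) (simp flip: ennreal_mult)
  also have "\<dots> = ennreal c * (\<integral>\<^sup>+ x. ennreal (normal_density 0 r x) \<partial>lborel)"
    by (simp add: nn_integral_cmult)
  also have "(\<integral>\<^sup>+ x. ennreal (normal_density 0 r x) \<partial>lborel) = 1"
    using prob_space.emeasure_space_1[OF prob_space_normal_density[OF r, of 0]] 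
    by (simp add: emeasure_density)
  finally show ?thesis by (simp add: c_def)
qed

lemma gauss_inner_measurable [measurable]:
  "(\<lambda>w. \<Sum>j<k. w j * y j) \<in> borel_measurable (PiM {..<k} (\<lambda>_. borel))"
  for y :: "nat \<Rightarrow> real"
  by (intro borel_measurable_sum borel_measurable_times) auto

lemma gauss_exp_square:
  fixes y :: "nat \<Rightarrow> real"
  assumes "2 * t * (L2_set y {..<k})\<^sup>2 < 1"
  shows "(\<integral>\<^sup>+ w. ennreal (exp (t * (\<Sum>j<k. w j * y j)\<^sup>2)) \<partial>gauss_vec {..<k})
     = ennreal (1 / sqrt (1 - 2 * t * (L2_set y {..<k})\<^sup>2))"
proof (cases "L2_set y {..<k} > 0")
  case True
  from distributed_nn_integral[OF distributed_gauss_inner[OF True], of "\<lambda>x. ennreal (exp (t * x\<^sup>2))"]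
  show ?thesis using nn_integral_normal_exp_square[OF True assms] by simp
next
  case False
  then have z: "L2_set y {..<k} = 0" using L2_set_nonneg[of y "{..<k}"] by linarith
  then have "\<And>j. j < k \<Longrightarrow> y j = 0" by (auto simp: L2_set_eq_0_iff)
  then have "(\<Sum>j<k. w j * y j) = 0" for w by (auto intro: sum.neutral)
  then show ?thesis using prob_space.emeasure_space_1[OF prob_space_gauss_vec, of "{..<k}"] by (simp add: z)
qed

text \<open>The normal density with standard deviation s is at most 1 / (2 s), because 2 pi >= 4,
  and the interval has length 2 \<tau> s.\<close>

lemma gauss_small_ball:
  fixes y :: "nat \<Rightarrow> real"
  assumes "L2_set y {..<k} > 0" "\<tau> \<ge> 0"
  shows "emeasure (gauss_vec {..<k}) {w \<in> space (gauss_vec {..<k}). \<bar>\<Sum>j<k. w j * y j\<bar> \<le> \<tau> * L2_set y {..<k}} \<le> ennreal \<tau>"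
proof -
  define s where "s = L2_set y {..<k}"
  have s: "s > 0" using assms by (simp add: s_def)
  have nd: "normal_density 0 s x \<le> 1 / (2 * s)" for x
  proof -
    have "2 * s \<le> sqrt (2 * pi * s\<^sup>2)"
      using s pi_ge_two by (intro real_le_rsqrt) (auto simp: power2_eq_square)
    then have "1 / sqrt (2 * pi * s\<^sup>2) \<le> 1 / (2 * s)" using s by (intro divide_left_mono) auto
    moreover have "normal_density 0 s x \<le> 1 / sqrt (2 * pi * s\<^sup>2) * 1"
      unfolding normal_density_def using s by (intro mult_left_mono) auto
    ultimately show ?thesis by simp
  qed
  have [measurable]: "(\<lambda>w. \<Sum>j<k. w j * y j) \<in> borel_measurable (gauss_vec {..<k})"
    by (subst measurable_cong_sets[OF sets_gauss_vec refl]) (rule gauss_inner_measurable)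
  have "emeasure (gauss_vec {..<k}) {w \<in> space (gauss_vec {..<k}). \<bar>\<Sum>j<k. w j * y j\<bar> \<le> \<tau> * s}
     = (\<integral>\<^sup>+ w. indicator {-(\<tau> * s)..\<tau> * s} (\<Sum>j<k. w j * y j) \<partial>gauss_vec {..<k})"
  proof -
    have "(\<integral>\<^sup>+ w. indicator {-(\<tau> * s)..\<tau> * s} (\<Sum>j<k. w j * y j) \<partial>gauss_vec {..<k})
      = (\<integral>\<^sup>+ w. indicator {w \<in> space (gauss_vec {..<k}). \<bar>\<Sum>j<k. w j * y j\<bar> \<le> \<tau> * s} w \<partial>gauss_vec {..<k})"
      by (intro nn_integral_cong) (simp add: indicator_def abs_le_iff, linarith)
    also have "\<dots> = emeasure (gauss_vec {..<k}) {w \<in> space (gauss_vec {..<k}). \<bar>\<Sum>j<k. w j * y j\<bar> \<le> \<tau> * s}"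
      by (intro nn_integral_indicator) measurable
    finally show ?thesis ..
  qed
  also have "\<dots> = (\<integral>\<^sup>+ x. ennreal (normal_density 0 s x) * indicator {-(\<tau> * s)..\<tau> * s} x \<partial>lborel)"
    using distributed_nn_integral[OF distributed_gauss_inner[OF assms(1)], of "indicator {-(\<tau> * s)..\<tau> * s}"]
    by (simp add: s_def)
  also have "\<dots> \<le> (\<integral>\<^sup>+ x. ennreal (1 / (2 * s)) * indicator {-(\<tau> * s)..\<tau> * s} x \<partial>lborel)"
    by (intro nn_integral_mono mult_right_mono ennreal_leI nd) auto
  also have "\<dots> = ennreal (1 / (2 * s)) * ennreal (2 * \<tau> * s)"
    using assms s by (simp add: nn_integral_cmult mult.assoc)
  also have "\<dots> = ennreal \<tau>"
    using s assms by (simp flip: ennreal_mult)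
  finally show ?thesis by (simp add: s_def)
qed

lemma gauss_vec_uminus:
  assumes "finite I" 
  shows "distr (gauss_vec I) (gauss_vec I) (\<lambda>w. \<lambda>i\<in>I. - w i) = gauss_vec I"
proof -
  have "distr std_gauss std_gauss uminus = density lborel (\<lambda>x. std_normal_density (- x))"
  proof -
    have "distr std_gauss std_gauss uminus = distr std_gauss borel uminus"
      by (intro distr_cong) auto
    also have "\<dots> = density (distr lborel borel uminus) (\<lambda>x. std_normal_density (- x))"
      by (subst density_distr) (auto simp: comp_def)
    finally show ?thesis by (simp add: lborel_distr_uminus)
  qed
  then have u: "distr std_gauss std_gauss uminus = std_gauss" 
    by (simp add: normal_density_def)
  have "(\<Pi>\<^sub>M i\<in>I. distr std_gauss std_gauss uminus) = distr (gauss_vec I) (gauss_vec I) (compose I uminus)"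
    using assms by (intro distr_PiM_finite_prob_space[symmetric] product_prob_spaceI prob_space_std_gauss) auto
  then show ?thesis by (simp add: u compose_def[abs_def])
qed

text \<open>By symmetry of the Gaussian law, twice the integral of \<open>f\<close> is the integral
  of f w + f (- w). The hypothesis \<open>le\<close> is tailored to exponentials of masked squares:
  at least one of \<open>w\<close> and \<open>- w\<close> has its mask off and contributes exp 0 =
  1.\<close>

lemma gauss_symmetrize:
  fixes f :: "(nat \<Rightarrow> real) \<Rightarrow> real"
  assumes [measurable]: "f \<in> borel_measurable (PiM {..<k} (\<lambda>_. borel))"
    and nn: "\<And>w. f w \<ge> 0"
    and le: "\<And>w. f w + f (\<lambda>i\<in>{..<k}. - w i) \<le> 1 + exp (t * (\<Sum>j<k. w j * y j)\<^sup>2)"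
    and t: "2 * t * (L2_set y {..<k})\<^sup>2 < 1"
  shows "(\<integral>\<^sup>+ w. ennreal (f w) \<partial>gauss_vec {..<k}) \<le> ennreal ((1 + 1 / sqrt (1 - 2 * t * (L2_set y {..<k})\<^sup>2)) / 2)"
proof -
  have fm[measurable]: "f \<in> borel_measurable (gauss_vec {..<k})"
    by (subst measurable_cong_sets[OF sets_gauss_vec refl]) (rule assms)
  have um[measurable]: "(\<lambda>w. \<lambda>i\<in>{..<k}. - w i) \<in> gauss_vec {..<k} \<rightarrow>\<^sub>M gauss_vec {..<k}"
    by (intro measurable_restrict) auto
  let ?I = "\<integral>\<^sup>+ w. ennreal (f w) \<partial>gauss_vec {..<k}"
  have "?I = (\<integral>\<^sup>+ w. ennreal (f w) \<partial>distr (gauss_vec {..<k}) (gauss_vec {..<k}) (\<lambda>w. \<lambda>i\<in>{..<k}. - w i))"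
    by (simp add: gauss_vec_uminus)
  also have "\<dots> = (\<integral>\<^sup>+ w. ennreal (f (\<lambda>i\<in>{..<k}. - w i)) \<partial>gauss_vec {..<k})"
    by (subst nn_integral_distr) auto
  finally have eq: "?I = (\<integral>\<^sup>+ w. ennreal (f (\<lambda>i\<in>{..<k}. - w i)) \<partial>gauss_vec {..<k})" .
  have [measurable]: "(\<lambda>w. \<Sum>j<k. w j * y j) \<in> borel_measurable (gauss_vec {..<k})"
    by (subst measurable_cong_sets[OF sets_gauss_vec refl]) (rule gauss_inner_measurable)
  have "2 * ?I = ?I + (\<integral>\<^sup>+ w. ennreal (f (\<lambda>i\<in>{..<k}. - w i)) \<partial>gauss_vec {..<k})"
    using eq by (simp add: mult_2)
  also have "\<dots> = (\<integral>\<^sup>+ w. ennreal (f w + f (\<lambda>i\<in>{..<k}. - w i)) \<partial>gauss_vec {..<k})"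
    using nn by (subst nn_integral_add[symmetric]) auto
  also have "\<dots> \<le> (\<integral>\<^sup>+ w. 1 + ennreal (exp (t * (\<Sum>j<k. w j * y j)\<^sup>2)) \<partial>gauss_vec {..<k})"
    using le by (intro nn_integral_mono) (simp add: ennreal_leI flip: ennreal_1 ennreal_plus)
  also have "\<dots> = ennreal (1 + 1 / sqrt (1 - 2 * t * (L2_set y {..<k})\<^sup>2))"
    using t prob_space.emeasure_space_1[OF prob_space_gauss_vec, of "{..<k}"]
    by (subst nn_integral_add) (auto simp: gauss_exp_square ennreal_plus)
  also have "\<dots> = 2 * ennreal ((1 + 1 / sqrt (1 - 2 * t * (L2_set y {..<k})\<^sup>2)) / 2)"
  proof -
    have two: "ennreal x = 2 * ennreal (x / 2)" if "x \<ge> 0" for x using that ennreal_mult[of 2 "x / 2"] by simp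
    show ?thesis using t by (intro two) auto
  qed
  finally show ?thesis
    by (subst (asm) ennreal_mult_le_mult_iff) auto
qed


section \<open>Tail bounds for the rows of a layer\<close>

text \<open>Restricted to \<open>{..<k}\<close> so that a row of \<open>G\<close> is a point of the
  product space \<open>gauss_vec {..<k}\<close>.\<close>

definition wrow :: "nat \<Rightarrow> weights \<Rightarrow> nat \<Rightarrow> nat \<Rightarrow> point" where
  "wrow k G l r = (\<lambda>j\<in>{..<k}. G (l, r, j))"

lemma wrow_inner: "(\<Sum>j<k. wrow k G l r j * y j) = (\<Sum>j<k. G (l, r, j) * y j)"
  by (intro sum.cong) (auto simp: wrow_def)

lemma product_sigma_finite_std_gauss: "product_sigma_finite (\<lambda>_. std_gauss)"
  by (intro product_sigma_finite.intro prob_space_imp_sigma_finite prob_space_std_gauss)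

lemma measurable_gauss_vec_iff: "f \<in> gauss_vec I \<rightarrow>\<^sub>M N \<longleftrightarrow> f \<in> PiM I (\<lambda>_. borel) \<rightarrow>\<^sub>M N"
  by (simp add: measurable_cong_sets[OF sets_gauss_vec refl])

text \<open>Rows occupy disjoint index sets and are independent copies of one Gaussian vector, so
  the integral of the product factorizes. The induction splits off one row by Fubini.\<close>

lemma nn_integral_rows:
  fixes \<psi> :: "point \<Rightarrow> ennreal"
  assumes "finite S" and \<psi>: "\<psi> \<in> borel_measurable (PiM {..<k} (\<lambda>_. borel))"
  shows "(\<integral>\<^sup>+ G. (\<Prod>r\<in>S. \<psi> (wrow k G l r)) \<partial>gauss_vec ({l} \<times> S \<times> {..<k}))
     = (\<integral>\<^sup>+ w. \<psi> w \<partial>gauss_vec {..<k}) ^ card S"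
  using assms(1)
proof induction
  case empty
  then show ?case using prob_space.emeasure_space_1[OF prob_space_gauss_vec] by simp
next
  case (insert s S)
  interpret product_sigma_finite "\<lambda>_. std_gauss" by (rule product_sigma_finite_std_gauss)
  let ?J = "{l} \<times> S \<times> {..<k}" and ?R = "{l} \<times> {s} \<times> {..<k}"
  have J: "{l} \<times> insert s S \<times> {..<k} = ?R \<union> ?J" by auto
  have rm: "(\<lambda>G. wrow k G l r) \<in> PiM A (\<lambda>_. borel) \<rightarrow>\<^sub>M PiM {..<k} (\<lambda>_. borel)" if "{l} \<times> {r} \<times> {..<k} \<subseteq> A" for r A
    unfolding wrow_def using that by (intro measurable_restrict measurable_component_singleton) auto
  have pm: "(\<lambda>G. \<Prod>r\<in>T. \<psi> (wrow k G l r)) \<in> borel_measurable (gauss_vec A)" if "{l} \<times> T \<times> {..<k} \<subseteq> A" for T A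
    unfolding measurable_gauss_vec_iff using that
    by (intro borel_measurable_prod_ennreal measurable_compose[OF rm \<psi>]) auto
  have one: "(\<integral>\<^sup>+ G. \<psi> (wrow k G l s) \<partial>gauss_vec ?R) = (\<integral>\<^sup>+ w. \<psi> w \<partial>gauss_vec {..<k})"
  proof -
    have "gauss_vec {..<k} = distr (gauss_vec ?R) (gauss_vec {..<k}) (\<lambda>\<omega>. \<lambda>j\<in>{..<k}. \<omega> (l, s, j))"
      by (intro distr_PiM_reindex[symmetric] prob_space_std_gauss) (auto simp: inj_on_def)
    then have "(\<integral>\<^sup>+ w. \<psi> w \<partial>gauss_vec {..<k}) = (\<integral>\<^sup>+ w. \<psi> w \<partial>distr (gauss_vec ?R) (gauss_vec {..<k}) (\<lambda>\<omega>. \<lambda>j\<in>{..<k}. \<omega> (l, s, j)))"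
      by simp
    also have "\<dots> = (\<integral>\<^sup>+ G. \<psi> (wrow k G l s) \<partial>gauss_vec ?R)"
      unfolding wrow_def
      by (intro nn_integral_distr) (auto simp: measurable_gauss_vec_iff \<psi> intro!: measurable_restrict)
    finally show ?thesis ..
  qed
  have "(\<integral>\<^sup>+ G. (\<Prod>r\<in>insert s S. \<psi> (wrow k G l r)) \<partial>gauss_vec ({l} \<times> insert s S \<times> {..<k}))
    = (\<integral>\<^sup>+ x. \<integral>\<^sup>+ y. (\<Prod>r\<in>insert s S. \<psi> (wrow k (merge ?R ?J (x, y)) l r)) \<partial>gauss_vec ?J \<partial>gauss_vec ?R)"
    unfolding J using insert by (intro product_nn_integral_fold pm) auto
  also have "\<dots> = (\<integral>\<^sup>+ x. \<integral>\<^sup>+ y. \<psi> (wrow k x l s) * (\<Prod>r\<in>S. \<psi> (wrow k y l r)) \<partial>gauss_vec ?J \<partial>gauss_vec ?R)"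
  proof (intro nn_integral_cong)
    fix x y
    have "wrow k (merge ?R ?J (x, y)) l s = wrow k x l s"
      by (auto simp: wrow_def merge_def)
    moreover have "wrow k (merge ?R ?J (x, y)) l r = wrow k y l r" if "r \<in> S" for r
      using that insert by (auto simp: wrow_def merge_def)
    ultimately show "(\<Prod>r\<in>insert s S. \<psi> (wrow k (merge ?R ?J (x, y)) l r)) = \<psi> (wrow k x l s) * (\<Prod>r\<in>S. \<psi> (wrow k y l r))"
      using insert by simp
  qed
  also have "\<dots> = (\<integral>\<^sup>+ x. \<psi> (wrow k x l s) * (\<integral>\<^sup>+ y. (\<Prod>r\<in>S. \<psi> (wrow k y l r)) \<partial>gauss_vec ?J) \<partial>gauss_vec ?R)"
    by (intro nn_integral_cong nn_integral_cmult pm) auto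
  also have "\<dots> = (\<integral>\<^sup>+ w. \<psi> w \<partial>gauss_vec {..<k}) * (\<integral>\<^sup>+ w. \<psi> w \<partial>gauss_vec {..<k}) ^ card S"
    using pm[of "{s}" ?R] by (subst nn_integral_multc) (auto simp: insert.IH one)
  finally show ?case using insert by simp
qed

text \<open>Conditional Chernoff bound: with the weights of the other layers held fixed, \<phi> is a
  fixed function of a row of layer \<open>l\<close>, so the rows in \<open>S\<close> contribute
  independent factors of mean at most \<rho>; Fubini then integrates out the rest. The Chernoff
  parameter is absorbed in \<phi>, which may therefore be scaled by norms that depend on the other
  layers.\<close>

lemma row_chernoff:
  fixes \<phi> :: "weights \<Rightarrow> point \<Rightarrow> real"
  assumes I: "finite I" "{l} \<times> S \<times> {..<k} \<subseteq> I" and S: "finite S"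
    and dep: "\<And>W W' w. (\<And>i. i \<in> I \<Longrightarrow> fst i \<noteq> l \<Longrightarrow> W i = W' i) \<Longrightarrow> \<phi> W w = \<phi> W' w"
    and bound: "\<And>W. (\<integral>\<^sup>+ w. ennreal (exp (\<phi> W w)) \<partial>gauss_vec {..<k}) \<le> ennreal \<rho>" and \<rho>: "0 \<le> \<rho>"
    and meas: "\<And>W. \<phi> W \<in> borel_measurable (PiM {..<k} (\<lambda>_. borel))"
    and jmeas: "\<And>r. r \<in> S \<Longrightarrow> (\<lambda>W. \<phi> W (wrow k W l r)) \<in> borel_measurable (PiM I (\<lambda>_. borel))"
  shows "emeasure (gauss_vec I) {W \<in> space (gauss_vec I). a \<le> (\<Sum>r\<in>S. \<phi> W (wrow k W l r))} \<le> ennreal (\<rho> ^ card S * exp (- a))"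
proof -
  interpret product_sigma_finite "\<lambda>_. std_gauss" by (rule product_sigma_finite_std_gauss)
  define J where "J = {l} \<times> S \<times> {..<k}"
  define g where "g W = ennreal (exp (\<Sum>r\<in>S. \<phi> W (wrow k W l r)))" for W
  have U: "I = (I - J) \<union> J" using I by (auto simp: J_def)
  have gm': "(\<lambda>W. \<Sum>r\<in>S. \<phi> W (wrow k W l r)) \<in> borel_measurable (gauss_vec I)"
    unfolding measurable_gauss_vec_iff by (intro borel_measurable_sum jmeas)
  then have gm: "g \<in> borel_measurable (gauss_vec I)"
    unfolding g_def by measurable
  have inner: "(\<integral>\<^sup>+ y. g (merge (I - J) J (x, y)) \<partial>gauss_vec J) \<le> ennreal (\<rho> ^ card S)" for x
  proof -
    have "(\<integral>\<^sup>+ y. g (merge (I - J) J (x, y)) \<partial>gauss_vec J) = (\<integral>\<^sup>+ y. (\<Prod>r\<in>S. ennreal (exp (\<phi> x (wrow k y l r)))) \<partial>gauss_vec J)"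
    proof (intro nn_integral_cong)
      fix y
      have "\<phi> (merge (I - J) J (x, y)) w = \<phi> x w" for w
        by (rule dep) (auto simp: merge_def J_def)
      moreover have "wrow k (merge (I - J) J (x, y)) l r = wrow k y l r" if "r \<in> S" for r
        using that by (auto simp: wrow_def merge_def J_def)
      ultimately show "g (merge (I - J) J (x, y)) = (\<Prod>r\<in>S. ennreal (exp (\<phi> x (wrow k y l r))))"
        using S by (simp add: g_def prod_ennreal exp_sum)
    qed
    also have "\<dots> = (\<integral>\<^sup>+ w. ennreal (exp (\<phi> x w)) \<partial>gauss_vec {..<k}) ^ card S"
      unfolding J_def using S meas[of x] by (intro nn_integral_rows) measurable
    also have "\<dots> \<le> ennreal \<rho> ^ card S"
      by (intro power_mono bound) auto
    finally show ?thesis using \<rho> by (simp add: ennreal_power)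
  qed
  have "(\<integral>\<^sup>+ W. g W \<partial>gauss_vec I) = (\<integral>\<^sup>+ x. \<integral>\<^sup>+ y. g (merge (I - J) J (x, y)) \<partial>gauss_vec J \<partial>gauss_vec (I - J))"
    using I gm U by (subst U, intro product_nn_integral_fold) (auto simp: J_def intro: finite_subset)
  also have "\<dots> \<le> (\<integral>\<^sup>+ x. ennreal (\<rho> ^ card S) \<partial>gauss_vec (I - J))"
    by (intro nn_integral_mono inner)
  also have "\<dots> = ennreal (\<rho> ^ card S)"
    by (simp only: nn_integral_const prob_space.emeasure_space_1[OF prob_space_gauss_vec] mult_1_right)
  finally have int: "(\<integral>\<^sup>+ W. g W \<partial>gauss_vec I) \<le> ennreal (\<rho> ^ card S)" .
  have "emeasure (gauss_vec I) {W \<in> space (gauss_vec I). a \<le> (\<Sum>r\<in>S. \<phi> W (wrow k W l r))}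
     \<le> emeasure (gauss_vec I) ({W \<in> space (gauss_vec I). 1 \<le> ennreal (exp (- a)) * g W} \<inter> space (gauss_vec I))"
  proof (intro emeasure_mono)
    show "{W \<in> space (gauss_vec I). a \<le> (\<Sum>r\<in>S. \<phi> W (wrow k W l r))} \<subseteq> {W \<in> space (gauss_vec I). 1 \<le> ennreal (exp (- a)) * g W} \<inter> space (gauss_vec I)"
      by (auto simp: g_def ennreal_1[symmetric] exp_minus_inverse simp flip: ennreal_mult exp_add simp del: ennreal_1)
    show "{W \<in> space (gauss_vec I). 1 \<le> ennreal (exp (- a)) * g W} \<inter> space (gauss_vec I) \<in> sets (gauss_vec I)"
      using gm by measurable
  qed
  also have "\<dots> \<le> ennreal (exp (- a)) * (\<integral>\<^sup>+ W. g W * indicator (space (gauss_vec I)) W \<partial>gauss_vec I)"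
  proof -
    have "{W \<in> space (gauss_vec I). 1 \<le> ennreal (exp (- a)) * g W} \<inter> space (gauss_vec I) = {W \<in> space (gauss_vec I). 1 \<le> ennreal (exp (- a)) * g W}"
      by auto
    moreover have "(\<lambda>W. g W * indicator (space (gauss_vec I)) W) \<in> borel_measurable (gauss_vec I)"
      using gm by measurable
    ultimately show ?thesis using nn_integral_Markov_inequality[of g "space (gauss_vec I)" "gauss_vec I" "ennreal (exp (- a))"] by simp
  qed
  also have "(\<integral>\<^sup>+ W. g W * indicator (space (gauss_vec I)) W \<partial>gauss_vec I) = (\<integral>\<^sup>+ W. g W \<partial>gauss_vec I)"
    by (intro nn_integral_cong) auto
  also have "ennreal (exp (- a)) * (\<integral>\<^sup>+ W. g W \<partial>gauss_vec I) \<le> ennreal (exp (- a)) * ennreal (\<rho> ^ card S)"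
    by (intro mult_left_mono int) auto
  also have "\<dots> = ennreal (\<rho> ^ card S * exp (- a))"
    using \<rho> by (simp add: ennreal_mult' mult.commute)
  finally show ?thesis .
qed

text \<open>Second-order expansion of the chi-square moment generating function at a small
  parameter, checked by squaring. The range u <= 1/4 fits the later choice u <= s / 2 with s <=
  1/2.\<close>

lemma inverse_sqrt_bound_pos:
  fixes u :: real assumes "0 \<le> u" "u \<le> 1/4"
  shows "1 / sqrt (1 - u) \<le> 1 + u/2 + u\<^sup>2/2"
proof -
  have "1 \<le> (1 - u) * (1 + u/2 + u\<^sup>2/2)\<^sup>2"
  proof -
    have "(1 - u) * (1 + u/2 + u\<^sup>2/2)\<^sup>2 = 1 + u\<^sup>2/4 * (1 - 3 * u - u\<^sup>2 - u^3)"
      by (simp add: power2_eq_square power3_eq_cube field_simps)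
    moreover have "u\<^sup>2 \<le> (1/4)\<^sup>2" "u^3 \<le> (1/4)^3" using assms by (auto intro: power_mono)
    ultimately show ?thesis using assms by (simp add: power2_eq_square power3_eq_cube)
  qed
  then have "1 \<le> sqrt (1 - u) * (1 + u/2 + u\<^sup>2/2)"
    using assms real_sqrt_le_mono[of 1 "(1 - u) * (1 + u/2 + u\<^sup>2/2)\<^sup>2"] by (simp add: real_sqrt_mult)
  then show ?thesis using assms by (simp add: field_simps)
qed

lemma inverse_sqrt_bound_neg:
  fixes u :: real assumes "0 \<le> u" "u \<le> 1/4"
  shows "1 / sqrt (1 + u) \<le> 1 - u/2 + u\<^sup>2/2"
proof -
  have "1 \<le> (1 + u) * (1 - u/2 + u\<^sup>2/2)\<^sup>2"
  proof -
    have "(1 + u) * (1 - u/2 + u\<^sup>2/2)\<^sup>2 = 1 + u\<^sup>2/4 * (1 - u\<^sup>2 + 3 * u + u^3)"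
      by (simp add: power2_eq_square power3_eq_cube field_simps)
    moreover have "u\<^sup>2 \<le> (1/4)\<^sup>2" "0 \<le> u^3" using assms by (auto intro: power_mono)
    ultimately show ?thesis using assms by (simp add: power2_eq_square)
  qed
  then have "1 \<le> sqrt (1 + u) * \<bar>1 - u/2 + u\<^sup>2/2\<bar>"
    using assms real_sqrt_le_mono[of 1 "(1 + u) * (1 - u/2 + u\<^sup>2/2)\<^sup>2"] by (simp add: real_sqrt_mult)
  moreover have "\<bar>1 - u/2 + u\<^sup>2/2\<bar> = 1 - u/2 + u\<^sup>2/2" using assms by (intro abs_of_nonneg) (auto intro: add_nonneg_nonneg)
  ultimately show ?thesis using assms by (simp add: field_simps)
qed

text \<open>
  An upper bound on the outer probability of an event; stating tail bounds in this form spares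
  measurability proofs for the events themselves.
\<close>

definition tail_le :: "'a measure \<Rightarrow> ('a \<Rightarrow> bool) \<Rightarrow> real \<Rightarrow> bool" where
  "tail_le M P b \<longleftrightarrow> (\<exists>A\<in>sets M. {W \<in> space M. P W} \<subseteq> A \<and> emeasure M A \<le> ennreal b)"

text \<open>
  A vector that depends on the weights outside layer \<open>l\<close> only; conditionally on those it is a
  constant for the Gaussian rows of layer \<open>l\<close>.
\<close>

definition off_layer :: "(nat \<times> nat \<times> nat) set \<Rightarrow> nat \<Rightarrow> nat \<Rightarrow> (weights \<Rightarrow> point) \<Rightarrow> bool" where
  "off_layer I l k y \<longleftrightarrow>
     (\<forall>W W'. (\<forall>i\<in>I. fst i \<noteq> l \<longrightarrow> W i = W' i) \<longrightarrow> (\<forall>j<k. y W j = y W' j)) \<and>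
     (\<forall>j<k. (\<lambda>W. y W j) \<in> borel_measurable (PiM I (\<lambda>_. borel)))"

lemma off_layer_cong:
  assumes "off_layer I l k y" "\<And>i. i \<in> I \<Longrightarrow> fst i \<noteq> l \<Longrightarrow> W i = W' i"
  shows "(\<Sum>j<k. w j * y W j) = (\<Sum>j<k. w j * y W' j)" "L2_set (y W) {..<k} = L2_set (y W') {..<k}"
proof -
  have "\<forall>j<k. y W j = y W' j" using assms unfolding off_layer_def by blast
  then show "(\<Sum>j<k. w j * y W j) = (\<Sum>j<k. w j * y W' j)" "L2_set (y W) {..<k} = L2_set (y W') {..<k}"
    by (auto intro!: sum.cong L2_set_cong)
qed

lemma off_layer_measurable:
  assumes "off_layer I l k y" "{l} \<times> {r} \<times> {..<k} \<subseteq> I"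
  shows "(\<lambda>W. \<Sum>j<k. wrow k W l r j * y W j) \<in> borel_measurable (PiM I (\<lambda>_. borel))"
  unfolding wrow_inner using assms
  by (intro borel_measurable_sum borel_measurable_times) (auto simp: off_layer_def intro!: measurable_component_singleton)

lemma off_layer_norm_measurable:
  assumes "off_layer I l k y"
  shows "(\<lambda>W. L2_set (y W) {..<k}) \<in> borel_measurable (PiM I (\<lambda>_. borel))"
proof -
  have [measurable]: "\<And>j. j \<in> {..<k} \<Longrightarrow> (\<lambda>W. y W j) \<in> borel_measurable (PiM I (\<lambda>_. borel))"
    using assms by (auto simp: off_layer_def)
  show ?thesis unfolding L2_set_def by measurable
qed

text \<open>Chernoff with parameter 1/4 relative to the squared norm, where each row has exponential
  moment sqrt 2. If the vector vanishes, division by zero makes \<phi> zero, which is harmless: the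
  strict inequality of the event is then false.\<close>

lemma chi_square_tail:
  assumes I: "finite I" "{l} \<times> S \<times> {..<k} \<subseteq> I" and S: "finite S" and y: "off_layer I l k y"
  shows "tail_le (gauss_vec I) (\<lambda>W. c * (L2_set (y W) {..<k})\<^sup>2 < (\<Sum>r\<in>S. (\<Sum>j<k. W (l, r, j) * y W j)\<^sup>2)) (sqrt 2 ^ card S * exp (- (c / 4)))"
proof -
  define \<phi> where "\<phi> W w = (\<Sum>j<k. w j * y W j)\<^sup>2 / (4 * (L2_set (y W) {..<k})\<^sup>2)" for W w
  have jm: "(\<lambda>W. \<phi> W (wrow k W l r)) \<in> borel_measurable (PiM I (\<lambda>_. borel))" if "r \<in> S" for r
  proof -
    have "{l} \<times> {r} \<times> {..<k} \<subseteq> I" using I that by auto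
    note [measurable] = off_layer_measurable[OF y this] off_layer_norm_measurable[OF y]
    show ?thesis unfolding \<phi>_def by measurable
  qed
  have bd: "(\<integral>\<^sup>+ w. ennreal (exp (\<phi> W w)) \<partial>gauss_vec {..<k}) \<le> ennreal (sqrt 2)" for W
  proof (cases "L2_set (y W) {..<k} = 0")
    case True
    have "ennreal 1 \<le> ennreal (sqrt 2)" by (intro ennreal_leI) simp
    then show ?thesis using True prob_space.emeasure_space_1[OF prob_space_gauss_vec, of "{..<k}"]
      by (simp add: \<phi>_def)
  next
    case False
    define t where "t = 1 / (4 * (L2_set (y W) {..<k})\<^sup>2)"
    have half: "2 * t * (L2_set (y W) {..<k})\<^sup>2 = 1/2" using False by (simp add: t_def)
    have "(\<integral>\<^sup>+ w. ennreal (exp (t * (\<Sum>j<k. w j * y W j)\<^sup>2)) \<partial>gauss_vec {..<k}) = ennreal (1 / sqrt (1 - 1/2))"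
      using gauss_exp_square[of t "y W" k] unfolding half by simp
    then have "(\<integral>\<^sup>+ w. ennreal (exp (t * (\<Sum>j<k. w j * y W j)\<^sup>2)) \<partial>gauss_vec {..<k}) = ennreal (sqrt 2)"
      by (simp add: real_sqrt_divide)
    then show ?thesis by (simp add: \<phi>_def t_def)
  qed
  have "emeasure (gauss_vec I) {W \<in> space (gauss_vec I). c / 4 \<le> (\<Sum>r\<in>S. \<phi> W (wrow k W l r))} \<le> ennreal (sqrt 2 ^ card S * exp (- (c / 4)))"
  proof (rule row_chernoff[OF I S])
    show "\<phi> W w = \<phi> W' w" if "\<And>i. i \<in> I \<Longrightarrow> fst i \<noteq> l \<Longrightarrow> W i = W' i" for W W' w
      proof -
      have e1: "(\<Sum>j<k. w j * y W j) = (\<Sum>j<k. w j * y W' j)" and e2: "L2_set (y W) {..<k} = L2_set (y W') {..<k}"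
        by (rule off_layer_cong[OF y], use that in auto)+
      show ?thesis unfolding \<phi>_def e1 e2 ..
    qed
    show "\<phi> W \<in> borel_measurable (PiM {..<k} (\<lambda>_. borel))" for W
      unfolding \<phi>_def by measurable
  qed (use bd jm in auto)
  moreover have "{W \<in> space (gauss_vec I). c * (L2_set (y W) {..<k})\<^sup>2 < (\<Sum>r\<in>S. (\<Sum>j<k. W (l, r, j) * y W j)\<^sup>2)}
     \<subseteq> {W \<in> space (gauss_vec I). c / 4 \<le> (\<Sum>r\<in>S. \<phi> W (wrow k W l r))}"
  proof safe
    fix W assume *: "c * (L2_set (y W) {..<k})\<^sup>2 < (\<Sum>r\<in>S. (\<Sum>j<k. W (l, r, j) * y W j)\<^sup>2)"
    have "L2_set (y W) {..<k} \<noteq> 0"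
    proof
      assume z: "L2_set (y W) {..<k} = 0"
      then have "\<And>j. j < k \<Longrightarrow> y W j = 0" by (auto simp: L2_set_eq_0_iff)
      with * z show False by simp
    qed
    then have pos: "(L2_set (y W) {..<k})\<^sup>2 > 0" by simp
    with * have "c < (\<Sum>r\<in>S. (\<Sum>j<k. W (l, r, j) * y W j)\<^sup>2) / (L2_set (y W) {..<k})\<^sup>2"
      by (simp add: pos_less_divide_eq)
    then show "c / 4 \<le> (\<Sum>r\<in>S. \<phi> W (wrow k W l r))"
      unfolding \<phi>_def wrow_inner by (simp add: sum_divide_distrib[symmetric] field_simps)
  qed
  moreover have "(\<lambda>W. \<Sum>r\<in>S. \<phi> W (wrow k W l r)) \<in> borel_measurable (gauss_vec I)"
    unfolding measurable_gauss_vec_iff by (intro borel_measurable_sum jm)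
  then have "{W \<in> space (gauss_vec I). c / 4 \<le> (\<Sum>r\<in>S. \<phi> W (wrow k W l r))} \<in> sets (gauss_vec I)"
    by measurable
  ultimately show ?thesis unfolding tail_le_def by blast
qed

text \<open>
  The mask \<open>0 < w \<bullet> h\<close> and its mirror image under \<open>w \<mapsto> - w\<close> exclude each other, so averaging over
  the sign of \<open>w\<close> gains a factor one half no matter how \<open>h\<close> and \<open>y\<close> are correlated.
\<close>

lemma masked_square_upper_tail:
  assumes I: "finite I" "{l} \<times> {..<m} \<times> {..<k} \<subseteq> I" and y: "off_layer I l k y" and h: "off_layer I l k h"
    and s: "0 < s" "s \<le> 1/2"
  shows "tail_le (gauss_vec I) (\<lambda>W. (1 + s) * real m * (L2_set (y W) {..<k})\<^sup>2 <
      2 * (\<Sum>r<m. (if 0 < (\<Sum>j<k. W (l, r, j) * h W j) then \<Sum>j<k. W (l, r, j) * y W j else 0)\<^sup>2)) (exp (- (real m * s\<^sup>2 / 16)))"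
proof -
  \<comment> \<open>With this parameter each row has exponential moment at most exp (s/8 + s^2/16),
    while the threshold \<open>a\<close> below is s/8 (1 + s) m. The difference of the exponents is
    - m s^2 / 16.\<close>
  define t where "t W = (s / 8) * 2 / (L2_set (y W) {..<k})\<^sup>2" for W
  define \<phi> where "\<phi> W w = t W * (if 0 < (\<Sum>j<k. w j * h W j) then \<Sum>j<k. w j * y W j else 0)\<^sup>2" for W w
  have tpos: "t W \<ge> 0" for W using s by (simp add: t_def)
  have jm: "(\<lambda>W. \<phi> W (wrow k W l r)) \<in> borel_measurable (PiM I (\<lambda>_. borel))" if "r < m" for r
  proof -
    have "{l} \<times> {r} \<times> {..<k} \<subseteq> I" using I that by auto
    note [measurable] = off_layer_measurable[OF y this] off_layer_measurable[OF h this] off_layer_norm_measurable[OF y]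
    show ?thesis unfolding \<phi>_def t_def by measurable
  qed
  have pm: "\<phi> W \<in> borel_measurable (PiM {..<k} (\<lambda>_. borel))" for W
    unfolding \<phi>_def by measurable
  have bd: "(\<integral>\<^sup>+ w. ennreal (exp (\<phi> W w)) \<partial>gauss_vec {..<k}) \<le> ennreal (exp (s / 8 + 4 * (s / 8)\<^sup>2))" for W
  proof -
    have tt: "2 * t W * (L2_set (y W) {..<k})\<^sup>2 \<le> s / 2" "0 \<le> 2 * t W * (L2_set (y W) {..<k})\<^sup>2"
      using s by (auto simp: t_def)
    have "(\<integral>\<^sup>+ w. ennreal (exp (\<phi> W w)) \<partial>gauss_vec {..<k})
       \<le> ennreal ((1 + 1 / sqrt (1 - 2 * t W * (L2_set (y W) {..<k})\<^sup>2)) / 2)"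
    proof (rule gauss_symmetrize)
      show "(\<lambda>w. exp (\<phi> W w)) \<in> borel_measurable (PiM {..<k} (\<lambda>_. borel))"
        using pm[of W] by measurable
      fix w :: point
      have neg: "(\<Sum>j<k. restrict (\<lambda>i. - w i) {..<k} j * v j) = - (\<Sum>j<k. w j * v j)" for v
        by (simp add: sum_negf)
      have "1 \<le> exp (t W * (\<Sum>j<k. w j * y W j)\<^sup>2)" using tpos[of W] by simp
      then show "exp (\<phi> W w) + exp (\<phi> W (\<lambda>i\<in>{..<k}. - w i)) \<le> 1 + exp (t W * (\<Sum>j<k. w j * y W j)\<^sup>2)"
        unfolding \<phi>_def neg by (simp split: if_splits)
    qed (use tt s in auto)
    also have "\<dots> \<le> ennreal (exp (s / 8 + 4 * (s / 8)\<^sup>2))"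
    proof (intro ennreal_leI)
      define u where "u = 2 * t W * (L2_set (y W) {..<k})\<^sup>2"
      have u: "0 \<le> u" "u \<le> s / 2" using tt by (auto simp: u_def)
      have "1 / sqrt (1 - u) \<le> 1 + u/2 + u\<^sup>2/2" using u s by (intro inverse_sqrt_bound_pos) auto
      then have "(1 + 1 / sqrt (1 - u)) / 2 \<le> 1 + (u/4 + u\<^sup>2/4)" by simp
      also have "\<dots> \<le> 1 + (s/8 + 4 * (s / 8)\<^sup>2)"
        using u power_mono[OF u(2) u(1), of 2] by (simp add: power2_eq_square)
      also have "\<dots> \<le> exp (s / 8 + 4 * (s / 8)\<^sup>2)" by (rule exp_ge_add_one_self)
      finally show "(1 + 1 / sqrt (1 - 2 * t W * (L2_set (y W) {..<k})\<^sup>2)) / 2 \<le> exp (s / 8 + 4 * (s / 8)\<^sup>2)"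
        by (simp add: u_def)
    qed
    finally show ?thesis .
  qed
  define a where "a = s / 8 * (1 + s) * real m"
  have "emeasure (gauss_vec I) {W \<in> space (gauss_vec I). a \<le> (\<Sum>r<m. \<phi> W (wrow k W l r))} \<le> ennreal (exp (s / 8 + 4 * (s / 8)\<^sup>2) ^ card {..<m} * exp (- a))"
  proof (rule row_chernoff[OF I])
    show "\<phi> W w = \<phi> W' w" if "\<And>i. i \<in> I \<Longrightarrow> fst i \<noteq> l \<Longrightarrow> W i = W' i" for W W' w
      proof -
      have e1: "(\<Sum>j<k. w j * y W j) = (\<Sum>j<k. w j * y W' j)" and e2: "L2_set (y W) {..<k} = L2_set (y W') {..<k}"
        by (rule off_layer_cong[OF y], use that in auto)+
      have e3: "(\<Sum>j<k. w j * h W j) = (\<Sum>j<k. w j * h W' j)"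
        by (rule off_layer_cong[OF h], use that in auto)
      show ?thesis unfolding \<phi>_def t_def e1 e2 e3 ..
    qed
  qed (use bd jm pm in auto)
  also have "exp (s / 8 + 4 * (s / 8)\<^sup>2) ^ card {..<m} * exp (- a) = exp (- (real m * s\<^sup>2 / 16))"
    by (simp add: a_def exp_add[symmetric] exp_of_nat_mult[symmetric]) (simp add: power2_eq_square field_simps)
  finally have E: "emeasure (gauss_vec I) {W \<in> space (gauss_vec I). a \<le> (\<Sum>r<m. \<phi> W (wrow k W l r))} \<le> ennreal (exp (- (real m * s\<^sup>2 / 16)))" .
  have sub: "{W \<in> space (gauss_vec I).
      (1 + s) * real m * (L2_set (y W) {..<k})\<^sup>2 <
      2 * (\<Sum>r<m. (if 0 < (\<Sum>j<k. W (l, r, j) * h W j) then \<Sum>j<k. W (l, r, j) * y W j else 0)\<^sup>2)}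
     \<subseteq> {W \<in> space (gauss_vec I). a \<le> (\<Sum>r<m. \<phi> W (wrow k W l r))}"
  proof safe
    fix W assume *: "(1 + s) * real m * (L2_set (y W) {..<k})\<^sup>2 <
      2 * (\<Sum>r<m. (if 0 < (\<Sum>j<k. W (l, r, j) * h W j) then \<Sum>j<k. W (l, r, j) * y W j else 0)\<^sup>2)" (is "_ < 2 * ?X")
    have "L2_set (y W) {..<k} \<noteq> 0"
    proof
      assume z: "L2_set (y W) {..<k} = 0"
      then have "\<And>j. j < k \<Longrightarrow> y W j = 0" by (auto simp: L2_set_eq_0_iff)
      then have "?X = 0" by (intro sum.neutral) simp
      with * z show False by simp
    qed
    then have pos: "(L2_set (y W) {..<k})\<^sup>2 > 0" by simp
    with * have "(1 + s) * real m < 2 * ?X / (L2_set (y W) {..<k})\<^sup>2"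
      by (simp add: pos_less_divide_eq)
    then have "s / 8 * ((1 + s) * real m) \<le> s / 8 * (2 * ?X / (L2_set (y W) {..<k})\<^sup>2)"
      using s by (intro mult_left_mono) auto
    also have "\<dots> = (\<Sum>r<m. \<phi> W (wrow k W l r))"
      unfolding \<phi>_def wrow_inner sum_distrib_left[symmetric] t_def by simp
    finally show "a \<le> (\<Sum>r<m. \<phi> W (wrow k W l r))" by (simp add: a_def mult.assoc)
  qed
  have "(\<lambda>W. \<Sum>r<m. \<phi> W (wrow k W l r)) \<in> borel_measurable (gauss_vec I)"
    unfolding measurable_gauss_vec_iff by (intro borel_measurable_sum jm) auto
  then have "{W \<in> space (gauss_vec I). a \<le> (\<Sum>r<m. \<phi> W (wrow k W l r))} \<in> sets (gauss_vec I)"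
    by measurable
  with sub E show ?thesis unfolding tail_le_def by blast
qed

text \<open>The same Chernoff argument with a negative parameter. It works because relu and its
  mirror image are exact complements: one of \<open>w\<close> and \<open>- w\<close> contributes 1
  and the other the full exponential, so the sum is still bounded from above although the exponents
  are negative.\<close>

lemma relu_square_lower_tail:
  assumes I: "finite I" "{l} \<times> {..<m} \<times> {..<k} \<subseteq> I" and y: "off_layer I l k y"
    and s: "0 < s" "s \<le> 1/2"
  shows "tail_le (gauss_vec I) (\<lambda>W. 2 * (\<Sum>r<m. (relu (\<Sum>j<k. W (l, r, j) * y W j))\<^sup>2) < (1 - s) * real m * (L2_set (y W) {..<k})\<^sup>2) (exp (- (real m * s\<^sup>2 / 16)))"
proof -
  define t where "t W = (s / 8) * 2 / (L2_set (y W) {..<k})\<^sup>2" for W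
  define \<phi> where "\<phi> W w = - (t W * (relu (\<Sum>j<k. w j * y W j))\<^sup>2)" for W w
  have [measurable]: "relu \<in> borel_measurable borel" unfolding relu_def by measurable
  have jm: "(\<lambda>W. \<phi> W (wrow k W l r)) \<in> borel_measurable (PiM I (\<lambda>_. borel))" if "r < m" for r
  proof -
    have "{l} \<times> {r} \<times> {..<k} \<subseteq> I" using I that by auto
    note [measurable] = off_layer_measurable[OF y this] off_layer_norm_measurable[OF y]
    show ?thesis unfolding \<phi>_def t_def by measurable
  qed
  have pm: "\<phi> W \<in> borel_measurable (PiM {..<k} (\<lambda>_. borel))" for W
    unfolding \<phi>_def by measurable
  have bd: "(\<integral>\<^sup>+ w. ennreal (exp (\<phi> W w)) \<partial>gauss_vec {..<k}) \<le> ennreal (exp (- (s / 8) + 4 * (s / 8)\<^sup>2))" if nz: "L2_set (y W) {..<k} \<noteq> 0" for W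
  proof -
    have tt: "2 * t W * (L2_set (y W) {..<k})\<^sup>2 = s / 2"
      using s nz by (auto simp: t_def)
    have "(\<integral>\<^sup>+ w. ennreal (exp (\<phi> W w)) \<partial>gauss_vec {..<k})
       \<le> ennreal ((1 + 1 / sqrt (1 - 2 * (- t W) * (L2_set (y W) {..<k})\<^sup>2)) / 2)"
    proof (rule gauss_symmetrize)
      show "(\<lambda>w. exp (\<phi> W w)) \<in> borel_measurable (PiM {..<k} (\<lambda>_. borel))"
        using pm[of W] by measurable
      fix w :: point
      have neg: "(\<Sum>j<k. restrict (\<lambda>i. - w i) {..<k} j * v j) = - (\<Sum>j<k. w j * v j)" for v
        by (simp add: sum_negf)
      show "exp (\<phi> W w) + exp (\<phi> W (\<lambda>i\<in>{..<k}. - w i)) \<le> 1 + exp (- t W * (\<Sum>j<k. w j * y W j)\<^sup>2)"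
        unfolding \<phi>_def neg by (auto simp: relu_def max_def)
    qed (use tt s in auto)
    also have "\<dots> \<le> ennreal (exp (- (s / 8) + 4 * (s / 8)\<^sup>2))"
    proof (intro ennreal_leI)
      define u where "u = s / 2"
      have "1 / sqrt (1 + u) \<le> 1 - u/2 + u\<^sup>2/2" using s by (intro inverse_sqrt_bound_neg) (auto simp: u_def)
      then have "(1 + 1 / sqrt (1 + u)) / 2 \<le> 1 + (- (u/4) + u\<^sup>2/4)" by simp
      also have "\<dots> = 1 + (- (s/8) + 4 * (s / 8)\<^sup>2)"
        by (simp add: power2_eq_square u_def)
      also have "\<dots> \<le> exp (- (s / 8) + 4 * (s / 8)\<^sup>2)" by (rule exp_ge_add_one_self)
      moreover have "1 - 2 * (- t W) * (L2_set (y W) {..<k})\<^sup>2 = 1 + u" using tt by (simp add: u_def)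
      ultimately show "(1 + 1 / sqrt (1 - 2 * (- t W) * (L2_set (y W) {..<k})\<^sup>2)) / 2 \<le> exp (- (s / 8) + 4 * (s / 8)\<^sup>2)"
        by (simp only:)
    qed
    finally show ?thesis .
  qed
  \<comment> \<open>When the vector vanishes, \<phi> is zero and its exponential exceeds the claimed
    moment, which is below one. The value - s/8 is put in its place; the strict inequality of the
    event excludes this case.\<close>
  define \<phi>' where "\<phi>' W w = (if L2_set (y W) {..<k} = 0 then - (s / 8) else \<phi> W w)" for W w
  have pm': "\<phi>' W \<in> borel_measurable (PiM {..<k} (\<lambda>_. borel))" for W
    using pm[of W] by (simp add: \<phi>'_def[abs_def])
  have jm': "(\<lambda>W. \<phi>' W (wrow k W l r)) \<in> borel_measurable (PiM I (\<lambda>_. borel))" if "r < m" for r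
  proof -
    note [measurable] = off_layer_norm_measurable[OF y] jm[OF that]
    show ?thesis unfolding \<phi>'_def by measurable
  qed
  have bd': "(\<integral>\<^sup>+ w. ennreal (exp (\<phi>' W w)) \<partial>gauss_vec {..<k}) \<le> ennreal (exp (- (s / 8) + 4 * (s / 8)\<^sup>2))" for W
  proof (cases "L2_set (y W) {..<k} = 0")
    case True
    then have "(\<integral>\<^sup>+ w. ennreal (exp (\<phi>' W w)) \<partial>gauss_vec {..<k}) = ennreal (exp (- (s/8)))"
      using prob_space.emeasure_space_1[OF prob_space_gauss_vec, of "{..<k}"] by (simp add: \<phi>'_def)
    also have "\<dots> \<le> ennreal (exp (- (s / 8) + 4 * (s / 8)\<^sup>2))" by (intro ennreal_leI) simp
    finally show ?thesis .
  next
    case False then show ?thesis using bd[OF False] by (simp add: \<phi>'_def)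
  qed
  define a where "a = - (s / 8 * (1 - s) * real m)"
  have "emeasure (gauss_vec I) {W \<in> space (gauss_vec I). a \<le> (\<Sum>r<m. \<phi>' W (wrow k W l r))} \<le> ennreal (exp (- (s / 8) + 4 * (s / 8)\<^sup>2) ^ card {..<m} * exp (- a))"
  proof (rule row_chernoff[OF I])
    show "\<phi>' W w = \<phi>' W' w" if "\<And>i. i \<in> I \<Longrightarrow> fst i \<noteq> l \<Longrightarrow> W i = W' i" for W W' w
      proof -
      have e1: "(\<Sum>j<k. w j * y W j) = (\<Sum>j<k. w j * y W' j)" and e2: "L2_set (y W) {..<k} = L2_set (y W') {..<k}"
        by (rule off_layer_cong[OF y], use that in auto)+
      show ?thesis unfolding \<phi>'_def \<phi>_def t_def e1 e2 ..
    qed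
  qed (use bd' jm' pm' in auto)
  also have "exp (- (s / 8) + 4 * (s / 8)\<^sup>2) ^ card {..<m} * exp (- a) = exp (- (real m * s\<^sup>2 / 16))"
    by (simp add: a_def exp_add[symmetric] exp_of_nat_mult[symmetric]) (simp add: power2_eq_square field_simps)
  finally have E: "emeasure (gauss_vec I) {W \<in> space (gauss_vec I). a \<le> (\<Sum>r<m. \<phi>' W (wrow k W l r))} \<le> ennreal (exp (- (real m * s\<^sup>2 / 16)))" .
  have sub: "{W \<in> space (gauss_vec I).
      2 * (\<Sum>r<m. (relu (\<Sum>j<k. W (l, r, j) * y W j))\<^sup>2) < (1 - s) * real m * (L2_set (y W) {..<k})\<^sup>2}
     \<subseteq> {W \<in> space (gauss_vec I). a \<le> (\<Sum>r<m. \<phi>' W (wrow k W l r))}"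
  proof safe
    fix W assume *: "2 * (\<Sum>r<m. (relu (\<Sum>j<k. W (l, r, j) * y W j))\<^sup>2) < (1 - s) * real m * (L2_set (y W) {..<k})\<^sup>2" (is "2 * ?X < _")
    have "?X \<ge> 0" by (intro sum_nonneg) auto
    with * have nz: "L2_set (y W) {..<k} \<noteq> 0" by auto
    then have pos: "(L2_set (y W) {..<k})\<^sup>2 > 0" by simp
    with * have "2 * ?X / (L2_set (y W) {..<k})\<^sup>2 < (1 - s) * real m"
      by (simp add: pos_divide_less_eq)
    then have "s / 8 * (2 * ?X / (L2_set (y W) {..<k})\<^sup>2) \<le> s / 8 * ((1 - s) * real m)"
      using s by (intro mult_left_mono) auto
    also have "s / 8 * (2 * ?X / (L2_set (y W) {..<k})\<^sup>2) = - (\<Sum>r<m. \<phi>' W (wrow k W l r))"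
      unfolding \<phi>'_def \<phi>_def wrow_inner using nz by (simp add: sum_negf sum_distrib_left sum_divide_distrib t_def)
    finally show "a \<le> (\<Sum>r<m. \<phi>' W (wrow k W l r))" by (simp add: a_def mult.assoc)
  qed
  have "(\<lambda>W. \<Sum>r<m. \<phi>' W (wrow k W l r)) \<in> borel_measurable (gauss_vec I)"
    unfolding measurable_gauss_vec_iff by (intro borel_measurable_sum jm') auto
  then have "{W \<in> space (gauss_vec I). a \<le> (\<Sum>r<m. \<phi>' W (wrow k W l r))} \<in> sets (gauss_vec I)"
    by measurable
  with sub E show ?thesis unfolding tail_le_def by blast
qed

text \<open>Each row is counted with probability at most \<tau> by \<open>gauss_small_ball\<close>,
  so its indicator has exponential moment at most 1 + 2 \<tau>, because e <= 3. A threshold of 3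
  \<tau> m against the exponent 2 \<tau> m leaves exp (- \<tau> m). The vector has to be nonzero, as
  otherwise every row would be counted.\<close>

lemma small_ball_count_tail:
  assumes I: "finite I" "{l} \<times> {..<m} \<times> {..<k} \<subseteq> I" and y: "off_layer I l k y"
    and \<tau>: "0 \<le> \<tau>"
  shows "tail_le (gauss_vec I) (\<lambda>W. 0 < L2_set (y W) {..<k} \<and>
      3 * \<tau> * real m < real (card {r. r < m \<and> \<bar>\<Sum>j<k. W (l, r, j) * y W j\<bar> \<le> \<tau> * L2_set (y W) {..<k}})) (exp (- (\<tau> * real m)))"
proof -
  define \<phi> where "\<phi> W w = (if 0 < L2_set (y W) {..<k} \<and> \<bar>\<Sum>j<k. w j * y W j\<bar> \<le> \<tau> * L2_set (y W) {..<k} then 1 else 0 :: real)" for W w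
  have jm: "(\<lambda>W. \<phi> W (wrow k W l r)) \<in> borel_measurable (PiM I (\<lambda>_. borel))" if "r < m" for r
  proof -
    have "{l} \<times> {r} \<times> {..<k} \<subseteq> I" using I that by auto
    note m1 = off_layer_measurable[OF y this] and m2 [measurable] = off_layer_norm_measurable[OF y]
    have [measurable]: "Measurable.pred (PiM I (\<lambda>_. borel)) (\<lambda>W. \<bar>\<Sum>j<k. wrow k W l r j * y W j\<bar> \<le> \<tau> * L2_set (y W) {..<k})"
      unfolding pred_def using m1 m2 by (intro borel_measurable_le) auto
    show ?thesis unfolding \<phi>_def by measurable
  qed
  have pm: "\<phi> W \<in> borel_measurable (PiM {..<k} (\<lambda>_. borel))" for W
    unfolding \<phi>_def by measurable
  have bd: "(\<integral>\<^sup>+ w. ennreal (exp (\<phi> W w)) \<partial>gauss_vec {..<k}) \<le> ennreal (exp (2 * \<tau>))" for W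
  proof (cases "0 < L2_set (y W) {..<k}")
    case True
    let ?B = "{w \<in> space (gauss_vec {..<k}). \<bar>\<Sum>j<k. w j * y W j\<bar> \<le> \<tau> * L2_set (y W) {..<k}}"
    have [measurable]: "(\<lambda>w. \<Sum>j<k. w j * y W j) \<in> borel_measurable (gauss_vec {..<k})"
      by (subst measurable_cong_sets[OF sets_gauss_vec refl]) (rule gauss_inner_measurable)
    have B: "?B \<in> sets (gauss_vec {..<k})" by measurable
    have "(\<integral>\<^sup>+ w. ennreal (exp (\<phi> W w)) \<partial>gauss_vec {..<k}) \<le> (\<integral>\<^sup>+ w. 1 + 2 * indicator ?B w \<partial>gauss_vec {..<k})"
    proof (intro nn_integral_mono)
      fix w assume w: "w \<in> space (gauss_vec {..<k})"
      have "exp 1 \<le> (3::real)" using exp_le by simp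
      then have "ennreal (exp 1) \<le> ennreal 3" by (rule ennreal_leI)
      then show "ennreal (exp (\<phi> W w)) \<le> 1 + 2 * indicator ?B w"
        using w by (auto simp: \<phi>_def indicator_def)
    qed
    also have "\<dots> = 1 + 2 * emeasure (gauss_vec {..<k}) ?B"
      using B by (subst nn_integral_add) (auto simp: nn_integral_cmult prob_space.emeasure_space_1[OF prob_space_gauss_vec])
    also have "\<dots> \<le> 1 + 2 * ennreal \<tau>"
      by (intro add_left_mono mult_left_mono gauss_small_ball True \<tau>) auto
    also have "\<dots> = ennreal (1 + 2 * \<tau>)"
      using \<tau> ennreal_mult[of 2 \<tau>] by simp
    also have "\<dots> \<le> ennreal (exp (2 * \<tau>))"
      by (intro ennreal_leI exp_ge_add_one_self)
    finally show ?thesis .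
  next
    case False
    have "ennreal 1 \<le> ennreal (exp (2 * \<tau>))" using \<tau> by (intro ennreal_leI) simp
    then show ?thesis using False prob_space.emeasure_space_1[OF prob_space_gauss_vec, of "{..<k}"]
      by (simp add: \<phi>_def)
  qed
  define a where "a = 3 * \<tau> * real m"
  have "emeasure (gauss_vec I) {W \<in> space (gauss_vec I). a \<le> (\<Sum>r<m. \<phi> W (wrow k W l r))} \<le> ennreal (exp (2 * \<tau>) ^ card {..<m} * exp (- a))"
  proof (rule row_chernoff[OF I])
    show "\<phi> W w = \<phi> W' w" if "\<And>i. i \<in> I \<Longrightarrow> fst i \<noteq> l \<Longrightarrow> W i = W' i" for W W' w
      proof -
      have e1: "(\<Sum>j<k. w j * y W j) = (\<Sum>j<k. w j * y W' j)" and e2: "L2_set (y W) {..<k} = L2_set (y W') {..<k}"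
        by (rule off_layer_cong[OF y], use that in auto)+
      show ?thesis unfolding \<phi>_def e1 e2 ..
    qed
  qed (use bd jm pm in auto)
  also have "exp (2 * \<tau>) ^ card {..<m} * exp (- a) = exp (- (\<tau> * real m))"
    by (simp add: a_def exp_add[symmetric] exp_of_nat_mult[symmetric])
  finally have E: "emeasure (gauss_vec I) {W \<in> space (gauss_vec I). a \<le> (\<Sum>r<m. \<phi> W (wrow k W l r))} \<le> ennreal (exp (- (\<tau> * real m)))" .
  have sub: "{W \<in> space (gauss_vec I). 0 < L2_set (y W) {..<k} \<and>
      3 * \<tau> * real m < real (card {r. r < m \<and> \<bar>\<Sum>j<k. W (l, r, j) * y W j\<bar> \<le> \<tau> * L2_set (y W) {..<k}})}
     \<subseteq> {W \<in> space (gauss_vec I). a \<le> (\<Sum>r<m. \<phi> W (wrow k W l r))}"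
  proof safe
    fix W assume *: "0 < L2_set (y W) {..<k}" "3 * \<tau> * real m < real (card {r. r < m \<and> \<bar>\<Sum>j<k. W (l, r, j) * y W j\<bar> \<le> \<tau> * L2_set (y W) {..<k}})"
    have "(\<Sum>r<m. \<phi> W (wrow k W l r)) = real (card {r. r < m \<and> \<bar>\<Sum>j<k. W (l, r, j) * y W j\<bar> \<le> \<tau> * L2_set (y W) {..<k}})"
      unfolding \<phi>_def wrow_inner using *(1) by (simp add: sum.If_cases Int_def)
    then show "a \<le> (\<Sum>r<m. \<phi> W (wrow k W l r))" using * by (simp add: a_def)
  qed
  have "(\<lambda>W. \<Sum>r<m. \<phi> W (wrow k W l r)) \<in> borel_measurable (gauss_vec I)"
    unfolding measurable_gauss_vec_iff by (intro borel_measurable_sum jm) auto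
  then have "{W \<in> space (gauss_vec I). a \<le> (\<Sum>r<m. \<phi> W (wrow k W l r))} \<in> sets (gauss_vec I)"
    by measurable
  with sub E show ?thesis unfolding tail_le_def by blast
qed


section \<open>Sparse grids and seminorms\<close>

text \<open>Points vanish at every index outside \<open>S\<close>, not just below some dimension,
  which makes the set finite for finite \<open>S\<close>.\<close>

definition grid :: "nat \<Rightarrow> nat set \<Rightarrow> point set" where
  "grid q S = {z. (\<forall>j. j \<notin> S \<longrightarrow> z j = 0) \<and> (\<forall>j\<in>S. \<exists>k::int. \<bar>k\<bar> \<le> int q \<and> z j = of_int k / real q)}"

definition small_sets :: "nat \<Rightarrow> nat \<Rightarrow> nat set set" where
  "small_sets m p = {S. S \<subseteq> {..<m} \<and> card S \<le> p}"

lemma grid_subset_image: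
  "grid q S \<subseteq> (\<lambda>k j. if j \<in> S then of_int (k j) / real q else 0) ` (S \<rightarrow>\<^sub>E {- int q..int q})"
proof
  fix z assume z: "z \<in> grid q S"
  then have "\<forall>j\<in>S. \<exists>k::int. \<bar>k\<bar> \<le> int q \<and> z j = of_int k / real q" by (simp add: grid_def)
  then obtain k :: "nat \<Rightarrow> int" where k: "\<And>j. j \<in> S \<Longrightarrow> \<bar>k j\<bar> \<le> int q \<and> z j = of_int (k j) / real q"
    by metis
  have "z = (\<lambda>j. if j \<in> S then of_int (restrict k S j) / real q else 0)"
    using z k by (auto simp: grid_def)
  moreover have "restrict k S \<in> S \<rightarrow>\<^sub>E {- int q..int q}"
    using k by (auto simp: abs_le_iff) (metis abs_le_iff minus_le_iff)
  ultimately show "z \<in> (\<lambda>k j. if j \<in> S then of_int (k j) / real q else 0) ` (S \<rightarrow>\<^sub>E {- int q..int q})"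
    by blast
qed

lemma finite_grid: "finite S \<Longrightarrow> finite (grid q S)"
  by (rule finite_subset[OF grid_subset_image]) (auto intro: finite_PiE)

lemma card_grid_le:
  assumes "finite S" shows "card (grid q S) \<le> (2 * q + 1) ^ card S"
proof -
  have "card (grid q S) \<le> card (S \<rightarrow>\<^sub>E {- int q..int q})"
    using assms by (intro surj_card_le[OF _ grid_subset_image] finite_PiE) auto
  also have "\<dots> = (2 * q + 1) ^ card S"
    using assms by (simp add: card_PiE nat_add_distrib nat_mult_distrib flip: mult_2)
  finally show ?thesis .
qed

lemma finite_small_sets: "finite (small_sets m p)"
  by (rule finite_subset[of _ "Pow {..<m}"]) (auto simp: small_sets_def)

lemma card_small_sets_le: "card (small_sets m p) \<le> (m + 1) ^ p"
proof -
  have "small_sets m p \<subseteq> (\<lambda>f. f ` {..<p} \<inter> {..<m}) ` ({..<p} \<rightarrow>\<^sub>E {..m})"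
  proof
    fix S assume "S \<in> small_sets m p"
    then have S: "S \<subseteq> {..<m}" "card S \<le> p" "finite S" by (auto simp: small_sets_def finite_subset)
    then obtain f where f: "bij_betw f {..<card S} S"
      using ex_bij_betw_nat_finite[of S] by (auto simp: atLeast0LessThan)
    define g where "g = (\<lambda>i\<in>{..<p}. if i < card S then f i else m)"
    have fS: "f i \<in> S" if "i < card S" for i using f that by (auto simp: bij_betw_def)
    have "g ` {..<p} \<inter> {..<m} = S"
    proof (intro equalityI subsetI)
      fix x assume "x \<in> g ` {..<p} \<inter> {..<m}"
      then show "x \<in> S" using fS by (auto simp: g_def split: if_splits)
    next
      fix x assume x: "x \<in> S"
      then obtain i where "i < card S" "x = f i" using f by (auto simp: bij_betw_def)
      then show "x \<in> g ` {..<p} \<inter> {..<m}" using S x by (auto simp: g_def intro!: image_eqI[of _ _ i])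
    qed
    moreover have "g \<in> {..<p} \<rightarrow>\<^sub>E {..m}"
      using fS S by (auto simp: g_def) (meson lessThan_iff less_imp_le subsetD)
    ultimately show "S \<in> (\<lambda>f. f ` {..<p} \<inter> {..<m}) ` ({..<p} \<rightarrow>\<^sub>E {..m})" by blast
  qed
  then have "card (small_sets m p) \<le> card ({..<p} \<rightarrow>\<^sub>E {..m})"
    by (intro surj_card_le finite_PiE) auto
  then show ?thesis by (simp add: card_PiE)
qed

text \<open>Coordinates are rounded towards zero, so that the approximation never has larger norm
  than the vector itself.\<close>

lemma grid_approx:
  assumes q: "q \<ge> 1" and z: "\<And>j. j \<in> S \<Longrightarrow> \<bar>z j\<bar> \<le> 1"
  shows "\<exists>z'\<in>grid q S. (\<forall>j\<in>S. \<bar>z' j\<bar> \<le> \<bar>z j\<bar> \<and> \<bar>z j - z' j\<bar> \<le> 1 / real q)"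
proof
  define k where "k j = (if z j \<ge> 0 then \<lfloor>real q * z j\<rfloor> else \<lceil>real q * z j\<rceil>)" for j
  define z' where "z' j = (if j \<in> S then of_int (k j) / real q else 0)" for j
  have q0: "real q > 0" using q by simp
  have k1: "\<bar>real_of_int (k j)\<bar> \<le> real q * \<bar>z j\<bar>" "\<bar>real q * z j - of_int (k j)\<bar> \<le> 1" for j
  proof -
    show "\<bar>real q * z j - of_int (k j)\<bar> \<le> 1" unfolding k_def by (auto simp: abs_le_iff) linarith+
    show "\<bar>real_of_int (k j)\<bar> \<le> real q * \<bar>z j\<bar>"
    proof (cases "z j \<ge> 0")
      case True
      then have "0 \<le> real q * z j" using q0 by simp
      then have "0 \<le> \<lfloor>real q * z j\<rfloor>" by simp
      then show ?thesis using True by (simp add: k_def)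
    next
      case False
      then have "real q * z j \<le> 0" using q0 by (simp add: mult_nonneg_nonpos)
      then have "\<lceil>real q * z j\<rceil> \<le> 0" by simp
      then have "\<bar>real_of_int \<lceil>real q * z j\<rceil>\<bar> = - real_of_int \<lceil>real q * z j\<rceil>" by linarith
      also have "\<dots> \<le> - (real q * z j)" by simp
      finally show ?thesis using False by (simp add: k_def)
    qed
  qed
  have kq: "\<bar>k j\<bar> \<le> int q" if "j \<in> S" for j
  proof -
    have "\<bar>real_of_int (k j)\<bar> \<le> real q * 1"
      using k1(1)[of j] z[OF that] q0 by (meson mult_left_mono order_trans less_imp_le)
    then show ?thesis by linarith
  qed
  show "z' \<in> grid q S" using kq by (auto simp: grid_def z'_def)
  show "\<forall>j\<in>S. \<bar>z' j\<bar> \<le> \<bar>z j\<bar> \<and> \<bar>z j - z' j\<bar> \<le> 1 / real q"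
  proof
    fix j assume "j \<in> S"
    have "\<bar>z' j\<bar> \<le> \<bar>z j\<bar>" using k1(1)[of j] q0 \<open>j \<in> S\<close> by (simp add: z'_def divide_le_eq mult.commute)
    moreover have "z j - z' j = (real q * z j - of_int (k j)) / real q" using q0 \<open>j \<in> S\<close> by (simp add: z'_def field_simps)
    then have "\<bar>z j - z' j\<bar> \<le> 1 / real q" using k1(2)[of j] q0 by (simp add: divide_right_mono)
    ultimately show "\<bar>z' j\<bar> \<le> \<bar>z j\<bar> \<and> \<bar>z j - z' j\<bar> \<le> 1 / real q" by simp
  qed
qed

lemma L2_set_mono_abs:
  assumes "\<And>i. i \<in> A \<Longrightarrow> \<bar>f i\<bar> \<le> \<bar>g i\<bar>"
  shows "L2_set f A \<le> L2_set g A"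
  unfolding L2_set_def using assms by (intro real_sqrt_le_mono sum_mono) (auto intro: abs_le_square_iff[THEN iffD1])

lemma L2_set_scale: "L2_set (\<lambda>i. c * f i) A = \<bar>c\<bar> * L2_set f A"
  unfolding L2_set_def by (simp add: power_mult_distrib real_sqrt_mult flip: sum_distrib_left)

lemma L2_set_abs_le: "finite A \<Longrightarrow> i \<in> A \<Longrightarrow> \<bar>f i\<bar> \<le> L2_set f A"
  using member_le_L2_set[of A i "\<lambda>i. \<bar>f i\<bar>"] by (simp add: L2_set_def)

lemma L2_set_le_card:
  assumes "finite A" "\<And>i. i \<in> A \<Longrightarrow> \<bar>f i\<bar> \<le> c"
  shows "L2_set f A \<le> real (card A) * c"
proof -
  have "L2_set f A = L2_set (\<lambda>i. \<bar>f i\<bar>) A" by (simp add: L2_set_def)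
  also have "\<dots> \<le> (\<Sum>i\<in>A. \<bar>f i\<bar>)" by (rule L2_set_le_sum) auto
  also have "\<dots> \<le> (\<Sum>i\<in>A. c)" using assms by (intro sum_mono) auto
  finally show ?thesis by simp
qed

text \<open>The last clause confines \<open>N\<close> to the first \<open>m\<close> coordinates,
  since vectors are functions on all natural numbers.\<close>

definition seminorm_on :: "nat \<Rightarrow> (point \<Rightarrow> real) \<Rightarrow> bool" where
  "seminorm_on m N \<longleftrightarrow> (\<forall>z w. N (\<lambda>j. z j + w j) \<le> N z + N w) \<and> (\<forall>c z. N (\<lambda>j. c * z j) = \<bar>c\<bar> * N z)
     \<and> (\<forall>z w. (\<forall>j<m. z j = w j) \<longrightarrow> N z = N w)"

lemma seminorm_onD:
  assumes "seminorm_on m N"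
  shows "N (\<lambda>j. z j + w j) \<le> N z + N w" "N (\<lambda>j. c * z j) = \<bar>c\<bar> * N z"
    "(\<And>j. j < m \<Longrightarrow> z j = w j) \<Longrightarrow> N z = N w" "N (\<lambda>j. 0) = 0" "0 \<le> N z"
proof -
  have add: "\<And>z w. N (\<lambda>j. z j + w j) \<le> N z + N w" and scale: "\<And>c z. N (\<lambda>j. c * z j) = \<bar>c\<bar> * N z"
    and "\<And>z w. (\<forall>j<m. z j = w j) \<Longrightarrow> N z = N w"
    using assms unfolding seminorm_on_def by blast+
  then show "N (\<lambda>j. z j + w j) \<le> N z + N w" "N (\<lambda>j. c * z j) = \<bar>c\<bar> * N z"
    "(\<And>j. j < m \<Longrightarrow> z j = w j) \<Longrightarrow> N z = N w" by blast+
  show zero: "N (\<lambda>j. 0) = 0" using scale[of 0] by simp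
  have "0 \<le> N z + N (\<lambda>j. - 1 * z j)" using add[of z "\<lambda>j. - 1 * z j"] zero by simp
  then show "0 \<le> N z" unfolding scale by simp
qed

lemma seminorm_sum_le:
  assumes N: "seminorm_on m N" and "finite A"
  shows "N (\<lambda>j. \<Sum>b\<in>A. z b j) \<le> (\<Sum>b\<in>A. N (z b))"
  using assms(2)
proof induction
  case empty then show ?case using seminorm_onD(4)[OF N] by simp
next
  case (insert b A)
  then show ?case using seminorm_onD(1)[OF N, of "z b" "\<lambda>j. \<Sum>b\<in>A. z b j"] by simp
qed

text \<open>On vectors supported in \<open>S\<close> the grid of mesh 1 / (2 p) is a 1/2-net of the
  unit ball, because at most \<open>p\<close> coordinates are rounded. A bound \<open>D\<close>
  therefore improves to Q + D / 2, and iterating from any finite bound leads to 2 Q in the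
  limit.\<close>

lemma sparse_seminorm_bound:
  assumes N: "seminorm_on m N" and p: "p \<ge> 1" and S: "S \<in> small_sets m p" and Q: "Q \<ge> 0"
    and grid: "\<And>z. z \<in> grid (2 * p) S \<Longrightarrow> N z \<le> Q * L2_set z {..<m}"
    and z: "\<And>j. j < m \<Longrightarrow> j \<notin> S \<Longrightarrow> z j = 0"
  shows "N z \<le> 2 * Q * L2_set z {..<m}"
proof -
  have fS: "finite S" "S \<subseteq> {..<m}" "card S \<le> p" using S by (auto simp: small_sets_def finite_subset)
  \<comment> \<open>A finite bound to start the iteration from, obtained by expanding into unit
    vectors.\<close>
  define C where "C = (\<Sum>j\<in>S. N (\<lambda>i. if i = j then 1 else 0))"
  have C: "N z \<le> C * L2_set z {..<m}" if "\<And>j. j < m \<Longrightarrow> j \<notin> S \<Longrightarrow> z j = 0" for z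
  proof -
    have "N z = N (\<lambda>i. \<Sum>j\<in>S. z j * (if i = j then 1 else 0))"
      using that fS by (intro seminorm_onD(3)[OF N]) (auto simp: if_distrib cong: if_cong)
    also have "\<dots> \<le> (\<Sum>j\<in>S. N (\<lambda>i. z j * (if i = j then 1 else 0)))"
      by (rule seminorm_sum_le[OF N fS(1)])
    also have "\<dots> = (\<Sum>j\<in>S. \<bar>z j\<bar> * N (\<lambda>i. (if i = j then 1 else 0)))"
      by (intro sum.cong refl seminorm_onD(2)[OF N])
    also have "\<dots> \<le> (\<Sum>j\<in>S. L2_set z {..<m} * N (\<lambda>i. (if i = j then 1 else 0)))"
      using fS by (intro sum_mono mult_right_mono seminorm_onD(5)[OF N] L2_set_abs_le) auto
    finally show ?thesis by (simp add: C_def sum_distrib_left mult.commute)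
  qed
  have step: "N z \<le> (Q + D / 2) * L2_set z {..<m}"
    if D: "D \<ge> 0" "\<And>z. (\<And>j. j < m \<Longrightarrow> j \<notin> S \<Longrightarrow> z j = 0) \<Longrightarrow> N z \<le> D * L2_set z {..<m}"
      and z: "\<And>j. j < m \<Longrightarrow> j \<notin> S \<Longrightarrow> z j = 0" for z D
  proof (cases "L2_set z {..<m} = 0")
    case True then show ?thesis using D(2)[of z] z by simp
  next
    case False
    define a where "a = L2_set z {..<m}"
    have a: "a > 0" using False by (simp add: a_def less_le)
    define u where "u j = (1 / a) * z j" for j
    have u1: "L2_set u {..<m} = 1" unfolding u_def L2_set_scale using a by (simp add: a_def)
    have "\<bar>u j\<bar> \<le> 1" if "j \<in> S" for j
      using L2_set_abs_le[of "{..<m}" j u] that fS u1 by auto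
    from grid_approx[of "2 * p" S u] this p obtain u' where u': "u' \<in> grid (2 * p) S"
      "\<And>j. j \<in> S \<Longrightarrow> \<bar>u' j\<bar> \<le> \<bar>u j\<bar>" "\<And>j. j \<in> S \<Longrightarrow> \<bar>u j - u' j\<bar> \<le> 1 / real (2 * p)"
      by auto
    have u'0: "u' j = 0" if "j \<notin> S" for j using u' that by (auto simp: grid_def)
    have "L2_set u' {..<m} \<le> L2_set u {..<m}"
      using u'(2) u'0 by (intro L2_set_mono_abs) (metis abs_ge_zero abs_zero)
    then have n1: "N u' \<le> Q * 1" using grid[OF u'(1)] Q u1 by (metis mult_left_mono order_trans)
    have "L2_set (\<lambda>j. u j - u' j) {..<m} = L2_set (\<lambda>j. u j - u' j) S"
      unfolding L2_set_def using fS u'0 z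
      by (intro arg_cong[where f=sqrt] sum.mono_neutral_right) (auto simp: u_def)
    also have "\<dots> \<le> real (card S) * (1 / real (2 * p))"
      using u'(3) fS by (intro L2_set_le_card) auto
    also have "\<dots> \<le> real p * (1 / real (2 * p))" using fS by (intro mult_right_mono) auto
    also have "\<dots> = 1/2" using p by simp
    finally have "L2_set (\<lambda>j. u j - u' j) {..<m} \<le> 1/2" .
    moreover have "N (\<lambda>j. u j - u' j) \<le> D * L2_set (\<lambda>j. u j - u' j) {..<m}"
      using z u'0 by (intro D(2)) (auto simp: u_def)
    ultimately have n2: "N (\<lambda>j. u j - u' j) \<le> D * (1/2)"
      using D(1) by (meson mult_left_mono order_trans)
    have "N u \<le> N u' + N (\<lambda>j. u j - u' j)"
      using seminorm_onD(1)[OF N, of u' "\<lambda>j. u j - u' j"] by simp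
    then have "N u \<le> Q + D / 2" using n1 n2 by simp
    moreover have "N u = (1/a) * N z" unfolding u_def seminorm_onD(2)[OF N] using a by simp
    ultimately have "N z / a \<le> Q + D / 2" by simp
    then show ?thesis using a unfolding a_def[symmetric] by (simp add: pos_divide_le_eq)
  qed
  have C0: "C \<ge> 0" unfolding C_def by (intro sum_nonneg seminorm_onD(5)[OF N])
  have iter: "\<forall>z. (\<forall>j<m. j \<notin> S \<longrightarrow> z j = 0) \<longrightarrow> N z \<le> (2 * Q + C / 2 ^ i) * L2_set z {..<m}" for i
  proof (induction i)
    case 0
    have "C * L2_set z {..<m} \<le> (2 * Q + C / 2 ^ 0) * L2_set z {..<m}" for z
      using Q by (intro mult_right_mono) auto
    then show ?case using C by (meson order_trans)
  next
    case (Suc i)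
    have eq: "Q + (2 * Q + C / 2 ^ i) / 2 = 2 * Q + C / 2 ^ Suc i" by simp
    show ?case
    proof (intro allI impI)
      fix z :: point assume z: "\<forall>j<m. j \<notin> S \<longrightarrow> z j = 0"
      show "N z \<le> (2 * Q + C / 2 ^ Suc i) * L2_set z {..<m}"
        unfolding eq[symmetric] using Suc.IH z Q C0 by (intro step) (auto intro!: add_nonneg_nonneg)
    qed
  qed
  have "(\<lambda>i. (2 * Q + C * (1 / 2) ^ i) * L2_set z {..<m}) \<longlonglongrightarrow> (2 * Q + C * 0) * L2_set z {..<m}"
    by (intro tendsto_intros LIMSEQ_power_zero) auto
  moreover have "N z \<le> (2 * Q + C * (1 / 2) ^ i) * L2_set z {..<m}" for i
    using iter[of i] z by (simp add: power_divide)
  ultimately have "N z \<le> (2 * Q + C * 0) * L2_set z {..<m}"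
    by (intro LIMSEQ_le_const) auto
  then show ?thesis by simp
qed

text \<open>Triangle inequality over consecutive blocks of length \<open>p\<close>, then
  Cauchy-Schwarz over the \<open>B\<close> blocks; the squared norms of the blocks add up to that of
  \<open>z\<close>.\<close>

lemma block_seminorm_bound:
  assumes N: "seminorm_on m N" and p: "p \<ge> 1" and mB: "m \<le> B * p" and Q: "Q \<ge> 0"
    and sparse: "\<And>S z. S \<in> small_sets m p \<Longrightarrow> (\<And>j. j < m \<Longrightarrow> j \<notin> S \<Longrightarrow> z j = 0) \<Longrightarrow> N z \<le> Q * L2_set z {..<m}"
  shows "N z \<le> Q * sqrt (real B) * L2_set z {..<m}"
proof -
  define zb where "zb b j = (if j div p = b then z j else 0)" for b j
  have lt: "j div p < B" if "j < m" for j
    using that mB by (intro less_mult_imp_div_less) (auto simp: mult.commute)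
  have "N z = N (\<lambda>j. \<Sum>b<B. zb b j)"
    using lt by (intro seminorm_onD(3)[OF N]) (simp add: zb_def)
  also have "\<dots> \<le> (\<Sum>b<B. N (zb b))" by (rule seminorm_sum_le[OF N]) simp
  also have "\<dots> \<le> (\<Sum>b<B. Q * L2_set (zb b) {..<m})"
  proof (intro sum_mono)
    fix b
    have "card {j. j < m \<and> j div p = b} \<le> card {b * p..<b * p + p}"
    proof (intro card_mono subsetI)
      fix j assume "j \<in> {j. j < m \<and> j div p = b}"
      then have "b = j div p" by simp
      then show "j \<in> {b * p..<b * p + p}" using p dividend_less_div_times[of p j] by (simp add: add.commute)
    qed simp
    then have "{j. j < m \<and> j div p = b} \<in> small_sets m p" by (auto simp: small_sets_def)
    then show "N (zb b) \<le> Q * L2_set (zb b) {..<m}" by (rule sparse) (auto simp: zb_def)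
  qed
  also have "\<dots> = Q * (\<Sum>b<B. \<bar>1\<bar> * \<bar>L2_set (zb b) {..<m}\<bar>)" by (simp add: sum_distrib_left L2_set_nonneg)
  also have "\<dots> \<le> Q * (L2_set (\<lambda>b. 1) {..<B} * L2_set (\<lambda>b. L2_set (zb b) {..<m}) {..<B})"
    by (intro mult_left_mono L2_set_mult_ineq Q)
  also have "L2_set (\<lambda>b. 1) {..<B} = sqrt (real B)" by (simp add: L2_set_def)
  also have "L2_set (\<lambda>b. L2_set (zb b) {..<m}) {..<B} = L2_set z {..<m}"
  proof -
    have "(\<Sum>b<B. (L2_set (zb b) {..<m})\<^sup>2) = (\<Sum>b<B. \<Sum>j<m. (zb b j)\<^sup>2)"
      by (intro sum.cong refl) (simp add: L2_set_def sum_nonneg)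
    also have "\<dots> = (\<Sum>j<m. \<Sum>b<B. (zb b j)\<^sup>2)" by (rule sum.swap)
    also have "\<dots> = (\<Sum>j<m. (z j)\<^sup>2)"
      using lt by (intro sum.cong refl) (simp add: zb_def if_distrib[where f="\<lambda>x. x\<^sup>2"] cong: if_cong)
    finally show ?thesis by (simp add: L2_set_def)
  qed
  finally show ?thesis by (simp add: mult.assoc)
qed


section \<open>Stability of the hidden layers\<close>

definition pre :: "nat \<Rightarrow> nat \<Rightarrow> weights \<Rightarrow> nat \<Rightarrow> point \<Rightarrow> nat \<Rightarrow> real" where
  "pre d m W l v r = (\<Sum>j<fan_in d m l. W (l, r, j) * v j)"

text \<open>
  Transport of a perturbation \<open>z\<close> of layer \<open>k\<close> through \<open>i\<close> further layers, with the activation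
  pattern that the unperturbed network has at \<open>x\<close>; this is linear in \<open>z\<close>.
\<close>

fun lprop :: "nat \<Rightarrow> nat \<Rightarrow> weights \<Rightarrow> point \<Rightarrow> nat \<Rightarrow> nat \<Rightarrow> point \<Rightarrow> point" where
  "lprop d m W x k 0 z = z"
| "lprop d m W x k (Suc i) z =
     (\<lambda>r. sqrt (2 / real m) *
        (if 0 < pre d m W (Suc (k + i)) (hidden d m W (k + i) x) r
         then pre d m W (Suc (k + i)) (lprop d m W x k i z) r else 0))"

text \<open>
  The second clause holds for finitely many vectors \<open>z\<close> but extends to all sparse vectors by
  approximation, and to all vectors by cutting them into blocks.  The threshold \<open>p / (6 m)\<close> of the
  last clause serves the hidden layers, where at most \<open>p\<close> units may flip, and \<open>1 / n\<close> the top layer.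
\<close>

definition good_point :: "nat \<Rightarrow> nat \<Rightarrow> nat \<Rightarrow> nat \<Rightarrow> nat \<Rightarrow> weights \<Rightarrow> point \<Rightarrow> bool" where
  "good_point d m L n p W x \<longleftrightarrow>
     (\<forall>l. Suc l < L \<longrightarrow>
        (1 - 1 / real L) * (L2_set (hidden d m W l x) {..<fan_in d m (Suc l)})\<^sup>2 \<le> (L2_set (hidden d m W (Suc l) x) {..<m})\<^sup>2
      \<and> (L2_set (hidden d m W (Suc l) x) {..<m})\<^sup>2 \<le> (1 + 1 / real L) * (L2_set (hidden d m W l x) {..<fan_in d m (Suc l)})\<^sup>2)
   \<and> (\<forall>S\<in>small_sets m p. \<forall>z\<in>grid (2 * p) S. \<forall>k i. 1 \<le> k \<and> Suc (k + i) < L \<longrightarrow>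
        (L2_set (lprop d m W x k (Suc i) z) {..<m})\<^sup>2 \<le> (1 + 1 / real L) * (L2_set (lprop d m W x k i z) {..<m})\<^sup>2
      \<and> (\<forall>S'\<in>small_sets m p. 200 * (real L)\<^sup>2 * (\<Sum>r\<in>S'. (pre d m W (Suc (k + i)) (lprop d m W x k i z) r)\<^sup>2)
           \<le> real m * (L2_set (lprop d m W x k i z) {..<m})\<^sup>2))
   \<and> (\<forall>l<L. \<forall>\<tau>\<in>{real p / (6 * real m), 1 / real n}. 0 < L2_set (hidden d m W l x) {..<fan_in d m (Suc l)} \<longrightarrow>
        real (card {r. r < m \<and> \<bar>pre d m W (Suc l) (hidden d m W l x) r\<bar> \<le> \<tau> * L2_set (hidden d m W l x) {..<fan_in d m (Suc l)}}) \<le> 3 * \<tau> * real m)"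

text \<open>The expectation of the left-hand side is \<open>m\<close> times the squared norm; the
  factor 8 leaves room for a union bound over all test vectors. No input occurs, and the layers 1
  and \<open>L\<close> are included.\<close>

definition good_op :: "nat \<Rightarrow> nat \<Rightarrow> nat \<Rightarrow> nat \<Rightarrow> weights \<Rightarrow> bool" where
  "good_op d m L p W \<longleftrightarrow>
     (\<forall>l\<in>{1..L}. \<forall>S\<in>small_sets (fan_in d m l) p. \<forall>z\<in>grid (2 * p) S.
        (\<Sum>r<m. (pre d m W l z r)\<^sup>2) \<le> 8 * real m * (L2_set z {..<fan_in d m l})\<^sup>2)"

lemma pre_cong: "(\<And>j. j < fan_in d m l \<Longrightarrow> v j = w j) \<Longrightarrow> pre d m W l v r = pre d m W l w r"
  by (auto simp: pre_def intro!: sum.cong)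

lemma pre_add: "pre d m W l (\<lambda>j. v j + w j) r = pre d m W l v r + pre d m W l w r"
  by (simp add: pre_def algebra_simps sum.distrib)

lemma pre_diff: "pre d m W l (\<lambda>j. v j - w j) r = pre d m W l v r - pre d m W l w r"
  by (simp add: pre_def algebra_simps sum_subtractf)

lemma pre_scale: "pre d m W l (\<lambda>j. c * v j) r = c * pre d m W l v r"
  by (simp add: pre_def algebra_simps sum_distrib_left)

lemma pre_sum: "pre d m W l (\<lambda>j. \<Sum>k\<in>A. v k j) r = (\<Sum>k\<in>A. pre d m W l (v k) r)"
  unfolding pre_def sum_distrib_left by (rule sum.swap)

lemma pre_diff_weights: "pre d m (\<lambda>i. W i - V i) l v r = pre d m W l v r - pre d m V l v r"
  by (simp add: pre_def algebra_simps sum_subtractf)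

lemma pre_fun:
  "pre d m W l (\<lambda>j. v j + w j) = (\<lambda>r. pre d m W l v r + pre d m W l w r)"
  "pre d m W l (\<lambda>j. c * v j) = (\<lambda>r. c * pre d m W l v r)"
  by (simp_all add: fun_eq_iff pre_add pre_scale)

lemma lprop_add: "lprop d m W x k i (\<lambda>j. v j + w j) r = lprop d m W x k i v r + lprop d m W x k i w r"
proof (induction i arbitrary: r)
  case (Suc i)
  have "lprop d m W x k i (\<lambda>j. v j + w j) = (\<lambda>r. lprop d m W x k i v r + lprop d m W x k i w r)"
    using Suc by auto
  then show ?case by (simp add: pre_add distrib_left)
qed simp

lemma lprop_scale: "lprop d m W x k i (\<lambda>j. c * v j) r = c * lprop d m W x k i v r"
proof (induction i arbitrary: r)
  case (Suc i)
  have "lprop d m W x k i (\<lambda>j. c * v j) = (\<lambda>r. c * lprop d m W x k i v r)"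
    using Suc by auto
  then show ?case by (simp add: pre_scale)
qed simp

lemma lprop_cong:
  assumes "k \<ge> 1" "\<And>j. j < m \<Longrightarrow> v j = w j" "r < m"
  shows "lprop d m W x k i v r = lprop d m W x k i w r"
  using assms(3)
proof (induction i arbitrary: r)
  case 0 then show ?case using assms by simp
next
  case (Suc i)
  have "pre d m W (Suc (k + i)) (lprop d m W x k i v) r = pre d m W (Suc (k + i)) (lprop d m W x k i w) r"
    using assms(1) by (intro pre_cong Suc.IH) (simp add: fan_in_def)
  then show ?case by simp
qed

lemma lprop_fun:
  "lprop d m W x k i (\<lambda>j. v j + w j) = (\<lambda>r. lprop d m W x k i v r + lprop d m W x k i w r)"
  "lprop d m W x k i (\<lambda>j. c * v j) = (\<lambda>r. c * lprop d m W x k i v r)"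
  by (simp_all add: fun_eq_iff lprop_add lprop_scale)

lemma seminorm_on_prop: "k \<ge> 1 \<Longrightarrow> seminorm_on m (\<lambda>z. L2_set (lprop d m W x k i z) {..<m})"
  unfolding seminorm_on_def
  by (auto simp: lprop_fun L2_set_triangle_ineq L2_set_scale intro!: L2_set_cong lprop_cong)

lemma seminorm_on_pre: "seminorm_on (fan_in d m l) (\<lambda>z. L2_set (pre d m W l z) A)"
  unfolding seminorm_on_def
  by (auto simp: pre_fun L2_set_triangle_ineq L2_set_scale intro!: L2_set_cong pre_cong)

lemma seminorm_on_pre_prop:
  assumes "k \<ge> 1"
  shows "seminorm_on m (\<lambda>z. L2_set (pre d m W (Suc (k + i)) (lprop d m W x k i z)) A)"
proof -
  have "pre d m W (Suc (k + i)) (lprop d m W x k i v) r = pre d m W (Suc (k + i)) (lprop d m W x k i w) r"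
    if "\<forall>j<m. v j = w j" for v w r
    using assms that by (intro pre_cong lprop_cong) (simp_all add: fan_in_def)
  then show ?thesis
    unfolding seminorm_on_def
    by (auto simp: pre_fun lprop_fun L2_set_triangle_ineq L2_set_scale intro!: L2_set_cong)
qed

lemma seminorm_on_cmult: "seminorm_on M N \<Longrightarrow> c \<ge> 0 \<Longrightarrow> seminorm_on M (\<lambda>z. c * N z)" for c :: real
  unfolding seminorm_on_def by (auto simp: distrib_left[symmetric] mult_left_mono)

lemma pre_Frobenius:
  "L2_set (pre d m W l v) {..<m} \<le> sqrt (\<Sum>r<m. \<Sum>j<fan_in d m l. (W (l, r, j))\<^sup>2) * L2_set v {..<fan_in d m l}"
proof -
  have "(\<Sum>r<m. (pre d m W l v r)\<^sup>2) \<le> (\<Sum>r<m. (\<Sum>j<fan_in d m l. (W (l, r, j))\<^sup>2) * (\<Sum>j<fan_in d m l. (v j)\<^sup>2))"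
    unfolding pre_def by (intro sum_mono Cauchy_Schwarz_ineq_sum)
  then show ?thesis
    unfolding L2_set_def by (simp add: sum_distrib_right[symmetric] real_sqrt_mult[symmetric])
qed

lemma layer_dist_le_frob:
  assumes "l \<in> {1..L}"
  shows "(\<Sum>r<m. \<Sum>j<fan_in d m l. (V (l, r, j) - W (l, r, j))\<^sup>2) \<le> frob_dist_sq d m L V W"
  unfolding frob_dist_sq_def using assms
  by (intro member_le_sum[of l "{1..L}" "\<lambda>l. \<Sum>r<m. \<Sum>j<fan_in d m l. (V (l, r, j) - W (l, r, j))\<^sup>2"] sum_nonneg) auto

lemma pre_diff_weights_le:
  assumes "l \<in> {1..L}" "frob_dist_sq d m L W W0 \<le> R\<^sup>2" "0 \<le> R"
  shows "L2_set (pre d m (\<lambda>i. W i - W0 i) l v) {..<m} \<le> R * L2_set v {..<fan_in d m l}"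
proof -
  have "sqrt (\<Sum>r<m. \<Sum>j<fan_in d m l. (W (l, r, j) - W0 (l, r, j))\<^sup>2) \<le> sqrt (R\<^sup>2)"
    using layer_dist_le_frob[OF assms(1), where d=d and m=m and V=W and W=W0] assms(2) by (intro real_sqrt_le_mono) linarith
  then have "sqrt (\<Sum>r<m. \<Sum>j<fan_in d m l. (W (l, r, j) - W0 (l, r, j))\<^sup>2) * L2_set v {..<fan_in d m l} \<le> R * L2_set v {..<fan_in d m l}"
    using assms by (intro mult_right_mono) auto
  with pre_Frobenius[of d m "\<lambda>i. W i - W0 i" l v] show ?thesis by linarith
qed

lemma relu_lipschitz: "\<bar>relu a - relu b\<bar> \<le> \<bar>a - b\<bar>"
  by (auto simp: relu_def)

lemma hidden_Suc: "r < m \<Longrightarrow> hidden d m W (Suc l) x r = sqrt (2 / real m) * relu (pre d m W (Suc l) (hidden d m W l x) r)"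
  by (simp add: pre_def)

lemma compound_upper:
  fixes L :: nat assumes "1 \<le> L" "i \<le> L"
  shows "(1 + 1 / real L) ^ i \<le> 3"
proof -
  have "(1 + 1 / real L) ^ i \<le> (1 + 1 / real L) ^ L" using assms by (intro power_increasing) auto
  also have "\<dots> \<le> exp (1 / real L) ^ L" by (intro power_mono exp_ge_add_one_self) auto
  also have "\<dots> = exp 1" using assms by (simp flip: exp_of_nat_mult)
  also have "\<dots> \<le> 3" by (rule exp_le)
  finally show ?thesis .
qed

text \<open>The factor 1 - 1/L is the inverse of 1 + 1/(L - 1), so the upper bound for L - 1 layers
  applies.\<close>

lemma compound_lower:
  fixes L :: nat assumes "2 \<le> L" "i < L"
  shows "1 / 3 \<le> (1 - 1 / real L) ^ i"
proof -
  define M where "M = L - 1"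
  have M: "M \<ge> 1" "i \<le> M" "real L = real M + 1" using assms by (auto simp: M_def)
  have "(1 - 1 / real L) * (1 + 1 / real M) = 1"
    using M(1) unfolding M(3) by (simp add: divide_simps)
  then have "(1 - 1 / real L) ^ i * (1 + 1 / real M) ^ i = 1" by (simp flip: power_mult_distrib)
  moreover have "(1 + 1 / real M) ^ i \<le> 3" using compound_upper[of M i] M by simp
  moreover have "0 \<le> (1 - 1 / real L) ^ i" using assms by (intro zero_le_power) auto
  ultimately have "1 \<le> (1 - 1 / real L) ^ i * 3"
    by (metis mult_left_mono)
  then show ?thesis by simp
qed

section \<open>Norm bounds at initialization for a single net point\<close>

locale good_init =
  fixes d m L n p B :: nat and W0 :: weights
  assumes L: "L \<ge> 2" and m: "m \<ge> 1" and p: "p \<ge> 1" and mB: "m \<le> B * p" and dm: "d \<le> m"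
    and n: "n \<ge> 1"
    and good_op: "good_op d m L p W0"
begin

abbreviation "c0 \<equiv> sqrt (2 / real m)"

lemma B: "B \<ge> 1" using mB m by (cases B) auto

lemma c0: "c0 > 0" using m by simp

text \<open>The constant 3 replaces sqrt 8, passing from grid points to all sparse vectors doubles
  it, and the blocks contribute sqrt B. By d <= m the same \<open>B\<close> blocks suffice for the
  first layer.\<close>

lemma op_bound:
  assumes "l \<in> {1..L}"
  shows "L2_set (pre d m W0 l z) {..<m} \<le> 6 * sqrt (real m * real B) * L2_set z {..<fan_in d m l}"
proof -
  let ?k = "fan_in d m l"
  have kB: "?k \<le> B * p" using mB dm by (auto simp: fan_in_def)
  have g: "L2_set (pre d m W0 l z) {..<m} \<le> 3 * sqrt (real m) * L2_set z {..<?k}"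
    if "S \<in> small_sets ?k p" "z \<in> grid (2 * p) S" for S z
  proof -
    have "(\<Sum>r<m. (pre d m W0 l z r)\<^sup>2) \<le> 8 * real m * (L2_set z {..<?k})\<^sup>2"
      using good_op that assms unfolding good_op_def by blast
    also have "\<dots> \<le> (3 * sqrt (real m) * L2_set z {..<?k})\<^sup>2"
      by (simp add: power_mult_distrib mult_right_mono)
    finally have "sqrt (\<Sum>r<m. (pre d m W0 l z r)\<^sup>2) \<le> sqrt ((3 * sqrt (real m) * L2_set z {..<?k})\<^sup>2)"
      by (rule real_sqrt_le_mono)
    then show ?thesis by (simp add: L2_set_def[of "pre d m W0 l z"] L2_set_nonneg abs_mult)
  qed
  have s: "L2_set (pre d m W0 l z) {..<m} \<le> 6 * sqrt (real m) * L2_set z {..<?k}"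
    if "S \<in> small_sets ?k p" "\<And>j. j < ?k \<Longrightarrow> j \<notin> S \<Longrightarrow> z j = 0" for S z
    using sparse_seminorm_bound[OF seminorm_on_pre p that(1) _ g[OF that(1)] that(2)] by simp
  have "L2_set (pre d m W0 l z) {..<m} \<le> 6 * sqrt (real m) * sqrt (real B) * L2_set z {..<?k}"
    by (rule block_seminorm_bound[OF seminorm_on_pre p kB _ s]) auto
  then show ?thesis by (simp add: real_sqrt_mult mult.assoc)
qed

end

text \<open>Rounding a unit vector to the net may shorten it, hence the range from 9/10 to 1 for the
  norm.\<close>

locale good_init_point = good_init +
  fixes x :: point
  assumes x1: "L2_set x {..<d} \<le> 1" and x2: "9/10 \<le> L2_set x {..<d}"
    and good: "good_point d m L n p W0 x"
begin

abbreviation "h0 l \<equiv> hidden d m W0 l x"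

lemma h0_bounds:
  assumes "l < L"
  shows "(1 - 1 / real L) ^ l * (L2_set x {..<d})\<^sup>2 \<le> (L2_set (h0 l) {..<fan_in d m (Suc l)})\<^sup>2"
    "(L2_set (h0 l) {..<fan_in d m (Suc l)})\<^sup>2 \<le> (1 + 1 / real L) ^ l * (L2_set x {..<d})\<^sup>2"
proof -
  have "(1 - 1 / real L) ^ l * (L2_set x {..<d})\<^sup>2 \<le> (L2_set (h0 l) {..<fan_in d m (Suc l)})\<^sup>2 \<and>
    (L2_set (h0 l) {..<fan_in d m (Suc l)})\<^sup>2 \<le> (1 + 1 / real L) ^ l * (L2_set x {..<d})\<^sup>2"
    using assms
  proof (induction l)
    case 0 then show ?case by (simp add: fan_in_def)
  next
    case (Suc l)
    have f: "fan_in d m (Suc (Suc l)) = m" by (simp add: fan_in_def)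
    have G: "(1 - 1 / real L) * (L2_set (h0 l) {..<fan_in d m (Suc l)})\<^sup>2 \<le> (L2_set (h0 (Suc l)) {..<m})\<^sup>2"
      "(L2_set (h0 (Suc l)) {..<m})\<^sup>2 \<le> (1 + 1 / real L) * (L2_set (h0 l) {..<fan_in d m (Suc l)})\<^sup>2"
      using good Suc.prems unfolding good_point_def by blast+
    have IH: "(1 - 1 / real L) ^ l * (L2_set x {..<d})\<^sup>2 \<le> (L2_set (h0 l) {..<fan_in d m (Suc l)})\<^sup>2"
      "(L2_set (h0 l) {..<fan_in d m (Suc l)})\<^sup>2 \<le> (1 + 1 / real L) ^ l * (L2_set x {..<d})\<^sup>2"
      using Suc by auto
    have "0 \<le> 1 - 1 / real L" using L by auto
    from mult_left_mono[OF IH(1) this] G(1)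
    have "(1 - 1 / real L) ^ Suc l * (L2_set x {..<d})\<^sup>2 \<le> (L2_set (h0 (Suc l)) {..<m})\<^sup>2"
      by (simp only: power_Suc mult.assoc)
    moreover have "0 \<le> 1 + 1 / real L" by simp
    from mult_left_mono[OF IH(2) this] G(2)
    have "(L2_set (h0 (Suc l)) {..<m})\<^sup>2 \<le> (1 + 1 / real L) ^ Suc l * (L2_set x {..<d})\<^sup>2"
      by (simp only: power_Suc mult.assoc)
    ultimately show ?case unfolding f by (rule conjI)
  qed
  then show "(1 - 1 / real L) ^ l * (L2_set x {..<d})\<^sup>2 \<le> (L2_set (h0 l) {..<fan_in d m (Suc l)})\<^sup>2"
    "(L2_set (h0 l) {..<fan_in d m (Suc l)})\<^sup>2 \<le> (1 + 1 / real L) ^ l * (L2_set x {..<d})\<^sup>2" by auto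
qed

lemma h0_le: assumes "l < L" shows "L2_set (h0 l) {..<fan_in d m (Suc l)} \<le> 2"
proof -
  have "(L2_set (h0 l) {..<fan_in d m (Suc l)})\<^sup>2 \<le> (1 + 1 / real L) ^ l * (L2_set x {..<d})\<^sup>2"
    by (rule h0_bounds[OF assms])
  also have "\<dots> \<le> 3 * 1\<^sup>2"
    using x1 assms by (intro mult_mono compound_upper power_mono) auto
  finally have "(L2_set (h0 l) {..<fan_in d m (Suc l)})\<^sup>2 \<le> 2\<^sup>2" by simp
  then show ?thesis by (rule power2_le_imp_le) simp
qed

lemma h0_ge: assumes "l < L" shows "1/2 \<le> L2_set (h0 l) {..<fan_in d m (Suc l)}"
proof -
  \<comment> \<open>The lower bound 9/10 is just large enough here: 0.81 / 3 = 0.27 exceeds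
    1/4.\<close>
  have "(1/2)\<^sup>2 \<le> 1/3 * (9/10 :: real)\<^sup>2" by (simp add: power2_eq_square)
  also have "\<dots> \<le> (1 - 1 / real L) ^ l * (L2_set x {..<d})\<^sup>2"
    using x2 assms L by (intro mult_mono compound_lower power_mono) auto
  also have "\<dots> \<le> (L2_set (h0 l) {..<fan_in d m (Suc l)})\<^sup>2"
    by (rule h0_bounds[OF assms])
  finally show ?thesis by (rule power2_le_imp_le) simp
qed

lemma prop_grid_bound:
  assumes "S \<in> small_sets m p" "z \<in> grid (2 * p) S" "1 \<le> k" "k + i < L"
  shows "L2_set (lprop d m W0 x k i z) {..<m} \<le> 2 * L2_set z {..<m}"
proof -
  have "(L2_set (lprop d m W0 x k i z) {..<m})\<^sup>2 \<le> (1 + 1 / real L) ^ i * (L2_set z {..<m})\<^sup>2"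
    using assms(4)
  proof (induction i)
    case (Suc i)
    have "(L2_set (lprop d m W0 x k (Suc i) z) {..<m})\<^sup>2 \<le> (1 + 1 / real L) * (L2_set (lprop d m W0 x k i z) {..<m})\<^sup>2"
      using good Suc.prems assms unfolding good_point_def by simp
    also have "\<dots> \<le> (1 + 1 / real L) * ((1 + 1 / real L) ^ i * (L2_set z {..<m})\<^sup>2)"
      using Suc by (intro mult_left_mono) auto
    finally show ?case by (simp only: power_Suc mult.assoc)
  qed simp
  also have "\<dots> \<le> 4 * (L2_set z {..<m})\<^sup>2"
    using assms compound_upper[of L i] L by (intro mult_right_mono) auto
  also have "\<dots> = (2 * L2_set z {..<m})\<^sup>2" by (simp add: power_mult_distrib)
  finally show ?thesis by (rule power2_le_imp_le) (simp add: L2_set_nonneg)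
qed

lemma prop_sparse_bound:
  assumes "S \<in> small_sets m p" "\<And>j. j < m \<Longrightarrow> j \<notin> S \<Longrightarrow> z j = 0" "1 \<le> k" "k + i < L"
  shows "L2_set (lprop d m W0 x k i z) {..<m} \<le> 4 * L2_set z {..<m}"
  using sparse_seminorm_bound[OF seminorm_on_prop[OF assms(3)] p assms(1) _ prop_grid_bound[OF assms(1) _ assms(3,4)] assms(2)]
  by simp

lemma prop_bound:
  assumes "1 \<le> k" "k + i < L"
  shows "L2_set (lprop d m W0 x k i z) {..<m} \<le> 4 * sqrt (real B) * L2_set z {..<m}"
  by (rule block_seminorm_bound[OF seminorm_on_prop[OF assms(1)] p mB _ prop_sparse_bound]) (use assms in auto)

text \<open>The factor 200 L^2 in \<open>good_point\<close> is made for this: with the scaling 2 / m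
  it becomes (1 / (10 L))^2, and the norm of the transported vector is at most twice that of
  \<open>z\<close>. After the doubling in \<open>pre_prop_sparse_bound\<close> the factor 2 / (5 L)
  is still below 1 / (2 L).\<close>

lemma pre_prop_grid_bound:
  assumes "S \<in> small_sets m p" "z \<in> grid (2 * p) S" "1 \<le> k" "Suc (k + i) < L" "S' \<in> small_sets m p"
  shows "c0 * L2_set (pre d m W0 (Suc (k + i)) (lprop d m W0 x k i z)) S' \<le> 1 / (5 * real L) * L2_set z {..<m}"
proof -
  let ?y = "lprop d m W0 x k i z"
  have L0: "real L > 0" using L by simp
  have g: "200 * (real L)\<^sup>2 * (\<Sum>r\<in>S'. (pre d m W0 (Suc (k + i)) ?y r)\<^sup>2) \<le> real m * (L2_set ?y {..<m})\<^sup>2"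
    using good assms unfolding good_point_def by simp
  have "(c0 * L2_set (pre d m W0 (Suc (k + i)) ?y) S')\<^sup>2 = 2 / real m * (\<Sum>r\<in>S'. (pre d m W0 (Suc (k + i)) ?y r)\<^sup>2)"
    using m by (simp add: power_mult_distrib L2_set_def sum_nonneg)
  also have "\<dots> \<le> (L2_set ?y {..<m})\<^sup>2 / (100 * (real L)\<^sup>2)"
    using g m L0 by (simp add: field_simps)
  also have "\<dots> = (L2_set ?y {..<m} / (10 * real L))\<^sup>2"
    by (simp add: power_divide power_mult_distrib)
  finally have "c0 * L2_set (pre d m W0 (Suc (k + i)) ?y) S' \<le> L2_set ?y {..<m} / (10 * real L)"
    by (rule power2_le_imp_le) (simp add: L2_set_nonneg)
  also have "\<dots> \<le> 2 * L2_set z {..<m} / (10 * real L)"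
    using prop_grid_bound[of S z k i] assms L0 by (intro divide_right_mono) auto
  finally show ?thesis by simp
qed

lemma pre_prop_sparse_bound:
  assumes "S \<in> small_sets m p" "\<And>j. j < m \<Longrightarrow> j \<notin> S \<Longrightarrow> z j = 0" "1 \<le> k" "Suc (k + i) < L" "S' \<in> small_sets m p"
  shows "c0 * L2_set (pre d m W0 (Suc (k + i)) (lprop d m W0 x k i z)) S' \<le> 1 / (2 * real L) * L2_set z {..<m}"
proof -
  have "c0 * L2_set (pre d m W0 (Suc (k + i)) (lprop d m W0 x k i z)) S' \<le> 2 * (1 / (5 * real L)) * L2_set z {..<m}"
    by (rule sparse_seminorm_bound[OF seminorm_on_cmult[OF seminorm_on_pre_prop[OF assms(3)]] p assms(1) _ pre_prop_grid_bound[OF assms(1) _ assms(3,4,5)] assms(2)])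
       auto
  also have "\<dots> \<le> 1 / (2 * real L) * L2_set z {..<m}"
    using L by (intro mult_right_mono) (auto simp: field_simps L2_set_nonneg)
  finally show ?thesis .
qed

text \<open>For the sources of the later expansion that are small but not sparse, where the price
  sqrt B is affordable. The set \<open>S'\<close> of units on which the result is read off stays
  sparse.\<close>

lemma pre_prop_bound:
  assumes "1 \<le> k" "Suc (k + i) < L" "S' \<in> small_sets m p"
  shows "c0 * L2_set (pre d m W0 (Suc (k + i)) (lprop d m W0 x k i z)) S' \<le> 1 / (2 * real L) * sqrt (real B) * L2_set z {..<m}"
  by (rule block_seminorm_bound[OF seminorm_on_cmult[OF seminorm_on_pre_prop[OF assms(1)]] p mB _ pre_prop_sparse_bound]) (use assms in auto)

end

section \<open>Activation flips and the propagation of a weight perturbation\<close>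

lemma L2_set_sum_le: "finite A \<Longrightarrow> L2_set (\<lambda>j. \<Sum>b\<in>A. z b j) S \<le> (\<Sum>b\<in>A. L2_set (z b) S)"
proof (induction A rule: finite_induct)
  case (insert b A)
  have "L2_set (\<lambda>j. \<Sum>b\<in>insert b A. z b j) S = L2_set (\<lambda>j. z b j + (\<Sum>b\<in>A. z b j)) S"
    using insert by simp
  also have "\<dots> \<le> L2_set (z b) S + L2_set (\<lambda>j. \<Sum>b\<in>A. z b j) S" by (rule L2_set_triangle_ineq)
  finally show ?case using insert by simp
qed (simp add: L2_set_def)

lemma L2_set_subset_le: "finite B \<Longrightarrow> A \<subseteq> B \<Longrightarrow> L2_set f A \<le> L2_set f B"
  unfolding L2_set_def by (intro real_sqrt_le_mono sum_mono2) auto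

lemma card_large_le:
  assumes "t > 0" "finite A"
  shows "t\<^sup>2 * real (card {r\<in>A. t < \<bar>g r\<bar>}) \<le> (L2_set g A)\<^sup>2"
proof -
  have "t\<^sup>2 * real (card {r\<in>A. t < \<bar>g r\<bar>}) = (\<Sum>r\<in>{r\<in>A. t < \<bar>g r\<bar>}. t\<^sup>2)" by simp
  also have "\<dots> \<le> (\<Sum>r\<in>{r\<in>A. t < \<bar>g r\<bar>}. (g r)\<^sup>2)"
    using assms by (intro sum_mono) (auto simp: abs_le_square_iff[symmetric])
  also have "\<dots> \<le> (\<Sum>r\<in>A. (g r)\<^sup>2)" using assms by (intro sum_mono2) auto
  also have "\<dots> = (L2_set g A)\<^sup>2" by (simp add: L2_set_def sum_nonneg)
  finally show ?thesis .
qed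

text \<open>Remainder of relu at \<open>g + u\<close> after linearization with the activation
  pattern of \<open>g\<close>; it vanishes unless \<open>u\<close> is large enough to change the
  sign.\<close>

definition flip_error :: "real \<Rightarrow> real \<Rightarrow> real" where
  "flip_error g u = relu (g + u) - relu g - (if 0 < g then u else 0)"

lemma flip_error_le: "\<bar>flip_error g u\<bar> \<le> \<bar>u\<bar>"
  by (auto simp: flip_error_def relu_def max_def)

lemma flip_error_zero: "\<bar>u\<bar> < \<bar>g\<bar> \<Longrightarrow> flip_error g u = 0"
  by (auto simp: flip_error_def relu_def max_def)

context good_init_point
begin

text \<open>The thresholds in \<open>good_point\<close> are relative to the norm of the layer, which
  is at least 1/2, so an absolute threshold is obtained at half the size.\<close>

lemma small_preact_card:
  assumes "l < L" "\<tau> \<in> {real p / (6 * real m), 1 / real n}"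
  shows "real (card {r. r < m \<and> \<bar>pre d m W0 (Suc l) (h0 l) r\<bar> \<le> \<tau> / 2}) \<le> 3 * \<tau> * real m"
proof -
  have "0 \<le> \<tau>" using assms by auto
  then have "\<tau> / 2 \<le> \<tau> * L2_set (h0 l) {..<fan_in d m (Suc l)}"
    using mult_left_mono[OF h0_ge[OF assms(1)], of \<tau>] by simp
  then have "card {r. r < m \<and> \<bar>pre d m W0 (Suc l) (h0 l) r\<bar> \<le> \<tau> / 2}
    \<le> card {r. r < m \<and> \<bar>pre d m W0 (Suc l) (h0 l) r\<bar> \<le> \<tau> * L2_set (h0 l) {..<fan_in d m (Suc l)}}"
    by (intro card_mono) auto
  moreover have "real (card {r. r < m \<and> \<bar>pre d m W0 (Suc l) (h0 l) r\<bar> \<le> \<tau> * L2_set (h0 l) {..<fan_in d m (Suc l)}}) \<le> 3 * \<tau> * real m"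
  proof -
    have "0 < L2_set (h0 l) {..<fan_in d m (Suc l)}" using h0_ge[OF assms(1)] by linarith
    then show ?thesis using good assms unfolding good_point_def by blast
  qed
  ultimately show ?thesis by linarith
qed

end

text \<open>The constants come from the places where they are spent: 70 exceeds 48 sqrt 2 in
  \<open>e_le\<close>, and 14112 is 49 * 288 in \<open>flips_small\<close>, where 49 m B
  \<epsilon>^2 is compared with p^3 / (288 m^2).\<close>

locale perturbed = good_init_point +
  fixes W :: weights and R :: real
  assumes R: "R > 0" and close: "frob_dist_sq d m L W W0 \<le> R\<^sup>2"
    and width: "(70 * real L * sqrt (real B) * R / sqrt (real m))\<^sup>2 * (14112 * real B * real m ^ 3) \<le> real p ^ 3"
    and width1: "70 * real L * sqrt (real B) * R / sqrt (real m) \<le> 1"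
begin

text \<open>
  The deviation \<open>e\<close> of the hidden layer is driven by two sources: \<open>\<xi>\<close>, the weight change seen through
  the frozen activation pattern, which is tiny, and \<open>y\<close>, the correction for units whose sign flips,
  which is sparse.  Sparse vectors lose a factor \<open>1 / (2 L)\<close> when they are read off on a sparse set
  of units, so the \<open>y\<close> of all layers stay of the order of \<open>\<xi>\<close>.
\<close>

definition "\<epsilon> = 70 * real L * sqrt (real B) * R / sqrt (real m)"
definition "\<omega> = 3 * c0 * R"

abbreviation "v l \<equiv> hidden d m W l x"

definition "e l r = v l r - h0 l r"
definition "dv l r = pre d m (\<lambda>i. W i - W0 i) (Suc l) (v l) r"
definition "g l r = pre d m W0 (Suc l) (h0 l) r"
definition "u l r = pre d m W0 (Suc l) (e l) r + dv l r"
definition "\<xi> l r = c0 * (if 0 < g l r then dv l r else 0)"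
definition "y l r = c0 * flip_error (g l r) (u l r)"

lemma eps_pos: "0 < \<epsilon>" using L m B R by (simp add: \<epsilon>_def)
lemma omega_pos: "0 < \<omega>" using R c0 by (simp add: \<omega>_def)

lemma preact: "pre d m W (Suc l) (v l) r = g l r + u l r"
proof -
  have "pre d m W0 (Suc l) (e l) r = pre d m W0 (Suc l) (v l) r - pre d m W0 (Suc l) (h0 l) r"
    unfolding e_def[abs_def] by (rule pre_diff)
  then show ?thesis by (simp add: u_def g_def dv_def pre_diff_weights)
qed

text \<open>An exact identity: relu is split into its frozen linear part and
  \<open>flip_error\<close>, and the linear part of \<open>u\<close> into the old deviation and the
  weight change.\<close>

lemma e_Suc: assumes "r < m"
  shows "e (Suc l) r = c0 * (if 0 < g l r then pre d m W0 (Suc l) (e l) r else 0) + (\<xi> l r + y l r)"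
proof -
  have "e (Suc l) r = c0 * relu (pre d m W (Suc l) (v l) r) - c0 * relu (pre d m W0 (Suc l) (h0 l) r)"
    unfolding e_def by (simp only: hidden_Suc[OF assms])
  also have "\<dots> = c0 * (relu (g l r + u l r) - relu (g l r))"
    by (simp add: preact g_def right_diff_distrib)
  also have "\<dots> = c0 * (if 0 < g l r then u l r else 0) + y l r"
    by (simp add: y_def flip_error_def algebra_simps)
  finally show ?thesis by (simp add: \<xi>_def u_def algebra_simps)
qed

text \<open>Unrolls the recursion \<open>e_Suc\<close>. The sources with index \<open>k\<close>
  arise in layer \<open>Suc k\<close> and travel through \<open>l - k\<close> further layers;
  nothing starts at the input, where both networks agree.\<close>

lemma e_expand: "r < m \<Longrightarrow> e (Suc l) r = (\<Sum>k\<le>l. lprop d m W0 x (Suc k) (l - k) (\<lambda>j. \<xi> k j + y k j) r)"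
proof (induction l arbitrary: r)
  case 0
  have "e 0 = (\<lambda>r. 0)" by (auto simp: e_def)
  then show ?case using e_Suc[OF 0, of 0] by (simp add: pre_def)
next
  case (Suc l)
  have "pre d m W0 (Suc (Suc l)) (e (Suc l)) r
     = pre d m W0 (Suc (Suc l)) (\<lambda>r. \<Sum>k\<le>l. lprop d m W0 x (Suc k) (l - k) (\<lambda>j. \<xi> k j + y k j) r) r"
    using Suc.IH by (intro pre_cong) (simp add: fan_in_def)
  also have "\<dots> = (\<Sum>k\<le>l. pre d m W0 (Suc (Suc l)) (lprop d m W0 x (Suc k) (l - k) (\<lambda>j. \<xi> k j + y k j)) r)"
    by (rule pre_sum)
  finally have P: "pre d m W0 (Suc (Suc l)) (e (Suc l)) r = \<dots>" .
  have "c0 * (if 0 < g (Suc l) r then pre d m W0 (Suc (Suc l)) (e (Suc l)) r else 0)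
     = (\<Sum>k\<le>l. lprop d m W0 x (Suc k) (Suc l - k) (\<lambda>j. \<xi> k j + y k j) r)"
  proof -
    have "lprop d m W0 x (Suc k) (Suc l - k) z r
       = c0 * (if 0 < g (Suc l) r then pre d m W0 (Suc (Suc l)) (lprop d m W0 x (Suc k) (l - k) z) r else 0)" if "k \<le> l" for k z
      using that by (simp add: Suc_diff_le g_def del: hidden.simps)
    then show ?thesis unfolding P by (simp add: sum_distrib_left)
  qed
  then show ?case using e_Suc[OF Suc.prems, of "Suc l"] by simp
qed

lemma y_support: "r \<notin> {r. r < m \<and> \<bar>g l r\<bar> \<le> \<bar>u l r\<bar>} \<Longrightarrow> r < m \<Longrightarrow> y l r = 0"
  using flip_error_zero[of "u l r" "g l r"] by (auto simp: y_def)

lemma v_le: assumes "L2_set (e l) {..<fan_in d m (Suc l)} \<le> 1" "l < L"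
  shows "L2_set (v l) {..<fan_in d m (Suc l)} \<le> 3"
proof -
  have "L2_set (v l) {..<fan_in d m (Suc l)} = L2_set (\<lambda>j. e l j + h0 l j) {..<fan_in d m (Suc l)}"
    by (simp add: e_def)
  also have "\<dots> \<le> L2_set (e l) {..<fan_in d m (Suc l)} + L2_set (h0 l) {..<fan_in d m (Suc l)}"
    by (rule L2_set_triangle_ineq)
  finally show ?thesis using assms h0_le[OF assms(2)] by linarith
qed

lemma dv_le: assumes "L2_set (e l) {..<fan_in d m (Suc l)} \<le> 1" "l < L"
  shows "L2_set (dv l) {..<m} \<le> 3 * R"
proof -
  have "L2_set (dv l) {..<m} \<le> R * L2_set (v l) {..<fan_in d m (Suc l)}"
    unfolding dv_def[abs_def] using assms R close by (intro pre_diff_weights_le) auto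
  also have "\<dots> \<le> R * 3" using v_le[OF assms] R by (intro mult_left_mono) auto
  finally show ?thesis by simp
qed

lemma u_le: assumes "L2_set (e l) {..<fan_in d m (Suc l)} \<le> \<epsilon>" "l < L"
  shows "L2_set (u l) {..<m} \<le> 7 * sqrt (real m * real B) * \<epsilon>"
proof -
  have e1: "\<epsilon> \<le> 1" using width1 by (simp add: \<epsilon>_def)
  have "L2_set (u l) {..<m} \<le> L2_set (pre d m W0 (Suc l) (e l)) {..<m} + L2_set (dv l) {..<m}"
    unfolding u_def[abs_def] by (rule L2_set_triangle_ineq)
  also have "L2_set (pre d m W0 (Suc l) (e l)) {..<m} \<le> 6 * sqrt (real m * real B) * L2_set (e l) {..<fan_in d m (Suc l)}"
    using assms by (intro op_bound) auto
  also have "\<dots> \<le> 6 * sqrt (real m * real B) * \<epsilon>" using assms by (intro mult_left_mono) auto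
  also have "L2_set (dv l) {..<m} \<le> 3 * R" using assms e1 by (intro dv_le) auto
  also have "3 * R \<le> sqrt (real m * real B) * \<epsilon>"
  proof -
    have "sqrt (real m * real B) * \<epsilon> = 70 * real L * real B * R"
      using m by (simp add: \<epsilon>_def real_sqrt_mult)
    moreover have "3 * 1 \<le> (70 * real L) * real B" using L B by (intro mult_mono) auto
    ultimately show ?thesis using R mult_right_mono[of "3 * 1" "(70 * real L) * real B" R] by simp
  qed
  finally show ?thesis by (simp add: algebra_simps)
qed

text \<open>A unit can flip only if its frozen pre-activation is at most \<tau>/2 or its change
  exceeds \<tau>/2. The small-ball count allows p/2 units of the first kind, since 3 \<tau> m = p/2;
  those of the second kind are counted by the squared norm of \<open>u\<close>.\<close>

lemma flips_small: assumes "L2_set (e l) {..<fan_in d m (Suc l)} \<le> \<epsilon>" "l < L"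
  shows "{r. r < m \<and> \<bar>g l r\<bar> \<le> \<bar>u l r\<bar>} \<in> small_sets m p"
proof -
  define \<tau> where "\<tau> = real p / (6 * real m)"
  have m0: "real m > 0" "real p > 0" using m p by auto
  have t0: "\<tau> > 0" using m0 by (simp add: \<tau>_def)
  have c1: "real (card {r. r < m \<and> \<bar>g l r\<bar> \<le> \<tau> / 2}) \<le> real p / 2"
    using small_preact_card[OF assms(2), of \<tau>] m0 by (simp add: g_def \<tau>_def)
  have "(\<tau>/2)\<^sup>2 * real (card {r \<in> {..<m}. \<tau> / 2 < \<bar>u l r\<bar>}) \<le> (L2_set (u l) {..<m})\<^sup>2"
    using t0 by (intro card_large_le) auto
  also have "\<dots> \<le> (7 * sqrt (real m * real B) * \<epsilon>)\<^sup>2"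
    using u_le[OF assms] by (intro power_mono L2_set_nonneg)
  also have "\<dots> = 49 * real m * real B * \<epsilon>\<^sup>2" by (simp add: power_mult_distrib)
  finally have "(\<tau>/2)\<^sup>2 * real (card {r \<in> {..<m}. \<tau> / 2 < \<bar>u l r\<bar>}) \<le> 49 * real m * real B * \<epsilon>\<^sup>2" .
  moreover have "49 * real m * real B * \<epsilon>\<^sup>2 \<le> (\<tau>/2)\<^sup>2 * (real p / 2)"
  proof -
    have A: "(\<tau>/2)\<^sup>2 * (real p / 2) = real p ^ 3 / (288 * (real m)\<^sup>2)"
      by (simp add: \<tau>_def power2_eq_square power3_eq_cube)
    have A': "49 * real m * real B * \<epsilon>\<^sup>2 = \<epsilon>\<^sup>2 * (14112 * real B * real m ^ 3) / (288 * (real m)\<^sup>2)"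
      using m0 by (simp add: power2_eq_square power3_eq_cube)
    show ?thesis unfolding A A' using width by (intro divide_right_mono) (simp_all add: \<epsilon>_def)
  qed
  ultimately have "(\<tau>/2)\<^sup>2 * real (card {r \<in> {..<m}. \<tau> / 2 < \<bar>u l r\<bar>}) \<le> (\<tau>/2)\<^sup>2 * (real p / 2)" by linarith
  then have c2: "real (card {r \<in> {..<m}. \<tau> / 2 < \<bar>u l r\<bar>}) \<le> real p / 2"
    using t0 by (subst (asm) mult_le_cancel_left_pos) auto
  have "card {r. r < m \<and> \<bar>g l r\<bar> \<le> \<bar>u l r\<bar>} \<le> card ({r. r < m \<and> \<bar>g l r\<bar> \<le> \<tau> / 2} \<union> {r \<in> {..<m}. \<tau> / 2 < \<bar>u l r\<bar>})"
    by (intro card_mono) auto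
  also have "\<dots> \<le> card {r. r < m \<and> \<bar>g l r\<bar> \<le> \<tau> / 2} + card {r \<in> {..<m}. \<tau> / 2 < \<bar>u l r\<bar>}"
    by (rule card_Un_le)
  finally have "real (card {r. r < m \<and> \<bar>g l r\<bar> \<le> \<bar>u l r\<bar>}) \<le> real p" using c1 c2 by linarith
  then show ?thesis by (auto simp: small_sets_def)
qed

lemma L2_xi: assumes "L2_set (e l) {..<fan_in d m (Suc l)} \<le> \<epsilon>" "l < L"
  shows "L2_set (\<xi> l) {..<m} \<le> \<omega>"
proof -
  have e1: "\<epsilon> \<le> 1" using width1 by (simp add: \<epsilon>_def)
  have "L2_set (\<xi> l) {..<m} \<le> L2_set (\<lambda>r. c0 * dv l r) {..<m}"
    by (intro L2_set_mono_abs) (auto simp: \<xi>_def)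
  also have "\<dots> = c0 * L2_set (dv l) {..<m}" using c0 by (simp only: L2_set_scale abs_of_pos)
  also have "\<dots> \<le> c0 * (3 * R)" using assms e1 c0 by (intro mult_left_mono dv_le) auto
  finally show ?thesis by (simp add: \<omega>_def)
qed

text \<open>The bound reproduces itself: each of the at most \<open>L\<close> earlier layers
  contributes (1 + 3) sqrt B \<omega> / (2 L), that is, 2 sqrt B \<omega> in total, and the direct
  weight change adds \<omega>. The factor 1 / (2 L) is available because the deviation is read off
  on the sparse flip set \<open>S\<close> of this layer.\<close>

lemma L2_y:
  assumes e: "\<And>k. k \<le> l \<Longrightarrow> L2_set (e k) {..<fan_in d m (Suc k)} \<le> \<epsilon>"
    and yk: "\<And>k. k < l \<Longrightarrow> L2_set (y k) {..<m} \<le> 3 * sqrt (real B) * \<omega>" and l: "Suc l < L"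
  shows "L2_set (y l) {..<m} \<le> 3 * sqrt (real B) * \<omega>"
proof -
  define S where "S = {r. r < m \<and> \<bar>g l r\<bar> \<le> \<bar>u l r\<bar>}"
  have S: "S \<in> small_sets m p" unfolding S_def using e[of l] l by (intro flips_small) auto
  have Sm: "S \<subseteq> {..<m}" by (auto simp: S_def)
  have fS: "finite S" using Sm finite_subset by blast
  have e1: "\<epsilon> \<le> 1" using width1 by (simp add: \<epsilon>_def)
  have sB: "1 \<le> sqrt (real B)" using B by simp
  have "L2_set (y l) {..<m} = L2_set (y l) S"
    unfolding L2_set_def using Sm y_support[of _ l]
    by (intro arg_cong[where f=sqrt] sum.mono_neutral_right) (auto simp: S_def)
  also have "\<dots> \<le> L2_set (\<lambda>r. c0 * u l r) S"
    using c0 by (intro L2_set_mono_abs) (auto simp: y_def abs_mult intro!: mult_left_mono flip_error_le)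
  also have "\<dots> = c0 * L2_set (u l) S" using c0 by (simp only: L2_set_scale abs_of_pos)
  also have "\<dots> \<le> c0 * (L2_set (pre d m W0 (Suc l) (e l)) S + L2_set (dv l) S)"
    unfolding u_def[abs_def] using c0 by (intro mult_left_mono L2_set_triangle_ineq) auto
  also have "\<dots> = c0 * L2_set (pre d m W0 (Suc l) (e l)) S + c0 * L2_set (dv l) S"
    by (simp add: distrib_left)
  also have "c0 * L2_set (dv l) S \<le> \<omega>"
  proof -
    have "L2_set (dv l) S \<le> L2_set (dv l) {..<m}" using Sm by (intro L2_set_subset_le) auto
    also have "\<dots> \<le> 3 * R" using e[of l] e1 l by (intro dv_le) auto
    finally show ?thesis using c0 by (simp add: \<omega>_def)
  qed
  also have "c0 * L2_set (pre d m W0 (Suc l) (e l)) S \<le> 2 * sqrt (real B) * \<omega>"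
  proof (cases l)
    case 0
    have "e 0 = (\<lambda>r. 0)" by (auto simp: e_def)
    then have "pre d m W0 (Suc l) (e l) = (\<lambda>r. 0)" using 0 by (simp add: pre_def fun_eq_iff)
    then show ?thesis using omega_pos by (simp add: L2_set_def)
  next
    case (Suc l')
    let ?P = "\<lambda>k z. pre d m W0 (Suc l) (lprop d m W0 x (Suc k) (l' - k) z)"
    have "pre d m W0 (Suc l) (e l) = (\<lambda>r. \<Sum>k\<le>l'. ?P k (\<lambda>j. \<xi> k j + y k j) r)"
    proof
      fix r
      have "pre d m W0 (Suc l) (e l) r = pre d m W0 (Suc l) (\<lambda>r. \<Sum>k\<le>l'. lprop d m W0 x (Suc k) (l' - k) (\<lambda>j. \<xi> k j + y k j) r) r"
        using e_expand[of _ l'] Suc by (intro pre_cong) (simp add: fan_in_def)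
      then show "pre d m W0 (Suc l) (e l) r = (\<Sum>k\<le>l'. ?P k (\<lambda>j. \<xi> k j + y k j) r)"
        by (simp add: pre_sum)
    qed
    then have "c0 * L2_set (pre d m W0 (Suc l) (e l)) S \<le> c0 * (\<Sum>k\<le>l'. L2_set (?P k (\<lambda>j. \<xi> k j + y k j)) S)"
      using c0 by (simp add: L2_set_sum_le)
    also have "\<dots> = (\<Sum>k\<le>l'. c0 * L2_set (?P k (\<lambda>j. \<xi> k j + y k j)) S)" by (simp add: sum_distrib_left)
    also have "\<dots> \<le> (\<Sum>k\<le>l'. 1 / real L * (2 * sqrt (real B) * \<omega>))"
    proof (intro sum_mono)
      fix k assume k: "k \<in> {..l'}"
      have eq: "Suc k + (l' - k) = l" using k Suc by simp
      have ek: "L2_set (e k) {..<fan_in d m (Suc k)} \<le> \<epsilon>" using e[of k] k Suc by simp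
      have 1: "c0 * L2_set (?P k (\<xi> k)) S \<le> 1 / (2 * real L) * sqrt (real B) * L2_set (\<xi> k) {..<m}"
        using pre_prop_bound[OF _ _ S, of "Suc k" "l' - k" "\<xi> k"] l unfolding eq by simp
      have "\<dots> \<le> 1 / (2 * real L) * sqrt (real B) * \<omega>"
        using ek k Suc l by (intro mult_left_mono L2_xi) auto
      with 1 have 1: "c0 * L2_set (?P k (\<xi> k)) S \<le> 1 / (2 * real L) * (sqrt (real B) * \<omega>)" by simp
      have "c0 * L2_set (?P k (y k)) S \<le> 1 / (2 * real L) * L2_set (y k) {..<m}"
        using pre_prop_sparse_bound[OF flips_small[OF ek] y_support _ _ S, where k="Suc k" and i="l' - k"] l k Suc unfolding eq by simp
      also have "\<dots> \<le> 1 / (2 * real L) * (3 * sqrt (real B) * \<omega>)"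
        using yk[of k] k Suc by (intro mult_left_mono) auto
      finally have 2: "c0 * L2_set (?P k (y k)) S \<le> 1 / (2 * real L) * (3 * sqrt (real B) * \<omega>)" .
      have "L2_set (?P k (\<lambda>j. \<xi> k j + y k j)) S \<le> L2_set (?P k (\<xi> k)) S + L2_set (?P k (y k)) S"
        unfolding lprop_fun pre_fun by (rule L2_set_triangle_ineq)
      then have "c0 * L2_set (?P k (\<lambda>j. \<xi> k j + y k j)) S \<le> c0 * (L2_set (?P k (\<xi> k)) S + L2_set (?P k (y k)) S)"
        using c0 by (intro mult_left_mono) auto
      also have "\<dots> \<le> 1 / (2 * real L) * (sqrt (real B) * \<omega>) + 1 / (2 * real L) * (3 * sqrt (real B) * \<omega>)"
        unfolding distrib_left using 1 2 by linarith
      also have "\<dots> = 1 / real L * (2 * sqrt (real B) * \<omega>)" using L by (simp add: field_simps)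
      finally show "c0 * L2_set (?P k (\<lambda>j. \<xi> k j + y k j)) S \<le> 1 / real L * (2 * sqrt (real B) * \<omega>)" .
    qed
    also have "\<dots> = (real (Suc l') / real L) * (2 * sqrt (real B) * \<omega>)" by simp
    also have "\<dots> \<le> 1 * (2 * sqrt (real B) * \<omega>)"
      using Suc l omega_pos by (intro mult_right_mono) auto
    finally show ?thesis by simp
  qed
  finally have "L2_set (y l) {..<m} \<le> 2 * sqrt (real B) * \<omega> + \<omega>" by simp
  moreover have "1 * \<omega> \<le> sqrt (real B) * \<omega>" by (rule mult_right_mono[OF sB]) (use omega_pos in simp)
  ultimately show ?thesis by linarith
qed

text \<open>Each layer contributes 4 sqrt B \<omega> from \<open>\<xi>\<close>, where sqrt B is the
  price of transporting a vector that is not sparse, and 4 times 3 sqrt B \<omega> from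
  \<open>y\<close>, whose transport is cheap. The sum over at most \<open>L\<close> layers is below
  \<open>\<epsilon>\<close> by its definition.\<close>

lemma e_le: 
  assumes e: "\<And>k. k \<le> l \<Longrightarrow> L2_set (e k) {..<fan_in d m (Suc k)} \<le> \<epsilon>"
    and yk: "\<And>k. k \<le> l \<Longrightarrow> L2_set (y k) {..<m} \<le> 3 * sqrt (real B) * \<omega>" and l: "Suc l < L"
  shows "L2_set (e (Suc l)) {..<m} \<le> \<epsilon>"
proof -
  have "L2_set (e (Suc l)) {..<m} = L2_set (\<lambda>r. \<Sum>k\<le>l. lprop d m W0 x (Suc k) (l - k) (\<lambda>j. \<xi> k j + y k j) r) {..<m}"
    by (intro L2_set_cong refl e_expand) auto
  also have "\<dots> \<le> (\<Sum>k\<le>l. L2_set (lprop d m W0 x (Suc k) (l - k) (\<lambda>j. \<xi> k j + y k j)) {..<m})"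
    by (rule L2_set_sum_le) simp
  also have "\<dots> \<le> (\<Sum>k\<le>l. 16 * sqrt (real B) * \<omega>)"
  proof (intro sum_mono)
    fix k assume k: "k \<in> {..l}"
    have ek: "L2_set (e k) {..<fan_in d m (Suc k)} \<le> \<epsilon>" using e[of k] k by simp
    have "L2_set (lprop d m W0 x (Suc k) (l - k) (\<xi> k)) {..<m} \<le> 4 * sqrt (real B) * L2_set (\<xi> k) {..<m}"
      using k l by (intro prop_bound) auto
    also have "\<dots> \<le> 4 * sqrt (real B) * \<omega>" using ek k l by (intro mult_left_mono L2_xi) auto
    finally have 1: "L2_set (lprop d m W0 x (Suc k) (l - k) (\<xi> k)) {..<m} \<le> 4 * sqrt (real B) * \<omega>" .
    have "L2_set (lprop d m W0 x (Suc k) (l - k) (y k)) {..<m} \<le> 4 * L2_set (y k) {..<m}"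
      using prop_sparse_bound[OF flips_small[OF ek] y_support, where k="Suc k" and i="l - k"] k l by simp
    also have "\<dots> \<le> 4 * (3 * sqrt (real B) * \<omega>)" using yk[of k] k by (intro mult_left_mono) auto
    finally have 2: "L2_set (lprop d m W0 x (Suc k) (l - k) (y k)) {..<m} \<le> 4 * (3 * sqrt (real B) * \<omega>)" .
    have "L2_set (lprop d m W0 x (Suc k) (l - k) (\<lambda>j. \<xi> k j + y k j)) {..<m}
      \<le> L2_set (lprop d m W0 x (Suc k) (l - k) (\<xi> k)) {..<m} + L2_set (lprop d m W0 x (Suc k) (l - k) (y k)) {..<m}"
      unfolding lprop_fun by (rule L2_set_triangle_ineq)
    then show "L2_set (lprop d m W0 x (Suc k) (l - k) (\<lambda>j. \<xi> k j + y k j)) {..<m} \<le> 16 * sqrt (real B) * \<omega>"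
      using 1 2 by simp
  qed
  also have "\<dots> = real (Suc l) * (16 * sqrt (real B) * \<omega>)" by simp
  also have "\<dots> \<le> real L * (16 * sqrt (real B) * \<omega>)"
    using l omega_pos by (intro mult_right_mono) auto
  also have "\<dots> \<le> \<epsilon>"
  proof -
    have "48 * sqrt 2 \<le> (70 :: real)" by (rule power2_le_imp_le) (auto simp: power_mult_distrib)
    then have "48 * sqrt 2 * (real L * sqrt (real B) * R / sqrt (real m)) \<le> 70 * (real L * sqrt (real B) * R / sqrt (real m))"
      using R by (intro mult_right_mono) auto
    then show ?thesis by (simp add: \<epsilon>_def \<omega>_def real_sqrt_divide algebra_simps)
  qed
  finally show ?thesis .
qed

text \<open>One strong induction for two bounds: the size of \<open>e\<close> limits the number of
  flips, this controls \<open>y\<close>, and both together control \<open>e\<close> in the next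
  layer.\<close>

theorem stability: "l < L \<Longrightarrow> L2_set (\<lambda>r. v l r - h0 l r) {..<fan_in d m (Suc l)} \<le> \<epsilon>"
proof -
  have "L2_set (e l) {..<fan_in d m (Suc l)} \<le> \<epsilon> \<and> (Suc l < L \<longrightarrow> L2_set (y l) {..<m} \<le> 3 * sqrt (real B) * \<omega>)" if "l < L" for l
    using that
  proof (induction l rule: less_induct)
    case (less l)
    have IH: "\<And>k. k < l \<Longrightarrow> L2_set (e k) {..<fan_in d m (Suc k)} \<le> \<epsilon>"
       "\<And>k. k < l \<Longrightarrow> L2_set (y k) {..<m} \<le> 3 * sqrt (real B) * \<omega>"
      using less by auto
    have el: "L2_set (e l) {..<fan_in d m (Suc l)} \<le> \<epsilon>"
    proof (cases l)
      case 0
      then show ?thesis using eps_pos by (simp add: e_def[abs_def] L2_set_def)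
    next
      case (Suc l')
      then show ?thesis using IH less.prems e_le[of l'] by (simp add: fan_in_def)
    qed
    then have "\<And>k. k \<le> l \<Longrightarrow> L2_set (e k) {..<fan_in d m (Suc k)} \<le> \<epsilon>" using IH(1) by (metis le_neq_implies_less)
    then show ?case using L2_y[of l] IH(2) el by auto
  qed
  then show "l < L \<Longrightarrow> L2_set (\<lambda>r. v l r - h0 l r) {..<fan_in d m (Suc l)} \<le> \<epsilon>" by (simp add: e_def[abs_def])
qed

end


section \<open>Linearization of the network\<close>

lemma relu_linearization_error:
  "\<bar>relu (g + u + \<delta>) - relu (g + u) - (if 0 < g then q else 0)\<bar>
     \<le> \<bar>\<delta> - q\<bar> + (if \<bar>g\<bar> \<le> \<bar>u\<bar> + \<bar>\<delta>\<bar> then \<bar>\<delta>\<bar> else 0)"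
  unfolding relu_def by (auto simp: max_def)

lemma sum_abs_le_L2_set:
  assumes "finite A" shows "(\<Sum>r\<in>A. \<bar>f r\<bar>) \<le> sqrt (real (card A)) * L2_set f A"
proof -
  have "(\<Sum>r\<in>A. \<bar>1\<bar> * \<bar>f r\<bar>) \<le> L2_set (\<lambda>_. 1) A * L2_set f A" by (rule L2_set_mult_ineq)
  then show ?thesis by (simp add: L2_set_def)
qed

context perturbed
begin

text \<open>Gradient of the network in the top-layer weights at \<open>W0\<close>, with derivative 0
  for relu at 0.\<close>

definition "feature a r j = c0 * (a r * (if 0 < pre d m W0 L (h0 (L - 1)) r then h0 (L - 1) j else 0))"

text \<open>Each row has squared norm at most 4 times 2/m, because the last hidden layer has norm at
  most 2; the prefactor 2/m cancels the number of rows.\<close>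

lemma feature_norm:
  assumes "\<And>r. r < m \<Longrightarrow> \<bar>a r\<bar> \<le> (1::real)"
  shows "(\<Sum>r<m. \<Sum>j<m. (feature a r j)\<^sup>2) \<le> 8"
proof -
  have f: "fan_in d m (Suc (L - 1)) = m" using L by (simp add: fan_in_def)
  have h: "(L2_set (h0 (L - 1)) {..<m})\<^sup>2 \<le> 2\<^sup>2"
    using h0_le[of "L - 1"] L unfolding f by (intro power_mono) auto
  have "(\<Sum>r<m. \<Sum>j<m. (feature a r j)\<^sup>2) \<le> (\<Sum>r<m. 2 / real m * (L2_set (h0 (L - 1)) {..<m})\<^sup>2)"
  proof (intro sum_mono)
    fix r assume r: "r \<in> {..<m}"
    have a2: "(a r)\<^sup>2 \<le> 1" using assms[of r] r by (simp add: abs_square_le_1)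
    have "(\<Sum>j<m. (feature a r j)\<^sup>2) \<le> (\<Sum>j<m. 2 / real m * (h0 (L - 1) j)\<^sup>2)"
    proof (intro sum_mono)
      fix j
      have "(a r)\<^sup>2 * (h0 (L - 1) j)\<^sup>2 \<le> 1 * (h0 (L - 1) j)\<^sup>2" using a2 by (intro mult_right_mono) auto
      then have "2 / real m * ((a r)\<^sup>2 * (h0 (L - 1) j)\<^sup>2) \<le> 2 / real m * (h0 (L - 1) j)\<^sup>2"
        by (intro mult_left_mono) auto
      then show "(feature a r j)\<^sup>2 \<le> 2 / real m * (h0 (L - 1) j)\<^sup>2"
        by (simp add: feature_def power_mult_distrib)
    qed
    also have "\<dots> = 2 / real m * (L2_set (h0 (L - 1)) {..<m})\<^sup>2"
      by (simp add: L2_set_def sum_nonneg sum_distrib_left)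
    finally show "(\<Sum>j<m. (feature a r j)\<^sup>2) \<le> 2 / real m * (L2_set (h0 (L - 1)) {..<m})\<^sup>2" .
  qed
  also have "\<dots> = 2 * (L2_set (h0 (L - 1)) {..<m})\<^sup>2" using m by simp
  finally show ?thesis using h by simp
qed

text \<open>
  By \<open>cancel\<close> a network with the initial top layer vanishes identically, whatever its hidden layers
  are; hence only the increment of the top layer enters, and its feature vector has norm of order
  one, independently of the depth.
\<close>

lemma linearization:
  assumes a: "\<And>r. r < m \<Longrightarrow> \<bar>a r\<bar> \<le> (1::real)"
    and cancel: "\<And>h. (\<Sum>r<m. a r * relu (pre d m W0 L h r)) = 0"
    and near: "L2_set (\<lambda>r. hidden d m W (L - 1) x' r - v (L - 1) r) {..<m} \<le> \<epsilon>"
    and width2: "2320 * real B * \<epsilon>\<^sup>2 * real n ^ 3 \<le> 1"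
    and \<rho>: "frob_dist_sq d m L W W0 \<le> \<rho>\<^sup>2" "0 \<le> \<rho>"
  shows "\<bar>network d m L a W x' - (\<Sum>r<m. \<Sum>j<m. feature a r j * (W (L, r, j) - W0 (L, r, j)))\<bar> \<le> 15 * \<rho> / sqrt (real n)"
proof -
  define l where "l = L - 1"
  have l: "Suc l = L" "l < L" "1 \<le> l" using L by (auto simp: l_def)
  have f: "fan_in d m L = m" using l by (simp add: fan_in_def)
  define h where "h = hidden d m W l x'"
  define z where "z r = h r - h0 l r" for r
  have m0: "real m > 0" and n0: "real n > 0" using m n by auto
  have z: "L2_set z {..<m} \<le> 2 * \<epsilon>"
  proof -
    have "L2_set z {..<m} = L2_set (\<lambda>r. (h r - v l r) + (v l r - h0 l r)) {..<m}" by (simp add: z_def[abs_def])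
    also have "\<dots> \<le> L2_set (\<lambda>r. h r - v l r) {..<m} + L2_set (\<lambda>r. v l r - h0 l r) {..<m}"
      by (rule L2_set_triangle_ineq)
    finally show ?thesis using near stability[OF l(2)] unfolding h_def l f l_def[symmetric] by linarith
  qed
  have e1: "\<epsilon> \<le> 1" using width1 by (simp add: \<epsilon>_def)
  have hn: "L2_set h {..<m} \<le> 4"
  proof -
    have "L2_set h {..<m} = L2_set (\<lambda>r. z r + h0 l r) {..<m}" by (simp add: z_def[abs_def])
    also have "\<dots> \<le> L2_set z {..<m} + L2_set (h0 l) {..<m}" by (rule L2_set_triangle_ineq)
    finally show ?thesis using z e1 h0_le[OF l(2)] unfolding l f by linarith
  qed
  let ?\<Delta> = "\<lambda>i. W i - W0 i"
  define G where "G r = pre d m W0 L (h0 l) r" for r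
  define U where "U r = pre d m W0 L z r" for r
  define D where "D r = pre d m ?\<Delta> L h r" for r
  define Q where "Q r = pre d m ?\<Delta> L (h0 l) r" for r
  have LL: "L \<in> {1..L}" using L by auto
  have DQ: "L2_set (\<lambda>r. D r - Q r) {..<m} \<le> \<rho> * (2 * \<epsilon>)"
  proof -
    have "(\<lambda>r. D r - Q r) = pre d m ?\<Delta> L z"
      by (simp add: D_def Q_def z_def[abs_def] pre_diff fun_eq_iff)
    then have "L2_set (\<lambda>r. D r - Q r) {..<m} \<le> \<rho> * L2_set z {..<m}"
      using pre_diff_weights_le[OF LL \<rho>, of z] f by simp
    also have "\<dots> \<le> \<rho> * (2 * \<epsilon>)" using z \<rho> by (intro mult_left_mono)
    finally show ?thesis .
  qed
  have D\<rho>: "L2_set D {..<m} \<le> t * 4" if "frob_dist_sq d m L W W0 \<le> t\<^sup>2" "0 \<le> t" for t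
  proof -
    have "L2_set D {..<m} \<le> t * L2_set h {..<m}"
      unfolding D_def[abs_def] using pre_diff_weights_le[OF LL that, of h] f by simp
    also have "\<dots> \<le> t * 4" using hn that by (intro mult_left_mono)
    finally show ?thesis .
  qed
  have U: "L2_set U {..<m} \<le> 12 * sqrt (real m * real B) * \<epsilon>"
  proof -
    have "L2_set U {..<m} \<le> 6 * sqrt (real m * real B) * L2_set z {..<m}"
      unfolding U_def[abs_def] using op_bound[OF LL, of z] f by simp
    also have "\<dots> \<le> 6 * sqrt (real m * real B) * (2 * \<epsilon>)" using z by (intro mult_left_mono) auto
    finally show ?thesis by simp
  qed
  have DR: "L2_set D {..<m} \<le> sqrt (real m * real B) * \<epsilon>"
  proof -
    have "L2_set D {..<m} \<le> R * 4" using D\<rho>[OF close] R by simp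
    also have "R * 4 \<le> sqrt (real m * real B) * \<epsilon>"
    proof -
      have "sqrt (real m * real B) * \<epsilon> = 70 * real L * real B * R"
        using m by (simp add: \<epsilon>_def real_sqrt_mult)
      moreover have "4 * 1 \<le> (70 * real L) * real B" using L B by (intro mult_mono) auto
      ultimately show ?thesis using R mult_right_mono[of "4 * 1" "(70 * real L) * real B" R] by simp
    qed
    finally show ?thesis .
  qed
  define S where "S = {r. r < m \<and> \<bar>G r\<bar> \<le> \<bar>U r\<bar> + \<bar>D r\<bar>}"
  have cardS: "real (card S) \<le> 4 * real m / real n"
  proof -
    define t where "t = 1 / (4 * real n)"
    have t0: "t > 0" using n0 by (simp add: t_def)
    have big: "real (card {r \<in> {..<m}. t < \<bar>g r\<bar>}) \<le> 16 * (real n)\<^sup>2 * (L2_set g {..<m})\<^sup>2" for g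
    proof -
      have "t\<^sup>2 * real (card {r \<in> {..<m}. t < \<bar>g r\<bar>}) \<le> (L2_set g {..<m})\<^sup>2"
        using t0 by (intro card_large_le) auto
      then show ?thesis using n0 by (simp add: t_def power_divide power_mult_distrib field_simps)
    qed
    have "card S \<le> card ({r. r < m \<and> \<bar>G r\<bar> \<le> (1 / real n) / 2} \<union> ({r \<in> {..<m}. t < \<bar>U r\<bar>} \<union> {r \<in> {..<m}. t < \<bar>D r\<bar>}))"
    proof (intro card_mono subsetI)
      fix r assume r: "r \<in> S"
      have "1 / real n / 2 = t + t" by (simp add: t_def)
      with r show "r \<in> {r. r < m \<and> \<bar>G r\<bar> \<le> (1 / real n) / 2} \<union> ({r \<in> {..<m}. t < \<bar>U r\<bar>} \<union> {r \<in> {..<m}. t < \<bar>D r\<bar>})"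
        by (cases "t < \<bar>U r\<bar> \<or> t < \<bar>D r\<bar>") (auto simp: S_def)
    qed auto
    also have "\<dots> \<le> card {r. r < m \<and> \<bar>G r\<bar> \<le> (1 / real n) / 2} + (card {r \<in> {..<m}. t < \<bar>U r\<bar>} + card {r \<in> {..<m}. t < \<bar>D r\<bar>})"
      by (meson add_left_mono card_Un_le order_trans)
    finally have "real (card S) \<le> real (card {r. r < m \<and> \<bar>G r\<bar> \<le> (1 / real n) / 2})
       + (real (card {r \<in> {..<m}. t < \<bar>U r\<bar>}) + real (card {r \<in> {..<m}. t < \<bar>D r\<bar>}))" by linarith
    also have "real (card {r. r < m \<and> \<bar>G r\<bar> \<le> (1 / real n) / 2}) \<le> 3 * (1 / real n) * real m"
      unfolding G_def l(1)[symmetric] using l(2) by (intro small_preact_card) auto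
    also have "real (card {r \<in> {..<m}. t < \<bar>U r\<bar>}) \<le> 16 * (real n)\<^sup>2 * (12 * sqrt (real m * real B) * \<epsilon>)\<^sup>2"
      using U by (intro order_trans[OF big] mult_left_mono power_mono L2_set_nonneg) auto
    also have "real (card {r \<in> {..<m}. t < \<bar>D r\<bar>}) \<le> 16 * (real n)\<^sup>2 * (sqrt (real m * real B) * \<epsilon>)\<^sup>2"
      using DR by (intro order_trans[OF big] mult_left_mono power_mono L2_set_nonneg) auto
    finally have "real (card S) \<le> 3 * (1 / real n) * real m + (16 * (real n)\<^sup>2 * (12 * sqrt (real m * real B) * \<epsilon>)\<^sup>2 + 16 * (real n)\<^sup>2 * (sqrt (real m * real B) * \<epsilon>)\<^sup>2)"
      by linarith
    \<comment> \<open>The number 2320 is 16 (12^2 + 1), from the norm bounds on \<open>U\<close> and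
      \<open>D\<close>.\<close>
    also have "\<dots> = (real m / real n) * (3 + 2320 * real B * \<epsilon>\<^sup>2 * real n ^ 3)"
      using n0 by (simp add: power_mult_distrib field_simps power2_eq_square power3_eq_cube)
    also have "\<dots> \<le> (real m / real n) * 4" using width2 m0 n0 by (intro mult_left_mono) auto
    finally show ?thesis by (simp add: mult.commute)
  qed
  \<comment> \<open>Since n <= n^3 and 2320 B >= 1, \<open>width2\<close> bounds the drift of the
    hidden layer as well as the number of sign errors.\<close>
  have \<epsilon>n: "\<epsilon> \<le> 1 / sqrt (real n)"
  proof -
    have "1 * 1 \<le> 2320 * real B" using B by simp
    moreover have "real n * 1 \<le> real n ^ 3" using n by (simp add: self_le_power)
    ultimately have "1 * (\<epsilon>\<^sup>2 * real n) \<le> (2320 * real B) * (\<epsilon>\<^sup>2 * real n ^ 3)"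
      using n0 by (intro mult_mono) auto
    then have "\<epsilon>\<^sup>2 * real n \<le> 1" using width2 by (simp add: mult.assoc)
    then have "\<epsilon>\<^sup>2 \<le> (1 / sqrt (real n))\<^sup>2" using n0 by (simp add: power_divide field_simps)
    then show ?thesis by (rule power2_le_imp_le) simp
  qed
  have net: "network d m L a W x' = c0 * (\<Sum>r<m. a r * (relu (G r + U r + D r) - relu (G r + U r)))"
  proof -
    have "network d m L a W x' = (\<Sum>r<m. a r * (c0 * relu (pre d m W (Suc l) h r)))"
      unfolding network_def h_def l(1)[symmetric]
      by (intro sum.cong refl) (metis hidden_Suc lessThan_iff)
    \<comment> \<open>The subtracted sum is zero by \<open>cancel\<close>: it puts the initial top
      weights on the perturbed hidden layer \<open>h\<close>.\<close>
    also have "\<dots> = c0 * (\<Sum>r<m. a r * relu (pre d m W L h r)) - c0 * (\<Sum>r<m. a r * relu (pre d m W0 L h r))"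
      by (simp add: cancel l(1) sum_distrib_left mult.left_commute)
    also have "\<dots> = c0 * (\<Sum>r<m. a r * (relu (pre d m W L h r) - relu (pre d m W0 L h r)))"
      by (simp add: right_diff_distrib sum_subtractf)
    also have "pre d m W0 L h r = G r + U r" for r
      by (simp add: G_def U_def z_def[abs_def] pre_diff)
    moreover have "pre d m W L h r = G r + U r + D r" for r
      by (simp add: G_def U_def D_def z_def[abs_def] pre_diff pre_diff_weights)
    ultimately show ?thesis by simp
  qed
  have lin: "(\<Sum>r<m. \<Sum>j<m. feature a r j * (W (L, r, j) - W0 (L, r, j))) = c0 * (\<Sum>r<m. a r * (if 0 < G r then Q r else 0))"
  proof -
    have "(\<Sum>j<m. feature a r j * (W (L, r, j) - W0 (L, r, j))) = c0 * (a r * (if 0 < G r then Q r else 0))" for r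
      unfolding feature_def G_def l_def[symmetric] Q_def pre_def f
      by (simp add: sum_distrib_left mult_ac)
    then show ?thesis by (simp add: sum_distrib_left)
  qed
  have "\<bar>network d m L a W x' - (\<Sum>r<m. \<Sum>j<m. feature a r j * (W (L, r, j) - W0 (L, r, j)))\<bar>
    = c0 * \<bar>\<Sum>r<m. a r * (relu (G r + U r + D r) - relu (G r + U r) - (if 0 < G r then Q r else 0))\<bar>"
    unfolding net lin right_diff_distrib[symmetric] sum_subtractf[symmetric] abs_mult using c0 by simp
  also have "\<dots> \<le> c0 * (\<Sum>r<m. \<bar>D r - Q r\<bar> + (if \<bar>G r\<bar> \<le> \<bar>U r\<bar> + \<bar>D r\<bar> then \<bar>D r\<bar> else 0))"
  proof (intro mult_left_mono order_trans[OF sum_abs] sum_mono)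
    fix r assume "r \<in> {..<m}"
    then have "\<bar>a r\<bar> * \<bar>relu (G r + U r + D r) - relu (G r + U r) - (if 0 < G r then Q r else 0)\<bar>
      \<le> 1 * (\<bar>D r - Q r\<bar> + (if \<bar>G r\<bar> \<le> \<bar>U r\<bar> + \<bar>D r\<bar> then \<bar>D r\<bar> else 0))"
      using a by (intro mult_mono relu_linearization_error) auto
    then show "\<bar>a r * (relu (G r + U r + D r) - relu (G r + U r) - (if 0 < G r then Q r else 0))\<bar>
      \<le> \<bar>D r - Q r\<bar> + (if \<bar>G r\<bar> \<le> \<bar>U r\<bar> + \<bar>D r\<bar> then \<bar>D r\<bar> else 0)" by (simp add: abs_mult)
  qed (use c0 in auto)
  also have "\<dots> = c0 * ((\<Sum>r<m. \<bar>D r - Q r\<bar>) + (\<Sum>r\<in>S. \<bar>D r\<bar>))"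
    by (simp add: sum.distrib sum.If_cases S_def Int_def)
  \<comment> \<open>Cauchy-Schwarz over all units for the drift of the hidden layer, and over the
    few units of \<open>S\<close> for the sign errors. The latter costs sqrt (4 m / n) instead of
    sqrt m, which gives the rate 1 / sqrt n.\<close>
  also have "\<dots> \<le> c0 * (sqrt (real m) * (\<rho> * (2 * \<epsilon>)) + sqrt (4 * real m / real n) * (\<rho> * 4))"
  proof (intro mult_left_mono add_mono)
    have "(\<Sum>r<m. \<bar>D r - Q r\<bar>) \<le> sqrt (real m) * L2_set (\<lambda>r. D r - Q r) {..<m}"
      using sum_abs_le_L2_set[of "{..<m}" "\<lambda>r. D r - Q r"] by simp
    also have "\<dots> \<le> sqrt (real m) * (\<rho> * (2 * \<epsilon>))" by (intro mult_left_mono DQ) auto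
    finally show "(\<Sum>r<m. \<bar>D r - Q r\<bar>) \<le> sqrt (real m) * (\<rho> * (2 * \<epsilon>))" .
    have "(\<Sum>r\<in>S. \<bar>D r\<bar>) \<le> sqrt (real (card S)) * L2_set D S"
      by (rule sum_abs_le_L2_set) (simp add: S_def)
    also have "\<dots> \<le> sqrt (4 * real m / real n) * (\<rho> * 4)"
    proof (intro mult_mono real_sqrt_le_mono cardS L2_set_nonneg)
      have "L2_set D S \<le> L2_set D {..<m}" by (intro L2_set_subset_le) (auto simp: S_def)
      then show "L2_set D S \<le> \<rho> * 4" using D\<rho>[OF \<rho>] by linarith
    qed auto
    finally show "(\<Sum>r\<in>S. \<bar>D r\<bar>) \<le> sqrt (4 * real m / real n) * (\<rho> * 4)" .
  qed (use c0 in auto)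
  also have "\<dots> = sqrt 2 * \<rho> * (2 * \<epsilon> + 8 / sqrt (real n))"
    using m0 n0 by (simp add: real_sqrt_divide real_sqrt_mult field_simps)
  also have "\<dots> \<le> sqrt 2 * \<rho> * (2 * (1 / sqrt (real n)) + 8 / sqrt (real n))"
    using \<epsilon>n \<rho> by (intro mult_left_mono add_right_mono) auto
  also have "\<dots> = (10 * sqrt 2) * (\<rho> / sqrt (real n))" by (simp add: field_simps)
  also have "\<dots> \<le> 15 * (\<rho> / sqrt (real n))"
  proof (intro mult_right_mono)
    show "10 * sqrt 2 \<le> (15 :: real)" by (rule power2_le_imp_le) (auto simp: power_mult_distrib)
  qed (use \<rho> in auto)
  finally show ?thesis by simp
qed

end

section \<open>From net points to all inputs of the sphere\<close>

lemma hidden_lipschitz: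
  assumes op: "\<And>l z. l \<in> {1..L} \<Longrightarrow> L2_set (pre d m W l z) {..<m} \<le> M * L2_set z {..<fan_in d m l}"
    and "l < L" "M \<ge> 0"
  shows "L2_set (\<lambda>r. hidden d m W l x r - hidden d m W l x' r) {..<fan_in d m (Suc l)} \<le> (sqrt (2 / real m) * M) ^ l * L2_set (\<lambda>j. x j - x' j) {..<d}"
  using \<open>l < L\<close>
proof (induction l)
  case 0 then show ?case by (simp add: fan_in_def)
next
  case (Suc l)
  let ?c = "sqrt (2 / real m)"
  have f: "fan_in d m (Suc (Suc l)) = m" by (simp add: fan_in_def)
  let ?z = "\<lambda>r. hidden d m W l x r - hidden d m W l x' r"
  have "L2_set (\<lambda>r. hidden d m W (Suc l) x r - hidden d m W (Suc l) x' r) {..<m} \<le> L2_set (\<lambda>r. ?c * pre d m W (Suc l) ?z r) {..<m}"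
  proof (intro L2_set_mono_abs)
    fix r assume "r \<in> {..<m}"
    then have "\<bar>hidden d m W (Suc l) x r - hidden d m W (Suc l) x' r\<bar>
      = ?c * \<bar>relu (pre d m W (Suc l) (hidden d m W l x) r) - relu (pre d m W (Suc l) (hidden d m W l x') r)\<bar>"
      by (simp add: hidden_Suc abs_mult right_diff_distrib[symmetric] del: hidden.simps)
    also have "\<dots> \<le> ?c * \<bar>pre d m W (Suc l) (hidden d m W l x) r - pre d m W (Suc l) (hidden d m W l x') r\<bar>"
      by (intro mult_left_mono relu_lipschitz) auto
    finally show "\<bar>hidden d m W (Suc l) x r - hidden d m W (Suc l) x' r\<bar> \<le> \<bar>?c * pre d m W (Suc l) ?z r\<bar>"
      by (simp add: pre_diff abs_mult del: hidden.simps)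
  qed
  also have "\<dots> = ?c * L2_set (pre d m W (Suc l) ?z) {..<m}" by (simp add: L2_set_scale)
  also have "\<dots> \<le> ?c * (M * L2_set ?z {..<fan_in d m (Suc l)})"
    using Suc.prems by (intro mult_left_mono op) auto
  also have "\<dots> \<le> ?c * (M * ((?c * M) ^ l * L2_set (\<lambda>j. x j - x' j) {..<d}))"
    using Suc assms by (intro mult_left_mono Suc.IH) auto
  finally show ?case unfolding f by (simp add: mult_ac del: hidden.simps)
qed

text \<open>
  The mesh is fine enough to absorb the crude bound \<open>m ^ (L - 1)\<close> on the Lipschitz constant of the
  hidden layers.
\<close>

definition net_scale :: "nat \<Rightarrow> nat \<Rightarrow> nat \<Rightarrow> nat" where
  "net_scale d m L = 10 * d * m ^ (L + 1)"

definition point_net :: "nat \<Rightarrow> nat \<Rightarrow> nat \<Rightarrow> point set" where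
  "point_net d m L = {x \<in> grid (net_scale d m L) {..<d}. 9/10 \<le> L2_set x {..<d} \<and> L2_set x {..<d} \<le> 1}"

lemma point_net_approx:
  assumes "x \<in> unit_sphere d" "d \<ge> 1" "m \<ge> 1"
  shows "\<exists>x'\<in>point_net d m L. L2_set (\<lambda>j. x j - x' j) {..<d} \<le> 1 / (10 * real m ^ (L + 1))"
proof -
  have x1: "L2_set x {..<d} = 1" using assms by (simp add: unit_sphere_def L2_set_def)
  have "\<bar>x j\<bar> \<le> 1" if "j < d" for j using L2_set_abs_le[of "{..<d}" j x] that x1 by simp
  moreover have q: "net_scale d m L \<ge> 1" using assms by (simp add: net_scale_def)
  ultimately obtain x' where x': "x' \<in> grid (net_scale d m L) {..<d}"
    "\<And>j. j < d \<Longrightarrow> \<bar>x' j\<bar> \<le> \<bar>x j\<bar>" "\<And>j. j < d \<Longrightarrow> \<bar>x j - x' j\<bar> \<le> 1 / real (net_scale d m L)"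
    using grid_approx[of "net_scale d m L" "{..<d}" x] by auto
  have "L2_set (\<lambda>j. x j - x' j) {..<d} \<le> real (card {..<d}) * (1 / real (net_scale d m L))"
    using x' by (intro L2_set_le_card) auto
  also have "\<dots> = 1 / (10 * real m ^ (L + 1))" using assms by (simp add: net_scale_def)
  finally have c: "L2_set (\<lambda>j. x j - x' j) {..<d} \<le> 1 / (10 * real m ^ (L + 1))" .
  have "1 \<le> real m ^ (L + 1)" using assms by (intro one_le_power) simp
  then have "1 / (10 * real m ^ (L + 1)) \<le> 1 / (10 * 1)" by (intro divide_left_mono mult_left_mono) auto
  from order_trans[OF c this] have c': "L2_set (\<lambda>j. x j - x' j) {..<d} \<le> 1 / 10" by (simp only: mult_1_right)
  have "L2_set x {..<d} = L2_set (\<lambda>j. (x j - x' j) + x' j) {..<d}" by simp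
  also have "\<dots> \<le> L2_set (\<lambda>j. x j - x' j) {..<d} + L2_set x' {..<d}" by (rule L2_set_triangle_ineq)
  finally have "9/10 \<le> L2_set x' {..<d}" using x1 c' by linarith
  moreover have "L2_set x' {..<d} \<le> L2_set x {..<d}" using x' by (intro L2_set_mono_abs) auto
  ultimately show ?thesis using x' x1 c by (auto simp: point_net_def)
qed

lemma sum_split_half:
  fixes F :: "nat \<Rightarrow> real"
  assumes "even m"
  shows "(\<Sum>r<m. F r) = (\<Sum>r<m div 2. F r) + (\<Sum>r<m div 2. F (r + m div 2))"
proof -
  have m: "m = m div 2 + m div 2" using assms by (metis dvd_mult_div_cancel mult_2)
  have "(\<Sum>r<m. F r) = (\<Sum>r<m div 2 + m div 2. F r)" using m by simp
  also have "\<dots> = (\<Sum>r<m div 2. F r) + (\<Sum>r<m div 2. F (r + m div 2))"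
    unfolding lessThan_atLeast0
    using sum.shift_bounds_nat_ivl[of F 0 "m div 2" "m div 2"]
    by (simp add: sum.atLeastLessThan_concat[of 0 "m div 2" "m div 2 + m div 2", symmetric])
  finally show ?thesis .
qed

lemma antisymmetric_cancel:
  assumes "antisymmetric_signs m a" "even m" "\<And>r. r < m div 2 \<Longrightarrow> b (r + m div 2) = b r"
  shows "(\<Sum>r<m. a r * b r) = (0::real)"
proof -
  have "(\<Sum>r<m div 2. a (r + m div 2) * b (r + m div 2)) = (\<Sum>r<m div 2. - (a r * b r))"
    using assms by (intro sum.cong) (auto simp: antisymmetric_signs_def)
  then show ?thesis by (simp add: sum_split_half[OF assms(2)] sum_negf)
qed

lemma antisymmetric_abs:
  assumes "antisymmetric_signs m a" "even m" "r < m" shows "\<bar>a r\<bar> \<le> 1"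
proof (cases "r < m div 2")
  case True then show ?thesis using assms by (auto simp: antisymmetric_signs_def)
next
  case False
  then have "r - m div 2 < m div 2" "r = (r - m div 2) + m div 2" using assms by (auto elim!: evenE)
  then have "a r = - a (r - m div 2)" "a (r - m div 2) \<in> {-1, 1}" using assms(1) unfolding antisymmetric_signs_def by (metis, metis)
  then show ?thesis by auto
qed

text \<open>Only net points and sparse test vectors are quantified over; neither the radius of the
  weight ball nor the sample points occur.\<close>

definition good_weights :: "nat \<Rightarrow> nat \<Rightarrow> nat \<Rightarrow> nat \<Rightarrow> nat \<Rightarrow> weights \<Rightarrow> bool" where
  "good_weights d m L n p W \<longleftrightarrow> good_op d m L p W \<and> (\<forall>x\<in>point_net d m L. good_point d m L n p W x)
     \<and> (\<forall>r<m div 2. \<forall>j. j < m \<longrightarrow> W (L, r + m div 2, j) = W (L, r, j))"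

text \<open>The features \<open>\<phi>\<close> depend on the input and the initialization and serve
  all \<open>W\<close> in the ball at once. This order of quantifiers is what makes the network
  class comparable to a linear class in a Rademacher average.\<close>

theorem uniform_linearization:
  fixes d m L n p B :: nat
  assumes L: "L \<ge> 2" and mp: "m \<ge> 1" "even m" and p: "p \<ge> 1" and mB: "m \<le> B * p" and d: "d \<ge> 1" "d \<le> m" and n: "n \<ge> 1"
    and a: "antisymmetric_signs m a" and goodW: "good_weights d m L n p W0" and R: "R \<ge> 1"
    and Bm: "100 * real B \<le> (real m)\<^sup>2"
    and eps: "eps = 70 * real L * sqrt (real B) * R / sqrt (real m)"
    and width: "eps\<^sup>2 * (14112 * real B * real m ^ 3) \<le> real p ^ 3"
    and width1: "eps \<le> 1" and width2: "2320 * real B * eps\<^sup>2 * real n ^ 3 \<le> 1"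
    and x: "x \<in> unit_sphere d"
  shows "\<exists>\<phi>. (\<Sum>r<m. \<Sum>j<m. (\<phi> r j)\<^sup>2) \<le> 8 \<and>
    (\<forall>W. frob_dist_sq d m L W W0 \<le> R\<^sup>2 \<longrightarrow>
      \<bar>network d m L a W x - (\<Sum>r<m. \<Sum>j<m. \<phi> r j * (W (L, r, j) - W0 (L, r, j)))\<bar> \<le> 15 * sqrt (frob_dist_sq d m L W W0) / sqrt (real n))"
proof -
  interpret good_init d m L n p B W0
    using assms by unfold_locales (auto simp: good_weights_def)
  obtain x' where x': "x' \<in> point_net d m L" "L2_set (\<lambda>j. x j - x' j) {..<d} \<le> 1 / (10 * real m ^ (L + 1))"
    using point_net_approx[OF x d(1) mp(1)] by auto
  interpret good_init_point d m L n p B W0 x'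
    using x' goodW by unfold_locales (auto simp: good_weights_def point_net_def)
  have pert: "perturbed d m L n p B W0 x' W R" if "frob_dist_sq d m L W W0 \<le> R\<^sup>2" for W
    using that R width width1 by unfold_locales (auto simp: eps)
  have refl: "frob_dist_sq d m L W0 W0 \<le> R\<^sup>2" by (simp add: frob_dist_sq_def)
  have aa: "\<bar>a r\<bar> \<le> 1" if "r < m" for r using antisymmetric_abs[OF a mp(2) that] .
  have fL: "fan_in d m L = m" using L by (simp add: fan_in_def)
  have cancel: "(\<Sum>r<m. a r * relu (pre d m W0 L h r)) = 0" for h
  proof (intro antisymmetric_cancel a mp(2))
    fix r assume r: "r < m div 2"
    have "W0 (L, r + m div 2, j) = W0 (L, r, j)" if "j < m" for j
      using goodW r that unfolding good_weights_def by blast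
    then show "relu (pre d m W0 L h (r + m div 2)) = relu (pre d m W0 L h r)" by (simp add: pre_def fL)
  qed
  \<comment> \<open>The term \<open>feature\<close> written out, so that it is visibly independent
    of the perturbed weights.\<close>
  define \<phi> where "\<phi> r j = sqrt (2 / real m) * (a r * (if 0 < pre d m W0 L (hidden d m W0 (L - 1) x') r then hidden d m W0 (L - 1) x' j else 0))" for r j
  have feat: "perturbed.feature d m L W0 x' a = \<phi>"
    using perturbed.feature_def[OF pert[OF refl]] by (simp add: \<phi>_def[abs_def] fun_eq_iff)
  show ?thesis
  proof (intro exI[of _ \<phi>] conjI allI impI)
    show "(\<Sum>r<m. \<Sum>j<m. (\<phi> r j)\<^sup>2) \<le> 8"
      using perturbed.feature_norm[OF pert[OF refl], of a] aa unfolding feat by blast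
    fix W assume W: "frob_dist_sq d m L W W0 \<le> R\<^sup>2"
    interpret P: perturbed d m L n p B W0 x' W R by (rule pert[OF W])
    have epsP: "P.\<epsilon> = eps" by (simp add: P.\<epsilon>_def eps)
    have dist0: "0 \<le> frob_dist_sq d m L W W0" unfolding frob_dist_sq_def by (intro sum_nonneg) auto
    have B0: "real B \<ge> 1" "sqrt (real B) \<ge> 1" using B by auto
    have "1 * 1 \<le> (70 * real L) * sqrt (real B)" using L B0 by (intro mult_mono) auto
    then have LB: "1 \<le> 70 * real L * sqrt (real B)" by simp
    have LBR: "R \<le> 70 * real L * sqrt (real B) * R" using mult_right_mono[OF LB, of R] R by simp
    have op: "L2_set (pre d m W l z) {..<m} \<le> (7 * sqrt (real m * real B)) * L2_set z {..<fan_in d m l}" if l: "l \<in> {1..L}" for l z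
    proof -
      have "L2_set (pre d m W l z) {..<m} = L2_set (\<lambda>r. pre d m W0 l z r + pre d m (\<lambda>i. W i - W0 i) l z r) {..<m}"
        by (simp add: pre_diff_weights)
      also have "\<dots> \<le> L2_set (pre d m W0 l z) {..<m} + L2_set (pre d m (\<lambda>i. W i - W0 i) l z) {..<m}"
        by (rule L2_set_triangle_ineq)
      also have "\<dots> \<le> 6 * sqrt (real m * real B) * L2_set z {..<fan_in d m l} + R * L2_set z {..<fan_in d m l}"
        using W R l by (intro add_mono op_bound pre_diff_weights_le) auto
      also have "R \<le> sqrt (real m * real B)"
      proof -
        have "70 * real L * sqrt (real B) * R \<le> sqrt (real m)"
          using width1 m unfolding eps by (simp add: divide_le_eq)
        moreover have "sqrt (real m) \<le> sqrt (real m * real B)" using B0 by (intro real_sqrt_le_mono) (simp add: mult_le_cancel_left1)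
        ultimately show ?thesis using LBR by linarith
      qed
      finally show ?thesis using L2_set_nonneg[of z] by (simp add: algebra_simps mult_right_mono)
    qed
    have "L2_set (\<lambda>r. hidden d m W (L - 1) x r - hidden d m W (L - 1) x' r) {..<fan_in d m (Suc (L - 1))}
      \<le> (sqrt (2 / real m) * (7 * sqrt (real m * real B))) ^ (L - 1) * L2_set (\<lambda>j. x j - x' j) {..<d}"
      using L by (intro hidden_lipschitz[where L=L] op) auto
    also have "sqrt (2 / real m) * (7 * sqrt (real m * real B)) = 7 * sqrt 2 * sqrt (real B)"
      using m by (simp add: real_sqrt_divide real_sqrt_mult)
    also have "(7 * sqrt 2 * sqrt (real B)) ^ (L - 1) * L2_set (\<lambda>j. x j - x' j) {..<d} \<le> real m ^ (L - 1) * (1 / (10 * real m ^ (L + 1)))"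
    proof (intro mult_mono power_mono x'(2))
      \<comment> \<open>By \<open>Bm\<close> the square 98 B is at most m^2. So the hidden layers
        have Lipschitz constant at most m^(L - 1), and the mesh leaves an error of 1 / (10
        m^2).\<close>
      have "(7 * sqrt 2 * sqrt (real B))\<^sup>2 \<le> (real m)\<^sup>2" using Bm by (simp add: power_mult_distrib)
      then show "7 * sqrt 2 * sqrt (real B) \<le> real m" by (rule power2_le_imp_le) simp
    qed auto
    also have "\<dots> \<le> eps"
    proof -
      have "L + 1 = (L - 1) + 2" using L by simp
      then have pm: "real m ^ (L + 1) = real m ^ (L - 1) * real m ^ 2" by (metis power_add)
      have "real m ^ (L - 1) * (1 / (10 * real m ^ (L + 1))) = 1 / (10 * real m ^ 2)"
        unfolding pm using m by simp
      also have "\<dots> \<le> 1 / sqrt (real m)"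
      proof (intro divide_left_mono)
        have "sqrt (real m) \<le> real m" using m by (intro real_le_lsqrt) (auto simp: power2_eq_square)
        also have "\<dots> \<le> 10 * real m ^ 2" using m by (simp add: power2_eq_square)
        finally show "sqrt (real m) \<le> 10 * real m ^ 2" .
      qed (use m in auto)
      also have "\<dots> \<le> eps"
      proof -
        have "1 \<le> 70 * real L * sqrt (real B) * R" using LBR R by linarith
        then show ?thesis unfolding eps by (intro divide_right_mono) auto
      qed
      finally show ?thesis .
    qed
    finally have near: "L2_set (\<lambda>r. hidden d m W (L - 1) x r - hidden d m W (L - 1) x' r) {..<m} \<le> P.\<epsilon>"
      using L unfolding epsP by (simp add: fan_in_def)
    show "\<bar>network d m L a W x - (\<Sum>r<m. \<Sum>j<m. \<phi> r j * (W (L, r, j) - W0 (L, r, j)))\<bar> \<le> 15 * sqrt (frob_dist_sq d m L W W0) / sqrt (real n)"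
      using P.linearization[where a=a and x'=x and \<rho>="sqrt (frob_dist_sq d m L W W0)"] aa cancel near width2 dist0 unfolding feat epsP by simp
  qed
qed


section \<open>Probability of a good initialization\<close>

lemma tail_le_mono:
  assumes "tail_le M Q b" "\<And>W. W \<in> space M \<Longrightarrow> P W \<Longrightarrow> Q W" "b \<le> b'"
  shows "tail_le M P b'"
proof -
  obtain A where A: "A \<in> sets M" "{W \<in> space M. Q W} \<subseteq> A" "emeasure M A \<le> ennreal b"
    using assms(1) unfolding tail_le_def by blast
  moreover have "{W \<in> space M. P W} \<subseteq> A" using A(2) assms(2) by blast
  moreover have "emeasure M A \<le> ennreal b'" using A(3) ennreal_leI[OF assms(3)] by (rule order_trans)
  ultimately show ?thesis unfolding tail_le_def by blast
qed

lemma tail_le_disj: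
  assumes "tail_le M P b" "tail_le M Q b'" "0 \<le> b" "0 \<le> b'"
  shows "tail_le M (\<lambda>W. P W \<or> Q W) (b + b')"
proof -
  obtain A where A: "A \<in> sets M" "{W \<in> space M. P W} \<subseteq> A" "emeasure M A \<le> ennreal b"
    using assms(1) unfolding tail_le_def by blast
  obtain A' where A': "A' \<in> sets M" "{W \<in> space M. Q W} \<subseteq> A'" "emeasure M A' \<le> ennreal b'"
    using assms(2) unfolding tail_le_def by blast
  have "emeasure M (A \<union> A') \<le> ennreal b + ennreal b'"
    using emeasure_subadditive[OF A(1) A'(1)] add_mono[OF A(3) A'(3)] by (rule order_trans)
  then have "emeasure M (A \<union> A') \<le> ennreal (b + b')" using assms by simp
  moreover have "{W \<in> space M. P W \<or> Q W} \<subseteq> A \<union> A'" using A(2) A'(2) by blast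
  ultimately show ?thesis using A(1) A'(1) unfolding tail_le_def by (intro bexI[of _ "A \<union> A'"]) auto
qed

text \<open>Stated with an upper bound \<open>c\<close> for the cardinality, so that nested
  quantifiers can be peeled off one after another.\<close>

lemma tail_le_bex:
  assumes "finite J" "\<And>j. j \<in> J \<Longrightarrow> tail_le M (P j) b" "0 \<le> b" "real (card J) \<le> c"
  shows "tail_le M (\<lambda>W. \<exists>j\<in>J. P j W) (c * b)"
proof -
  have "\<forall>j\<in>J. \<exists>A. A \<in> sets M \<and> {W \<in> space M. P j W} \<subseteq> A \<and> emeasure M A \<le> ennreal b"
    using assms(2) unfolding tail_le_def by blast
  then obtain A where A: "\<And>j. j \<in> J \<Longrightarrow> A j \<in> sets M" "\<And>j. j \<in> J \<Longrightarrow> {W \<in> space M. P j W} \<subseteq> A j"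
    "\<And>j. j \<in> J \<Longrightarrow> emeasure M (A j) \<le> ennreal b" by metis
  have "emeasure M (\<Union>j\<in>J. A j) \<le> (\<Sum>j\<in>J. emeasure M (A j))"
    using assms A by (intro emeasure_subadditive_finite) auto
  also have "\<dots> \<le> (\<Sum>j\<in>J. ennreal b)" by (intro sum_mono A)
  also have "\<dots> = ennreal (real (card J) * b)" using assms by (simp add: ennreal_mult ennreal_of_nat_eq_real_of_nat)
  also have "\<dots> \<le> ennreal (c * b)" using assms by (intro ennreal_leI mult_right_mono)
  finally have "emeasure M (\<Union>j\<in>J. A j) \<le> ennreal (c * b)" .
  moreover have "{W \<in> space M. \<exists>j\<in>J. P j W} \<subseteq> (\<Union>j\<in>J. A j)" using A(2) by blast
  ultimately show ?thesis using A(1) assms(1) unfolding tail_le_def by (intro bexI[of _ "\<Union>j\<in>J. A j"]) auto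
qed

section \<open>Dependence of the layers on the freely drawn weights\<close>

lemma free_idx_iff:
  "(l, r, j) \<in> free_idx d m L \<longleftrightarrow> 1 \<le> l \<and> l \<le> L \<and> r < m \<and> j < fan_in d m l \<and> (l < L \<or> r < m div 2)"
  by (auto simp: free_idx_def weight_idx_def)

lemma finite_weight_idx: "finite (weight_idx d m L)"
  by (simp add: weight_idx_def)

lemma finite_free_idx: "finite (free_idx d m L)"
  by (rule finite_subset[OF _ finite_weight_idx]) (auto simp: free_idx_def)

lemma hidden_weights_cong:
  assumes "\<And>l' r j. 1 \<le> l' \<Longrightarrow> l' \<le> l \<Longrightarrow> r < m \<Longrightarrow> j < fan_in d m l' \<Longrightarrow> W (l', r, j) = W' (l', r, j)"
  shows "hidden d m W l x = hidden d m W' l x"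
  using assms
proof (induction l)
  case (Suc l)
  have "hidden d m W l x = hidden d m W' l x" by (rule Suc.IH) (rule Suc.prems, auto)
  then show ?case using Suc.prems[of "Suc l"] by (auto intro!: restrict_ext arg_cong[where f=relu] sum.cong)
qed simp

lemma pre_weights_cong:
  assumes "\<And>j. j < fan_in d m l \<Longrightarrow> W (l, r, j) = W' (l, r, j)"
  shows "pre d m W l v r = pre d m W' l v r"
  using assms by (auto simp: pre_def intro!: sum.cong)

lemma lprop_weights_cong:
  assumes "\<And>l' r j. 1 \<le> l' \<Longrightarrow> l' \<le> k + i \<Longrightarrow> r < m \<Longrightarrow> j < fan_in d m l' \<Longrightarrow> W (l', r, j) = W' (l', r, j)" "r < m" "k \<ge> 1"
  shows "lprop d m W x k i z r = lprop d m W' x k i z r"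
  using assms(1,2)
proof (induction i arbitrary: r)
  case (Suc i)
  have h: "hidden d m W (k + i) x = hidden d m W' (k + i) x"
    using Suc.prems by (intro hidden_weights_cong) auto
  have p: "pre d m W (Suc (k + i)) v r = pre d m W' (Suc (k + i)) v r" for v
    using Suc.prems by (intro pre_weights_cong) auto
  have q: "pre d m W' (Suc (k + i)) (lprop d m W x k i z) r = pre d m W' (Suc (k + i)) (lprop d m W' x k i z) r"
    using Suc assms(3) by (intro pre_cong Suc.IH) (auto simp: fan_in_def)
  show ?case by (simp add: h p q)
qed simp

lemma pre_measurable:
  assumes "\<And>j. j < fan_in d m l \<Longrightarrow> (l, r, j) \<in> I" "\<And>j. j < fan_in d m l \<Longrightarrow> (\<lambda>W. y W j) \<in> borel_measurable (PiM I (\<lambda>_. borel))"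
  shows "(\<lambda>W. pre d m W l (y W) r) \<in> borel_measurable (PiM I (\<lambda>_. borel))"
  unfolding pre_def using assms
  by (intro borel_measurable_sum borel_measurable_times measurable_component_singleton) auto

lemma relu_measurable [measurable]: "relu \<in> borel_measurable borel"
  unfolding relu_def by measurable

lemma hidden_measurable:
  assumes "\<And>l' r j. 1 \<le> l' \<Longrightarrow> l' \<le> l \<Longrightarrow> r < m \<Longrightarrow> j < fan_in d m l' \<Longrightarrow> (l', r, j) \<in> I" "r < fan_in d m (Suc l)"
  shows "(\<lambda>W. hidden d m W l x r) \<in> borel_measurable (PiM I (\<lambda>_. borel))"
  using assms
proof (induction l arbitrary: r)
  case (Suc l)
  have r: "r < m" using Suc.prems(2) by (simp add: fan_in_def)
  have "(\<lambda>W. pre d m W (Suc l) (hidden d m W l x) r) \<in> borel_measurable (PiM I (\<lambda>_. borel))"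
    using Suc.prems r by (intro pre_measurable Suc.IH) auto
  then have "(\<lambda>W. sqrt (2 / real m) * relu (pre d m W (Suc l) (hidden d m W l x) r)) \<in> borel_measurable (PiM I (\<lambda>_. borel))"
    by measurable
  then show ?case using r by (simp add: hidden_Suc del: hidden.simps)
qed simp

lemma lprop_measurable:
  assumes "\<And>l' r j. 1 \<le> l' \<Longrightarrow> l' \<le> k + i \<Longrightarrow> r < m \<Longrightarrow> j < fan_in d m l' \<Longrightarrow> (l', r, j) \<in> I" "r < m" "k \<ge> 1"
  shows "(\<lambda>W. lprop d m W x k i z r) \<in> borel_measurable (PiM I (\<lambda>_. borel))"
  using assms(1,2)
proof (induction i arbitrary: r)
  case (Suc i)
  have [measurable]: "(\<lambda>W. pre d m W (Suc (k + i)) (hidden d m W (k + i) x) r) \<in> borel_measurable (PiM I (\<lambda>_. borel))"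
    using Suc.prems by (intro pre_measurable hidden_measurable) auto
  have [measurable]: "(\<lambda>W. pre d m W (Suc (k + i)) (lprop d m W x k i z) r) \<in> borel_measurable (PiM I (\<lambda>_. borel))"
    using Suc assms(3) by (intro pre_measurable Suc.IH) (auto simp: fan_in_def)
  show ?case by simp
qed simp

text \<open>Layer \<open>l\<close> is computed from the weights of the layers up to
  \<open>l\<close>, so it is fixed once everything except layer \<open>Suc l\<close> is conditioned
  on.\<close>

lemma off_layer_hidden: "l < L \<Longrightarrow> off_layer (free_idx d m L) (Suc l) (fan_in d m (Suc l)) (\<lambda>W. hidden d m W l x)"
  unfolding off_layer_def
proof (intro conjI allI impI)
  fix W W' :: weights and j assume l: "l < L" and eq: "\<forall>i\<in>free_idx d m L. fst i \<noteq> Suc l \<longrightarrow> W i = W' i"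
  have "hidden d m W l x = hidden d m W' l x"
    using eq l by (intro hidden_weights_cong) (auto simp: free_idx_iff)
  then show "hidden d m W l x j = hidden d m W' l x j" by simp
next
  fix j assume "l < L" "j < fan_in d m (Suc l)"
  then show "(\<lambda>W. hidden d m W l x j) \<in> borel_measurable (PiM (free_idx d m L) (\<lambda>_. borel))"
    by (intro hidden_measurable) (auto simp: free_idx_iff)
qed

lemma off_layer_lprop:
  assumes "k \<ge> 1" "k + i < L"
  shows "off_layer (free_idx d m L) (Suc (k + i)) (fan_in d m (Suc (k + i))) (\<lambda>W. lprop d m W x k i z)"
  unfolding off_layer_def
proof (intro conjI allI impI)
  fix W W' :: weights and j assume j: "j < fan_in d m (Suc (k + i))" and eq: "\<forall>i'\<in>free_idx d m L. fst i' \<noteq> Suc (k + i) \<longrightarrow> W i' = W' i'"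
  show "lprop d m W x k i z j = lprop d m W' x k i z j"
    using eq assms j by (intro lprop_weights_cong) (auto simp: free_idx_iff fan_in_def)
next
  fix j assume "j < fan_in d m (Suc (k + i))"
  then show "(\<lambda>W. lprop d m W x k i z j) \<in> borel_measurable (PiM (free_idx d m L) (\<lambda>_. borel))"
    using assms by (intro lprop_measurable) (auto simp: free_idx_iff fan_in_def)
qed

lemma off_layer_const: "off_layer I l k (\<lambda>W. z)"
  by (simp add: off_layer_def)

lemma layer_subset:
  "1 \<le> l \<Longrightarrow> l < L \<Longrightarrow> S \<subseteq> {..<m} \<Longrightarrow> {l} \<times> S \<times> {..<fan_in d m l} \<subseteq> free_idx d m L"
  by (auto simp: free_idx_iff)

text \<open>Number of independent rows; half of the top layer consists of copies.\<close>

definition free_rows :: "nat \<Rightarrow> nat \<Rightarrow> nat \<Rightarrow> nat" where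
  "free_rows m L l = (if l = L then m div 2 else m)"

lemma free_layer_subset:
  "1 \<le> l \<Longrightarrow> l \<le> L \<Longrightarrow> {l} \<times> {..<free_rows m L l} \<times> {..<fan_in d m l} \<subseteq> free_idx d m L"
  by (auto simp: free_idx_iff free_rows_def split: if_splits)

lemma L2_hidden_Suc:
  "(L2_set (hidden d m W (Suc l) x) {..<m})\<^sup>2 = 2 / real m * (\<Sum>r<m. (relu (pre d m W (Suc l) (hidden d m W l x) r))\<^sup>2)"
proof -
  have "(L2_set (hidden d m W (Suc l) x) {..<m})\<^sup>2 = (\<Sum>r<m. (hidden d m W (Suc l) x r)\<^sup>2)"
    by (simp add: L2_set_def sum_nonneg del: hidden.simps)
  also have "\<dots> = (\<Sum>r<m. 2 / real m * (relu (pre d m W (Suc l) (hidden d m W l x) r))\<^sup>2)"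
    by (intro sum.cong refl) (simp add: hidden_Suc power_mult_distrib del: hidden.simps)
  finally show ?thesis by (simp add: sum_distrib_left)
qed

lemma L2_lprop_Suc:
  "(L2_set (lprop d m W x k (Suc i) z) {..<m})\<^sup>2 = 2 / real m *
    (\<Sum>r<m. (if 0 < pre d m W (Suc (k + i)) (hidden d m W (k + i) x) r then pre d m W (Suc (k + i)) (lprop d m W x k i z) r else 0)\<^sup>2)"
proof -
  have "(L2_set (lprop d m W x k (Suc i) z) {..<m})\<^sup>2 = (\<Sum>r<m. (lprop d m W x k (Suc i) z r)\<^sup>2)"
    by (simp add: L2_set_def sum_nonneg del: lprop.simps)
  also have "\<dots> = (\<Sum>r<m. 2 / real m * (if 0 < pre d m W (Suc (k + i)) (hidden d m W (k + i) x) r then pre d m W (Suc (k + i)) (lprop d m W x k i z) r else 0)\<^sup>2)"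
    by (intro sum.cong refl) (simp add: power_mult_distrib)
  finally show ?thesis by (simp add: sum_distrib_left)
qed

section \<open>Passing between tied and untied weights\<close>

lemma tie_rows_low:
  assumes "1 \<le> l" "l < L" "r < m" "j < fan_in d m l"
  shows "tie_rows d m L g (l, r, j) = g (l, r, j)"
  using assms by (auto simp: tie_rows_def weight_idx_def)

lemma tie_rows_top:
  assumes "1 \<le> L" "r < m" "j < fan_in d m L"
  shows "tie_rows d m L g (L, r, j) = (if m div 2 \<le> r then g (L, r - m div 2, j) else g (L, r, j))"
  using assms by (auto simp: tie_rows_def weight_idx_def)

lemma hidden_tie_rows: "l < L \<Longrightarrow> hidden d m (tie_rows d m L g) l x = hidden d m g l x"
  by (intro hidden_weights_cong tie_rows_low) auto

lemma pre_tie_rows: "1 \<le> l \<Longrightarrow> l < L \<Longrightarrow> r < m \<Longrightarrow> pre d m (tie_rows d m L g) l v r = pre d m g l v r"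
  by (intro pre_weights_cong tie_rows_low) auto

lemma lprop_tie_rows:
  "1 \<le> k \<Longrightarrow> k + i < L \<Longrightarrow> r < m \<Longrightarrow> lprop d m (tie_rows d m L g) x k i z r = lprop d m g x k i z r"
  by (intro lprop_weights_cong tie_rows_low) auto

lemma pre_tie_rows_top:
  assumes "1 \<le> L" "r < m"
  shows "pre d m (tie_rows d m L g) L v r = pre d m g L v (if m div 2 \<le> r then r - m div 2 else r)"
  using assms by (auto simp: pre_def tie_rows_top intro!: sum.cong)

text \<open>In the top layer each free row occurs twice, elsewhere once; cross-multiplication covers
  both cases by one formula.\<close>

lemma tied_pre_sum:
  fixes F :: "real \<Rightarrow> real"
  assumes "even m" "1 \<le> l" "l \<le> L"
  shows "real (free_rows m L l) * (\<Sum>r<m. F (pre d m (tie_rows d m L g) l v r)) = real m * (\<Sum>r<free_rows m L l. F (pre d m g l v r))"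
proof (cases "l = L")
  case True
  have "(\<Sum>r<m. F (pre d m (tie_rows d m L g) L v r)) = 2 * (\<Sum>r<m div 2. F (pre d m (tie_rows d m L g) L v r))"
  proof -
    have "(\<Sum>r<m div 2. F (pre d m (tie_rows d m L g) L v (r + m div 2))) = (\<Sum>r<m div 2. F (pre d m (tie_rows d m L g) L v r))"
    proof (intro sum.cong refl arg_cong[where f=F])
      fix r assume "r \<in> {..<m div 2}"
      then have r: "r < m div 2" "r + m div 2 < m" "r < m" by auto
      then show "pre d m (tie_rows d m L g) L v (r + m div 2) = pre d m (tie_rows d m L g) L v r"
        using True assms by (simp add: pre_tie_rows_top)
    qed
    then show ?thesis by (simp add: sum_split_half[OF assms(1)])
  qed
  also have "(\<Sum>r<m div 2. F (pre d m (tie_rows d m L g) L v r)) = (\<Sum>r<m div 2. F (pre d m g L v r))"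
    using True assms by (intro sum.cong refl arg_cong[where f=F]) (simp add: pre_tie_rows_top)
  finally show ?thesis using True assms(1) by (auto simp: free_rows_def real_of_nat_div)
next
  case False
  then have "(\<Sum>r<m. F (pre d m (tie_rows d m L g) l v r)) = (\<Sum>r<m. F (pre d m g l v r))"
    using assms by (intro sum.cong refl arg_cong[where f=F] pre_tie_rows) auto
  then show ?thesis using False by (simp add: free_rows_def)
qed

lemma card_as_sum: fixes m :: nat shows "real (card {r. r < m \<and> P r}) = (\<Sum>r<m. if P r then 1 else 0)"
proof -
  have "(\<Sum>r<m. if P r then 1 else 0 :: real) = (\<Sum>r\<in>{r \<in> {..<m}. P r}. 1)"
    by (rule sum.inter_filter[symmetric]) simp
  then show ?thesis by simp
qed

text \<open>This and the next four definitions negate the clauses of \<open>good_point\<close> and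
  \<open>good_op\<close> for the untied Gaussian weights, in the shape of the tail bounds for rows.
  Where the top layer takes part, only its independent rows are counted.\<close>

definition fail_forward where
  "fail_forward d m L x l g \<longleftrightarrow>
     2 * (\<Sum>r<m. (relu (pre d m g (Suc l) (hidden d m g l x) r))\<^sup>2) < (1 - 1 / real L) * real m * (L2_set (hidden d m g l x) {..<fan_in d m (Suc l)})\<^sup>2 \<or>
     (1 + 1 / real L) * real m * (L2_set (hidden d m g l x) {..<fan_in d m (Suc l)})\<^sup>2 < 2 * (\<Sum>r<m. (relu (pre d m g (Suc l) (hidden d m g l x) r))\<^sup>2)"

definition fail_prop where
  "fail_prop d m L x z k i g \<longleftrightarrow>
     (1 + 1 / real L) * real m * (L2_set (lprop d m g x k i z) {..<m})\<^sup>2 <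
     2 * (\<Sum>r<m. (if 0 < pre d m g (Suc (k + i)) (hidden d m g (k + i) x) r then pre d m g (Suc (k + i)) (lprop d m g x k i z) r else 0)\<^sup>2)"

definition fail_sparse where
  "fail_sparse d m L x z k i S' g \<longleftrightarrow>
     real m / (200 * (real L)\<^sup>2) * (L2_set (lprop d m g x k i z) {..<m})\<^sup>2 < (\<Sum>r\<in>S'. (pre d m g (Suc (k + i)) (lprop d m g x k i z) r)\<^sup>2)"

definition fail_count where
  "fail_count d m L \<tau> x l g \<longleftrightarrow> 0 < L2_set (hidden d m g l x) {..<fan_in d m (Suc l)} \<and>
     3 * \<tau> * real (free_rows m L (Suc l)) < real (card {r. r < free_rows m L (Suc l) \<and> \<bar>pre d m g (Suc l) (hidden d m g l x) r\<bar> \<le> \<tau> * L2_set (hidden d m g l x) {..<fan_in d m (Suc l)}})"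

definition fail_op where
  "fail_op d m L l z g \<longleftrightarrow>
     8 * real (free_rows m L l) * (L2_set z {..<fan_in d m l})\<^sup>2 < (\<Sum>r<free_rows m L l. (pre d m g l z r)\<^sup>2)"

lemma good_opI:
  assumes "even m" "m \<ge> 1"
    and "\<And>l S z. l \<in> {1..L} \<Longrightarrow> S \<in> small_sets (fan_in d m l) p \<Longrightarrow> z \<in> grid (2 * p) S \<Longrightarrow> \<not> fail_op d m L l z g"
  shows "good_op d m L p (tie_rows d m L g)"
  unfolding good_op_def
proof (intro ballI)
  fix l S z assume *: "l \<in> {1..L}" "S \<in> small_sets (fan_in d m l) p" "z \<in> grid (2 * p) S"
  have pos: "real (free_rows m L l) > 0" using assms by (auto simp: free_rows_def elim!: evenE)
  have "real (free_rows m L l) * (\<Sum>r<m. (pre d m (tie_rows d m L g) l z r)\<^sup>2) = real m * (\<Sum>r<free_rows m L l. (pre d m g l z r)\<^sup>2)"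
    using tied_pre_sum[where F="\<lambda>x. x\<^sup>2"] assms * by simp
  also have "\<dots> \<le> real m * (8 * real (free_rows m L l) * (L2_set z {..<fan_in d m l})\<^sup>2)"
    using assms(3)[OF *] by (intro mult_left_mono) (auto simp: fail_op_def not_less)
  also have "\<dots> = real (free_rows m L l) * (8 * real m * (L2_set z {..<fan_in d m l})\<^sup>2)" by simp
  finally show "(\<Sum>r<m. (pre d m (tie_rows d m L g) l z r)\<^sup>2) \<le> 8 * real m * (L2_set z {..<fan_in d m l})\<^sup>2"
    using pos by (subst (asm) mult_le_cancel_left_pos) auto
qed

text \<open>Hidden layers and frozen propagation do not see the tied top rows, so only the counting
  clause needs \<open>tied_pre_sum\<close>.\<close>

lemma good_pointI:
  assumes "even m" "m \<ge> 1" "L \<ge> 2"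
    and f: "\<And>l. Suc l < L \<Longrightarrow> \<not> fail_forward d m L x l g"
    and pr: "\<And>S z k i. S \<in> small_sets m p \<Longrightarrow> z \<in> grid (2 * p) S \<Longrightarrow> 1 \<le> k \<Longrightarrow> Suc (k + i) < L \<Longrightarrow> \<not> fail_prop d m L x z k i g"
    and sp: "\<And>S z k i S'. S \<in> small_sets m p \<Longrightarrow> z \<in> grid (2 * p) S \<Longrightarrow> 1 \<le> k \<Longrightarrow> Suc (k + i) < L \<Longrightarrow> S' \<in> small_sets m p \<Longrightarrow> \<not> fail_sparse d m L x z k i S' g"
    and ct: "\<And>l \<tau>. l < L \<Longrightarrow> \<tau> \<in> {real p / (6 * real m), 1 / real n} \<Longrightarrow> \<not> fail_count d m L \<tau> x l g"
  shows "good_point d m L n p (tie_rows d m L g) x"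
proof -
  let ?W = "tie_rows d m L g"
  have m0: "real m > 0" and L0: "real L > 0" using assms by auto
  have lp: "L2_set (lprop d m ?W x k i z) {..<m} = L2_set (lprop d m g x k i z) {..<m}" if "1 \<le> k" "k + i < L" for k i z
    using that by (intro L2_set_cong refl lprop_tie_rows) auto
  have fwd: "(1 - 1 / real L) * (L2_set (hidden d m ?W l x) {..<fan_in d m (Suc l)})\<^sup>2 \<le> (L2_set (hidden d m ?W (Suc l) x) {..<m})\<^sup>2 \<and>
    (L2_set (hidden d m ?W (Suc l) x) {..<m})\<^sup>2 \<le> (1 + 1 / real L) * (L2_set (hidden d m ?W l x) {..<fan_in d m (Suc l)})\<^sup>2"
    if l: "Suc l < L" for l
  proof -
    have h: "hidden d m ?W l x = hidden d m g l x" "hidden d m ?W (Suc l) x = hidden d m g (Suc l) x"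
      using l by (intro hidden_tie_rows; simp)+
    show ?thesis
      unfolding h L2_hidden_Suc using f[OF l] m0 L0 by (auto simp: fail_forward_def not_less field_simps)
  qed
  have prp: "(L2_set (lprop d m ?W x k (Suc i) z) {..<m})\<^sup>2 \<le> (1 + 1 / real L) * (L2_set (lprop d m ?W x k i z) {..<m})\<^sup>2"
    if "S \<in> small_sets m p" "z \<in> grid (2 * p) S" "1 \<le> k" "Suc (k + i) < L" for S z k i
  proof -
    have 1: "L2_set (lprop d m ?W x k (Suc i) z) {..<m} = L2_set (lprop d m g x k (Suc i) z) {..<m}"
      "L2_set (lprop d m ?W x k i z) {..<m} = L2_set (lprop d m g x k i z) {..<m}"
      by (rule lp; use that in simp)+
    show ?thesis unfolding 1 L2_lprop_Suc using pr[OF that] m0 L0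
      by (auto simp: fail_prop_def not_less field_simps)
  qed
  have sparse: "200 * (real L)\<^sup>2 * (\<Sum>r\<in>S'. (pre d m ?W (Suc (k + i)) (lprop d m ?W x k i z) r)\<^sup>2)
           \<le> real m * (L2_set (lprop d m ?W x k i z) {..<m})\<^sup>2"
    if "S \<in> small_sets m p" "z \<in> grid (2 * p) S" "1 \<le> k" "Suc (k + i) < L" "S' \<in> small_sets m p" for S z k i S'
  proof -
    have "(\<Sum>r\<in>S'. (pre d m ?W (Suc (k + i)) (lprop d m ?W x k i z) r)\<^sup>2) = (\<Sum>r\<in>S'. (pre d m g (Suc (k + i)) (lprop d m g x k i z) r)\<^sup>2)"
    proof (intro sum.cong refl arg_cong[where f="\<lambda>x. x\<^sup>2"])
      fix r assume "r \<in> S'"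
      then have r: "r < m" using that by (auto simp: small_sets_def)
      have "pre d m ?W (Suc (k + i)) (lprop d m ?W x k i z) r = pre d m g (Suc (k + i)) (lprop d m ?W x k i z) r"
        using r that by (intro pre_tie_rows) auto
      also have "\<dots> = pre d m g (Suc (k + i)) (lprop d m g x k i z) r"
        using r that by (intro pre_cong lprop_tie_rows) (auto simp: fan_in_def)
      finally show "pre d m ?W (Suc (k + i)) (lprop d m ?W x k i z) r = \<dots>" .
    qed
    moreover have "L2_set (lprop d m ?W x k i z) {..<m} = L2_set (lprop d m g x k i z) {..<m}" using that by (intro lp) auto
    ultimately show ?thesis using sp[OF that] m0 L0 by (auto simp: fail_sparse_def not_less field_simps)
  qed
  have count: "real (card {r. r < m \<and> \<bar>pre d m ?W (Suc l) (hidden d m ?W l x) r\<bar> \<le> \<tau> * L2_set (hidden d m ?W l x) {..<fan_in d m (Suc l)}}) \<le> 3 * \<tau> * real m"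
    if l: "l < L" and \<tau>: "\<tau> \<in> {real p / (6 * real m), 1 / real n}" and pos: "0 < L2_set (hidden d m ?W l x) {..<fan_in d m (Suc l)}" for l \<tau>
  proof -
    have h: "hidden d m ?W l x = hidden d m g l x" using l by (rule hidden_tie_rows)
    let ?t = "\<tau> * L2_set (hidden d m g l x) {..<fan_in d m (Suc l)}"
    let ?F = "\<lambda>y. if \<bar>y\<bar> \<le> ?t then 1 else (0::real)"
    have fr: "real (free_rows m L (Suc l)) > 0" using assms by (auto simp: free_rows_def elim!: evenE)
    have "real (free_rows m L (Suc l)) * (\<Sum>r<m. ?F (pre d m ?W (Suc l) (hidden d m g l x) r)) = real m * (\<Sum>r<free_rows m L (Suc l). ?F (pre d m g (Suc l) (hidden d m g l x) r))"
      using tied_pre_sum[where F="?F"] assms l by simp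
    also have "\<dots> \<le> real m * (3 * \<tau> * real (free_rows m L (Suc l)))"
    proof (intro mult_left_mono)
      show "(\<Sum>r<free_rows m L (Suc l). ?F (pre d m g (Suc l) (hidden d m g l x) r)) \<le> 3 * \<tau> * real (free_rows m L (Suc l))"
        using ct[OF l \<tau>] pos unfolding fail_count_def h card_as_sum by simp
    qed simp
    also have "\<dots> = real (free_rows m L (Suc l)) * (3 * \<tau> * real m)" by simp
    finally have "(\<Sum>r<m. ?F (pre d m ?W (Suc l) (hidden d m g l x) r)) \<le> 3 * \<tau> * real m"
      using fr by (subst (asm) mult_le_cancel_left_pos) auto
    then show ?thesis unfolding h card_as_sum .
  qed
  show ?thesis
    unfolding good_point_def using fwd prp sparse count by blast
qed

lemma good_weightsI:
  assumes "even m" "m \<ge> 1" "L \<ge> 2"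
    and "good_op d m L p (tie_rows d m L g)" "\<And>x. x \<in> point_net d m L \<Longrightarrow> good_point d m L n p (tie_rows d m L g) x"
  shows "good_weights d m L n p (tie_rows d m L g)"
  unfolding good_weights_def
proof (intro conjI assms ballI allI impI)
  fix r j assume r: "r < m div 2" and j: "j < m"
  then have "r + m div 2 < m" "r < m" by linarith+
  then show "tie_rows d m L g (L, r + m div 2, j) = tie_rows d m L g (L, r, j)"
    using r j assms by (simp add: tie_rows_top fan_in_def)
qed

section \<open>Cardinalities of the nets and tails of the failure events\<close>

lemma card_point_net:
  assumes "d \<ge> 1" "d \<le> m" "m \<ge> 21"
  shows "finite (point_net d m L)" "real (card (point_net d m L)) \<le> real (m ^ (d * (L + 3)))"
proof -
  have sub: "point_net d m L \<subseteq> grid (net_scale d m L) {..<d}" by (auto simp: point_net_def)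
  then show "finite (point_net d m L)" using finite_grid finite_subset by blast
  have "card (point_net d m L) \<le> card (grid (net_scale d m L) {..<d})"
    by (intro card_mono finite_grid sub) auto
  also have "\<dots> \<le> (2 * net_scale d m L + 1) ^ d" using card_grid_le[of "{..<d}"] by simp
  also have "\<dots> \<le> (m ^ (L + 3)) ^ d"
  proof (intro power_mono)
    \<comment> \<open>The requirement m >= 21 stems from here: 21 d <= m^2.\<close>
    have "2 * net_scale d m L + 1 \<le> 20 * (d * m ^ (L + 1)) + 1 * (d * m ^ (L + 1))"
      using assms by (simp add: net_scale_def)
    also have "\<dots> = 21 * (d * m ^ (L + 1))" by simp
    also have "\<dots> \<le> m * (m * m ^ (L + 1))" using assms by (intro mult_mono) auto
    also have "\<dots> = m ^ (L + 3)" by (simp add: power_add eval_nat_numeral)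
    finally show "2 * net_scale d m L + 1 \<le> m ^ (L + 3)" .
  qed simp
  also have "\<dots> = m ^ (d * (L + 3))" by (simp add: power_mult[symmetric] mult.commute)
  finally show "real (card (point_net d m L)) \<le> real (m ^ (d * (L + 3)))" by (simp only: of_nat_le_iff)
qed

definition sparse_net :: "nat \<Rightarrow> nat \<Rightarrow> point set" where
  "sparse_net m p = (\<Union>S\<in>small_sets m p. grid (2 * p) S)"

lemma card_small_sets_power:
  assumes "k \<le> m" "m \<ge> 21" shows "real (card (small_sets k p)) \<le> real (m ^ (2 * p))"
proof -
  have "card (small_sets k p) \<le> (k + 1) ^ p" by (rule card_small_sets_le)
  also have "\<dots> \<le> (m ^ 2) ^ p"
  proof (intro power_mono)
    have "k + 1 \<le> m + m" using assms by simp
    also have "\<dots> = 2 * m" by simp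
    also have "\<dots> \<le> m * m" using assms by (intro mult_right_mono) auto
    finally show "k + 1 \<le> m ^ 2" by (simp add: power2_eq_square)
  qed simp
  also have "\<dots> = m ^ (2 * p)" by (simp add: power_mult)
  finally show ?thesis by (simp only: of_nat_le_iff)
qed

text \<open>At most m^(2p) supports of size up to \<open>p\<close>, and at most m^(2p) grid points
  on each.\<close>

lemma card_sparse_net:
  assumes "p \<le> m" "k \<le> m" "m \<ge> 21"
  shows "finite (sparse_net k p)" "real (card (sparse_net k p)) \<le> real (m ^ (4 * p))"
proof -
  have fin: "finite (grid (2 * p) S)" if "S \<in> small_sets k p" for S
    using that by (intro finite_grid) (auto simp: small_sets_def finite_subset)
  show "finite (sparse_net k p)" unfolding sparse_net_def using fin finite_small_sets by blast
  have "card (sparse_net k p) \<le> (\<Sum>S\<in>small_sets k p. card (grid (2 * p) S))"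
    unfolding sparse_net_def by (intro card_UN_le finite_small_sets)
  also have "\<dots> \<le> (\<Sum>S\<in>small_sets k p. m ^ (2 * p))"
  proof (intro sum_mono)
    fix S assume "S \<in> small_sets k p"
    then have S: "finite S" "card S \<le> p" by (auto simp: small_sets_def finite_subset)
    have "card (grid (2 * p) S) \<le> (2 * (2 * p) + 1) ^ card S" using S by (intro card_grid_le)
    also have "\<dots> \<le> (2 * (2 * p) + 1) ^ p" using S by (intro power_increasing) auto
    also have "\<dots> \<le> (m ^ 2) ^ p"
    proof (intro power_mono)
      have "2 * (2 * p) + 1 \<le> 5 * m" using assms by simp
      also have "\<dots> \<le> m * m" using assms by (intro mult_mono) auto
      finally show "2 * (2 * p) + 1 \<le> m ^ 2" by (simp add: power2_eq_square)
    qed simp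
    finally show "card (grid (2 * p) S) \<le> m ^ (2 * p)" by (simp add: power_mult)
  qed
  also have "\<dots> = card (small_sets k p) * m ^ (2 * p)" by simp
  finally have "real (card (sparse_net k p)) \<le> real (card (small_sets k p)) * real (m ^ (2 * p))"
    by (metis of_nat_le_iff of_nat_mult)
  also have "\<dots> \<le> real (m ^ (2 * p)) * real (m ^ (2 * p))"
    using card_small_sets_power[OF assms(2,3)] by (intro mult_right_mono) auto
  also have "\<dots> = real (m ^ (4 * p))" by (simp add: power_add[symmetric])
  finally show "real (card (sparse_net k p)) \<le> real (m ^ (4 * p))" .
qed

lemma fail_forward_tail:
  assumes "L \<ge> 2" "Suc l < L"
  shows "tail_le (gauss_vec (free_idx d m L)) (fail_forward d m L x l) (2 * exp (- (real m / (16 * (real L)\<^sup>2))))"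
proof -
  have s: "0 < 1 / real L" "1 / real L \<le> 1/2" using assms by (auto simp: field_simps)
  have sub: "{Suc l} \<times> {..<m} \<times> {..<fan_in d m (Suc l)} \<subseteq> free_idx d m L" using assms by (intro layer_subset) auto
  have off: "off_layer (free_idx d m L) (Suc l) (fan_in d m (Suc l)) (\<lambda>W. hidden d m W l x)" using assms by (intro off_layer_hidden) auto
  \<comment> \<open>With the same vector as mask and as argument,
    \<open>masked_square_upper_tail\<close> becomes the upper bound for relu.\<close>
  have relu: "(if 0 < y then y else 0) = relu y" for y :: real by (simp add: relu_def max_def)
  have e: "real m * (1 / real L)\<^sup>2 / 16 = real m / (16 * (real L)\<^sup>2)" by (simp add: power_divide)
  show ?thesis
    using tail_le_disj[OF relu_square_lower_tail[OF finite_free_idx sub off s] masked_square_upper_tail[OF finite_free_idx sub off off s]]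
    unfolding relu e fail_forward_def[abs_def] pre_def by simp
qed

lemma fail_prop_tail:
  assumes "L \<ge> 2" "1 \<le> k" "Suc (k + i) < L"
  shows "tail_le (gauss_vec (free_idx d m L)) (fail_prop d m L x z k i) (exp (- (real m / (16 * (real L)\<^sup>2))))"
proof -
  have s: "0 < 1 / real L" "1 / real L \<le> 1/2" using assms by (auto simp: field_simps)
  have f: "fan_in d m (Suc (k + i)) = m" using assms by (simp add: fan_in_def)
  have sub: "{Suc (k + i)} \<times> {..<m} \<times> {..<m} \<subseteq> free_idx d m L" using layer_subset[of "Suc (k + i)" L "{..<m}" m d] assms f by simp
  have off: "off_layer (free_idx d m L) (Suc (k + i)) m (\<lambda>W. hidden d m W (k + i) x)" using off_layer_hidden[of "k + i" L d m x] assms f by simp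
  have off': "off_layer (free_idx d m L) (Suc (k + i)) m (\<lambda>W. lprop d m W x k i z)" using off_layer_lprop[of k i L d m x z] assms f by simp
  have e: "real m * (1 / real L)\<^sup>2 / 16 = real m / (16 * (real L)\<^sup>2)" by (simp add: power_divide)
  show ?thesis
    using masked_square_upper_tail[OF finite_free_idx sub off' off s]
    unfolding e fail_prop_def[abs_def] pre_def f by simp
qed

lemma sqrt2_power_le: "sqrt 2 ^ k \<le> exp (real k)"
proof -
  have "sqrt 2 \<le> 2" by (rule power2_le_imp_le) auto
  also have "2 \<le> exp (1::real)" using exp_ge_add_one_self[of 1] by simp
  finally have "sqrt 2 ^ k \<le> exp 1 ^ k" by (intro power_mono) auto
  then show ?thesis by (simp flip: exp_of_nat_mult)
qed

text \<open>Relative to the squared norm, a sum of at most \<open>p\<close> squares has mean at most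
  \<open>p\<close>. The threshold m / (200 L^2) is much larger for the chosen \<open>p\<close>, so
  the chi-square tail beats the number of choices for \<open>S'\<close>.\<close>

lemma fail_sparse_tail:
  assumes "L \<ge> 2" "1 \<le> k" "Suc (k + i) < L" "S' \<in> small_sets m p"
  shows "tail_le (gauss_vec (free_idx d m L)) (fail_sparse d m L x z k i S') (exp (real p) * exp (- (real m / (800 * (real L)\<^sup>2))))"
proof -
  have f: "fan_in d m (Suc (k + i)) = m" using assms by (simp add: fan_in_def)
  have S: "finite S'" "S' \<subseteq> {..<m}" "card S' \<le> p" using assms by (auto simp: small_sets_def finite_subset)
  have sub: "{Suc (k + i)} \<times> S' \<times> {..<m} \<subseteq> free_idx d m L" using layer_subset[of "Suc (k + i)" L S' m d] assms S f by simp
  have off': "off_layer (free_idx d m L) (Suc (k + i)) m (\<lambda>W. lprop d m W x k i z)" using off_layer_lprop[of k i L d m x z] assms f by simp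
  have "tail_le (gauss_vec (free_idx d m L)) (fail_sparse d m L x z k i S') (sqrt 2 ^ card S' * exp (- (real m / (200 * (real L)\<^sup>2) / 4)))"
    using chi_square_tail[where c="real m / (200 * (real L)\<^sup>2)", OF finite_free_idx sub S(1) off'] unfolding fail_sparse_def[abs_def] pre_def f by simp
  moreover have "sqrt 2 ^ card S' * exp (- (real m / (200 * (real L)\<^sup>2) / 4)) \<le> exp (real p) * exp (- (real m / (800 * (real L)\<^sup>2)))"
  proof (intro mult_mono)
    show "sqrt 2 ^ card S' \<le> exp (real p)" using sqrt2_power_le[of "card S'"] S by (meson exp_le_cancel_iff of_nat_le_iff order_trans)
  qed auto
  ultimately show ?thesis by (elim tail_le_mono) auto
qed

lemma half_le_free_rows: "even m \<Longrightarrow> real m / 2 \<le> real (free_rows m L l)"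
  by (auto simp: free_rows_def elim!: evenE)

lemma fail_count_tail:
  assumes "even m" "l < L" "0 \<le> \<tau>"
  shows "tail_le (gauss_vec (free_idx d m L)) (fail_count d m L \<tau> x l) (exp (- (\<tau> * real m / 2)))"
proof -
  have sub: "{Suc l} \<times> {..<free_rows m L (Suc l)} \<times> {..<fan_in d m (Suc l)} \<subseteq> free_idx d m L" using assms by (intro free_layer_subset) auto
  have off: "off_layer (free_idx d m L) (Suc l) (fan_in d m (Suc l)) (\<lambda>W. hidden d m W l x)" using assms by (intro off_layer_hidden) auto
  have "tail_le (gauss_vec (free_idx d m L)) (fail_count d m L \<tau> x l) (exp (- (\<tau> * real (free_rows m L (Suc l)))))"
    using small_ball_count_tail[OF finite_free_idx sub off assms(3)] unfolding fail_count_def[abs_def] pre_def by simp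
  moreover have "\<tau> * real m / 2 \<le> \<tau> * real (free_rows m L (Suc l))"
    using mult_left_mono[OF half_le_free_rows[OF assms(1)] assms(3)] by simp
  ultimately show ?thesis by (elim tail_le_mono) auto
qed

text \<open>The factor 8 yields an exponent 2 per row, of which sqrt 2 <= e takes one; at least m /
  2 rows are independent.\<close>

lemma fail_op_tail:
  assumes "even m" "l \<in> {1..L}"
  shows "tail_le (gauss_vec (free_idx d m L)) (fail_op d m L l z) (exp (- (real m / 2)))"
proof -
  let ?R = "free_rows m L l"
  have sub: "{l} \<times> {..<?R} \<times> {..<fan_in d m l} \<subseteq> free_idx d m L" using assms by (intro free_layer_subset) auto
  have "tail_le (gauss_vec (free_idx d m L)) (fail_op d m L l z) (sqrt 2 ^ ?R * exp (- (8 * real ?R / 4)))"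
    using chi_square_tail[where c="8 * real ?R" and y="\<lambda>_. z", OF finite_free_idx sub _ off_layer_const] unfolding fail_op_def[abs_def] pre_def by simp
  moreover have "sqrt 2 ^ ?R * exp (- (8 * real ?R / 4)) \<le> exp (- (real m / 2))"
  proof -
    have "sqrt 2 ^ ?R * exp (- (8 * real ?R / 4)) \<le> exp (real ?R) * exp (- (8 * real ?R / 4))"
      by (intro mult_right_mono sqrt2_power_le) auto
    also have "\<dots> = exp (- real ?R)" by (simp flip: exp_add)
    also have "\<dots> \<le> exp (- (real m / 2))" using half_le_free_rows[OF assms(1)] by simp
    finally show ?thesis .
  qed
  ultimately show ?thesis by (elim tail_le_mono) auto
qed

text \<open>Union bound over net points, layers and test vectors. In \<open>H1\<close> the exponent
  7 p collects m^(4p) sparse vectors, m^(2p) row sets and e^p <= m^p from the chi-square bound.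
  There are six families of failure events, and the forward one has two sides and counts twice,
  hence 7 \<beta>.\<close>

theorem good_weights_tail:
  assumes m: "even m" "m \<ge> 21" and L: "L \<ge> 2" and d: "d \<ge> 1" "d \<le> m" and p: "p \<le> m"
    and H1: "real (m ^ (d * (L + 3))) * (real L)\<^sup>2 * real (m ^ (7 * p)) * exp (- (real m / (800 * (real L)\<^sup>2))) \<le> \<beta>"
    and H2: "real (m ^ (d * (L + 3))) * (real L)\<^sup>2 * exp (- (real p / 12)) \<le> \<beta>"
    and H3: "real (m ^ (d * (L + 3))) * (real L)\<^sup>2 * exp (- (real m / (2 * real n))) \<le> \<beta>"
  shows "tail_le (gauss_vec (free_idx d m L)) (\<lambda>g. \<not> good_weights d m L n p (tie_rows d m L g)) (7 * \<beta>)"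
proof -
  let ?G = "gauss_vec (free_idx d m L)"
  let ?X = "point_net d m L" and ?Z = "sparse_net m p"
  define N where "N = real (m ^ (d * (L + 3)))"
  define E where "E = exp (- (real m / (800 * (real L)\<^sup>2)))"
  have L0: "real L \<ge> 1" "real L \<le> (real L)\<^sup>2" using L by (auto simp: power2_eq_square)
  have X: "finite ?X" "real (card ?X) \<le> N" using card_point_net[OF d m(2)] by (auto simp: N_def)
  have Z: "finite ?Z" "real (card ?Z) \<le> real (m ^ (4 * p))" using card_sparse_net[OF p _ m(2)] by auto
  have N0: "N \<ge> 0" by (simp add: N_def)
  have E0: "E > 0" by (simp add: E_def)
  have mp: "real (m ^ a) \<le> real (m ^ b)" if "a \<le> b" for a b
    using that m by (simp add: power_increasing)
  have mp1: "1 \<le> real (m ^ a)" for a using m by (simp add: one_le_power)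
  have \<beta>0: "0 \<le> \<beta>" by (rule order_trans[OF _ H2]) auto
  have E16: "exp (- (real m / (16 * (real L)\<^sup>2))) \<le> E"
    unfolding E_def using L0 by (simp add: divide_left_mono mult_right_mono)
  have Em: "exp (- (real m / 2)) \<le> E"
  proof -
    have "2 \<le> 800 * (real L)\<^sup>2" using L0 by linarith
    then have "real m / (800 * (real L)\<^sup>2) \<le> real m / 2" by (rule divide_left_mono) (use L in auto)
    then show ?thesis by (simp add: E_def)
  qed
  have H1': "N * (real L)\<^sup>2 * real (m ^ (7 * p)) * E \<le> \<beta>" using H1 by (simp add: N_def E_def)
  let ?J = "{1..<L} \<times> {..<L}"
  have J: "real (card ?J) \<le> (real L)\<^sup>2" by (simp add: power2_eq_square mult_right_mono)

  have F1: "tail_le ?G (\<lambda>g. \<exists>x\<in>?X. \<exists>l\<in>{..<L}. Suc l < L \<and> fail_forward d m L x l g) (2 * \<beta>)"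
  proof -
    have "tail_le ?G (\<lambda>g. \<exists>x\<in>?X. \<exists>l\<in>{l. Suc l < L}. fail_forward d m L x l g) (N * (real L * (2 * exp (- (real m / (16 * (real L)\<^sup>2))))))"
      
    proof (intro tail_le_bex X fail_forward_tail L)
      have "card {l. Suc l < L} \<le> card {..<L}" by (intro card_mono) auto
      then show "real (card {l. Suc l < L}) \<le> real L" by simp
      show "finite {l. Suc l < L}" by (rule finite_subset[of _ "{..<L}"]) auto
    qed auto
    moreover have "N * (real L * (2 * exp (- (real m / (16 * (real L)\<^sup>2))))) \<le> 2 * \<beta>"
    proof -
      have "N * (real L * exp (- (real m / (16 * (real L)\<^sup>2)))) \<le> N * ((real L)\<^sup>2 * E)"
        using L0 E16 N0 by (intro mult_left_mono mult_mono) auto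
      also have "\<dots> = N * (real L)\<^sup>2 * 1 * E" by simp
      also have "\<dots> \<le> N * (real L)\<^sup>2 * real (m ^ (7 * p)) * E" using N0 E0 mp1 by (intro mult_right_mono mult_left_mono) auto
      finally show ?thesis using H1' by simp
    qed
    ultimately show ?thesis
      by (elim tail_le_mono) auto
  qed
  have F2: "tail_le ?G (\<lambda>g. \<exists>x\<in>?X. \<exists>z\<in>?Z. \<exists>ki\<in>?J. Suc (fst ki + snd ki) < L \<and> fail_prop d m L x z (fst ki) (snd ki) g) \<beta>"
  proof -
    have t: "tail_le ?G (\<lambda>g. Suc (fst ki + snd ki) < L \<and> fail_prop d m L x z (fst ki) (snd ki) g) E" if "ki \<in> ?J" for x z ki
    proof (cases "Suc (fst ki + snd ki) < L")
      case True
      then show ?thesis using that E16 by (intro tail_le_mono[OF fail_prop_tail[OF L _ True]]) auto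
    next
      case False then show ?thesis using E0 by (auto simp: tail_le_def intro!: bexI[of _ "{}"])
    qed
    have "tail_le ?G (\<lambda>g. \<exists>x\<in>?X. \<exists>z\<in>?Z. \<exists>ki\<in>?J. Suc (fst ki + snd ki) < L \<and> fail_prop d m L x z (fst ki) (snd ki) g) (N * (real (m ^ (4 * p)) * ((real L)\<^sup>2 * E)))"
      using E0 by (intro tail_le_bex X Z J t) auto
    moreover have "N * (real (m ^ (4 * p)) * ((real L)\<^sup>2 * E)) \<le> \<beta>"
    proof -
      have "N * (real (m ^ (4 * p)) * ((real L)\<^sup>2 * E)) \<le> N * (real (m ^ (7 * p)) * ((real L)\<^sup>2 * E))"
        using N0 E0 by (intro mult_left_mono mult_right_mono mp) auto
      then show ?thesis using H1' by (simp add: mult_ac)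
    qed
    ultimately show ?thesis by (elim tail_le_mono) auto
  qed
  have F3: "tail_le ?G (\<lambda>g. \<exists>x\<in>?X. \<exists>z\<in>?Z. \<exists>ki\<in>?J. \<exists>S'\<in>small_sets m p. Suc (fst ki + snd ki) < L \<and> fail_sparse d m L x z (fst ki) (snd ki) S' g) \<beta>"
  proof -
    have t: "tail_le ?G (\<lambda>g. Suc (fst ki + snd ki) < L \<and> fail_sparse d m L x z (fst ki) (snd ki) S' g) (exp (real p) * E)" if "ki \<in> ?J" "S' \<in> small_sets m p" for x z ki S'
    proof (cases "Suc (fst ki + snd ki) < L")
      case True
      show ?thesis using that by (intro tail_le_mono[OF fail_sparse_tail[OF L _ True that(2)]]) (auto simp: E_def)
    next
      case False then show ?thesis using E0 by (auto simp: tail_le_def intro!: bexI[of _ "{}"])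
    qed
    have "tail_le ?G (\<lambda>g. \<exists>x\<in>?X. \<exists>z\<in>?Z. \<exists>ki\<in>?J. \<exists>S'\<in>small_sets m p. Suc (fst ki + snd ki) < L \<and> fail_sparse d m L x z (fst ki) (snd ki) S' g)
       (N * (real (m ^ (4 * p)) * ((real L)\<^sup>2 * (real (m ^ (2 * p)) * (exp (real p) * E)))))"
      using E0 m(2) by (intro tail_le_bex X Z J t card_small_sets_power finite_small_sets) auto
    moreover have "N * (real (m ^ (4 * p)) * ((real L)\<^sup>2 * (real (m ^ (2 * p)) * (exp (real p) * E)))) \<le> \<beta>"
    proof -
      have "exp (real p) \<le> real (m ^ p)"
      proof -
        have "exp (real p) = exp 1 ^ p" by (simp flip: exp_of_nat_mult)
        also have "\<dots> \<le> real m ^ p" using exp_le m by (intro power_mono) auto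
        finally show ?thesis by simp
      qed
      then have "N * (real (m ^ (4 * p)) * ((real L)\<^sup>2 * (real (m ^ (2 * p)) * (exp (real p) * E)))) \<le> N * (real (m ^ (4 * p)) * ((real L)\<^sup>2 * (real (m ^ (2 * p)) * (real (m ^ p) * E))))"
        using N0 E0 by (intro mult_left_mono mult_right_mono) auto
      also have "\<dots> = N * (real L)\<^sup>2 * (real (m ^ (4 * p)) * real (m ^ (2 * p)) * real (m ^ p)) * E" by simp
      also have "real (m ^ (4 * p)) * real (m ^ (2 * p)) * real (m ^ p) = real (m ^ (7 * p))"
        by (simp add: power_add[symmetric])
      finally show ?thesis using H1' by linarith
    qed
    ultimately show ?thesis by (elim tail_le_mono) auto
  qed
  have F4: "tail_le ?G (\<lambda>g. \<exists>x\<in>?X. \<exists>l\<in>{..<L}. fail_count d m L (real p / (6 * real m)) x l g) \<beta>"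
  proof -
    have "tail_le ?G (\<lambda>g. \<exists>x\<in>?X. \<exists>l\<in>{..<L}. fail_count d m L (real p / (6 * real m)) x l g) (N * (real L * exp (- (real p / (6 * real m) * real m / 2))))"
      by (intro tail_le_bex X fail_count_tail m) auto
    moreover have "real p / (6 * real m) * real m / 2 = real p / 12" using m by simp
    moreover have "N * (real L * exp (- (real p / 12))) \<le> N * ((real L)\<^sup>2 * exp (- (real p / 12)))"
      using N0 L0 by (intro mult_left_mono mult_right_mono) auto
    ultimately show ?thesis using H2 by (elim tail_le_mono) (auto simp: N_def)
  qed
  have F5: "tail_le ?G (\<lambda>g. \<exists>x\<in>?X. \<exists>l\<in>{..<L}. fail_count d m L (1 / real n) x l g) \<beta>"
  proof -
    have A: "tail_le ?G (\<lambda>g. \<exists>x\<in>?X. \<exists>l\<in>{..<L}. fail_count d m L (1 / real n) x l g) (N * (real L * exp (- (1 / real n * real m / 2))))"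
      by (intro tail_le_bex X fail_count_tail m) auto
    have t: "1 / real n * real m / 2 = real m / (2 * real n)" by simp
    have B: "N * (real L * exp (- (real m / (2 * real n)))) \<le> N * ((real L)\<^sup>2 * exp (- (real m / (2 * real n))))"
      using N0 L0 by (intro mult_left_mono mult_right_mono) auto
    show ?thesis
    proof (rule tail_le_mono[OF A[unfolded t]])
      show "N * (real L * exp (- (real m / (2 * real n)))) \<le> \<beta>" using B H3 unfolding N_def mult.assoc by linarith
    qed
  qed
  have F6: "tail_le ?G (\<lambda>g. \<exists>l\<in>{1..L}. \<exists>z\<in>sparse_net (fan_in d m l) p. fail_op d m L l z g) \<beta>"
  proof -
    have k: "fan_in d m l \<le> m" for l using d by (simp add: fan_in_def)
    have "tail_le ?G (\<lambda>g. \<exists>l\<in>{1..L}. \<exists>z\<in>sparse_net (fan_in d m l) p. fail_op d m L l z g) (real L * (real (m ^ (4 * p)) * E))"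
      using E0 m by (intro tail_le_bex card_sparse_net[OF p k m(2)] tail_le_mono[OF fail_op_tail _ Em]) auto
    moreover have "real L * (real (m ^ (4 * p)) * E) \<le> \<beta>"
    proof -
      have "1 * (real L * real (m ^ (4 * p)) * E) \<le> N * ((real L)\<^sup>2 * real (m ^ (7 * p)) * E)"
        using N0 E0 L0 mp1 by (intro mult_mono mult_right_mono mp) (auto simp: N_def)
      then show ?thesis using H1' by (simp add: mult_ac)
    qed
    ultimately show ?thesis by (elim tail_le_mono) auto
  qed
  have "tail_le ?G (\<lambda>g. (\<exists>x\<in>?X. \<exists>l\<in>{..<L}. Suc l < L \<and> fail_forward d m L x l g) \<or>
     (\<exists>x\<in>?X. \<exists>z\<in>?Z. \<exists>ki\<in>?J. Suc (fst ki + snd ki) < L \<and> fail_prop d m L x z (fst ki) (snd ki) g) \<or>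
     (\<exists>x\<in>?X. \<exists>z\<in>?Z. \<exists>ki\<in>?J. \<exists>S'\<in>small_sets m p. Suc (fst ki + snd ki) < L \<and> fail_sparse d m L x z (fst ki) (snd ki) S' g) \<or>
     (\<exists>x\<in>?X. \<exists>l\<in>{..<L}. fail_count d m L (real p / (6 * real m)) x l g) \<or>
     (\<exists>x\<in>?X. \<exists>l\<in>{..<L}. fail_count d m L (1 / real n) x l g) \<or>
     (\<exists>l\<in>{1..L}. \<exists>z\<in>sparse_net (fan_in d m l) p. fail_op d m L l z g)) (2 * \<beta> + (\<beta> + (\<beta> + (\<beta> + (\<beta> + \<beta>)))))"
    using \<beta>0 by (intro tail_le_disj F1 F2 F3 F4 F5 F6) auto
  then show ?thesis
  proof (rule tail_le_mono)
    fix g assume bad: "\<not> good_weights d m L n p (tie_rows d m L g)"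
    show "(\<exists>x\<in>?X. \<exists>l\<in>{..<L}. Suc l < L \<and> fail_forward d m L x l g) \<or>
     (\<exists>x\<in>?X. \<exists>z\<in>?Z. \<exists>ki\<in>?J. Suc (fst ki + snd ki) < L \<and> fail_prop d m L x z (fst ki) (snd ki) g) \<or>
     (\<exists>x\<in>?X. \<exists>z\<in>?Z. \<exists>ki\<in>?J. \<exists>S'\<in>small_sets m p. Suc (fst ki + snd ki) < L \<and> fail_sparse d m L x z (fst ki) (snd ki) S' g) \<or>
     (\<exists>x\<in>?X. \<exists>l\<in>{..<L}. fail_count d m L (real p / (6 * real m)) x l g) \<or>
     (\<exists>x\<in>?X. \<exists>l\<in>{..<L}. fail_count d m L (1 / real n) x l g) \<or>
     (\<exists>l\<in>{1..L}. \<exists>z\<in>sparse_net (fan_in d m l) p. fail_op d m L l z g)" (is "?A \<or> ?B \<or> ?C \<or> ?D \<or> ?E \<or> ?F")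
    proof (rule ccontr)
      assume "\<not> ?thesis"
      then have A: "\<not> ?A" and B: "\<not> ?B" and C: "\<not> ?C" and D: "\<not> ?D" and E: "\<not> ?E" and F: "\<not> ?F" by blast+
      have m1: "m \<ge> 1" using m by simp
      have op: "good_op d m L p (tie_rows d m L g)"
        using F by (intro good_opI m(1) m1) (auto simp: sparse_net_def)
      have pt: "good_point d m L n p (tie_rows d m L g) x" if x: "x \<in> ?X" for x
      proof (rule good_pointI[OF m(1) m1 L])
        show "\<not> fail_forward d m L x l g" if "Suc l < L" for l using A x that by auto
        show "\<not> fail_prop d m L x z k i g" if "S \<in> small_sets m p" "z \<in> grid (2 * p) S" "1 \<le> k" "Suc (k + i) < L" for S z k i
        proof -
          have "z \<in> ?Z" "(k, i) \<in> ?J" using that by (auto simp: sparse_net_def)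
          then show ?thesis using B x that by force
        qed
        show "\<not> fail_sparse d m L x z k i S' g" if "S \<in> small_sets m p" "z \<in> grid (2 * p) S" "1 \<le> k" "Suc (k + i) < L" "S' \<in> small_sets m p" for S z k i S'
        proof -
          have "z \<in> ?Z" "(k, i) \<in> ?J" using that by (auto simp: sparse_net_def)
          then show ?thesis using C x that by force
        qed
        show "\<not> fail_count d m L \<tau> x l g" if "l < L" "\<tau> \<in> {real p / (6 * real m), 1 / real n}" for l \<tau>
          using D E x that by auto
      qed
      show False using bad good_weightsI[OF m(1) m1 L op pt] by blast
    qed
  qed auto
qed


section \<open>Rademacher complexity and concentration of the risk\<close>

abbreviation signs_pmf :: "nat \<Rightarrow> (nat \<Rightarrow> real) pmf" where
  "signs_pmf n \<equiv> Pi_pmf {..<n} 0 (\<lambda>_. pmf_of_set {-1, 1})"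

text \<open>Finite support turns every expectation over the signs into a finite sum, so
  integrability is automatic.\<close>

lemma finite_set_signs_pmf: "finite (set_pmf (signs_pmf n))"
  by (rule finite_subset[OF set_Pi_pmf_subset']) (auto intro!: finite_PiE_dflt)

lemma signs_pmf_abs: "\<epsilon> \<in> set_pmf (signs_pmf n) \<Longrightarrow> i < n \<Longrightarrow> \<bar>\<epsilon> i\<bar> = 1"
  by (auto simp: set_Pi_pmf PiE_dflt_def)

lemma signs_pmf_uncorrelated:
  assumes "i < n" "j < n"
  shows "measure_pmf.expectation (signs_pmf n) (\<lambda>\<epsilon>. \<epsilon> i * \<epsilon> j) = (if i = j then 1 else 0)"
proof (cases "i = j")
  case True
  have "measure_pmf.expectation (signs_pmf n) (\<lambda>\<epsilon>. \<epsilon> i * \<epsilon> j) = measure_pmf.expectation (signs_pmf n) (\<lambda>\<epsilon>. 1)"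
  proof (rule integral_cong_AE)
    show "AE \<epsilon> in measure_pmf (signs_pmf n). \<epsilon> i * \<epsilon> j = 1"
      using assms True by (auto simp: AE_measure_pmf_iff set_Pi_pmf PiE_dflt_def)
  qed auto
  then show ?thesis using True by simp
next
  case False
  let ?M = "measure_pmf (signs_pmf n)"
  have one: "measure_pmf.expectation (signs_pmf n) (\<lambda>\<epsilon>. \<epsilon> k) = 0" if "k < n" for k
  proof -
    have "measure_pmf.expectation (signs_pmf n) (\<lambda>\<epsilon>. \<epsilon> k) = measure_pmf.expectation (map_pmf (\<lambda>f. f k) (signs_pmf n)) (\<lambda>x. x)"
      by simp
    also have "map_pmf (\<lambda>f. f k) (signs_pmf n) = pmf_of_set {-1, 1}"
      using that by (simp add: Pi_pmf_component)
    also have "measure_pmf.expectation \<dots> (\<lambda>x. x) = 0"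
      by (subst integral_pmf_of_set) auto
    finally show ?thesis .
  qed
  have "prob_space.indep_vars (measure_pmf (signs_pmf n)) (\<lambda>_. borel) (\<lambda>k \<epsilon>. \<epsilon> k) {..<n}"
    using prob_space.indep_vars_compose2[OF prob_space_measure_pmf indep_vars_Pi_pmf[of "{..<n}" 0 "\<lambda>_. pmf_of_set {-1, 1::real}"], of "\<lambda>_ x. x" "\<lambda>_. borel"]
    by simp
  then have ind: "prob_space.indep_vars (measure_pmf (signs_pmf n)) (\<lambda>_. borel) (\<lambda>k \<epsilon>. \<epsilon> k) {i, j}"
    by (rule prob_space.indep_vars_subset[OF prob_space_measure_pmf]) (use assms in auto)
  have "measure_pmf.expectation (signs_pmf n) (\<lambda>\<epsilon>. \<Prod>k\<in>{i, j}. \<epsilon> k) = (\<Prod>k\<in>{i, j}. measure_pmf.expectation (signs_pmf n) (\<lambda>\<epsilon>. \<epsilon> k))"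
    using ind by (intro prob_space.indep_vars_lebesgue_integral[OF prob_space_measure_pmf]) (auto intro!: integrable_measure_pmf_finite finite_set_signs_pmf)
  then show ?thesis using False one assms by simp
qed

lemma signs_pmf_second_moment:
  "measure_pmf.expectation (signs_pmf n) (\<lambda>\<epsilon>. (\<Sum>i<n. \<epsilon> i * c i)\<^sup>2) = (\<Sum>i<n. (c i)\<^sup>2)"
proof -
  have int: "integrable (measure_pmf (signs_pmf n)) f" for f :: "_ \<Rightarrow> real"
    by (intro integrable_measure_pmf_finite finite_set_signs_pmf)
  have "(\<Sum>i<n. \<epsilon> i * c i)\<^sup>2 = (\<Sum>i<n. \<Sum>j<n. c i * c j * (\<epsilon> i * \<epsilon> j))" for \<epsilon> :: "nat \<Rightarrow> real"
    by (simp add: power2_eq_square sum_product mult_ac)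
  then have "measure_pmf.expectation (signs_pmf n) (\<lambda>\<epsilon>. (\<Sum>i<n. \<epsilon> i * c i)\<^sup>2)
    = (\<Sum>i<n. \<Sum>j<n. c i * c j * measure_pmf.expectation (signs_pmf n) (\<lambda>\<epsilon>. \<epsilon> i * \<epsilon> j))"
    by (simp add: int Bochner_Integration.integral_sum)
  also have "\<dots> = (\<Sum>i<n. \<Sum>j<n. if i = j then c i * c j else 0)"
    by (intro sum.cong refl) (simp add: signs_pmf_uncorrelated)
  finally show ?thesis by (simp add: power2_eq_square)
qed

text \<open>The supremum is at most \<rho> / n times the norm of the random vector \<open>V\<close>,
  plus the error \<eta>. The mean of that norm is estimated through x <= x^2 / (2 a) + a / 2, where
  a = s sqrt n is optimal for the second moment n s^2.\<close>

lemma rademacher_le_linear: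
  fixes \<phi> :: "nat \<Rightarrow> 'k \<Rightarrow> real"
  assumes n: "n \<ge> 1" and K: "finite K" and ne: "\<F> \<noteq> {}" and s: "s > 0" and \<rho>: "\<rho> \<ge> 0"
    and \<phi>: "\<And>i. i < n \<Longrightarrow> (\<Sum>k\<in>K. (\<phi> i k)\<^sup>2) \<le> s\<^sup>2"
    and lin: "\<And>f. f \<in> \<F> \<Longrightarrow> \<exists>\<Delta>. (\<Sum>k\<in>K. (\<Delta> k)\<^sup>2) \<le> \<rho>\<^sup>2 \<and> (\<forall>i<n. \<bar>f (x i) - (\<Sum>k\<in>K. \<phi> i k * \<Delta> k)\<bar> \<le> \<eta>)"
  shows "rademacher n x \<F> \<le> \<rho> * s / sqrt (real n) + \<eta>"
proof -
  let ?P = "signs_pmf n"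
  have int: "integrable (measure_pmf ?P) f" for f :: "_ \<Rightarrow> real"
    by (intro integrable_measure_pmf_finite finite_set_signs_pmf)
  have n0: "real n > 0" using n by simp
  define V where "V \<epsilon> k = (\<Sum>i<n. \<epsilon> i * \<phi> i k)" for \<epsilon> k
  define a where "a = s * sqrt (real n)"
  have a: "a > 0" using s n0 by (simp add: a_def)
  define h where "h \<epsilon> = \<rho> / real n * ((\<Sum>k\<in>K. (V \<epsilon> k)\<^sup>2) / (2 * a) + a / 2) + \<eta>" for \<epsilon>
  have le: "(SUP f\<in>\<F>. (\<Sum>i<n. \<epsilon> i * f (x i)) / real n) \<le> h \<epsilon>" if \<epsilon>: "\<epsilon> \<in> set_pmf ?P" for \<epsilon>
  proof (intro cSUP_least ne)
    fix f assume "f \<in> \<F>"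
    then obtain \<Delta> where \<Delta>: "(\<Sum>k\<in>K. (\<Delta> k)\<^sup>2) \<le> \<rho>\<^sup>2" "\<And>i. i < n \<Longrightarrow> \<bar>f (x i) - (\<Sum>k\<in>K. \<phi> i k * \<Delta> k)\<bar> \<le> \<eta>"
      using lin by blast
    have "(\<Sum>i<n. \<epsilon> i * f (x i)) \<le> (\<Sum>i<n. \<epsilon> i * (\<Sum>k\<in>K. \<phi> i k * \<Delta> k) + \<eta>)"
    proof (intro sum_mono)
      fix i assume i: "i \<in> {..<n}"
      have "\<epsilon> i * (f (x i) - (\<Sum>k\<in>K. \<phi> i k * \<Delta> k)) \<le> \<bar>\<epsilon> i * (f (x i) - (\<Sum>k\<in>K. \<phi> i k * \<Delta> k))\<bar>" by simp
      also have "\<dots> = \<bar>f (x i) - (\<Sum>k\<in>K. \<phi> i k * \<Delta> k)\<bar>" using signs_pmf_abs[OF \<epsilon>, of i] i by (simp add: abs_mult)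
      also have "\<dots> \<le> \<eta>" using \<Delta>(2) i by simp
      finally show "\<epsilon> i * f (x i) \<le> \<epsilon> i * (\<Sum>k\<in>K. \<phi> i k * \<Delta> k) + \<eta>" by (simp add: right_diff_distrib)
    qed
    also have "\<dots> = (\<Sum>k\<in>K. V \<epsilon> k * \<Delta> k) + real n * \<eta>"
    proof -
      have "(\<Sum>i<n. \<epsilon> i * (\<Sum>k\<in>K. \<phi> i k * \<Delta> k)) = (\<Sum>i<n. \<Sum>k\<in>K. \<epsilon> i * \<phi> i k * \<Delta> k)"
        by (simp add: sum_distrib_left mult.assoc)
      also have "\<dots> = (\<Sum>k\<in>K. \<Sum>i<n. \<epsilon> i * \<phi> i k * \<Delta> k)" by (rule sum.swap)
      finally show ?thesis by (simp add: sum.distrib V_def sum_distrib_right)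
    qed
    also have "(\<Sum>k\<in>K. V \<epsilon> k * \<Delta> k) \<le> L2_set (V \<epsilon>) K * L2_set \<Delta> K"
    proof -
      have "(\<Sum>k\<in>K. V \<epsilon> k * \<Delta> k) \<le> (\<Sum>k\<in>K. \<bar>V \<epsilon> k\<bar> * \<bar>\<Delta> k\<bar>)" by (intro sum_mono) (simp add: abs_mult[symmetric])
      also have "\<dots> \<le> L2_set (V \<epsilon>) K * L2_set \<Delta> K" by (rule L2_set_mult_ineq)
      finally show ?thesis .
    qed
    also have "\<dots> \<le> L2_set (V \<epsilon>) K * \<rho>"
      using \<Delta>(1) \<rho> by (intro mult_left_mono L2_set_nonneg) (auto simp: L2_set_def intro!: real_le_lsqrt sum_nonneg)
    also have "\<dots> \<le> ((\<Sum>k\<in>K. (V \<epsilon> k)\<^sup>2) / (2 * a) + a / 2) * \<rho>"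
    proof (intro mult_right_mono \<rho>)
      have "0 \<le> (L2_set (V \<epsilon>) K - a)\<^sup>2" by simp
      then have "2 * a * L2_set (V \<epsilon>) K \<le> (L2_set (V \<epsilon>) K)\<^sup>2 + a\<^sup>2" by (simp add: power2_eq_square algebra_simps)
      also have "(L2_set (V \<epsilon>) K)\<^sup>2 = (\<Sum>k\<in>K. (V \<epsilon> k)\<^sup>2)" by (simp add: L2_set_def sum_nonneg)
      finally show "L2_set (V \<epsilon>) K \<le> (\<Sum>k\<in>K. (V \<epsilon> k)\<^sup>2) / (2 * a) + a / 2"
        using a by (simp add: field_simps power2_eq_square)
    qed
    finally have "(\<Sum>i<n. \<epsilon> i * f (x i)) \<le> ((\<Sum>k\<in>K. (V \<epsilon> k)\<^sup>2) / (2 * a) + a / 2) * \<rho> + real n * \<eta>" by simp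
    then have "(\<Sum>i<n. \<epsilon> i * f (x i)) / real n \<le> (((\<Sum>k\<in>K. (V \<epsilon> k)\<^sup>2) / (2 * a) + a / 2) * \<rho> + real n * \<eta>) / real n"
      by (intro divide_right_mono) auto
    also have "\<dots> = h \<epsilon>" using n0 by (simp add: h_def add_divide_distrib mult.commute)
    finally show "(\<Sum>i<n. \<epsilon> i * f (x i)) / real n \<le> h \<epsilon>" .
  qed
  have "rademacher n x \<F> \<le> measure_pmf.expectation ?P h"
    unfolding rademacher_def by (intro integral_mono_AE int) (auto simp: AE_measure_pmf_iff le)
  also have "\<dots> = \<rho> / real n * (measure_pmf.expectation ?P (\<lambda>\<epsilon>. \<Sum>k\<in>K. (V \<epsilon> k)\<^sup>2) / (2 * a) + a / 2) + \<eta>"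
    unfolding h_def by (simp add: int)
  also have "measure_pmf.expectation ?P (\<lambda>\<epsilon>. \<Sum>k\<in>K. (V \<epsilon> k)\<^sup>2) = (\<Sum>k\<in>K. \<Sum>i<n. (\<phi> i k)\<^sup>2)"
    by (subst Bochner_Integration.integral_sum) (auto simp: int V_def signs_pmf_second_moment)
  also have "\<dots> = (\<Sum>i<n. \<Sum>k\<in>K. (\<phi> i k)\<^sup>2)" by (rule sum.swap)
  also have "\<rho> / real n * ((\<Sum>i<n. \<Sum>k\<in>K. (\<phi> i k)\<^sup>2) / (2 * a) + a / 2) + \<eta> \<le> \<rho> / real n * (a\<^sup>2 / (2 * a) + a / 2) + \<eta>"
  proof (intro add_right_mono mult_left_mono divide_right_mono)
    have "(\<Sum>i<n. \<Sum>k\<in>K. (\<phi> i k)\<^sup>2) \<le> (\<Sum>i<n. s\<^sup>2)" by (intro sum_mono \<phi>) auto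
    then show "(\<Sum>i<n. \<Sum>k\<in>K. (\<phi> i k)\<^sup>2) \<le> a\<^sup>2" by (simp add: a_def power_mult_distrib mult.commute)
  qed (use a \<rho> n0 in auto)
  also have "\<rho> / real n * (a\<^sup>2 / (2 * a) + a / 2) = \<rho> * s / sqrt (real n)"
    using a n0 unfolding a_def by (simp add: power2_eq_square field_simps)
  finally show ?thesis .
qed

section \<open>Concentration of the empirical risk\<close>

lemma exp_neg_le_chord: fixes u :: real assumes "0 \<le> u" "u \<le> 1" shows "exp (- u) \<le> 1 - u / 2"
proof -
  have "exp (- u) = 1 / exp u" by (simp add: exp_minus inverse_eq_divide)
  also have "\<dots> \<le> 1 / (1 + u)" using assms by (intro divide_left_mono exp_ge_add_one_self) auto
  also have "\<dots> \<le> 1 - u / 2"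
  proof -
    have "u * u \<le> 1 * u" using assms by (intro mult_right_mono) auto
    then have "1 \<le> (1 - u / 2) * (1 + u)" by (simp add: algebra_simps)
    then show ?thesis using assms by (simp add: divide_le_eq)
  qed
  finally show ?thesis .
qed

text \<open>
  The slack factor 2 in front of the empirical mean makes the deviation term linear in \<open>1 / n\<close>.
\<close>

lemma empirical_mean_lower_tail:
  fixes Z :: "'a \<Rightarrow> real"
  assumes "prob_space \<rho>" and Zm: "Z \<in> borel_measurable \<rho>"
    and Z: "\<And>z. z \<in> space \<rho> \<Longrightarrow> 0 \<le> Z z" "\<And>z. z \<in> space \<rho> \<Longrightarrow> Z z \<le> G" and G: "G > 0" and n: "n \<ge> 1" and \<delta>: "\<delta> > 0"
  shows "tail_le (PiM {..<n} (\<lambda>_. \<rho>)) (\<lambda>S. 2 * ((\<Sum>i<n. Z (S i)) / real n) + 2 * G * ln (1 / \<delta>) / real n < (\<integral>z. Z z \<partial>\<rho>)) \<delta>"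
proof -
  interpret prob_space \<rho> by fact
  interpret P: product_sigma_finite "\<lambda>_. \<rho>"
    by (intro product_sigma_finite.intro sigma_finite_measure_axioms)
  let ?M = "PiM {..<n} (\<lambda>_. \<rho>)"
  define \<mu> where "\<mu> = (\<integral>z. Z z \<partial>\<rho>)"
  note [measurable] = Zm
  have intZ: "integrable \<rho> Z"
    using Z G by (intro integrable_const_bound[of _ G]) auto
  have intE: "integrable \<rho> (\<lambda>z. exp (- (Z z / G)))"
    using Z G by (intro integrable_const_bound[of _ 1]) auto
  \<comment> \<open>The slope 1/2 of the chord is what produces the slack factor 2.\<close>
  have Ele: "(\<integral>z. exp (- (Z z / G)) \<partial>\<rho>) \<le> exp (- (\<mu> / (2 * G)))"
  proof -
    have "(\<integral>z. exp (- (Z z / G)) \<partial>\<rho>) \<le> (\<integral>z. 1 - Z z / (2 * G) \<partial>\<rho>)"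
    proof (intro integral_mono intE)
      show "integrable \<rho> (\<lambda>z. 1 - Z z / (2 * G))" using intZ by simp
      fix z assume "z \<in> space \<rho>"
      then have "0 \<le> Z z / G" "Z z / G \<le> 1" using Z G by (auto simp: divide_le_eq)
      from exp_neg_le_chord[OF this] show "exp (- (Z z / G)) \<le> 1 - Z z / (2 * G)" by simp
    qed
    also have "\<dots> = 1 + (- (\<mu> / (2 * G)))" using intZ by (simp add: \<mu>_def prob_space)
    also have "\<dots> \<le> exp (- (\<mu> / (2 * G)))" by (rule exp_ge_add_one_self)
    finally show ?thesis .
  qed
  define g where "g S = ennreal (exp (- ((\<Sum>i<n. Z (S i)) / G)))" for S
  have Zi: "(\<lambda>S. Z (S i)) \<in> borel_measurable ?M" if "i < n" for i
    using that by (intro measurable_compose[OF _ Zm] measurable_component_singleton) auto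
  then have gs: "(\<lambda>S. \<Sum>i<n. Z (S i)) \<in> borel_measurable ?M"
    by (intro borel_measurable_sum) auto
  then have gm: "g \<in> borel_measurable ?M" unfolding g_def by measurable
  have "(\<integral>\<^sup>+ S. g S \<partial>?M) = (\<integral>\<^sup>+ S. (\<Prod>i<n. ennreal (exp (- (Z (S i) / G)))) \<partial>?M)"
    by (intro nn_integral_cong) (simp add: g_def prod_ennreal exp_sum[symmetric] sum_negf sum_divide_distrib)
  also have "\<dots> = (\<Prod>i<n. \<integral>\<^sup>+ z. ennreal (exp (- (Z z / G))) \<partial>\<rho>)"
    by (intro P.product_nn_integral_prod) auto
  also have "\<dots> = ennreal (\<integral>z. exp (- (Z z / G)) \<partial>\<rho>) ^ n"
    using intE by (simp add: nn_integral_eq_integral)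
  also have "\<dots> \<le> ennreal (exp (- (\<mu> / (2 * G)))) ^ n"
    by (intro power_mono ennreal_leI Ele) auto
  also have "\<dots> = ennreal (exp (- (real n * \<mu> / (2 * G))))"
    by (simp add: ennreal_power exp_of_nat_mult[symmetric])
  finally have int: "(\<integral>\<^sup>+ S. g S \<partial>?M) \<le> ennreal (exp (- (real n * \<mu> / (2 * G))))" .
  \<comment> \<open>Scaling for Markov's inequality: \<open>c\<close> times the expectation of
    \<open>g\<close> is at most \<delta>.\<close>
  define c where "c = \<delta> * exp (real n * \<mu> / (2 * G))"
  have c: "c > 0" using \<delta> by (simp add: c_def)
  let ?A = "{S \<in> space ?M. 1 \<le> ennreal c * g S}"
  have A: "?A \<in> sets ?M" using gm by measurable
  have "emeasure ?M ?A \<le> ennreal c * (\<integral>\<^sup>+ S. g S * indicator (space ?M) S \<partial>?M)"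
    using nn_integral_Markov_inequality[of g "space ?M" ?M "ennreal c"] gm by simp
  also have "(\<integral>\<^sup>+ S. g S * indicator (space ?M) S \<partial>?M) = (\<integral>\<^sup>+ S. g S \<partial>?M)"
    by (intro nn_integral_cong) auto
  also have "ennreal c * (\<integral>\<^sup>+ S. g S \<partial>?M) \<le> ennreal c * ennreal (exp (- (real n * \<mu> / (2 * G))))"
    by (intro mult_left_mono int) auto
  also have "\<dots> = ennreal \<delta>"
    using \<delta> by (simp add: c_def ennreal_mult'[symmetric] mult.assoc exp_add[symmetric])
  finally have E: "emeasure ?M ?A \<le> ennreal \<delta>" .
  have "{S \<in> space ?M. 2 * ((\<Sum>i<n. Z (S i)) / real n) + 2 * G * ln (1 / \<delta>) / real n < \<mu>} \<subseteq> ?A"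
  proof safe
    fix S assume *: "2 * ((\<Sum>i<n. Z (S i)) / real n) + 2 * G * ln (1 / \<delta>) / real n < \<mu>"
    let ?s = "\<Sum>i<n. Z (S i)"
    have "real n * (2 * (?s / real n) + 2 * G * ln (1 / \<delta>) / real n) \<le> real n * \<mu>"
      using * by (intro mult_left_mono) auto
    then have "2 * ?s + 2 * G * ln (1 / \<delta>) \<le> real n * \<mu>" using n by (simp add: distrib_left)
    then have "(2 * ?s + 2 * G * ln (1 / \<delta>)) / (2 * G) \<le> real n * \<mu> / (2 * G)"
      using G by (intro divide_right_mono) auto
    then have "ln (1 / \<delta>) \<le> real n * \<mu> / (2 * G) - ?s / G" using G by (simp add: add_divide_distrib)
    then have "exp (ln (1 / \<delta>)) \<le> exp (real n * \<mu> / (2 * G) - ?s / G)" by (subst exp_le_cancel_iff)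
    then have "1 \<le> \<delta> * exp (real n * \<mu> / (2 * G) - ?s / G)" using \<delta> by (simp add: field_simps)
    also have "\<dots> = c * exp (- (?s / G))" by (simp add: c_def exp_diff exp_minus field_simps)
    finally have "ennreal 1 \<le> ennreal (c * exp (- (?s / G)))" by (rule ennreal_leI)
    then show "1 \<le> ennreal c * g S" using c by (simp add: g_def ennreal_mult)
  qed
  with A E show ?thesis unfolding tail_le_def \<mu>_def by blast
qed


section \<open>Measurability of the event\<close>

text \<open>Density is needed inside sets with empty interior, such as the labelled sphere; one
  point is picked from each basic open set that meets the given set.\<close>

lemma countable_dense_subset:
  fixes A :: "'a::second_countable_topology set"
  obtains D where "countable D" "D \<subseteq> A" "A \<subseteq> closure D"
proof -
  obtain \<B> :: "'a set set" where \<B>: "countable \<B>" "topological_basis \<B>"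
    using ex_countable_basis by blast
  define f where "f C = (SOME x. x \<in> C \<inter> A)" for C
  define D where "D = f ` {C \<in> \<B>. C \<inter> A \<noteq> {}}"
  have f: "f C \<in> C \<inter> A" if "C \<inter> A \<noteq> {}" for C
    unfolding f_def by (rule someI_ex) (use that in blast)
  show ?thesis
  proof (rule that)
    show "countable D" using \<B>(1) by (auto simp: D_def)
    show "D \<subseteq> A" using f by (auto simp: D_def)
    show "A \<subseteq> closure D"
    proof
      fix x assume x: "x \<in> A"
      show "x \<in> closure D"
        unfolding closure_iff_nhds_not_empty
      proof (intro allI impI)
        fix S V assume V: "V \<subseteq> S" "open V" "x \<in> V"
        obtain C where C: "C \<in> \<B>" "x \<in> C" "C \<subseteq> V"
          by (rule topological_basisE[OF \<B>(2) V(2,3)])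
        then have "f C \<in> C \<inter> A" "f C \<in> D" using f[of C] x by (auto simp: D_def)
        then show "D \<inter> S \<noteq> {}" using C V by blast
      qed
    qed
  qed
qed

text \<open>A continuous function bounded by a constant on \<open>D\<close> is bounded by it on the
  closure. Uncountable suprema thereby become countable ones, for which measurability can be
  shown.\<close>

lemma SUP_dense:
  fixes g :: "'a::metric_space \<Rightarrow> real"
  assumes "continuous_on UNIV g" "D \<subseteq> A" "A \<subseteq> closure D" "bdd_above (g ` A)" "A \<noteq> {}"
  shows "(SUP x\<in>A. g x) = (SUP x\<in>D. g x)"
proof (rule antisym)
  have D: "D \<noteq> {}" using assms by auto
  have bD: "bdd_above (g ` D)" using assms(4) by (rule bdd_above_mono) (use assms in auto)
  show "(SUP x\<in>A. g x) \<le> (SUP x\<in>D. g x)"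
  proof (rule cSUP_least[OF assms(5)])
    fix x assume "x \<in> A"
    then have "x \<in> closure D" using assms by blast
    then show "g x \<le> (SUP x\<in>D. g x)"
      by (rule continuous_le_on_closure[rotated]) (auto intro: cSUP_upper bD continuous_on_subset[OF assms(1)])
  qed
  show "(SUP x\<in>D. g x) \<le> (SUP x\<in>A. g x)"
    using assms D by (intro cSUP_subset_mono) auto
qed

lemma continuous_on_hidden:
  assumes W: "\<And>i. continuous_on UNIV (\<lambda>p. W p i)" and x: "\<And>j. continuous_on UNIV (\<lambda>p. x p j)"
  shows "continuous_on UNIV (\<lambda>p. hidden d m (W p) l (x p) r)"
proof (induction l arbitrary: r)
  case (Suc l)
  show ?case
  proof (cases "r < m")
    case True
    have "continuous_on UNIV (\<lambda>p. max (\<Sum>j<fan_in d m (Suc l). W p (Suc l, r, j) * hidden d m (W p) l (x p) j) 0)"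
      by (intro continuous_intros Suc W)
    then show ?thesis using True by (auto simp: relu_def intro!: continuous_intros)
  next
    case False then show ?thesis by simp
  qed
qed (simp add: x)

lemma continuous_on_network:
  assumes "\<And>i. continuous_on UNIV (\<lambda>p. W p i)" "\<And>j. continuous_on UNIV (\<lambda>p. x p j)"
  shows "continuous_on UNIV (\<lambda>p. network d m L a (W p) (x p))"
  unfolding network_def by (intro continuous_intros continuous_on_hidden assms)

text \<open>The bound is uniform over all weights with prescribed entrywise bounds. It is used to
  see that the suprema over inputs and over balls of weights are suprema of bounded sets, as a
  meaningful real supremum requires.\<close>

lemma hidden_bounded:
  "\<exists>C\<ge>0. \<forall>W x. (\<forall>l' r j. \<bar>W (l', r, j)\<bar> \<le> c l' r j) \<longrightarrow> (\<forall>j<d. \<bar>x j\<bar> \<le> 1) \<longrightarrow> (\<forall>r<fan_in d m (Suc l). \<bar>hidden d m W l x r\<bar> \<le> C)"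
  for c :: "nat \<Rightarrow> nat \<Rightarrow> nat \<Rightarrow> real"
proof (induction l)
  case 0 then show ?case by (intro exI[of _ 1]) (auto simp: fan_in_def)
next
  case (Suc l)
  then obtain C where C: "C \<ge> 0" "\<And>W x r. \<lbrakk>\<And>l' r j. \<bar>W (l', r, j)\<bar> \<le> c l' r j; \<And>j. j < d \<Longrightarrow> \<bar>x j\<bar> \<le> 1; r < fan_in d m (Suc l)\<rbrakk> \<Longrightarrow> \<bar>hidden d m W l x r\<bar> \<le> C"
    by blast
  define C' where "C' = (\<Sum>r<m. sqrt (2 / real m) * (\<Sum>j<fan_in d m (Suc l). \<bar>c (Suc l) r j\<bar> * C))"
  show ?case
  proof (intro exI[of _ C'] conjI allI impI)
    show "C' \<ge> 0" unfolding C'_def using C(1) by (intro sum_nonneg mult_nonneg_nonneg) auto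
    fix W :: weights and x :: point and r assume W: "\<forall>l' r j. \<bar>W (l', r, j)\<bar> \<le> c l' r j" and x: "\<forall>j<d. \<bar>x j\<bar> \<le> 1" and "r < fan_in d m (Suc (Suc l))"
    then have r: "r < m" by (simp add: fan_in_def)
    have "\<bar>hidden d m W (Suc l) x r\<bar> = sqrt (2 / real m) * \<bar>relu (pre d m W (Suc l) (hidden d m W l x) r)\<bar>"
      using r by (simp add: hidden_Suc abs_mult del: hidden.simps)
    also have "\<dots> \<le> sqrt (2 / real m) * (\<Sum>j<fan_in d m (Suc l). \<bar>c (Suc l) r j\<bar> * C)"
    proof (intro mult_left_mono)
      have "\<bar>relu (pre d m W (Suc l) (hidden d m W l x) r)\<bar> \<le> \<bar>pre d m W (Suc l) (hidden d m W l x) r\<bar>"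
        by (simp add: relu_def)
      also have "\<dots> \<le> (\<Sum>j<fan_in d m (Suc l). \<bar>W (Suc l, r, j) * hidden d m W l x j\<bar>)"
        unfolding pre_def by (rule sum_abs)
      also have "\<dots> \<le> (\<Sum>j<fan_in d m (Suc l). \<bar>c (Suc l) r j\<bar> * C)"
      proof (intro sum_mono)
        fix j assume "j \<in> {..<fan_in d m (Suc l)}"
        then have "\<bar>hidden d m W l x j\<bar> \<le> C" using C(2)[of W x j] W x by auto
        moreover have "\<bar>W (Suc l, r, j)\<bar> \<le> \<bar>c (Suc l) r j\<bar>" using W by (meson abs_ge_self order_trans)
        ultimately show "\<bar>W (Suc l, r, j) * hidden d m W l x j\<bar> \<le> \<bar>c (Suc l) r j\<bar> * C"
          unfolding abs_mult by (intro mult_mono) auto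
      qed
      finally show "\<bar>relu (pre d m W (Suc l) (hidden d m W l x) r)\<bar> \<le> (\<Sum>j<fan_in d m (Suc l). \<bar>c (Suc l) r j\<bar> * C)" .
    qed simp
    also have "\<dots> \<le> C'"
      unfolding C'_def using r C(1)
      by (intro member_le_sum[of r "{..<m}" "\<lambda>r. sqrt (2 / real m) * (\<Sum>j<fan_in d m (Suc l). \<bar>c (Suc l) r j\<bar> * C)"]) (auto intro!: mult_nonneg_nonneg sum_nonneg)
    finally show "\<bar>hidden d m W (Suc l) x r\<bar> \<le> C'" .
  qed
qed

lemma network_bounded:
  fixes c :: "nat \<Rightarrow> nat \<Rightarrow> nat \<Rightarrow> real"
  assumes L: "L \<ge> 1"
  shows "\<exists>C. \<forall>W x. (\<forall>l' r j. \<bar>W (l', r, j)\<bar> \<le> c l' r j) \<longrightarrow> (\<forall>j<d. \<bar>x j\<bar> \<le> 1) \<longrightarrow> \<bar>network d m L a W x\<bar> \<le> C"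
proof -
  have f: "fan_in d m (Suc L) = m" using L by (simp add: fan_in_def)
  obtain C where C: "\<And>W x r. \<lbrakk>\<And>l' r j. \<bar>W (l', r, j)\<bar> \<le> c l' r j; \<And>j. j < d \<Longrightarrow> \<bar>x j\<bar> \<le> 1; r < m\<rbrakk> \<Longrightarrow> \<bar>hidden d m W L x r\<bar> \<le> C"
    using hidden_bounded[of c d m L] unfolding f by blast
  have "\<bar>network d m L a W x\<bar> \<le> (\<Sum>r<m. \<bar>a r\<bar> * C)" if "\<forall>l' r j. \<bar>W (l', r, j)\<bar> \<le> c l' r j" "\<forall>j<d. \<bar>x j\<bar> \<le> 1" for W x
    unfolding network_def
  proof (rule order_trans[OF sum_abs], intro sum_mono)
    fix r assume "r \<in> {..<m}"
    then show "\<bar>a r * hidden d m W L x r\<bar> \<le> \<bar>a r\<bar> * C"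
      unfolding abs_mult using that by (intro mult_left_mono C) auto
  qed
  then show ?thesis by blast
qed

section \<open>The logistic loss on the sphere\<close>

lemma unit_sphere_abs_le: "x \<in> unit_sphere d \<Longrightarrow> j < d \<Longrightarrow> \<bar>x j\<bar> \<le> 1"
  using L2_set_abs_le[of "{..<d}" j x] by (simp add: unit_sphere_def L2_set_def)

lemma unit_sphere_nonempty: "d \<ge> 1 \<Longrightarrow> unit_sphere d \<noteq> {}"
proof -
  assume d: "d \<ge> 1"
  have "(\<Sum>i<d. (if i = 0 then 1 else 0 :: real)\<^sup>2) = (\<Sum>i<d. if i = 0 then 1 else 0)" by (intro sum.cong) auto
  also have "\<dots> = 1" using d by simp
  finally have "(\<lambda>i\<in>{..<d}. if i = 0 then 1 else 0) \<in> unit_sphere d"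
    by (simp add: unit_sphere_def)
  then show ?thesis by blast
qed

lemma logistic_nonneg: "0 \<le> logistic z" by (simp add: logistic_def)

lemma logistic_pos: "0 < logistic z" by (simp add: logistic_def add_pos_pos)

lemma logistic_le: "logistic z \<le> 1 + \<bar>z\<bar>"
proof -
  have "1 + exp (- z) \<le> exp \<bar>z\<bar> + exp \<bar>z\<bar>" by (intro add_mono) auto
  also have "\<dots> \<le> exp 1 * exp \<bar>z\<bar>" using exp_ge_add_one_self[of 1] by simp
  finally have "logistic z \<le> ln (exp (1 + \<bar>z\<bar>))"
    unfolding logistic_def by (subst ln_le_cancel_iff) (auto simp: exp_add add_pos_pos)
  then show ?thesis by simp
qed

lemma continuous_on_logistic: "continuous_on UNIV logistic"
proof -
  have "1 + exp (- z) \<noteq> 0" for z :: real using exp_gt_zero[of "- z"] by linarith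
  then show ?thesis unfolding logistic_def[abs_def] by (auto intro!: continuous_intros)
qed

lemma logistic_measurable [measurable]: "logistic \<in> borel_measurable borel"
  by (intro borel_measurable_continuous_onI continuous_on_logistic)

text \<open>The closed form makes \<open>emp_deriv\<close>, hence the step-size condition inside the
  event, measurable.\<close>

lemma deriv_logistic: "deriv logistic z = - exp (- z) / (1 + exp (- z))"
proof -
  have "0 < 1 + exp (- z)" by (simp add: add_pos_pos)
  then have "((\<lambda>z. ln (1 + exp (- z))) has_real_derivative - exp (- z) / (1 + exp (- z))) (at z)"
    by (auto intro!: derivative_eq_intros)
  then show ?thesis unfolding logistic_def[abs_def] by (rule DERIV_imp_deriv)
qed

lemma deriv_logistic_measurable [measurable]: "deriv logistic \<in> borel_measurable borel"
  unfolding deriv_logistic[abs_def] by measurable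

lemma loss_bdd_above:
  assumes "L \<ge> 1"
  shows "bdd_above ((\<lambda>z. logistic (snd z * network d m L a W (fst z))) ` labelled_points d)"
proof -
  obtain C where C: "\<And>x. (\<forall>j<d. \<bar>x j\<bar> \<le> 1) \<Longrightarrow> \<bar>network d m L a W x\<bar> \<le> C"
    using network_bounded[OF assms, of "\<lambda>l r j. \<bar>W (l, r, j)\<bar>" d m a] by blast
  show ?thesis
  proof (intro bdd_aboveI2)
    fix z assume z: "z \<in> labelled_points d"
    then have "\<bar>network d m L a W (fst z)\<bar> \<le> C" by (intro C) (auto simp: labelled_points_def unit_sphere_abs_le)
    moreover have "\<bar>snd z * network d m L a W (fst z)\<bar> = \<bar>network d m L a W (fst z)\<bar>"
      using z by (auto simp: labelled_points_def abs_mult)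
    ultimately show "logistic (snd z * network d m L a W (fst z)) \<le> 1 + C"
      using logistic_le[of "snd z * network d m L a W (fst z)"] by linarith
  qed
qed

lemma loss_le_sup_loss:
  assumes "L \<ge> 1" "z \<in> labelled_points d"
  shows "logistic (snd z * network d m L a W (fst z)) \<le> sup_loss d (network d m L a W)"
  unfolding sup_loss_def using loss_bdd_above[OF assms(1)] assms(2) by (intro cSUP_upper)

lemma sup_loss_pos:
  assumes "L \<ge> 1" "d \<ge> 1" shows "0 < sup_loss d (network d m L a W)"
proof -
  obtain x where "x \<in> unit_sphere d" using unit_sphere_nonempty[OF assms(2)] by blast
  then have "(x, 1) \<in> labelled_points d" by (simp add: labelled_points_def)
  from loss_le_sup_loss[OF assms(1) this, of m a W] logistic_pos show ?thesis by (rule less_le_trans[rotated])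
qed

lemma hidden_joint_measurable:
  assumes W: "\<And>l r j. (l, r, j) \<in> weight_idx d m L \<Longrightarrow> (\<lambda>p. W p (l, r, j)) \<in> borel_measurable M"
    and x: "\<And>j. j < d \<Longrightarrow> (\<lambda>p. x p j) \<in> borel_measurable M" and "l \<le> L" "r < fan_in d m (Suc l)"
  shows "(\<lambda>p. hidden d m (W p) l (x p) r) \<in> borel_measurable M"
  using assms(3,4)
proof (induction l arbitrary: r)
  case 0 then show ?case using x by (simp add: fan_in_def)
next
  case (Suc l)
  have r: "r < m" using Suc.prems by (simp add: fan_in_def)
  have "(\<lambda>p. \<Sum>j<fan_in d m (Suc l). W p (Suc l, r, j) * hidden d m (W p) l (x p) j) \<in> borel_measurable M"
    using Suc.prems r by (intro borel_measurable_sum borel_measurable_times W Suc.IH) (auto simp: weight_idx_def)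
  then have "(\<lambda>p. sqrt (2 / real m) * relu (\<Sum>j<fan_in d m (Suc l). W p (Suc l, r, j) * hidden d m (W p) l (x p) j)) \<in> borel_measurable M"
    by measurable
  then show ?case using r by simp
qed

lemma network_measurable:
  assumes "\<And>l r j. (l, r, j) \<in> weight_idx d m L \<Longrightarrow> (\<lambda>p. W p (l, r, j)) \<in> borel_measurable M"
    and "\<And>j. j < d \<Longrightarrow> (\<lambda>p. x p j) \<in> borel_measurable M" and "L \<ge> 1"
  shows "(\<lambda>p. network d m L a (W p) (x p)) \<in> borel_measurable M"
  unfolding network_def using assms(3)
  by (intro borel_measurable_sum borel_measurable_times hidden_joint_measurable assms(1,2)) (auto simp: fan_in_def)

lemma network_weights_cong:
  assumes "\<And>i. i \<in> weight_idx d m L \<Longrightarrow> W i = W' i"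
  shows "network d m L a W x = network d m L a W' x"
  unfolding network_def by (subst hidden_weights_cong[of L m d W W']) (auto simp: assms weight_idx_def)

text \<open>The labelled sphere is uncountable; by continuity in the input and the label a countable
  dense subset can replace it.\<close>

lemma sup_loss_measurable:
  assumes W: "\<And>l r j. (l, r, j) \<in> weight_idx d m L \<Longrightarrow> (\<lambda>p. W p (l, r, j)) \<in> borel_measurable M" and L: "L \<ge> 1" and d: "d \<ge> 1"
  shows "(\<lambda>p. sup_loss d (network d m L a (W p))) \<in> borel_measurable M"
proof -
  obtain D where D: "countable D" "D \<subseteq> labelled_points d" "labelled_points d \<subseteq> closure D"
    by (rule countable_dense_subset)
  have ne: "labelled_points d \<noteq> {}" using unit_sphere_nonempty[OF d] by (auto simp: labelled_points_def)
  have "sup_loss d (network d m L a V) = (SUP z\<in>D. logistic (snd z * network d m L a V (fst z)))" for V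
    unfolding sup_loss_def
  proof (rule SUP_dense[OF _ D(2,3) loss_bdd_above[OF L] ne])
    have "continuous_on UNIV (\<lambda>z::point \<times> real. fst z j)" for j
      using continuous_on_compose2[OF continuous_on_product_coordinates[of j] continuous_on_fst[OF continuous_on_id]] by auto
    then have "continuous_on UNIV (\<lambda>z::point \<times> real. snd z * network d m L a V (fst z))"
      by (intro continuous_intros continuous_on_network) auto
    then show "continuous_on UNIV (\<lambda>z. logistic (snd z * network d m L a V (fst z)))"
      using continuous_on_compose2[OF continuous_on_logistic] by auto
  qed
  moreover have "(\<lambda>p. SUP z\<in>D. logistic (snd z * network d m L a (W p) (fst z))) \<in> borel_measurable M"
  proof (rule borel_measurable_cSUP[OF D(1)])
    fix z assume "z \<in> D"
    have [measurable]: "(\<lambda>p. network d m L a (W p) (fst z)) \<in> borel_measurable M"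
      by (intro network_measurable W L) auto
    show "(\<lambda>p. logistic (snd z * network d m L a (W p) (fst z))) \<in> borel_measurable M" by measurable
  next
    fix p
    show "bdd_above ((\<lambda>z. logistic (snd z * network d m L a (W p) (fst z))) ` D)"
      using loss_bdd_above[OF L, of d m a "W p"] by (rule bdd_above_mono) (use D in auto)
  qed
  ultimately show ?thesis by simp
qed

section \<open>Measurability of the Rademacher complexity over a random ball\<close>

definition unit_ball_weights :: "nat \<Rightarrow> nat \<Rightarrow> nat \<Rightarrow> weights set" where
  "unit_ball_weights d m L = {U \<in> weight_space d m L. frob_dist_sq d m L U (\<lambda>_. 0) \<le> 1}"

lemma frob_dist_sq_idx: "frob_dist_sq d m L V W = (\<Sum>i\<in>weight_idx d m L. (V i - W i)\<^sup>2)"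
  unfolding frob_dist_sq_def weight_idx_def
  by (simp add: sum.Sigma sum.cartesian_product split_def)

lemma frob_dist_sq_nonneg: "0 \<le> frob_dist_sq d m L V W"
  by (simp add: frob_dist_sq_idx sum_nonneg)

text \<open>
  The supremum over a random ball becomes one over a fixed set, where a countable dense subset
  suffices; this is what makes the Rademacher complexity measurable.
\<close>

lemma ball_class_reparam:
  assumes V: "V \<in> weight_space d m L" and B: "0 \<le> B"
  shows "ball_class d m L a V B = (\<lambda>U. network d m L a (\<lambda>i. V i + sqrt B * U i)) ` unit_ball_weights d m L"
proof (intro equalityI subsetI)
  fix f assume "f \<in> ball_class d m L a V B"
  then obtain W where W: "W \<in> weight_space d m L" "frob_dist_sq d m L W V \<le> B" "f = network d m L a W"
    by (auto simp: ball_class_def)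
  define U where "U = (\<lambda>i\<in>weight_idx d m L. (W i - V i) / sqrt B)"
  have eq: "V i + sqrt B * U i = W i" if i: "i \<in> weight_idx d m L" for i
  \<comment> \<open>For radius 0 the quotient in \<open>U\<close> is 0 by convention, and
    \<open>W\<close> coincides with \<open>V\<close> on the index set.\<close>
  proof (cases "B = 0")
    case True
    then have "(\<Sum>i\<in>weight_idx d m L. (W i - V i)\<^sup>2) = 0" using W(2) sum_nonneg[of "weight_idx d m L" "\<lambda>i. (W i - V i)\<^sup>2"] by (simp add: frob_dist_sq_idx)
    then have "W i = V i" using i by (subst (asm) sum_nonneg_eq_0_iff) (auto simp: finite_weight_idx)
    then show ?thesis using True by simp
  next
    case False then show ?thesis using i by (simp add: U_def)
  qed
  have "frob_dist_sq d m L U (\<lambda>_. 0) = (\<Sum>i\<in>weight_idx d m L. (W i - V i)\<^sup>2 / B)"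
    unfolding frob_dist_sq_idx using B by (intro sum.cong) (auto simp: U_def power_divide)
  also have "\<dots> = frob_dist_sq d m L W V / B" by (simp add: frob_dist_sq_idx sum_divide_distrib)
  also have "\<dots> \<le> 1" using W(2) B by (simp add: divide_le_eq)
  finally have "U \<in> unit_ball_weights d m L" by (auto simp: unit_ball_weights_def weight_space_def U_def)
  moreover have "f = network d m L a (\<lambda>i. V i + sqrt B * U i)"
    unfolding W(3) by (intro ext network_weights_cong) (simp add: eq)
  ultimately show "f \<in> (\<lambda>U. network d m L a (\<lambda>i. V i + sqrt B * U i)) ` unit_ball_weights d m L" by blast
next
  fix f assume "f \<in> (\<lambda>U. network d m L a (\<lambda>i. V i + sqrt B * U i)) ` unit_ball_weights d m L"
  then obtain U where U: "U \<in> unit_ball_weights d m L" "f = network d m L a (\<lambda>i. V i + sqrt B * U i)" by blast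
  define W where "W = (\<lambda>i\<in>weight_idx d m L. V i + sqrt B * U i)"
  have "frob_dist_sq d m L W V = (\<Sum>i\<in>weight_idx d m L. B * (U i)\<^sup>2)"
    unfolding frob_dist_sq_idx using B by (intro sum.cong) (auto simp: W_def power_mult_distrib)
  also have "\<dots> = B * frob_dist_sq d m L U (\<lambda>_. 0)" by (simp add: frob_dist_sq_idx sum_distrib_left)
  also have "\<dots> \<le> B * 1" using U(1) B by (intro mult_left_mono) (auto simp: unit_ball_weights_def)
  finally have "frob_dist_sq d m L W V \<le> B" by simp
  moreover have "W \<in> weight_space d m L" by (auto simp: W_def weight_space_def)
  moreover have "f = network d m L a W" unfolding U(2) by (intro ext network_weights_cong) (simp add: W_def)
  ultimately show "f \<in> ball_class d m L a V B" by (auto simp: ball_class_def)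
qed

lemma unit_ball_weights_abs: "U \<in> unit_ball_weights d m L \<Longrightarrow> i \<in> weight_idx d m L \<Longrightarrow> \<bar>U i\<bar> \<le> 1"
proof -
  assume U: "U \<in> unit_ball_weights d m L" and i: "i \<in> weight_idx d m L"
  have "(U i)\<^sup>2 \<le> (\<Sum>i\<in>weight_idx d m L. (U i)\<^sup>2)"
    using i by (intro member_le_sum finite_weight_idx) auto
  also have "\<dots> \<le> 1" using U by (simp add: unit_ball_weights_def frob_dist_sq_idx)
  finally show ?thesis by (simp add: abs_square_le_1)
qed

lemma zero_in_unit_ball_weights: "(\<lambda>i\<in>weight_idx d m L. 0) \<in> unit_ball_weights d m L"
  by (simp add: unit_ball_weights_def weight_space_def frob_dist_sq_idx)

lemma ball_sup_bdd_above:
  assumes L: "L \<ge> 1" and x: "\<And>i. i < n \<Longrightarrow> x i \<in> unit_sphere d"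
  shows "bdd_above ((\<lambda>U. (\<Sum>i<n. \<epsilon> i * network d m L a (\<lambda>i. V i + b * U i) (x i)) / real n) ` unit_ball_weights d m L)"
proof -
  obtain C where C: "\<And>W x. (\<forall>l r j. \<bar>W (l, r, j)\<bar> \<le> \<bar>V (l, r, j)\<bar> + \<bar>b\<bar>) \<Longrightarrow> (\<forall>j<d. \<bar>x j\<bar> \<le> 1) \<Longrightarrow> \<bar>network d m L a W x\<bar> \<le> C"
    using network_bounded[OF L, of "\<lambda>l r j. \<bar>V (l, r, j)\<bar> + \<bar>b\<bar>" d m a] by blast
  show ?thesis
  proof (intro bdd_aboveI2)
    fix U assume U: "U \<in> unit_ball_weights d m L"
    \<comment> \<open>Outside the index set the values of \<open>U\<close> are not controlled,
      whereas the uniform bound speaks about all entries. The network ignores those entries, so they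
      are set to 0.\<close>
    define W where "W i = (if i \<in> weight_idx d m L then V i + b * U i else 0)" for i
    have "\<bar>W (l, r, j)\<bar> \<le> \<bar>V (l, r, j)\<bar> + \<bar>b\<bar>" for l r j
    proof (cases "(l, r, j) \<in> weight_idx d m L")
      case True
      have "\<bar>b * U (l, r, j)\<bar> \<le> \<bar>b\<bar> * 1" unfolding abs_mult using unit_ball_weights_abs[OF U True] by (intro mult_left_mono) auto
      then show ?thesis using True by (simp add: W_def)
    qed (simp add: W_def)
    then have "\<bar>network d m L a W (x i)\<bar> \<le> C" if "i < n" for i
      using x[OF that] by (intro C) (auto simp: unit_sphere_abs_le)
    moreover have "network d m L a W y = network d m L a (\<lambda>i. V i + b * U i) y" for y
      by (intro network_weights_cong) (simp add: W_def)
    ultimately have N: "\<bar>network d m L a (\<lambda>i. V i + b * U i) (x i)\<bar> \<le> C" if "i < n" for i using that by simp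
    have "(\<Sum>i<n. \<epsilon> i * network d m L a (\<lambda>i. V i + b * U i) (x i)) \<le> (\<Sum>i<n. \<bar>\<epsilon> i\<bar> * C)"
    proof (intro sum_mono)
      fix i assume "i \<in> {..<n}"
      have "\<epsilon> i * network d m L a (\<lambda>i. V i + b * U i) (x i) \<le> \<bar>\<epsilon> i\<bar> * \<bar>network d m L a (\<lambda>i. V i + b * U i) (x i)\<bar>"
        by (simp add: abs_mult[symmetric])
      also have "\<dots> \<le> \<bar>\<epsilon> i\<bar> * C" using N[of i] \<open>i \<in> {..<n}\<close> by (intro mult_left_mono) auto
      finally show "\<epsilon> i * network d m L a (\<lambda>i. V i + b * U i) (x i) \<le> \<bar>\<epsilon> i\<bar> * C" .
    qed
    then show "(\<Sum>i<n. \<epsilon> i * network d m L a (\<lambda>i. V i + b * U i) (x i)) / real n \<le> (\<Sum>i<n. \<bar>\<epsilon> i\<bar> * C) / real n"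
      by (intro divide_right_mono) auto
  qed
qed

text \<open>The law of the signs has finite support, so the complexity is a finite sum of countable
  suprema of measurable functions.\<close>

lemma rademacher_measurable:
  assumes V: "\<And>l r j. (l, r, j) \<in> weight_idx d m L \<Longrightarrow> (\<lambda>p. V p (l, r, j)) \<in> borel_measurable M"
    and Vs: "\<And>p. p \<in> space M \<Longrightarrow> V p \<in> weight_space d m L"
    and b: "b \<in> borel_measurable M" "\<And>p. p \<in> space M \<Longrightarrow> 0 \<le> b p"
    and x: "\<And>i j. i < n \<Longrightarrow> j < d \<Longrightarrow> (\<lambda>p. x p i j) \<in> borel_measurable M"
    and xs: "\<And>p i. p \<in> space M \<Longrightarrow> i < n \<Longrightarrow> x p i \<in> unit_sphere d"
    and L: "L \<ge> 1"
  shows "(\<lambda>p. rademacher n (x p) (ball_class d m L a (V p) (b p))) \<in> borel_measurable M"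
proof -
  let ?U = "unit_ball_weights d m L"
  obtain D where D: "countable D" "D \<subseteq> ?U" "?U \<subseteq> closure D"
    by (rule countable_dense_subset)
  have ne: "?U \<noteq> {}" using zero_in_unit_ball_weights by blast
  define h where "h \<epsilon> U p = (\<Sum>i<n. \<epsilon> i * network d m L a (\<lambda>k. V p k + sqrt (b p) * U k) (x p i)) / real n" for \<epsilon> U p
  have bdd: "bdd_above ((\<lambda>U. h \<epsilon> U p) ` ?U)" if "p \<in> space M" for \<epsilon> p
    unfolding h_def using xs[OF that] by (intro ball_sup_bdd_above L)
  have eq: "(SUP f\<in>ball_class d m L a (V p) (b p). (\<Sum>i<n. \<epsilon> i * f (x p i)) / real n) = (SUP U\<in>D. h \<epsilon> U p)" if p: "p \<in> space M" for \<epsilon> p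
  proof -
    have "(SUP f\<in>ball_class d m L a (V p) (b p). (\<Sum>i<n. \<epsilon> i * f (x p i)) / real n) = (SUP U\<in>?U. h \<epsilon> U p)"
      unfolding ball_class_reparam[OF Vs[OF p] b(2)[OF p]] image_image h_def ..
    also have "\<dots> = (SUP U\<in>D. h \<epsilon> U p)"
    proof (rule SUP_dense[OF _ D(2,3) bdd[OF p] ne])
      show "continuous_on UNIV (\<lambda>U. h \<epsilon> U p)"
        unfolding h_def divide_inverse by (intro continuous_intros continuous_on_network) auto
    qed
    finally show ?thesis .
  qed
  have hm: "(\<lambda>p. SUP U\<in>D. h \<epsilon> U p) \<in> borel_measurable M" for \<epsilon>
  proof (rule borel_measurable_cSUP[OF D(1)])
    fix U assume "U \<in> D"
    have sb: "(\<lambda>p. sqrt (b p)) \<in> borel_measurable M" using b(1) by measurable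
    have "(\<lambda>p. network d m L a (\<lambda>k. V p k + sqrt (b p) * U k) (x p i)) \<in> borel_measurable M" if "i < n" for i
      using that by (intro network_measurable L borel_measurable_add borel_measurable_times V sb x) auto
    then have "(\<lambda>p. \<Sum>i<n. \<epsilon> i * network d m L a (\<lambda>k. V p k + sqrt (b p) * U k) (x p i)) \<in> borel_measurable M"
      by (intro borel_measurable_sum borel_measurable_times) auto
    then show "h \<epsilon> U \<in> borel_measurable M" unfolding h_def[abs_def] by measurable
  next
    fix p assume "p \<in> space M"
    from bdd[OF this] show "bdd_above ((\<lambda>U. h \<epsilon> U p) ` D)" by (rule bdd_above_mono) (use D in auto)
  qed
  have "rademacher n (x p) (ball_class d m L a (V p) (b p)) = (\<Sum>\<epsilon>\<in>set_pmf (signs_pmf n). pmf (signs_pmf n) \<epsilon> * (SUP U\<in>D. h \<epsilon> U p))" if p: "p \<in> space M" for p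
    unfolding rademacher_def using eq[OF p]
    by (subst integral_measure_pmf[OF finite_set_signs_pmf]) auto
  moreover have "(\<lambda>p. \<Sum>\<epsilon>\<in>set_pmf (signs_pmf n). pmf (signs_pmf n) \<epsilon> * (SUP U\<in>D. h \<epsilon> U p)) \<in> borel_measurable M"
    by (intro borel_measurable_sum borel_measurable_times hm) auto
  ultimately show ?thesis by (simp cong: measurable_cong)
qed

lemma rademacher_cong: "(\<And>i. i < n \<Longrightarrow> x i = y i) \<Longrightarrow> rademacher n x \<F> = rademacher n y \<F>"
  by (simp add: rademacher_def)

text \<open>Samples drawn from the data are described by index maps, a finite set that does not vary
  with the data. The supremum becomes a finite maximum of measurable functions.\<close>

lemma worst_rademacher_reindex:
  "worst_rademacher (X ` {..<n}) n \<F> = (SUP k\<in>{..<n} \<rightarrow>\<^sub>E {..<n}. rademacher n (\<lambda>i. X (k i)) \<F>)"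
proof -
  have "(\<lambda>x. rademacher n x \<F>) ` ({..<n} \<rightarrow>\<^sub>E X ` {..<n}) = (\<lambda>k. rademacher n (\<lambda>i. X (k i)) \<F>) ` ({..<n} \<rightarrow>\<^sub>E {..<n})"
  proof (intro equalityI subsetI)
    fix y assume "y \<in> (\<lambda>x. rademacher n x \<F>) ` ({..<n} \<rightarrow>\<^sub>E X ` {..<n})"
    then obtain x where x: "x \<in> {..<n} \<rightarrow>\<^sub>E X ` {..<n}" "y = rademacher n x \<F>" by blast
    have "\<forall>i\<in>{..<n}. \<exists>k. k < n \<and> x i = X k" using x by (auto dest: PiE_mem)
    then obtain k where k: "\<And>i. i < n \<Longrightarrow> k i < n \<and> x i = X (k i)" by (metis lessThan_iff)
    have "y = rademacher n (\<lambda>i. X (restrict k {..<n} i)) \<F>" unfolding x(2) using k by (intro rademacher_cong) simp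
    moreover have "restrict k {..<n} \<in> {..<n} \<rightarrow>\<^sub>E {..<n}" using k by auto
    ultimately show "y \<in> (\<lambda>k. rademacher n (\<lambda>i. X (k i)) \<F>) ` ({..<n} \<rightarrow>\<^sub>E {..<n})" by blast
  next
    fix y assume "y \<in> (\<lambda>k. rademacher n (\<lambda>i. X (k i)) \<F>) ` ({..<n} \<rightarrow>\<^sub>E {..<n})"
    then obtain k where k: "k \<in> {..<n} \<rightarrow>\<^sub>E {..<n}" "y = rademacher n (\<lambda>i. X (k i)) \<F>" by blast
    have "y = rademacher n (\<lambda>i\<in>{..<n}. X (k i)) \<F>" unfolding k(2) by (intro rademacher_cong) simp
    moreover have "(\<lambda>i\<in>{..<n}. X (k i)) \<in> {..<n} \<rightarrow>\<^sub>E X ` {..<n}" using k by (auto dest: PiE_mem)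
    ultimately show "y \<in> (\<lambda>x. rademacher n x \<F>) ` ({..<n} \<rightarrow>\<^sub>E X ` {..<n})" by blast
  qed
  then show ?thesis unfolding worst_rademacher_def by simp
qed


section \<open>From good initializations to the Rademacher bound\<close>

lemma frob_dist_sq_commute: "frob_dist_sq d m L V W = frob_dist_sq d m L W V"
  by (simp add: frob_dist_sq_def power2_commute)

lemma frob_dist_sq_triangle:
  assumes "frob_dist_sq d m L W V \<le> F" "frob_dist_sq d m L V W0 \<le> F"
  shows "frob_dist_sq d m L W W0 \<le> (2 * sqrt F)\<^sup>2"
proof -
  have s: "sqrt (frob_dist_sq d m L V W) = L2_set (\<lambda>i. V i - W i) (weight_idx d m L)" for V W
    by (simp add: frob_dist_sq_idx L2_set_def)
  have "L2_set (\<lambda>i. W i - W0 i) (weight_idx d m L) = L2_set (\<lambda>i. (W i - V i) + (V i - W0 i)) (weight_idx d m L)" by simp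
  also have "\<dots> \<le> L2_set (\<lambda>i. W i - V i) (weight_idx d m L) + L2_set (\<lambda>i. V i - W0 i) (weight_idx d m L)"
    by (rule L2_set_triangle_ineq)
  also have "\<dots> = sqrt (frob_dist_sq d m L W V) + sqrt (frob_dist_sq d m L V W0)" by (simp only: s)
  also have "\<dots> \<le> sqrt F + sqrt F" by (intro add_mono real_sqrt_le_mono assms)
  finally have "sqrt (frob_dist_sq d m L W W0) \<le> 2 * sqrt F" unfolding s by simp
  then have "(sqrt (frob_dist_sq d m L W W0))\<^sup>2 \<le> (2 * sqrt F)\<^sup>2"
    by (intro power_mono) (auto simp: frob_dist_sq_nonneg)
  then show ?thesis by (simp add: frob_dist_sq_nonneg)
qed

text \<open>Used with q = L^2 ln m. The number 20000 makes 7 p ln m a small part of m / (800 L^2).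
  Rounding \<open>p\<close> down costs a factor of at most 2, and rounding \<open>B\<close> up is
  covered by 50000 in place of 40000.\<close>

lemma exists_block_parameters:
  fixes m L :: nat
  assumes q: "q \<ge> 1" and m: "real m \<ge> 40000 * q"
  obtains p B :: nat where "p \<ge> 1" "p \<le> m" "m \<le> B * p" "real p \<le> real m / (20000 * q)"
    "real m / (40000 * q) \<le> real p" "real B \<le> 50000 * q"
proof -
  define t where "t = real m / (20000 * q)"
  have t2: "t \<ge> 2" using q m by (simp add: t_def field_simps)
  define p where "p = nat \<lfloor>t\<rfloor>"
  have p: "real p \<le> t" "t - 1 \<le> real p" using t2 unfolding p_def by linarith+
  have p1: "real p \<ge> 1" using p t2 by linarith
  define B where "B = nat \<lceil>real m / real p\<rceil>"
  have mp0: "0 \<le> real m / real p" by simp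
  have B: "real m / real p \<le> real B" "real B \<le> real m / real p + 1" using mp0 unfolding B_def by linarith+
  have tp: "t / 2 \<le> real p" using p t2 by linarith
  show ?thesis
  proof (rule that[of p B])
    show "1 \<le> p" using p1 by simp
    have "t \<le> real m" using q unfolding t_def by (simp add: divide_le_eq mult_le_cancel_left1)
    then show "p \<le> m" using p by linarith
    have "real m \<le> real B * real p" using B(1) p1 by (simp add: divide_le_eq)
    then show "m \<le> B * p" by (metis of_nat_le_iff of_nat_mult)
    show "real p \<le> real m / (20000 * q)" using p by (simp add: t_def)
    show "real m / (40000 * q) \<le> real p" using tp by (simp add: t_def)
    have "real m / real p \<le> 40000 * q"
    proof -
      have "real m / (40000 * q) \<le> real p" using tp by (simp add: t_def)
      then have "real m \<le> real p * (40000 * q)" using q by (simp add: divide_le_eq)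
      then show ?thesis using p1 by (simp add: divide_le_eq mult.commute)
    qed
    then show "real B \<le> 50000 * q" using B q by linarith
  qed
qed

text \<open>The binding condition is the one on flips: B^2 contributes q^2 and p^3 contributes q^3,
  hence q^5. The product 4900 * 14112 * 50000^2 * 40000^3 is about 1.11 * 10^31, just below the
  constant in \<open>big\<close>.\<close>

lemma width_conditions:
  fixes m n L p B :: nat and q R :: real
  assumes m: "m \<ge> 1" and n: "n \<ge> 1" and L: "L \<ge> 1" and q: "q \<ge> 1" and R: "R \<ge> 1"
    and big: "(12 * 10 ^ 30) * real n ^ 3 * (real L)\<^sup>2 * q ^ 5 * R\<^sup>2 \<le> real m"
    and p: "real m / (40000 * q) \<le> real p" and B: "real B \<le> 50000 * q" "B \<ge> 1"
    and eps: "eps = 70 * real L * sqrt (real B) * R / sqrt (real m)"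
  shows "100 * real B \<le> (real m)\<^sup>2" "eps\<^sup>2 * (14112 * real B * real m ^ 3) \<le> real p ^ 3" "eps \<le> 1"
    "2320 * real B * eps\<^sup>2 * real n ^ 3 \<le> 1"
proof -
  have m0: "real m > 0" using m by simp
  have e2: "eps\<^sup>2 = 4900 * (real L)\<^sup>2 * real B * R\<^sup>2 / real m"
    unfolding eps by (simp add: power_mult_distrib power_divide)
  define X where "X = (real L)\<^sup>2 * R\<^sup>2"
  have L1: "1 \<le> (real L)\<^sup>2" using L by (simp add: one_le_power)
  have R1: "1 \<le> R\<^sup>2" using R by (simp add: one_le_power)
  have X1: "1 \<le> X" unfolding X_def using mult_mono[OF L1 R1] by simp
  have n1: "1 \<le> real n ^ 3" using n by (simp add: one_le_power)
  have qp: "q ^ a \<le> q ^ 5" if "a \<le> 5" for a using that q by (intro power_increasing) auto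
  have big': "(12 * 10 ^ 30) * (q ^ 5 * X) * real n ^ 3 \<le> real m" using big by (simp add: X_def mult_ac)
  have main: "k * (q ^ a * X) * real n ^ 3 \<le> real m" if "a \<le> 5" "0 \<le> k" "k \<le> (12 * 10 ^ 30)" for k :: real and a
  proof -
    have "k * (q ^ a * X) * real n ^ 3 \<le> (12 * 10 ^ 30) * (q ^ 5 * X) * real n ^ 3"
      using that qp X1 n1 q by (intro mult_mono mult_nonneg_nonneg) auto
    then show ?thesis using big' by linarith
  qed
  have main1: "k * (q ^ a * X) \<le> real m" if "a \<le> 5" "0 \<le> k" "k \<le> (12 * 10 ^ 30)" for k :: real and a
  proof -
    have "k * (q ^ a * X) * 1 \<le> k * (q ^ a * X) * real n ^ 3"
      using that n1 X1 q by (intro mult_left_mono mult_nonneg_nonneg) auto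
    then show ?thesis using main[OF that] by linarith
  qed
  have B0: "0 \<le> real B" by simp
  show "100 * real B \<le> (real m)\<^sup>2"
  proof -
    have "100 * real B \<le> 5000000 * (q ^ 1 * 1)" using B by simp
    also have "\<dots> \<le> 5000000 * (q ^ 1 * X)" using X1 q by (intro mult_left_mono) auto
    also have "\<dots> \<le> real m" by (rule main1) auto
    also have "\<dots> \<le> (real m)\<^sup>2" using m by (simp add: power2_eq_square)
    finally show ?thesis .
  qed
  show "eps \<le> 1"
  proof -
    have "4900 * X * real B \<le> 4900 * X * (50000 * q)" using B X1 by (intro mult_left_mono) auto
    also have "\<dots> = 245000000 * (q ^ 1 * X)" by simp
    also have "\<dots> \<le> real m" by (rule main1) auto
    finally have "eps\<^sup>2 \<le> 1" using m0 by (simp add: e2 X_def divide_le_eq mult_ac)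
    then have "eps\<^sup>2 \<le> 1\<^sup>2" by simp
    then show ?thesis by (rule power2_le_imp_le) simp
  qed
  have B2: "(real B)\<^sup>2 \<le> 2500000000 * q\<^sup>2"
    using power_mono[OF B(1) B0, of 2] by (simp add: power_mult_distrib)
  show "2320 * real B * eps\<^sup>2 * real n ^ 3 \<le> 1"
  proof -
    have "11368000 * X * (real B)\<^sup>2 * real n ^ 3 \<le> 11368000 * X * (2500000000 * q\<^sup>2) * real n ^ 3"
      using B2 X1 n1 by (intro mult_right_mono mult_left_mono) auto
    also have "\<dots> = 28420000000000000 * (q ^ 2 * X) * real n ^ 3" by simp
    also have "\<dots> \<le> real m" by (rule main) auto
    finally have le: "11368000 * X * (real B)\<^sup>2 * real n ^ 3 \<le> real m" .
    have "2320 * real B * eps\<^sup>2 * real n ^ 3 = 11368000 * X * (real B)\<^sup>2 * real n ^ 3 / real m"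
      unfolding e2 X_def by (simp add: power2_eq_square)
    then show ?thesis using le m0 by (simp add: divide_le_eq)
  qed
  show "eps\<^sup>2 * (14112 * real B * real m ^ 3) \<le> real p ^ 3"
  proof -
    have "69148800 * X * (real B)\<^sup>2 \<le> 69148800 * X * (2500000000 * q\<^sup>2)"
      using B2 X1 by (intro mult_left_mono) auto
    then have "69148800 * X * (real B)\<^sup>2 * (64000000000000 * q ^ 3) \<le> 69148800 * X * (2500000000 * q\<^sup>2) * (64000000000000 * q ^ 3)"
      using q by (intro mult_right_mono) auto
    also have "\<dots> = 11063808000000000000000000000000 * (q ^ 5 * X)" by (simp add: eval_nat_numeral)
    also have "\<dots> \<le> real m" by (rule main1) auto
    finally have 1: "69148800 * X * (real B)\<^sup>2 \<le> real m / (64000000000000 * q ^ 3)"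
      using q by (simp add: pos_le_divide_eq)
    have "eps\<^sup>2 * (14112 * real B * real m ^ 3) = 69148800 * X * (real B)\<^sup>2 * (real m)\<^sup>2"
      unfolding e2 X_def using m0 by (simp add: power2_eq_square power3_eq_cube)
    also have "\<dots> \<le> real m / (64000000000000 * q ^ 3) * (real m)\<^sup>2" using 1 by (rule mult_right_mono) simp
    also have "\<dots> = (real m / (40000 * q)) ^ 3" by (simp add: power_divide power_mult_distrib power2_eq_square power3_eq_cube)
    also have "\<dots> \<le> real p ^ 3" using p q by (intro power_mono) auto
    finally show ?thesis .
  qed
qed

text \<open>The quantity \<Gamma> is the logarithm of 14 / \<delta> times L^2 times the bound on the
  size of the net, so each condition becomes a comparison of exponents.\<close>

lemma failure_conditions:
  fixes m n L d p :: nat and \<delta> :: real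
  defines "\<Gamma> \<equiv> real d * (real L + 3) * ln (real m) + 2 * ln (real L) + ln (14 / \<delta>)"
  assumes m: "m \<ge> 3" and L: "L \<ge> 2" and n: "n \<ge> 1" and \<delta>: "0 < \<delta>"
    and p: "real p \<le> real m / (20000 * ((real L)\<^sup>2 * ln (real m)))" "real m / (40000 * ((real L)\<^sup>2 * ln (real m))) \<le> real p"
    and g1: "480000 * (real L)\<^sup>2 * ln (real m) * \<Gamma> \<le> real m" and g2: "2 * real n * \<Gamma> \<le> real m" and l1: "1 \<le> ln (real m)"
  shows "real (m ^ (d * (L + 3))) * (real L)\<^sup>2 * real (m ^ (7 * p)) * exp (- (real m / (800 * (real L)\<^sup>2))) \<le> \<delta> / 14"
    "real (m ^ (d * (L + 3))) * (real L)\<^sup>2 * exp (- (real p / 12)) \<le> \<delta> / 14"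
    "real (m ^ (d * (L + 3))) * (real L)\<^sup>2 * exp (- (real m / (2 * real n))) \<le> \<delta> / 14"
proof -
  have m0: "real m > 0" and L0: "real L > 0" and n0: "real n > 0" using m L n by auto
  have pw: "real (m ^ k) = exp (real k * ln (real m))" for k
    using m0 by (simp add: exp_of_nat_mult)
  have L2: "(real L)\<^sup>2 = exp (2 * ln (real L))"
    using L0 exp_of_nat_mult[of 2 "ln (real L)"] by simp
  have d14: "\<delta> / 14 = exp (- ln (14 / \<delta>))" using \<delta> by (simp add: exp_minus)
  have nd: "real (m ^ (d * (L + 3))) * (real L)\<^sup>2 = exp (\<Gamma> - ln (14 / \<delta>))"
    unfolding pw L2 \<Gamma>_def by (simp add: exp_add[symmetric])
  have key: "real (m ^ (d * (L + 3))) * (real L)\<^sup>2 * exp (- y) \<le> \<delta> / 14" if "\<Gamma> \<le> y" for y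
    unfolding nd d14 exp_add[symmetric] using that by simp
  have q0: "0 < 480000 * (real L)\<^sup>2 * ln (real m)" using L0 l1 by simp
  have G1: "\<Gamma> \<le> real m / (480000 * (real L)\<^sup>2 * ln (real m))"
    using g1 q0 by (simp add: pos_le_divide_eq mult.commute)
  show "real (m ^ (d * (L + 3))) * (real L)\<^sup>2 * exp (- (real p / 12)) \<le> \<delta> / 14"
  proof (rule key)
    have "real m / (480000 * (real L)\<^sup>2 * ln (real m)) = real m / (40000 * ((real L)\<^sup>2 * ln (real m))) / 12" by simp
    then show "\<Gamma> \<le> real p / 12" using G1 p(2) by linarith
  qed
  show "real (m ^ (d * (L + 3))) * (real L)\<^sup>2 * exp (- (real m / (2 * real n))) \<le> \<delta> / 14"
    using g2 n0 by (intro key) (simp add: pos_le_divide_eq mult.commute)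
  have "\<Gamma> + 7 * real p * ln (real m) \<le> real m / (800 * (real L)\<^sup>2)"
  proof -
    have "real p * ln (real m) \<le> real m / (20000 * ((real L)\<^sup>2 * ln (real m))) * ln (real m)"
      using p(1) l1 by (intro mult_right_mono) auto
    also have "\<dots> = real m / (20000 * (real L)\<^sup>2)" using l1 by simp
    finally have "7 * real p * ln (real m) \<le> 7 * (real m / (20000 * (real L)\<^sup>2))" by simp
    moreover have "real m / (480000 * (real L)\<^sup>2 * ln (real m)) \<le> real m / (480000 * (real L)\<^sup>2 * 1)"
      using l1 L0 by (intro divide_left_mono mult_left_mono) auto
    moreover have "real m / (480000 * (real L)\<^sup>2 * 1) + 7 * (real m / (20000 * (real L)\<^sup>2)) \<le> real m / (800 * (real L)\<^sup>2)"
      using L0 m0 by (simp add: field_simps)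
    ultimately show ?thesis using G1 by linarith
  qed
  then have "exp (\<Gamma> - ln (14 / \<delta>) + 7 * real p * ln (real m) - real m / (800 * (real L)\<^sup>2)) \<le> \<delta> / 14"
    unfolding d14 by simp
  moreover have "real (m ^ (d * (L + 3))) * (real L)\<^sup>2 * real (m ^ (7 * p)) * exp (- (real m / (800 * (real L)\<^sup>2)))
    = exp (\<Gamma> - ln (14 / \<delta>) + 7 * real p * ln (real m) - real m / (800 * (real L)\<^sup>2))"
    unfolding nd unfolding pw by (simp add: exp_add[symmetric])
  ultimately show "real (m ^ (d * (L + 3))) * (real L)\<^sup>2 * real (m ^ (7 * p)) * exp (- (real m / (800 * (real L)\<^sup>2))) \<le> \<delta> / 14"
    by linarith
qed

lemma layer_inner_le:
  assumes "L \<ge> 2" "(\<Sum>r<m. \<Sum>j<m. (\<phi> r j)\<^sup>2) \<le> 8"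
  shows "\<bar>\<Sum>r<m. \<Sum>j<m. \<phi> r j * (W (L, r, j) - W0 (L, r, j))\<bar> \<le> 3 * sqrt (frob_dist_sq d m L W W0)"
proof -
  have f: "fan_in d m L = m" using assms by (simp add: fan_in_def)
  have "(\<Sum>r<m. \<Sum>j<m. \<phi> r j * (W (L, r, j) - W0 (L, r, j)))\<^sup>2 = (\<Sum>(r,j)\<in>{..<m}\<times>{..<m}. \<phi> r j * (W (L, r, j) - W0 (L, r, j)))\<^sup>2"
    by (simp add: sum.cartesian_product)
  also have "\<dots> = (\<Sum>k\<in>{..<m}\<times>{..<m}. \<phi> (fst k) (snd k) * (W (L, fst k, snd k) - W0 (L, fst k, snd k)))\<^sup>2"
    by (simp add: split_def)
  also have "\<dots> \<le> (\<Sum>k\<in>{..<m}\<times>{..<m}. (\<phi> (fst k) (snd k))\<^sup>2) * (\<Sum>k\<in>{..<m}\<times>{..<m}. (W (L, fst k, snd k) - W0 (L, fst k, snd k))\<^sup>2)"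
    by (rule Cauchy_Schwarz_ineq_sum)
  also have "\<dots> = (\<Sum>r<m. \<Sum>j<m. (\<phi> r j)\<^sup>2) * (\<Sum>r<m. \<Sum>j<m. (W (L, r, j) - W0 (L, r, j))\<^sup>2)"
    by (simp add: sum.cartesian_product split_def)
  also have "\<dots> \<le> 9 * frob_dist_sq d m L W W0"
    using assms layer_dist_le_frob[of L L, where m=m and d=d and V=W and W=W0] f by (intro mult_mono) (auto intro!: sum_nonneg)
  also have "\<dots> = (3 * sqrt (frob_dist_sq d m L W W0))\<^sup>2" by (simp add: power_mult_distrib frob_dist_sq_nonneg)
  finally have "\<bar>\<Sum>r<m. \<Sum>j<m. \<phi> r j * (W (L, r, j) - W0 (L, r, j))\<bar>\<^sup>2 \<le> (3 * sqrt (frob_dist_sq d m L W W0))\<^sup>2"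
    by (simp only: power2_abs)
  then show ?thesis by (rule power2_le_imp_le) (simp add: frob_dist_sq_nonneg)
qed

lemma risk_nonneg: "0 \<le> risk \<rho> f"
  unfolding risk_def by (intro Bochner_Integration.integral_nonneg logistic_nonneg)

lemma emp_risk_nonneg: "0 \<le> emp_risk n S f"
  unfolding emp_risk_def by (intro divide_nonneg_nonneg sum_nonneg logistic_nonneg) auto

text \<open>Because the radius dominates the squared distance, \<open>W0\<close> lies in the ball
  around the reference model; nonnegativity of the radius follows too.\<close>

lemma F_pop_ge:
  assumes "L \<ge> 1" "d \<ge> 1" "0 < \<eta>" "0 < \<delta>" "\<delta> < 1"
  shows "frob_dist_sq d m L W0 V \<le> F_pop d m L a n \<eta> T \<delta> \<rho> W0 V"
proof -
  have "0 \<le> ln (2 / \<delta>)" using assms by (intro ln_ge_zero) (simp add: pos_le_divide_eq)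
  moreover have "0 \<le> sup_loss d (network d m L a V)" using sup_loss_pos[OF assms(1,2)] less_imp_le by blast
  ultimately have "0 \<le> 3 * \<eta> * real T * (2 * risk \<rho> (network d m L a V) + 7 * sup_loss d (network d m L a V) * ln (2 / \<delta>) / (6 * real n))"
    using assms risk_nonneg by (intro mult_nonneg_nonneg add_nonneg_nonneg divide_nonneg_nonneg) auto
  then show ?thesis by (simp add: F_pop_def)
qed

text \<open>The linearization holds in a ball of radius \<open>R\<close> around \<open>W0\<close>,
  and \<open>RF\<close> ties \<open>R\<close> to the empirical quantity \<open>F_emp\<close>. To
  place the whole class in that ball the population radius must be estimated. The reference model
  itself lies in the ball, so its linearization bounds its outputs, and thereby
  \<open>sup_loss\<close> by 19 \<open>F_emp\<close>; together with \<open>emp\<close> this bounds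
  the population radius by (6 + 300 c2) \<open>F_emp\<close> \<open>lam\<close>. The logarithm
  affects \<open>R\<close>, hence the width, but not the final bound. The constant 36 is 2 * 3 + 2 *
  15, from the radius 2 sqrt F, the feature norm 3 and the linearization error 15.\<close>

theorem rademacher_bound_of_good:
  fixes d m L n p B T :: nat
  assumes L: "L \<ge> 2" and m: "m \<ge> 1" "even m" and p: "p \<ge> 1" and mB: "m \<le> B * p" and d: "d \<ge> 1" "d \<le> m" and n: "n \<ge> 1"
    and a: "antisymmetric_signs m a" and good: "good_weights d m L n p W0" and R: "R \<ge> 1"
    and Bm: "100 * real B \<le> (real m)\<^sup>2"
    and eps: "eps = 70 * real L * sqrt (real B) * R / sqrt (real m)"
    and width: "eps\<^sup>2 * (14112 * real B * real m ^ 3) \<le> real p ^ 3" "eps \<le> 1" "2320 * real B * eps\<^sup>2 * real n ^ 3 \<le> 1"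
    and V: "V \<in> weight_space d m L" and S: "\<And>i. i < n \<Longrightarrow> S i \<in> labelled_points d"
    and \<eta>: "0 < \<eta>" "\<eta> * real T \<le> c2 * real n" and \<delta>: "0 < \<delta>" "\<delta> < 1"
    and emp: "risk \<rho> (network d m L a V) \<le> 2 * emp_risk n S (network d m L a V) + 2 * sup_loss d (network d m L a V) * ln (2 / \<delta>) / real n"
    and F1: "F_emp d m L a n \<eta> T S W0 V \<ge> 1" and lam: "ln (2 / \<delta>) \<le> lam"
    and RF: "4 * (6 + 300 * c2) * F_emp d m L a n \<eta> T S W0 V * lam \<le> R\<^sup>2"
  shows "worst_rademacher ((fst \<circ> S) ` {..<n}) n (ball_class d m L a V (F_pop d m L a n \<eta> T \<delta> \<rho> W0 V))
     \<le> 36 * sqrt (F_pop d m L a n \<eta> T \<delta> \<rho> W0 V / real n)"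
proof -
  define \<Phi> where "\<Phi> = F_emp d m L a n \<eta> T S W0 V"
  define F where "F = F_pop d m L a n \<eta> T \<delta> \<rho> W0 V"
  let ?er = "emp_risk n S (network d m L a V)" and ?G = "sup_loss d (network d m L a V)"
  have \<Phi>1: "\<Phi> \<ge> 1" using F1 by (simp add: \<Phi>_def)
  have n0: "real n > 0" using n by simp
  have eT: "0 \<le> \<eta> * real T" using \<eta> by simp
  have c2: "0 \<le> c2" using order_trans[OF eT \<eta>(2)] n0 by (simp add: zero_le_mult_iff)
  have \<Phi>: "\<Phi> = 3 * (\<eta> * real T) * ?er + frob_dist_sq d m L W0 V" by (simp add: \<Phi>_def F_emp_def)
  have dist\<Phi>: "frob_dist_sq d m L V W0 \<le> \<Phi>"
    using eT emp_risk_nonneg[of n S "network d m L a V"] unfolding \<Phi> frob_dist_sq_commute[of d m L V] by simp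
  have ln2: "2/3 \<le> ln (2 / \<delta>)"
  proof -
    have "2/3 \<le> ln (2::real)" by (rule ln2_ge_two_thirds)
    also have "\<dots> \<le> ln (2 / \<delta>)" using \<delta> by (subst ln_le_cancel_iff) (auto simp: pos_le_divide_eq)
    finally show ?thesis .
  qed
  have lam0: "2/3 \<le> lam" using ln2 lam by linarith
  \<comment> \<open>Since \<open>lam\<close> is at least 2/3, the factor 24 \<open>lam\<close>
    exceeds 1; so the reference model lies within distance \<open>R\<close> of
    \<open>W0\<close>.\<close>
  have \<Phi>R: "\<Phi> \<le> R\<^sup>2"
  proof -
    have "\<Phi> * 1 \<le> \<Phi> * (24 * lam)" using \<Phi>1 lam0 by (intro mult_left_mono) auto
    also have "\<dots> \<le> \<Phi> * (24 * lam) + 1200 * (c2 * (\<Phi> * lam))" using c2 \<Phi>1 lam0 by simp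
    also have "\<dots> = 4 * (6 + 300 * c2) * \<Phi> * lam" by (simp add: algebra_simps)
    finally show ?thesis using RF by (simp add: \<Phi>_def)
  qed
  note ul = uniform_linearization[OF L m p mB d n a good R Bm eps width(1,2,3)]
  \<comment> \<open>A name for the property, so that a feature map can be chosen for every sample
    point.\<close>
  define linearizes where "linearizes x \<phi> \<longleftrightarrow> (\<Sum>r<m. \<Sum>j<m. (\<phi> r j)\<^sup>2) \<le> 8 \<and>
      (\<forall>W. frob_dist_sq d m L W W0 \<le> R\<^sup>2 \<longrightarrow>
      \<bar>network d m L a W x - (\<Sum>r<m. \<Sum>j<m. \<phi> r j * (W (L, r, j) - W0 (L, r, j)))\<bar> \<le> 15 * sqrt (frob_dist_sq d m L W W0) / sqrt (real n))" for x \<phi>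
  have lz: "\<exists>\<phi>. linearizes x \<phi>" if "x \<in> unit_sphere d" for x
    unfolding linearizes_def by (rule ul[OF that])
  have netV: "\<bar>network d m L a V x\<bar> \<le> 18 * \<Phi>" if x: "x \<in> unit_sphere d" for x
  proof -
    obtain \<phi> where \<phi>0: "linearizes x \<phi>" using lz[OF x] by blast
    have \<phi>: "(\<Sum>r<m. \<Sum>j<m. (\<phi> r j)\<^sup>2) \<le> 8"
      "\<bar>network d m L a V x - (\<Sum>r<m. \<Sum>j<m. \<phi> r j * (V (L, r, j) - W0 (L, r, j)))\<bar> \<le> 15 * sqrt (frob_dist_sq d m L V W0) / sqrt (real n)"
      using \<phi>0 order_trans[OF dist\<Phi> \<Phi>R] by (simp_all add: linearizes_def)
    have "15 * sqrt (frob_dist_sq d m L V W0) / sqrt (real n) \<le> 15 * sqrt (frob_dist_sq d m L V W0) / 1"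
      using n by (intro divide_left_mono) (auto simp: frob_dist_sq_nonneg)
    then have "\<bar>network d m L a V x\<bar> \<le> 18 * sqrt (frob_dist_sq d m L V W0)"
      using \<phi>(2) layer_inner_le[OF L \<phi>(1), of V W0 d] by linarith
    also have "\<dots> \<le> 18 * sqrt \<Phi>" using dist\<Phi> by simp
    also have "\<dots> \<le> 18 * \<Phi>" using \<Phi>1 by (intro mult_left_mono real_le_lsqrt) (auto simp: power2_eq_square)
    finally show ?thesis .
  qed
  have G: "?G \<le> 19 * \<Phi>"
    unfolding sup_loss_def
  proof (rule cSUP_least)
    show "labelled_points d \<noteq> {}" using unit_sphere_nonempty[OF d(1)] by (auto simp: labelled_points_def)
    fix z assume z: "z \<in> labelled_points d"
    then have "\<bar>snd z * network d m L a V (fst z)\<bar> = \<bar>network d m L a V (fst z)\<bar>" by (auto simp: labelled_points_def abs_mult)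
    moreover have "\<bar>network d m L a V (fst z)\<bar> \<le> 18 * \<Phi>" using z by (intro netV) (auto simp: labelled_points_def)
    ultimately show "logistic (snd z * network d m L a V (fst z)) \<le> 19 * \<Phi>"
      using logistic_le[of "snd z * network d m L a V (fst z)"] \<Phi>1 by linarith
  qed
  have G0: "0 \<le> ?G" using sup_loss_pos[of L d m a V] L d by simp
  have F4: "4 * F \<le> R\<^sup>2"
  proof -
    have "F = 3 * (\<eta> * real T) * (2 * risk \<rho> (network d m L a V) + 7 * ?G * ln (2 / \<delta>) / (6 * real n)) + frob_dist_sq d m L W0 V"
      by (simp add: F_def F_pop_def)
    also have "\<dots> \<le> 3 * (\<eta> * real T) * (2 * (2 * ?er + 2 * ?G * ln (2 / \<delta>) / real n) + 7 * ?G * ln (2 / \<delta>) / (6 * real n)) + frob_dist_sq d m L W0 V"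
      using eT emp by (intro add_right_mono mult_left_mono) auto
    \<comment> \<open>The number 31/2 is 3 (4 + 7/6), from the concentration error and the
      \<open>sup_loss\<close> term of \<open>F_pop\<close>; 19 times 31/2 is later rounded up to
      300.\<close>
    also have "\<dots> = 4 * (3 * (\<eta> * real T) * ?er) + frob_dist_sq d m L W0 V + (\<eta> * real T / real n) * (31/2 * (?G * ln (2 / \<delta>)))"
      using n0 by (simp add: field_simps)
    also have "\<dots> \<le> 4 * \<Phi> + c2 * (31/2 * (19 * \<Phi> * lam))"
    proof (intro add_mono mult_mono)
      show "4 * (3 * (\<eta> * real T) * ?er) + frob_dist_sq d m L W0 V \<le> 4 * \<Phi>"
        unfolding \<Phi> using frob_dist_sq_nonneg[of d m L W0 V] by simp
      show "\<eta> * real T / real n \<le> c2" using \<eta>(2) n0 by (simp add: divide_le_eq)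
    qed (use G G0 lam ln2 \<Phi>1 c2 in auto)
    also have "\<dots> \<le> (6 + 300 * c2) * \<Phi> * lam"
    proof -
      have "4 * \<Phi> \<le> (6 * lam) * \<Phi>" using \<Phi>1 lam0 by (intro mult_right_mono) auto
      moreover have "0 \<le> c2 * (\<Phi> * lam)" using c2 \<Phi>1 lam0 by simp
      ultimately show ?thesis by (simp add: algebra_simps)
    qed
    finally have "F \<le> (6 + 300 * c2) * \<Phi> * lam" .
    then have "4 * F \<le> 4 * ((6 + 300 * c2) * \<Phi> * lam)" by simp
    also have "4 * ((6 + 300 * c2) * \<Phi> * lam) = 4 * (6 + 300 * c2) * \<Phi> * lam" by simp
    also have "\<dots> \<le> R\<^sup>2" using RF by (simp add: \<Phi>_def)
    finally show ?thesis .
  qed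
  have distF: "frob_dist_sq d m L V W0 \<le> F"
    using F_pop_ge[of L d \<eta> \<delta> m W0 V] L d \<eta> \<delta> by (simp add: F_def frob_dist_sq_commute)
  have F0: "0 \<le> F" using distF frob_dist_sq_nonneg by (rule order_trans[rotated])
  let ?K = "{..<m} \<times> {..<m}"
  let ?\<F> = "ball_class d m L a V F"
  have rad: "rademacher n x ?\<F> \<le> 36 * sqrt (F / real n)" if x: "x \<in> {..<n} \<rightarrow>\<^sub>E (fst \<circ> S) ` {..<n}" for x
  proof -
    have xs: "x i \<in> unit_sphere d" if i: "i < n" for i
    proof -
      have "x i \<in> (fst \<circ> S) ` {..<n}" using x i by (auto dest: PiE_mem)
      then show ?thesis using S by (auto simp: labelled_points_def mem_Times_iff)
    qed
    have "\<forall>i\<in>{..<n}. \<exists>\<phi>. linearizes (x i) \<phi>" using lz xs by simp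
    then obtain \<phi> where "\<forall>i\<in>{..<n}. linearizes (x i) (\<phi> i)" by (rule bchoice[THEN exE])
    then have \<phi>: "\<And>i. i < n \<Longrightarrow> (\<Sum>r<m. \<Sum>j<m. (\<phi> i r j)\<^sup>2) \<le> 8"
      "\<And>i W. i < n \<Longrightarrow> frob_dist_sq d m L W W0 \<le> R\<^sup>2 \<Longrightarrow>
      \<bar>network d m L a W (x i) - (\<Sum>r<m. \<Sum>j<m. \<phi> i r j * (W (L, r, j) - W0 (L, r, j)))\<bar> \<le> 15 * sqrt (frob_dist_sq d m L W W0) / sqrt (real n)"
      by (simp_all add: linearizes_def)
    have "rademacher n x ?\<F> \<le> (2 * sqrt F) * 3 / sqrt (real n) + 15 * (2 * sqrt F) / sqrt (real n)"
    proof (rule rademacher_le_linear[where K="?K" and \<phi>="\<lambda>i k. \<phi> i (fst k) (snd k)"])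
      show "?\<F> \<noteq> {}"
        using V F0 unfolding ball_class_def by (auto simp: frob_dist_sq_idx intro!: exI[of _ V])
      fix i assume i: "i < n"
      show "(\<Sum>k\<in>?K. (\<phi> i (fst k) (snd k))\<^sup>2) \<le> 3\<^sup>2"
        using \<phi>(1)[OF i] by (simp add: sum.cartesian_product split_def)
    next
      fix f assume "f \<in> ?\<F>"
      then obtain W where W: "frob_dist_sq d m L W V \<le> F" "f = network d m L a W" by (auto simp: ball_class_def)
      \<comment> \<open>Both \<open>W\<close> and \<open>W0\<close> are within distance sqrt F of
        \<open>V\<close>; this is why 4 F has to be below R^2.\<close>
      have D: "frob_dist_sq d m L W W0 \<le> (2 * sqrt F)\<^sup>2" by (rule frob_dist_sq_triangle[OF W(1) distF])
      then have DR: "frob_dist_sq d m L W W0 \<le> R\<^sup>2" using F4 F0 by (simp add: power_mult_distrib)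
      have sD: "sqrt (frob_dist_sq d m L W W0) \<le> 2 * sqrt F" using D F0 by (intro real_le_lsqrt) auto
      have fL: "fan_in d m L = m" using L by (simp add: fan_in_def)
      show "\<exists>\<Delta>. (\<Sum>k\<in>?K. (\<Delta> k)\<^sup>2) \<le> (2 * sqrt F)\<^sup>2 \<and>
        (\<forall>i<n. \<bar>f (x i) - (\<Sum>k\<in>?K. \<phi> i (fst k) (snd k) * \<Delta> k)\<bar> \<le> 15 * (2 * sqrt F) / sqrt (real n))"
      proof (intro exI[of _ "\<lambda>k. W (L, fst k, snd k) - W0 (L, fst k, snd k)"] conjI allI impI)
        have "(\<Sum>k\<in>?K. (W (L, fst k, snd k) - W0 (L, fst k, snd k))\<^sup>2) = (\<Sum>r<m. \<Sum>j<fan_in d m L. (W (L, r, j) - W0 (L, r, j))\<^sup>2)"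
          by (simp add: sum.cartesian_product split_def fL)
        also have "\<dots> \<le> frob_dist_sq d m L W W0" using L by (intro layer_dist_le_frob) auto
        finally show "(\<Sum>k\<in>?K. (W (L, fst k, snd k) - W0 (L, fst k, snd k))\<^sup>2) \<le> (2 * sqrt F)\<^sup>2" using D by linarith
        fix i assume i: "i < n"
        have "(\<Sum>k\<in>?K. \<phi> i (fst k) (snd k) * (W (L, fst k, snd k) - W0 (L, fst k, snd k))) = (\<Sum>r<m. \<Sum>j<m. \<phi> i r j * (W (L, r, j) - W0 (L, r, j)))"
          by (simp add: sum.cartesian_product split_def)
        then have "\<bar>f (x i) - (\<Sum>k\<in>?K. \<phi> i (fst k) (snd k) * (W (L, fst k, snd k) - W0 (L, fst k, snd k)))\<bar>
          \<le> 15 * sqrt (frob_dist_sq d m L W W0) / sqrt (real n)"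
          using \<phi>(2)[OF i DR] by (simp add: W(2))
        also have "\<dots> \<le> 15 * (2 * sqrt F) / sqrt (real n)"
          using sD by (intro divide_right_mono mult_left_mono) auto
        finally show "\<bar>f (x i) - (\<Sum>k\<in>?K. \<phi> i (fst k) (snd k) * (W (L, fst k, snd k) - W0 (L, fst k, snd k)))\<bar> \<le> 15 * (2 * sqrt F) / sqrt (real n)" .
      qed
    qed (use n F0 in auto)
    also have "\<dots> = 36 * sqrt (F / real n)" by (simp add: real_sqrt_divide add_divide_distrib[symmetric])
    finally show ?thesis .
  qed
  have "{..<n} \<rightarrow>\<^sub>E (fst \<circ> S) ` {..<n} \<noteq> {}" using n by (auto simp: PiE_eq_empty_iff)
  then show ?thesis unfolding worst_rademacher_def F_def[symmetric] by (intro cSUP_least rad)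
qed

text \<open>By \<open>even m\<close> every tied row is a copy of a row that was drawn.\<close>

lemma tie_rows_measurable:
  assumes "even m"
  shows "tie_rows d m L \<in> gauss_vec (free_idx d m L) \<rightarrow>\<^sub>M weight_borel d m L"
proof -
  have "(\<lambda>g. \<lambda>i\<in>weight_idx d m L. case i of (l, r, j) \<Rightarrow> if l = L \<and> m div 2 \<le> r then g (l, r - m div 2, j) else g (l, r, j))
     \<in> PiM (free_idx d m L) (\<lambda>_. borel) \<rightarrow>\<^sub>M weight_borel d m L"
  proof (rule measurable_restrict)
    fix i assume i: "i \<in> weight_idx d m L"
    obtain l r j where lrj: "i = (l, r, j)" by (cases i)
    have h: "r - m div 2 < m div 2" if "r < m" "m div 2 \<le> r" using that assms by (auto elim!: evenE)
    show "(\<lambda>g. case i of (l, r, j) \<Rightarrow> if l = L \<and> m div 2 \<le> r then g (l, r - m div 2, j) else g (l, r, j)) \<in> PiM (free_idx d m L) (\<lambda>_. borel) \<rightarrow>\<^sub>M borel"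
    proof (cases "l = L \<and> m div 2 \<le> r")
      case True
      have "(L, r - m div 2, j) \<in> free_idx d m L" using i lrj True h by (auto simp: free_idx_iff weight_idx_def)
      then show ?thesis using True lrj by (auto intro!: measurable_component_singleton)
    next
      case False
      have "(l, r, j) \<in> free_idx d m L" using i lrj False by (auto simp: free_idx_iff weight_idx_def)
      then show ?thesis using False lrj by (auto intro!: measurable_component_singleton)
    qed
  qed
  then show ?thesis
    unfolding measurable_gauss_vec_iff tie_rows_def[abs_def] by (simp add: split_def)
qed

lemma space_labelled_borel: "space (labelled_borel d) = labelled_points d"
  by (auto simp: labelled_borel_def space_restrict_space space_pair_measure space_PiM labelled_points_def unit_sphere_def)

lemma labelled_borel_coord:
  "j < d \<Longrightarrow> (\<lambda>z. fst z j) \<in> borel_measurable (labelled_borel d)"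
  "snd \<in> borel_measurable (labelled_borel d)"
proof -
  show "(\<lambda>z. fst z j) \<in> borel_measurable (labelled_borel d)" if "j < d"
    unfolding labelled_borel_def
    by (intro measurable_restrict_space1 measurable_compose[OF measurable_fst measurable_component_singleton]) (use that in auto)
  show "snd \<in> borel_measurable (labelled_borel d)"
    unfolding labelled_borel_def by (intro measurable_restrict_space1 measurable_snd)
qed

text \<open>The value of \<open>measure\<close> is 0 on a set that is not measurable, so a lower
  bound 1 - \<delta> depends on this.\<close>

theorem event_measurable:
  fixes d m L n T :: nat and \<eta> \<delta> c C :: real and \<rho> :: "(point \<times> real) measure"
  assumes L: "L \<ge> 1" and d: "d \<ge> 1" and n: "n \<ge> 1" and \<eta>: "0 < \<eta>" and \<delta>: "0 < \<delta>" "\<delta> < 1" and \<rho>: "prob_space \<rho>" "sets \<rho> = sets (labelled_borel d)"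
    and Wbar: "Wbar \<in> weight_borel d m L \<rightarrow>\<^sub>M weight_borel d m L"
  defines "M \<equiv> weight_borel d m L \<Otimes>\<^sub>M PiM {..<n} (\<lambda>_. \<rho>)"
  shows "{(W0, S) \<in> space M.
               \<eta> \<le> min (4 / (5 * real L))
                      (1 / (20 * real L * emp_deriv n S (network d m L a (Wbar W0))))
               \<and> F_emp d m L a n \<eta> T S W0 (Wbar W0) \<ge> 1
               \<and> real m \<ge> c * real n ^ 3 * real L ^ 16 * real d * ln (real m) ^ 5
                             * ln (real n * real L / \<delta>)
                             * F_emp d m L a n \<eta> T S W0 (Wbar W0) ^ 4
               \<longrightarrow> worst_rademacher ((fst \<circ> S) ` {..<n}) n
                     (ball_class d m L a (Wbar W0) (F_pop d m L a n \<eta> T \<delta> \<rho> W0 (Wbar W0)))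
                   \<le> C * sqrt (F_pop d m L a n \<eta> T \<delta> \<rho> W0 (Wbar W0) / real n)} \<in> sets M"
proof -
  interpret \<rho>: prob_space \<rho> by fact
  have fstM: "fst \<in> M \<rightarrow>\<^sub>M weight_borel d m L" unfolding M_def by (rule measurable_fst)
  have W0: "(\<lambda>p. fst p (l, r, j)) \<in> borel_measurable M" if "(l, r, j) \<in> weight_idx d m L" for l r j
    using that by (intro measurable_compose[OF fstM] measurable_component_singleton)
  have V0: "(\<lambda>W. Wbar W (l, r, j)) \<in> borel_measurable (weight_borel d m L)" if "(l, r, j) \<in> weight_idx d m L" for l r j
    using that by (intro measurable_compose[OF Wbar] measurable_component_singleton)
  have V: "(\<lambda>p. Wbar (fst p) (l, r, j)) \<in> borel_measurable M" if "(l, r, j) \<in> weight_idx d m L" for l r j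
    by (rule measurable_compose[OF fstM V0[OF that]])
  have Vs: "Wbar (fst p) \<in> weight_space d m L" if "p \<in> space M" for p
    using measurable_space[OF Wbar measurable_space[OF fstM that]] by (simp add: space_PiM weight_space_def)
  have Si: "(\<lambda>p. snd p i) \<in> M \<rightarrow>\<^sub>M labelled_borel d" if "i < n" for i
  proof -
    have "(\<lambda>p. snd p i) \<in> M \<rightarrow>\<^sub>M \<rho>"
      unfolding M_def using that by (intro measurable_compose[OF measurable_snd] measurable_component_singleton) auto
    then show ?thesis by (simp add: measurable_cong_sets[OF refl \<rho>(2)])
  qed
  have x: "(\<lambda>p. fst (snd p i) j) \<in> borel_measurable M" if "i < n" "j < d" for i j
    using that by (intro measurable_compose[OF Si labelled_borel_coord(1)])
  have y: "(\<lambda>p. snd (snd p i)) \<in> borel_measurable M" if "i < n" for i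
    using that by (intro measurable_compose[OF Si labelled_borel_coord(2)])
  have xs: "fst (snd p i) \<in> unit_sphere d" if "p \<in> space M" "i < n" for p i
    using measurable_space[OF Si[OF that(2)] that(1)] by (auto simp: space_labelled_borel labelled_points_def)
  have net: "(\<lambda>p. network d m L a (Wbar (fst p)) (fst (snd p i))) \<in> borel_measurable M" if "i < n" for i
    using that by (intro network_measurable V x L)
  have er[measurable]: "(\<lambda>p. emp_risk n (snd p) (network d m L a (Wbar (fst p)))) \<in> borel_measurable M"
    unfolding emp_risk_def
    by (intro borel_measurable_divide borel_measurable_sum measurable_compose[OF borel_measurable_times[OF y net] logistic_measurable] borel_measurable_const) auto
  have ed[measurable]: "(\<lambda>p. emp_deriv n (snd p) (network d m L a (Wbar (fst p)))) \<in> borel_measurable M"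
    unfolding emp_deriv_def
    by (intro borel_measurable_divide borel_measurable_sum borel_measurable_abs measurable_compose[OF borel_measurable_times[OF y net] deriv_logistic_measurable] borel_measurable_const) auto
  have fr[measurable]: "(\<lambda>p. frob_dist_sq d m L (fst p) (Wbar (fst p))) \<in> borel_measurable M"
    unfolding frob_dist_sq_def
    by (intro borel_measurable_sum borel_measurable_power borel_measurable_diff W0 V) (auto simp: weight_idx_def)
  have Fe[measurable]: "(\<lambda>p. F_emp d m L a n \<eta> T (snd p) (fst p) (Wbar (fst p))) \<in> borel_measurable M"
    unfolding F_emp_def by measurable
  \<comment> \<open>The risk is an integral with a parameter; its integrand is jointly measurable in
    the initialization and the data point because \<open>Wbar\<close> is measurable.\<close>
  have rk[measurable]: "(\<lambda>p. risk \<rho> (network d m L a (Wbar (fst p)))) \<in> borel_measurable M"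
  proof -
    let ?N = "weight_borel d m L \<Otimes>\<^sub>M \<rho>"
    have s: "snd \<in> ?N \<rightarrow>\<^sub>M labelled_borel d" by (subst measurable_cong_sets[OF refl \<rho>(2)[symmetric]]) (rule measurable_snd)
    have "(\<lambda>q. network d m L a (Wbar (fst q)) (fst (snd q))) \<in> borel_measurable ?N"
      by (intro network_measurable L measurable_compose[OF measurable_fst V0] measurable_compose[OF s labelled_borel_coord(1)])
    moreover have "(\<lambda>q. snd (snd q)) \<in> borel_measurable ?N" by (rule measurable_compose[OF s labelled_borel_coord(2)])
    ultimately have "(\<lambda>q. logistic (snd (snd q) * network d m L a (Wbar (fst q)) (fst (snd q)))) \<in> borel_measurable ?N"
      by (intro measurable_compose[OF borel_measurable_times logistic_measurable])
    then have "(\<lambda>W. risk \<rho> (network d m L a (Wbar W))) \<in> borel_measurable (weight_borel d m L)"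
      unfolding risk_def by (intro \<rho>.borel_measurable_lebesgue_integral) (simp add: split_def)
    then show ?thesis by (rule measurable_compose[OF fstM])
  qed
  have sl[measurable]: "(\<lambda>p. sup_loss d (network d m L a (Wbar (fst p)))) \<in> borel_measurable M"
    by (intro sup_loss_measurable V L d)
  have Fp[measurable]: "(\<lambda>p. F_pop d m L a n \<eta> T \<delta> \<rho> (fst p) (Wbar (fst p))) \<in> borel_measurable M"
    unfolding F_pop_def by measurable
  have Fp0: "0 \<le> F_pop d m L a n \<eta> T \<delta> \<rho> (fst p) (Wbar (fst p))" for p
    using F_pop_ge[of L d \<eta> \<delta> m "fst p" "Wbar (fst p)"] frob_dist_sq_nonneg[of d m L "fst p" "Wbar (fst p)"] L d \<eta> \<delta> by (meson order_trans)
  have rd: "(\<lambda>p. rademacher n (\<lambda>i. fst (snd p (k i))) (ball_class d m L a (Wbar (fst p)) (F_pop d m L a n \<eta> T \<delta> \<rho> (fst p) (Wbar (fst p))))) \<in> borel_measurable M"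
    if "k \<in> {..<n} \<rightarrow>\<^sub>E {..<n}" for k
    using that by (intro rademacher_measurable V Vs Fp Fp0 x xs L) (auto dest: PiE_mem)
  have wr[measurable]: "(\<lambda>p. worst_rademacher ((fst \<circ> snd p) ` {..<n}) n (ball_class d m L a (Wbar (fst p)) (F_pop d m L a n \<eta> T \<delta> \<rho> (fst p) (Wbar (fst p))))) \<in> borel_measurable M"
    unfolding worst_rademacher_reindex comp_def
  proof (rule borel_measurable_cSUP)
    have fin: "finite ({..<n} \<rightarrow>\<^sub>E {..<n})" by (intro finite_PiE) auto
    then show "countable ({..<n} \<rightarrow>\<^sub>E {..<n})" by (rule countable_finite)
    fix p show "bdd_above ((\<lambda>k. rademacher n (\<lambda>i. fst (snd p (k i))) (ball_class d m L a (Wbar (fst p)) (F_pop d m L a n \<eta> T \<delta> \<rho> (fst p) (Wbar (fst p))))) ` ({..<n} \<rightarrow>\<^sub>E {..<n}))"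
      using fin by (intro bdd_above_finite finite_imageI)
  qed (rule rd)
  show ?thesis
    unfolding case_prod_unfold prod.collapse by measurable
qed

text \<open>The conditions that do not involve the radius follow from the width bound with
  \<open>F_emp\<close> replaced by its lower bound 1, so \<open>p\<close> and \<open>B\<close> do
  not depend on the sample. The size requirements on \<open>m\<close> reduce to monomials in
  \<open>n\<close>, \<open>L\<close>, \<open>d\<close>, \<open>l\<close> and
  \<open>\<Lambda>\<close> that are dominated by the one in \<open>M\<close>.\<close>

lemma network_parameters:
  fixes m n L d :: nat and \<delta> K :: real
  assumes m: "m \<ge> 2" and L: "L \<ge> 2" and n: "n \<ge> 1" and d: "d \<ge> 1" and \<delta>: "0 < \<delta>" "\<delta> < 1" and K: "K \<ge> 24"
    and M: "12 * 10 ^ 30 * K * real n ^ 3 * real L ^ 16 * real d * ln (real m) ^ 5 * ln (real n * real L / \<delta>) \<le> real m"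
  obtains p B :: nat where "m \<ge> 21" "d \<le> m" "p \<ge> 1" "p \<le> m" "m \<le> B * p"
    "real (m ^ (d * (L + 3))) * (real L)\<^sup>2 * real (m ^ (7 * p)) * exp (- (real m / (800 * (real L)\<^sup>2))) \<le> \<delta> / 14"
    "real (m ^ (d * (L + 3))) * (real L)\<^sup>2 * exp (- (real p / 12)) \<le> \<delta> / 14"
    "real (m ^ (d * (L + 3))) * (real L)\<^sup>2 * exp (- (real m / (2 * real n))) \<le> \<delta> / 14"
    "real m / (40000 * ((real L)\<^sup>2 * ln (real m))) \<le> real p" "real B \<le> 50000 * ((real L)\<^sup>2 * ln (real m))" "B \<ge> 1"
    "1 \<le> (real L)\<^sup>2 * ln (real m)"
proof -
  define \<Lambda> where "\<Lambda> = ln (real n * real L / \<delta>)"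
  define l where "l = ln (real m)"
  have L1: "1 \<le> real L" "2 \<le> real L" and n1: "1 \<le> real n" and d1: "1 \<le> real d" using L n d by auto
  have d2: "1 / \<delta> \<ge> 1" using \<delta> by (simp add: pos_le_divide_eq)
  have "2 / \<delta> \<le> real n * real L / \<delta>"
  proof (intro divide_right_mono)
    show "2 \<le> real n * real L" using mult_mono[OF n1 L1(2)] by simp
  qed (use \<delta> in auto)
  moreover have "2 \<le> 2 / \<delta>" using \<delta> by (simp add: pos_le_divide_eq)
  ultimately have nL2: "2 \<le> real n * real L / \<delta>" by linarith
  have "2/3 \<le> ln (2::real)" by (rule ln2_ge_two_thirds)
  also have "\<dots> \<le> \<Lambda>" unfolding \<Lambda>_def using nL2 by (subst ln_le_cancel_iff) auto
  finally have \<Lambda>: "2/3 \<le> \<Lambda>" .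
  have "2/3 \<le> ln (2::real)" by (rule ln2_ge_two_thirds)
  also have "\<dots> \<le> l" unfolding l_def using m by (subst ln_le_cancel_iff) auto
  finally have l23: "2/3 \<le> l" .
  define P where "P = real n ^ 3 * real L ^ 16 * real d * l ^ 5 * \<Lambda>"
  have n31: "1 \<le> real n ^ 3" using n1 by (simp add: one_le_power)
  have "(1 * 1 * 1 * (2/3) ^ 5 * (2/3)) \<le> P"
    unfolding P_def using n31 L1 d1 l23 \<Lambda> by (intro mult_mono power_mono) (auto simp: one_le_power)
  then have P0: "1/20 \<le> P" by (simp add: eval_nat_numeral)
  have MP: "12 * 10 ^ 30 * K * P \<le> real m" using M by (simp add: P_def l_def \<Lambda>_def mult_ac)
  have kP: "k * P \<le> real m" if "k \<le> 12 * 10 ^ 30" for k :: real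
  proof -
    have "k * P \<le> 12 * 10 ^ 30 * P" using that P0 by (intro mult_right_mono) auto
    also have "\<dots> \<le> 12 * 10 ^ 30 * K * P" using K P0 by (intro mult_right_mono) auto
    finally show ?thesis using MP by linarith
  qed
  \<comment> \<open>Before ln m >= 1 is known, the crude bound ln m >= ln 2 >= 2/3 gives P >= 1/20,
    which already forces m >= 21.\<close>
  have m21: "m \<ge> 21"
  proof -
    have "21 \<le> 420 * P" using P0 by simp
    also have "\<dots> \<le> real m" by (rule kP) simp
    finally show ?thesis by simp
  qed
  have l1: "1 \<le> l"
  proof -
    have "exp 1 \<le> real m" using exp_le m21 by linarith
    then show ?thesis unfolding l_def using m21 by (subst ln_ge_iff) auto
  qed
  have mono: "k * (real n ^ a * real L ^ b * real d ^ e * l ^ f * \<Lambda>) \<le> real m" if "0 \<le> k" "k \<le> 12 * 10 ^ 30" "a \<le> 3" "b \<le> 16" "e \<le> 1" "f \<le> 5" for k :: real and a b e f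
  proof -
    have "real n ^ a * real L ^ b * real d ^ e * l ^ f * \<Lambda> \<le> real n ^ 3 * real L ^ 16 * real d ^ 1 * l ^ 5 * \<Lambda>"
      using that n1 L1 d1 l1 \<Lambda> by (intro mult_mono power_increasing mult_nonneg_nonneg) auto
    then have "k * (real n ^ a * real L ^ b * real d ^ e * l ^ f * \<Lambda>) \<le> k * P"
      using that by (intro mult_left_mono) (auto simp: P_def)
    then show ?thesis using kP[OF that(2)] by linarith
  qed
  have dm: "d \<le> m"
  proof -
    have "real d * 1 \<le> real d * (3/2 * \<Lambda>)" using \<Lambda> by (intro mult_left_mono) auto
    also have "\<dots> = 3/2 * (real n ^ 0 * real L ^ 0 * real d ^ 1 * l ^ 0 * \<Lambda>)" by simp
    also have "\<dots> \<le> real m" by (rule mono) auto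
    finally show ?thesis by simp
  qed
  define q where "q = (real L)\<^sup>2 * l"
  have q1: "1 \<le> q" unfolding q_def using mult_mono[of 1 "(real L)\<^sup>2" 1 l] L1 l1 by (simp add: one_le_power)
  have mq: "40000 * q \<le> real m"
  proof -
    have "40000 * q * 1 \<le> 40000 * q * (3/2 * \<Lambda>)" using \<Lambda> q1 by (intro mult_left_mono) auto
    also have "\<dots> = 60000 * (real n ^ 0 * real L ^ 2 * real d ^ 0 * l ^ 1 * \<Lambda>)" by (simp add: q_def)
    also have "\<dots> \<le> real m" by (rule mono) auto
    finally show ?thesis by simp
  qed
  define \<Gamma> where "\<Gamma> = real d * (real L + 3) * ln (real m) + 2 * ln (real L) + ln (14 / \<delta>)"
  have G: "\<Gamma> \<le> 12 * (real d * real L * l * \<Lambda>)"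
  proof -
    have dLl: "1 \<le> real d * real L * l"
      using mult_mono[OF mult_mono[OF d1 L1(1)] l1] d1 L1 l1 by simp
    have dL: "real L \<le> real d * real L * l"
    proof -
      have "1 * real L * 1 \<le> real d * real L * l" using d1 L1 l1 by (intro mult_mono) auto
      then show ?thesis by simp
    qed
    have t1: "real d * (real L + 3) * l \<le> 5 * (real d * real L * l * \<Lambda>)"
    proof -
      have "real d * (real L + 3) * l \<le> real d * (5/2 * real L) * l" using L1 l1 by (intro mult_mono mult_left_mono) auto
      also have "\<dots> = 5/2 * (real d * real L * l) * 1" by simp
      also have "\<dots> \<le> 5/2 * (real d * real L * l) * (3/2 * \<Lambda>)" using \<Lambda> dLl by (intro mult_left_mono) auto
      also have "\<dots> = 15/4 * (real d * real L * l * \<Lambda>)" by simp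
      also have "\<dots> \<le> 5 * (real d * real L * l * \<Lambda>)"
      proof (rule mult_right_mono)
        show "0 \<le> real d * real L * l * \<Lambda>" using l1 \<Lambda> by simp
      qed simp
      finally show ?thesis .
    qed
    have t2: "2 * ln (real L) \<le> 3 * (real d * real L * l * \<Lambda>)"
    proof -
      have "ln (real L) \<le> real L" using ln_le_minus_one[of "real L"] L1 by linarith
      also have "\<dots> \<le> real d * real L * l * 1" using dL by simp
      also have "\<dots> \<le> real d * real L * l * (3/2 * \<Lambda>)" using \<Lambda> dLl by (intro mult_left_mono) auto
      finally show ?thesis by simp
    qed
    have t3: "ln (14 / \<delta>) \<le> 4 * (real d * real L * l * \<Lambda>)"
    proof -
      \<comment> \<open>Since 14 <= 2^4 and \<delta> < 1, the number 14 is absorbed by a fourth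
        power of 2 / \<delta>, whose logarithm is below \<open>\<Lambda>\<close>.\<close>
      have "ln (14 / \<delta>) \<le> ln ((2 / \<delta>) ^ 4)"
      proof (subst ln_le_cancel_iff)
        have "1 \<le> (1 / \<delta>) ^ 3" using d2 by (rule one_le_power)
        then have "14 / \<delta> * 1 \<le> 16 / \<delta> * (1 / \<delta>) ^ 3" using \<delta> by (intro mult_mono divide_right_mono) auto
        also have "\<dots> = (2 / \<delta>) ^ 4" by (simp add: power_divide eval_nat_numeral)
        finally show "14 / \<delta> \<le> (2 / \<delta>) ^ 4" by simp
      qed (use \<delta> in auto)
      also have "\<dots> = 4 * ln (2 / \<delta>)" using \<delta> by (simp add: ln_realpow)
      also have "ln (2 / \<delta>) \<le> \<Lambda>" unfolding \<Lambda>_def using \<open>2 / \<delta> \<le> real n * real L / \<delta>\<close> \<delta> nL2 by (subst ln_le_cancel_iff) auto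
      also have "4 * \<Lambda> \<le> 4 * (real d * real L * l * \<Lambda>)"
        using mult_right_mono[OF dLl, of \<Lambda>] \<Lambda> by simp
      finally show ?thesis by simp
    qed
    show ?thesis using t1 t2 t3 unfolding \<Gamma>_def l_def[symmetric] by linarith
  qed
  have g1: "480000 * (real L)\<^sup>2 * ln (real m) * \<Gamma> \<le> real m"
  proof -
    have "480000 * (real L)\<^sup>2 * l * \<Gamma> \<le> 480000 * (real L)\<^sup>2 * l * (12 * (real d * real L * l * \<Lambda>))"
      using G l1 by (intro mult_left_mono) auto
    also have "\<dots> = 5760000 * (real n ^ 0 * real L ^ 3 * real d ^ 1 * l ^ 2 * \<Lambda>)" by (simp add: power2_eq_square power3_eq_cube)
    also have "\<dots> \<le> real m" by (rule mono) auto
    finally show ?thesis by (simp add: l_def)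
  qed
  have g2: "2 * real n * \<Gamma> \<le> real m"
  proof -
    have "2 * real n * \<Gamma> \<le> 2 * real n * (12 * (real d * real L * l * \<Lambda>))" using G by (intro mult_left_mono) auto
    also have "\<dots> = 24 * (real n ^ 1 * real L ^ 1 * real d ^ 1 * l ^ 1 * \<Lambda>)" by simp
    also have "\<dots> \<le> real m" by (rule mono) auto
    finally show ?thesis .
  qed
  obtain p B where pB: "p \<ge> 1" "p \<le> m" "m \<le> B * p" "real p \<le> real m / (20000 * q)"
    "real m / (40000 * q) \<le> real p" "real B \<le> 50000 * q"
    using exists_block_parameters[OF q1 mq] by blast
  have m3: "m \<ge> 3" using m21 by simp
  have B1: "B \<ge> 1" using pB(3) m by (cases B) auto
  note fc = failure_conditions[OF m3 L n \<delta>(1) pB(4)[unfolded q_def l_def] pB(5)[unfolded q_def l_def] g1[unfolded \<Gamma>_def] g2[unfolded \<Gamma>_def] l1[unfolded l_def]]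
  show ?thesis
    by (rule that[OF m21 dm pB(1,2,3) fc pB(5)[unfolded q_def l_def] pB(6)[unfolded q_def l_def] B1 q1[unfolded q_def l_def]])
qed


section \<open>The probability bound\<close>

lemma prob_space_init_law:
  assumes "even m" shows "prob_space (init_law d m L)"
  unfolding init_law_def using tie_rows_measurable[OF assms]
  by (intro prob_space.prob_space_distr prob_space_gauss_vec) 

lemma sets_init_law [measurable_cong]: "sets (init_law d m L) = sets (weight_borel d m L)"
  by (simp add: init_law_def)

text \<open>Fubini over the initialization. On the exceptional set \<open>A\<close> the conditional
  probability is bounded by 1; elsewhere the initialization, and with it the reference model, is
  fixed while the sample is averaged.\<close>

lemma emeasure_joint_law_le:
  assumes m: "even m" and \<rho>: "prob_space \<rho>" and N: "N \<in> sets (joint_law d m L n \<rho>)"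
    and good: "tail_le (gauss_vec (free_idx d m L)) (\<lambda>g. \<not> G (tie_rows d m L g)) \<alpha>" and \<alpha>: "0 \<le> \<alpha>"
    and cond: "\<And>W0. W0 \<in> space (weight_borel d m L) \<Longrightarrow> G W0 \<Longrightarrow> tail_le (PiM {..<n} (\<lambda>_. \<rho>)) (\<lambda>S. (W0, S) \<in> N) \<beta>" and \<beta>: "0 \<le> \<beta>"
  shows "emeasure (joint_law d m L n \<rho>) N \<le> ennreal (\<alpha> + \<beta>)"
proof -
  let ?\<gamma> = "gauss_vec (free_idx d m L)" and ?P = "PiM {..<n} (\<lambda>_. \<rho>)"
  interpret P: prob_space ?P by (intro prob_space_PiM \<rho>)
  obtain A where A: "A \<in> sets ?\<gamma>" "{g \<in> space ?\<gamma>. \<not> G (tie_rows d m L g)} \<subseteq> A" "emeasure ?\<gamma> A \<le> ennreal \<alpha>"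
    using good unfolding tail_le_def by blast
  have N': "N \<in> sets (init_law d m L \<Otimes>\<^sub>M ?P)" using N by (simp add: joint_law_def)
  have tm: "tie_rows d m L \<in> ?\<gamma> \<rightarrow>\<^sub>M weight_borel d m L" by (rule tie_rows_measurable[OF m])
  have "emeasure (joint_law d m L n \<rho>) N = (\<integral>\<^sup>+ W0. emeasure ?P (Pair W0 -` N) \<partial>init_law d m L)"
    unfolding joint_law_def by (rule P.emeasure_pair_measure_alt[OF N'])
  also have "\<dots> = (\<integral>\<^sup>+ g. emeasure ?P (Pair (tie_rows d m L g) -` N) \<partial>?\<gamma>)"
  proof -
    have "(\<lambda>W0. emeasure ?P (Pair W0 -` N)) \<in> borel_measurable (init_law d m L)"
      by (rule P.measurable_emeasure_Pair[OF N'])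
    then show ?thesis unfolding init_law_def by (intro nn_integral_distr tm) simp
  qed
  also have "\<dots> \<le> (\<integral>\<^sup>+ g. indicator A g + ennreal \<beta> \<partial>?\<gamma>)"
  proof (intro nn_integral_mono)
    fix g assume g: "g \<in> space ?\<gamma>"
    show "emeasure ?P (Pair (tie_rows d m L g) -` N) \<le> indicator A g + ennreal \<beta>"
    proof (cases "g \<in> A")
      case True
      have "emeasure ?P (Pair (tie_rows d m L g) -` N) \<le> 1" by (rule P.emeasure_le_1)
      also have "\<dots> \<le> indicator A g + ennreal \<beta>" using True by simp
      finally show ?thesis .
    next
      case False
      then have "G (tie_rows d m L g)" using A(2) g by blast
      then obtain A' where A': "A' \<in> sets ?P" "{S \<in> space ?P. (tie_rows d m L g, S) \<in> N} \<subseteq> A'" "emeasure ?P A' \<le> ennreal \<beta>"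
        using cond[OF measurable_space[OF tm g]] unfolding tail_le_def by blast
      have "N \<subseteq> space (init_law d m L) \<times> space ?P" using sets.sets_into_space[OF N'] by (simp add: space_pair_measure)
      then have "Pair (tie_rows d m L g) -` N \<subseteq> A'" using A'(2) by auto
      then have "emeasure ?P (Pair (tie_rows d m L g) -` N) \<le> emeasure ?P A'" using A'(1) by (rule emeasure_mono)
      also have "\<dots> \<le> indicator A g + ennreal \<beta>" using A'(3) by (simp add: add_increasing)
      finally show ?thesis .
    qed
  qed
  also have "\<dots> = emeasure ?\<gamma> A + ennreal \<beta>"
    using A(1) by (subst nn_integral_add) (auto simp: prob_space.emeasure_space_1[OF prob_space_gauss_vec])
  also have "\<dots> \<le> ennreal \<alpha> + ennreal \<beta>" using A(3) by (intro add_right_mono)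
  also have "\<dots> = ennreal (\<alpha> + \<beta>)" using \<alpha> \<beta> by simp
  finally show ?thesis .
qed

text \<open>The weights \<open>V\<close> are fixed here: this is where it matters that the reference
  model does not depend on the sample.\<close>

lemma risk_concentration:
  assumes L: "L \<ge> 1" and d: "d \<ge> 1" and n: "n \<ge> 1" and \<delta>: "0 < \<delta>"
    and \<rho>: "prob_space \<rho>" "sets \<rho> = sets (labelled_borel d)"
  shows "tail_le (PiM {..<n} (\<lambda>_. \<rho>))
    (\<lambda>S. \<not> risk \<rho> (network d m L a V) \<le> 2 * emp_risk n S (network d m L a V) + 2 * sup_loss d (network d m L a V) * ln (2 / \<delta>) / real n) (\<delta> / 2)"
proof -
  let ?Z = "\<lambda>z. logistic (snd z * network d m L a V (fst z))"
  have sp: "space \<rho> = labelled_points d" using sets_eq_imp_space_eq[OF \<rho>(2)] by (simp add: space_labelled_borel)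
  have "(\<lambda>z. network d m L a V (fst z)) \<in> borel_measurable (labelled_borel d)"
    by (intro network_measurable L labelled_borel_coord) auto
  then have "?Z \<in> borel_measurable (labelled_borel d)"
    by (intro measurable_compose[OF borel_measurable_times logistic_measurable] labelled_borel_coord)
  then have Z: "?Z \<in> borel_measurable \<rho>" by (simp add: measurable_cong_sets[OF \<rho>(2) refl])
  have "tail_le (PiM {..<n} (\<lambda>_. \<rho>)) (\<lambda>S. 2 * ((\<Sum>i<n. ?Z (S i)) / real n) + 2 * sup_loss d (network d m L a V) * ln (1 / (\<delta> / 2)) / real n < (\<integral>z. ?Z z \<partial>\<rho>)) (\<delta> / 2)"
    using \<delta> by (intro empirical_mean_lower_tail \<rho>(1) Z logistic_nonneg sup_loss_pos L d n loss_le_sup_loss) (auto simp: sp)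
  then show ?thesis by (rule tail_le_mono) (auto simp: risk_def emp_risk_def not_le)
qed

theorem lemma22:
  fixes c\<^sub>1 c\<^sub>2 :: real
  assumes "0 < c\<^sub>1" and "c\<^sub>1 \<le> c\<^sub>2"
  shows "\<exists>c>0. \<exists>C>0.
    \<forall>(d::nat) (m::nat) (L::nat) (n::nat) (T::nat) (\<eta>::real) (\<delta>::real)
      (\<rho>::(point \<times> real) measure) (a::nat \<Rightarrow> real) (Wbar::weights \<Rightarrow> weights).
      d \<ge> 1 \<and> m \<ge> 1 \<and> even m \<and> L \<ge> 2 \<and> n \<ge> 1 \<and> T \<ge> 1 \<and> \<eta> > 0 \<and> 0 < \<delta> \<and> \<delta> < 1
      \<and> c\<^sub>1 * real n \<le> \<eta> * real T \<and> \<eta> * real T \<le> c\<^sub>2 * real n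
      \<and> antisymmetric_signs m a
      \<and> prob_space \<rho> \<and> sets \<rho> = sets (labelled_borel d)
      \<and> Wbar \<in> weight_borel d m L \<rightarrow>\<^sub>M weight_borel d m L
      \<longrightarrow> measure (joint_law d m L n \<rho>)
            {(W0, S) \<in> space (joint_law d m L n \<rho>).
               \<eta> \<le> min (4 / (5 * real L))
                      (1 / (20 * real L * emp_deriv n S (network d m L a (Wbar W0))))
               \<and> F_emp d m L a n \<eta> T S W0 (Wbar W0) \<ge> 1
               \<and> real m \<ge> c * real n ^ 3 * real L ^ 16 * real d * ln (real m) ^ 5
                             * ln (real n * real L / \<delta>)
                             * F_emp d m L a n \<eta> T S W0 (Wbar W0) ^ 4
               \<longrightarrow> worst_rademacher ((fst \<circ> S) ` {..<n}) n
                     (ball_class d m L a (Wbar W0) (F_pop d m L a n \<eta> T \<delta> \<rho> W0 (Wbar W0)))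
                   \<le> C * sqrt (F_pop d m L a n \<eta> T \<delta> \<rho> W0 (Wbar W0) / real n)}
          \<ge> 1 - \<delta>"
proof -
  \<comment> \<open>\<open>K\<close> is the factor in the squared radius R^2 = K F_emp ln (n L /
    \<delta>) that \<open>rademacher_bound_of_good\<close> asks for, and 12 * 10^30 comes from
    \<open>width_conditions\<close>. Half of \<delta> is spent on the initialization and half on the
    sample.\<close>
  define K where "K = 4 * (6 + 300 * c\<^sub>2)"
  define c where "c = 12 * 10 ^ 30 * K"
  have K: "K \<ge> 24" using assms by (simp add: K_def)
  then have c: "c > 0" by (simp add: c_def)
  show ?thesis
  proof (rule exI[of _ c], rule conjI[OF c], rule exI[of _ "36::real"], rule conjI, simp, intro allI impI, elim conjE)
    fix d m L n T :: nat and \<eta> \<delta> :: real and \<rho> :: "(point \<times> real) measure" and a :: "nat \<Rightarrow> real" and Wbar :: "weights \<Rightarrow> weights"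
    assume d: "d \<ge> 1" and m1: "m \<ge> 1" and ev: "even m" and L: "L \<ge> 2" and n: "n \<ge> 1" and \<eta>: "\<eta> > 0" and \<delta>: "0 < \<delta>" "\<delta> < 1"
      and \<eta>T: "\<eta> * real T \<le> c\<^sub>2 * real n" and a: "antisymmetric_signs m a"
      and \<rho>: "prob_space \<rho>" "sets \<rho> = sets (labelled_borel d)"
      and Wbar: "Wbar \<in> weight_borel d m L \<rightarrow>\<^sub>M weight_borel d m L"
    let ?J = "joint_law d m L n \<rho>"
    define Fe where "Fe W0 S = F_emp d m L a n \<eta> T S W0 (Wbar W0)" for W0 S
    define Q where "Q = real n ^ 3 * real L ^ 16 * real d * ln (real m) ^ 5 * ln (real n * real L / \<delta>)"
    let ?E = "{(W0, S) \<in> space ?J.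
               \<eta> \<le> min (4 / (5 * real L))
                      (1 / (20 * real L * emp_deriv n S (network d m L a (Wbar W0))))
               \<and> F_emp d m L a n \<eta> T S W0 (Wbar W0) \<ge> 1
               \<and> real m \<ge> c * real n ^ 3 * real L ^ 16 * real d * ln (real m) ^ 5
                             * ln (real n * real L / \<delta>)
                             * F_emp d m L a n \<eta> T S W0 (Wbar W0) ^ 4
               \<longrightarrow> worst_rademacher ((fst \<circ> S) ` {..<n}) n
                     (ball_class d m L a (Wbar W0) (F_pop d m L a n \<eta> T \<delta> \<rho> W0 (Wbar W0)))
                   \<le> 36 * sqrt (F_pop d m L a n \<eta> T \<delta> \<rho> W0 (Wbar W0) / real n)}"
    define N where "N = space ?J - ?E"
    have L1: "L \<ge> 1" using L by simp
    have m2: "m \<ge> 2" using ev m1 by (cases "m = 1") auto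
    have setsJ: "sets ?J = sets (weight_borel d m L \<Otimes>\<^sub>M PiM {..<n} (\<lambda>_. \<rho>))"
      unfolding joint_law_def by (intro sets_pair_measure_cong sets_init_law refl)
    have spJ: "space ?J = space (weight_borel d m L \<Otimes>\<^sub>M PiM {..<n} (\<lambda>_. \<rho>))"
      by (rule sets_eq_imp_space_eq[OF setsJ])
    have E: "?E \<in> sets ?J"
      unfolding spJ setsJ by (rule event_measurable[OF L1 d n \<eta> \<delta> \<rho> Wbar])
    interpret J: prob_space ?J
      unfolding joint_law_def by (intro prob_space_pair prob_space_init_law ev prob_space_PiM \<rho>(1))
    have N: "N \<in> sets ?J" using E by (simp add: N_def)
    have inN: "(W0, S) \<in> space ?J \<and> Fe W0 S \<ge> 1 \<and> c * Q * Fe W0 S ^ 4 \<le> real m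
      \<and> \<not> worst_rademacher ((fst \<circ> S) ` {..<n}) n
                     (ball_class d m L a (Wbar W0) (F_pop d m L a n \<eta> T \<delta> \<rho> W0 (Wbar W0)))
                   \<le> 36 * sqrt (F_pop d m L a n \<eta> T \<delta> \<rho> W0 (Wbar W0) / real n)" if "(W0, S) \<in> N" for W0 S
      using that unfolding N_def Fe_def Q_def by (simp add: mult.assoc)
    have "emeasure ?J N \<le> ennreal \<delta>"
    \<comment> \<open>The width condition is part of the event and depends on the sample. If no pair
      is bad there is nothing to prove; otherwise a single bad pair yields the deterministic
      consequence \<open>M\<close>, because \<open>Fe\<close> is at least 1 there.\<close>
    proof (cases "N = {}")
      case True then show ?thesis by simp
    next
      case False
      then obtain W1 S1 where "(W1, S1) \<in> N" by (metis ex_in_conv surj_pair)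
      from inN[OF this] have f1: "Fe W1 S1 \<ge> 1" and M1: "c * Q * Fe W1 S1 ^ 4 \<le> real m" by auto
      have "2/3 \<le> ln (2::real)" by (rule ln2_ge_two_thirds)
      have nL: "2 / \<delta> \<le> real n * real L / \<delta>"
      proof (intro divide_right_mono)
        show "2 \<le> real n * real L" using mult_mono[of 1 "real n" 2 "real L"] n L by simp
      qed (use \<delta> in auto)
      define lam where "lam = ln (real n * real L / \<delta>)"
      have lam: "ln (2 / \<delta>) \<le> lam" unfolding lam_def using nL \<delta> by (subst ln_le_cancel_iff) (auto intro: less_le_trans[OF _ nL])
      have "ln 2 \<le> ln (2 / \<delta>)" using \<delta> by (subst ln_le_cancel_iff) (auto simp: pos_le_divide_eq)
      then have lam0: "2/3 \<le> lam" using lam ln2_ge_two_thirds by linarith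
      have lm0: "0 \<le> ln (real m)" using m2 by simp
      have Q0: "0 \<le> Q" unfolding Q_def lam_def[symmetric] using lam0 lm0 by (intro mult_nonneg_nonneg) auto
      have "c * Q * 1 \<le> c * Q * Fe W1 S1 ^ 4" using c Q0 f1 by (intro mult_left_mono one_le_power) auto
      then have M: "12 * 10 ^ 30 * K * real n ^ 3 * real L ^ 16 * real d * ln (real m) ^ 5 * ln (real n * real L / \<delta>) \<le> real m"
        using M1 by (simp add: c_def Q_def mult.assoc)
      obtain p B :: nat where par: "m \<ge> 21" "d \<le> m" "p \<ge> 1" "p \<le> m" "m \<le> B * p"
        "real (m ^ (d * (L + 3))) * (real L)\<^sup>2 * real (m ^ (7 * p)) * exp (- (real m / (800 * (real L)\<^sup>2))) \<le> \<delta> / 14"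
        "real (m ^ (d * (L + 3))) * (real L)\<^sup>2 * exp (- (real p / 12)) \<le> \<delta> / 14"
        "real (m ^ (d * (L + 3))) * (real L)\<^sup>2 * exp (- (real m / (2 * real n))) \<le> \<delta> / 14"
        "real m / (40000 * ((real L)\<^sup>2 * ln (real m))) \<le> real p" "real B \<le> 50000 * ((real L)\<^sup>2 * ln (real m))" "B \<ge> 1"
        "1 \<le> (real L)\<^sup>2 * ln (real m)"
        by (rule network_parameters[OF m2 L n d \<delta> K M])
      let ?G = "good_weights d m L n p"
      have good: "tail_le (gauss_vec (free_idx d m L)) (\<lambda>g. \<not> ?G (tie_rows d m L g)) (\<delta> / 2)"
        using good_weights_tail[OF ev par(1) L d par(2,4,6,7,8)] by simp
      have "emeasure ?J N \<le> ennreal (\<delta> / 2 + \<delta> / 2)"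
      proof (rule emeasure_joint_law_le[OF ev \<rho>(1) N good])
        fix W0 assume W0: "W0 \<in> space (weight_borel d m L)" and G: "?G W0"
        have V: "Wbar W0 \<in> weight_space d m L"
          using measurable_space[OF Wbar W0] by (simp add: space_PiM weight_space_def)
        show "tail_le (PiM {..<n} (\<lambda>_. \<rho>)) (\<lambda>S. (W0, S) \<in> N) (\<delta> / 2)"
        proof (rule tail_le_mono[OF risk_concentration[OF L1 d n \<delta>(1) \<rho>]])
          fix S assume S: "S \<in> space (PiM {..<n} (\<lambda>_. \<rho>))" and "(W0, S) \<in> N"
          from inN[OF this(2)] have f: "Fe W0 S \<ge> 1" and MF: "c * Q * Fe W0 S ^ 4 \<le> real m"
            and bad: "\<not> worst_rademacher ((fst \<circ> S) ` {..<n}) n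
                     (ball_class d m L a (Wbar W0) (F_pop d m L a n \<eta> T \<delta> \<rho> W0 (Wbar W0)))
                   \<le> 36 * sqrt (F_pop d m L a n \<eta> T \<delta> \<rho> W0 (Wbar W0) / real n)" by auto
          have Si: "S i \<in> labelled_points d" if "i < n" for i
            using S that sets_eq_imp_space_eq[OF \<rho>(2)] by (auto simp: space_PiM space_labelled_borel dest: PiE_mem)
          \<comment> \<open>This radius depends on the sample, which is harmless because
            \<open>good_weights\<close> does not involve it.\<close>
          define R where "R = sqrt (K * Fe W0 S * lam)"
          have KF: "1 \<le> K * Fe W0 S * lam"
          proof -
            have "24 * 1 * (2/3) \<le> K * Fe W0 S * lam" using K f lam0 by (intro mult_mono) auto
            then show ?thesis by simp
          qed
          have R1: "R \<ge> 1" unfolding R_def using KF by simp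
          have R2: "R\<^sup>2 = K * Fe W0 S * lam" unfolding R_def using KF by simp
          \<comment> \<open>With q = L^2 ln m the product q^5 L^2 is L^12 (ln m)^5, and R^2 is
            linear in \<open>Fe\<close>; both are covered by the powers L^16 and F^4 of the
            hypothesis.\<close>
          have big: "(12 * 10 ^ 30) * real n ^ 3 * (real L)\<^sup>2 * ((real L)\<^sup>2 * ln (real m)) ^ 5 * R\<^sup>2 \<le> real m"
          proof -
            have "(12 * 10 ^ 30) * real n ^ 3 * (real L)\<^sup>2 * ((real L)\<^sup>2 * ln (real m)) ^ 5 * R\<^sup>2
               = (12 * 10 ^ 30 * K * real n ^ 3 * ln (real m) ^ 5 * lam) * (real L ^ 12 * 1 * Fe W0 S)"
              unfolding R2 by (simp add: power_mult_distrib power_mult[symmetric] power_add[symmetric] mult_ac)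
            also have "\<dots> \<le> (12 * 10 ^ 30 * K * real n ^ 3 * ln (real m) ^ 5 * lam) * (real L ^ 16 * real d * Fe W0 S ^ 4)"
            proof (intro mult_left_mono mult_mono)
              show "real L ^ 12 \<le> real L ^ 16" using L by (intro power_increasing) auto
              show "Fe W0 S \<le> Fe W0 S ^ 4" using f by (intro self_le_power) auto
            qed (use d f K lam0 lm0 in auto)
            also have "\<dots> = c * Q * Fe W0 S ^ 4" by (simp add: c_def Q_def lam_def mult_ac)
            finally show ?thesis using MF by linarith
          qed
          define eps where "eps = 70 * real L * sqrt (real B) * R / sqrt (real m)"
          note w = width_conditions[OF m1 n L1 par(12) R1 big par(9,10,11) eps_def]
          have RF: "4 * (6 + 300 * c\<^sub>2) * F_emp d m L a n \<eta> T S W0 (Wbar W0) * lam \<le> R\<^sup>2"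
            unfolding R2 K_def Fe_def by simp
          \<comment> \<open>By contraposition: for a good initialization a bad sample has to violate
            the concentration of the risk.\<close>
          show "\<not> risk \<rho> (network d m L a (Wbar W0)) \<le> 2 * emp_risk n S (network d m L a (Wbar W0)) + 2 * sup_loss d (network d m L a (Wbar W0)) * ln (2 / \<delta>) / real n"
          proof
            assume emp: "risk \<rho> (network d m L a (Wbar W0)) \<le> 2 * emp_risk n S (network d m L a (Wbar W0)) + 2 * sup_loss d (network d m L a (Wbar W0)) * ln (2 / \<delta>) / real n"
            show False
              using rademacher_bound_of_good[OF L m1 ev par(3,5) d par(2) n a G R1 w(1) eps_def w(2,3,4) V Si \<eta> \<eta>T \<delta> emp f[unfolded Fe_def] lam RF] bad by blast
          qed
        qed simp
      qed (use \<delta> in auto)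
      then show ?thesis by simp
    qed
    then have "J.prob N \<le> \<delta>" using \<delta> by (simp add: J.emeasure_eq_measure)
    moreover have "J.prob N = 1 - J.prob ?E" unfolding N_def using E by (rule J.prob_compl)
    ultimately show "measure ?J ?E \<ge> 1 - \<delta>" by linarith
  qed
qed

end
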